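(* Let $M^{m+1}$ ($m\geq 2$) be a connected Riemannian manifold. Then $M^{m+1}$ is a space form (i.e., has constant sectional curvature) if and only if every regular $C^2$ curve $\alpha:I\to G$ on a geodesic sphere $G$ of sufficiently small radius satisfies $$\kappa(s)\geq |H(\alpha(s))|\quad\text{for all } s\in I,$$ with equality (for all $s\in I$) if and only if $\alpha$ is a geodesic of $G$, where $H$ is the mean curvature of $G$ and $\kappa$ is the curvature function of $\alpha$ in $M^{m+1}$.
   Context: $M^{m+1}$ is an $(m+1)$-dimensional Riemannian manifold (of class at least $C^3$) with Levi-Civita connection $\nabla$. Curves are parametrized by arc-length $s$, and the curvature function of $\alpha$ in $M^{m+1}$ is $\kappa=\Vert\nabla_{\alpha'}\alpha'\Vert$. For $p\in M$ and sufficiently small $R>0$, the geodesic sphere with center $p$ and radius $R$ is the hypersurface $G(p,R)=\{\exp_p(RV): V\in T_pM,\ \Vert V\Vert=1\}$ ("sufficiently small radius" means: for each $p$ there is $R_0(p)>0$ such that the condition is imposed for all $0<R<R_0(p)$, where $G(p,R)$ is a smooth hypersurface). The mean curvature is $H=\frac1m\mathrm{tr}(S)$, where $S(X)=-\nabla_X\xi$ is the shape operator with respect to a unit normal field $\xi$ of the geodesic sphere. *)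

theory Defs
  imports "HOL-Analysis.Analysis"
begin

section \<open>Functions and manifolds of class \<open>C\<^sup>k\<close>\<close>

text \<open>Only meant for open sets \<open>S\<close>: the derivative is the unrestricted one, and \<open>C\<^sup>k\<^sup>+\<^sup>1\<close>
  means differentiable with all directional derivatives of class \<open>C\<^sup>k\<close>.\<close>

primrec Ck_on :: "nat \<Rightarrow> ('e::euclidean_space \<Rightarrow> 'b::real_normed_vector) \<Rightarrow> 'e set \<Rightarrow> bool" where
  "Ck_on 0 f S \<longleftrightarrow> continuous_on S f"
| "Ck_on (Suc k) f S \<longleftrightarrow> f differentiable_on S \<and> (\<forall>v. Ck_on k (\<lambda>x. frechet_derivative f (at x) v) S)"

text \<open>A chart is its domain together with its coordinate map; the map is arbitrary off the domain.\<close>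

type_synonym ('a, 'e) chart = "'a set \<times> ('a \<Rightarrow> 'e)"

abbreviation chart_dom :: "('a, 'e) chart \<Rightarrow> 'a set" where "chart_dom \<equiv> fst"
abbreviation chart_map :: "('a, 'e) chart \<Rightarrow> 'a \<Rightarrow> 'e" where "chart_map \<equiv> snd"
abbreviation chart_range :: "('a, 'e) chart \<Rightarrow> 'e set" where
  "chart_range c \<equiv> chart_map c ` chart_dom c"

definition chart_inv :: "('a, 'e) chart \<Rightarrow> 'e \<Rightarrow> 'a" where
  "chart_inv c = inv_into (chart_dom c) (chart_map c)"

text \<open>The model spaces may differ: for a chart \<open>c\<close> of a submanifold and a chart \<open>d\<close> of the ambient
  manifold this is the coordinate expression of the inclusion.\<close>

definition transition :: "('a, 'f) chart \<Rightarrow> ('a, 'e) chart \<Rightarrow> 'f \<Rightarrow> 'e" where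
  "transition c d = chart_map d \<circ> chart_inv c"

text \<open>The metric is the family of its local expressions: \<open>metric M c x u v\<close> is
  \<open>\<Sum>ij. g\<^sub>i\<^sub>j(x) u\<^sub>i v\<^sub>j\<close>, where \<open>x\<close> is a point in the range of the chart \<open>c\<close>.\<close>

record ('a, 'e) riem =
  mtop :: "'a topology"
  atlas :: "('a, 'e) chart set"
  metric :: "('a, 'e) chart \<Rightarrow> 'e \<Rightarrow> 'e \<Rightarrow> 'e \<Rightarrow> real"

abbreviation points :: "('a, 'e) riem \<Rightarrow> 'a set" where "points M \<equiv> topspace (mtop M)"

text \<open>A Riemannian manifold of class \<open>C\<^sup>3\<close>: transition maps of class \<open>C\<^sup>3\<close>, hence a metric of
  class \<open>C\<^sup>2\<close>, the highest class that is invariant under such transition maps.\<close>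

definition riemannian_manifold :: "('a, 'e::euclidean_space) riem \<Rightarrow> bool" where
  "riemannian_manifold M \<longleftrightarrow>
     Hausdorff_space (mtop M) \<and> second_countable (mtop M) \<and>
     points M = (\<Union>c\<in>atlas M. chart_dom c) \<and>
     (\<forall>c\<in>atlas M.
        openin (mtop M) (chart_dom c) \<and> open (chart_range c) \<and>
        homeomorphic_map (subtopology (mtop M) (chart_dom c)) (top_of_set (chart_range c)) (chart_map c)) \<and>
     (\<forall>c\<in>atlas M. \<forall>d\<in>atlas M.
        Ck_on 3 (transition c d) (chart_map c ` (chart_dom c \<inter> chart_dom d))) \<and>
     (\<forall>c\<in>atlas M. \<forall>x\<in>chart_range c.
        bilinear (metric M c x) \<and>
        (\<forall>u v. metric M c x u v = metric M c x v u) \<and>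
        (\<forall>u. u \<noteq> 0 \<longrightarrow> metric M c x u u > 0)) \<and>
     (\<forall>c\<in>atlas M. \<forall>u v. Ck_on 2 (\<lambda>x. metric M c x u v) (chart_range c)) \<and>
     (\<forall>c\<in>atlas M. \<forall>d\<in>atlas M. \<forall>x \<in> chart_map c ` (chart_dom c \<inter> chart_dom d). \<forall>u v.
        metric M c x u v =
        metric M d (transition c d x)
          (frechet_derivative (transition c d) (at x) u)
          (frechet_derivative (transition c d) (at x) v))"

section \<open>Tangent vectors, connection, curvature\<close>

text \<open>\<open>T\<^sub>pM\<close> is identified with the model space through a chart chosen at \<open>p\<close>. Everything below
  that is a number or a condition does not depend on that choice.\<close>

definition chart_at :: "('a, 'e) riem \<Rightarrow> 'a \<Rightarrow> ('a, 'e) chart" where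
  "chart_at M p = (SOME c. c \<in> atlas M \<and> p \<in> chart_dom c)"

definition coords :: "('a, 'e) riem \<Rightarrow> 'a \<Rightarrow> 'e" where
  "coords M p = chart_map (chart_at M p) p"

text \<open>The components in the chart \<open>d\<close> of \<open>v \<in> T\<^sub>pM\<close>.\<close>

definition components :: "('a, 'e::euclidean_space) riem \<Rightarrow> ('a, 'e) chart \<Rightarrow> 'a \<Rightarrow> 'e \<Rightarrow> 'e" where
  "components M d p v = frechet_derivative (transition (chart_at M p) d) (at (coords M p)) v"

definition inner_at :: "('a, 'e) riem \<Rightarrow> 'a \<Rightarrow> 'e \<Rightarrow> 'e \<Rightarrow> real" where
  "inner_at M p = metric M (chart_at M p) (coords M p)"

definition norm_at :: "('a, 'e) riem \<Rightarrow> 'a \<Rightarrow> 'e \<Rightarrow> real" where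
  "norm_at M p v = sqrt (inner_at M p v v)"

text \<open>\<open>christoffel M c x u v\<close> is \<open>\<nabla>\<^sub>u v\<close> for vector fields \<open>u\<close>, \<open>v\<close> with constant components
  in the chart \<open>c\<close>. The Levi-Civita connection is the torsion-free (for constant fields: symmetric)
  connection compatible with the metric.\<close>

definition christoffel :: "('a, 'e::euclidean_space) riem \<Rightarrow> ('a, 'e) chart \<Rightarrow> 'e \<Rightarrow> 'e \<Rightarrow> 'e \<Rightarrow> 'e" where
  "christoffel M c x = (THE \<Gamma>. bilinear \<Gamma> \<and> (\<forall>u v. \<Gamma> u v = \<Gamma> v u) \<and>
     (\<forall>u v w. frechet_derivative (\<lambda>y. metric M c y u v) (at x) w =
              metric M c x (\<Gamma> w u) v + metric M c x u (\<Gamma> w v)))"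

text \<open>\<open>R(u,v)w = \<nabla>\<^sub>u\<nabla>\<^sub>v w - \<nabla>\<^sub>v\<nabla>\<^sub>u w - \<nabla>\<^bsub>[u,v]\<^esub> w\<close>, evaluated on fields with constant components.\<close>

definition riemann :: "('a, 'e::euclidean_space) riem \<Rightarrow> 'a \<Rightarrow> 'e \<Rightarrow> 'e \<Rightarrow> 'e \<Rightarrow> 'e" where
  "riemann M p u v w =
     (let c = chart_at M p; x = coords M p; \<Gamma> = christoffel M c in
        frechet_derivative (\<lambda>y. \<Gamma> y v w) (at x) u + \<Gamma> x u (\<Gamma> x v w)
      - (frechet_derivative (\<lambda>y. \<Gamma> y u w) (at x) v + \<Gamma> x v (\<Gamma> x u w)))"

definition sectional_curvature :: "('a, 'e::euclidean_space) riem \<Rightarrow> 'a \<Rightarrow> 'e \<Rightarrow> 'e \<Rightarrow> real" where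
  "sectional_curvature M p u v =
     inner_at M p (riemann M p u v v) u /
     (inner_at M p u u * inner_at M p v v - (inner_at M p u v)\<^sup>2)"

definition space_form :: "('a, 'e::euclidean_space) riem \<Rightarrow> bool" where
  "space_form M \<longleftrightarrow>
     (\<exists>K. \<forall>p\<in>points M. \<forall>u v. u \<noteq> v \<and> independent {u, v} \<longrightarrow> sectional_curvature M p u v = K)"

section \<open>Curves and geodesic spheres\<close>

text \<open>\<open>I\<close> is a nondegenerate interval, open or not; derivatives at endpoints are one-sided.\<close>

definition nondegenerate_interval :: "real set \<Rightarrow> bool" where
  "nondegenerate_interval I \<longleftrightarrow> is_interval I \<and> (\<exists>a\<in>I. \<exists>b\<in>I. a < b)"

definition C2_curve :: "('a, 'e::euclidean_space) riem \<Rightarrow> real set \<Rightarrow> (real \<Rightarrow> 'a) \<Rightarrow> bool" where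
  "C2_curve M I \<alpha> \<longleftrightarrow>
     continuous_map (top_of_set I) (mtop M) \<alpha> \<and>
     (\<forall>c\<in>atlas M. \<exists>v a.
        (\<forall>s\<in>I. \<alpha> s \<in> chart_dom c \<longrightarrow>
           ((chart_map c \<circ> \<alpha>) has_vector_derivative v s) (at s within I) \<and>
           (v has_vector_derivative a s) (at s within I)) \<and>
        continuous_on {s\<in>I. \<alpha> s \<in> chart_dom c} a)"

definition velocity :: "('a, 'e::euclidean_space) riem \<Rightarrow> real set \<Rightarrow> (real \<Rightarrow> 'a) \<Rightarrow> real \<Rightarrow> 'e" where
  "velocity M I \<alpha> s = vector_derivative (chart_map (chart_at M (\<alpha> s)) \<circ> \<alpha>) (at s within I)"

text \<open>Covariant derivative at \<open>s\<close> of a vector field \<open>Y\<close> along \<open>\<alpha>\<close>, where \<open>Y t \<in> T\<^bsub>\<alpha>(t)\<^esub>M\<close>. Since the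
  chart chosen at \<open>\<alpha> t\<close> varies with \<open>t\<close>, the field is first expressed in the chart chosen at \<open>\<alpha> s\<close>.\<close>

definition covariant_derivative ::
    "('a, 'e::euclidean_space) riem \<Rightarrow> real set \<Rightarrow> (real \<Rightarrow> 'a) \<Rightarrow> (real \<Rightarrow> 'e) \<Rightarrow> real \<Rightarrow> 'e" where
  "covariant_derivative M I \<alpha> Y s =
     (let c = chart_at M (\<alpha> s) in
        vector_derivative (\<lambda>t. components M c (\<alpha> t) (Y t)) (at s within I)
        + christoffel M c (coords M (\<alpha> s)) (velocity M I \<alpha> s) (Y s))"

abbreviation acceleration :: "('a, 'e::euclidean_space) riem \<Rightarrow> real set \<Rightarrow> (real \<Rightarrow> 'a) \<Rightarrow> real \<Rightarrow> 'e" where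
  "acceleration M I \<alpha> \<equiv> covariant_derivative M I \<alpha> (velocity M I \<alpha>)"

definition arclength_C2_curve :: "('a, 'e::euclidean_space) riem \<Rightarrow> real set \<Rightarrow> (real \<Rightarrow> 'a) \<Rightarrow> bool" where
  "arclength_C2_curve M I \<alpha> \<longleftrightarrow>
     C2_curve M I \<alpha> \<and> (\<forall>s\<in>I. norm_at M (\<alpha> s) (velocity M I \<alpha> s) = 1)"

definition curvature :: "('a, 'e::euclidean_space) riem \<Rightarrow> real set \<Rightarrow> (real \<Rightarrow> 'a) \<Rightarrow> real \<Rightarrow> real" where
  "curvature M I \<alpha> s = norm_at M (\<alpha> s) (acceleration M I \<alpha> s)"

definition geodesic :: "('a, 'e::euclidean_space) riem \<Rightarrow> real set \<Rightarrow> (real \<Rightarrow> 'a) \<Rightarrow> bool" where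
  "geodesic M I \<gamma> \<longleftrightarrow> C2_curve M I \<gamma> \<and> (\<forall>s\<in>I. acceleration M I \<gamma> s = 0)"

definition exp_graph :: "('a, 'e::euclidean_space) riem \<Rightarrow> 'a \<Rightarrow> 'e \<Rightarrow> 'a \<Rightarrow> bool" where
  "exp_graph M p v q \<longleftrightarrow>
     (\<exists>\<gamma>. geodesic M {0..1} \<gamma> \<and> \<gamma> 0 = p \<and> velocity M {0..1} \<gamma> 0 = v \<and> \<gamma> 1 = q)"

definition exp_domain :: "('a, 'e::euclidean_space) riem \<Rightarrow> 'a \<Rightarrow> 'e set" where
  "exp_domain M p = {v. \<exists>q. exp_graph M p v q}"

definition exp_map :: "('a, 'e::euclidean_space) riem \<Rightarrow> 'a \<Rightarrow> 'e \<Rightarrow> 'a" where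
  "exp_map M p v = (THE q. exp_graph M p v q)"

definition geodesic_sphere :: "('a, 'e::euclidean_space) riem \<Rightarrow> 'a \<Rightarrow> real \<Rightarrow> 'a set" where
  "geodesic_sphere M p R = {exp_map M p (R *\<^sub>R V) | V. norm_at M p V = 1}"

section \<open>Submanifolds and mean curvature\<close>

text \<open>Charts of a subset \<open>S\<close>, in its subspace topology, whose inverses are \<open>C\<^sup>2\<close> immersions. (In a
  \<open>C\<^sup>3\<close> manifold with \<open>C\<^sup>2\<close> metric small geodesic spheres are of class \<open>C\<^sup>2\<close> in general.)\<close>

definition submanifold_chart ::
    "('a, 'e::euclidean_space) riem \<Rightarrow> 'a set \<Rightarrow> ('a, 'f::euclidean_space) chart \<Rightarrow> bool" where
  "submanifold_chart M S c \<longleftrightarrow>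
     openin (subtopology (mtop M) S) (chart_dom c) \<and> open (chart_range c) \<and>
     homeomorphic_map (subtopology (mtop M) (chart_dom c)) (top_of_set (chart_range c)) (chart_map c) \<and>
     (\<forall>d\<in>atlas M.
        Ck_on 2 (transition c d) (chart_map c ` (chart_dom c \<inter> chart_dom d)) \<and>
        (\<forall>y \<in> chart_map c ` (chart_dom c \<inter> chart_dom d).
           inj (frechet_derivative (transition c d) (at y))))"

text \<open>\<open>S\<close> with its induced Riemannian structure. The dimension is that of the model space \<open>'f\<close>.\<close>

definition submanifold :: "('a, 'e::euclidean_space) riem \<Rightarrow> 'a set \<Rightarrow> ('a, 'f::euclidean_space) riem" where
  "submanifold M S =
     \<lparr> mtop = subtopology (mtop M) S,
       atlas = {c. submanifold_chart M S c},
       metric = (\<lambda>c y u v.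
         let q = chart_inv c y; D = frechet_derivative (transition c (chart_at M q)) (at y)
         in inner_at M q (D u) (D v)) \<rparr>"

definition is_submanifold :: "('a, 'e::euclidean_space) riem \<Rightarrow> 'a set \<Rightarrow> 'f::euclidean_space itself \<Rightarrow> bool" where
  "is_submanifold M S _ \<longleftrightarrow>
     S \<subseteq> points M \<and> (\<forall>q\<in>S. \<exists>c :: ('a, 'f) chart. submanifold_chart M S c \<and> q \<in> chart_dom c)"

text \<open>In the rest of this section \<open>N\<close> is a submanifold of \<open>M\<close>. The differential of the inclusion
  at \<open>q\<close> embeds \<open>T\<^sub>qN\<close> into \<open>T\<^sub>qM\<close>.\<close>

definition d_incl ::
    "('a, 'e::euclidean_space) riem \<Rightarrow> ('a, 'f::euclidean_space) riem \<Rightarrow> 'a \<Rightarrow> 'f \<Rightarrow> 'e" where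
  "d_incl M N q = frechet_derivative (transition (chart_at N q) (chart_at M q)) (at (coords N q))"

text \<open>A \<open>C\<^sup>1\<close> unit normal field; \<open>\<xi> q \<in> T\<^sub>qM\<close>.\<close>

definition unit_normal_field ::
    "('a, 'e::euclidean_space) riem \<Rightarrow> ('a, 'f::euclidean_space) riem \<Rightarrow> ('a \<Rightarrow> 'e) \<Rightarrow> bool" where
  "unit_normal_field M N \<xi> \<longleftrightarrow>
     (\<forall>q\<in>points N. norm_at M q (\<xi> q) = 1 \<and> (\<forall>u. inner_at M q (\<xi> q) (d_incl M N q u) = 0)) \<and>
     (\<forall>c\<in>atlas N. \<forall>d\<in>atlas M.
        Ck_on 1 (\<lambda>y. components M d (chart_inv c y) (\<xi> (chart_inv c y)))
          (chart_map c ` (chart_dom c \<inter> chart_dom d)))"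

text \<open>\<open>\<nabla>\<^sub>u \<xi>\<close> for a field \<open>\<xi>\<close> of vectors of \<open>M\<close> along \<open>N\<close> and \<open>u \<in> T\<^sub>qN\<close>.\<close>

definition nabla_along ::
    "('a, 'e::euclidean_space) riem \<Rightarrow> ('a, 'f::euclidean_space) riem \<Rightarrow> ('a \<Rightarrow> 'e) \<Rightarrow> 'a \<Rightarrow> 'f \<Rightarrow> 'e" where
  "nabla_along M N \<xi> q u =
     (let c = chart_at N q; d = chart_at M q in
        frechet_derivative (\<lambda>y. components M d (chart_inv c y) (\<xi> (chart_inv c y))) (at (coords N q)) u
        + christoffel M d (coords M q) (d_incl M N q u) (\<xi> q))"

text \<open>For a unit normal field along a hypersurface \<open>\<nabla>\<^sub>u \<xi>\<close> is tangent to it, so that the shape operator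
  is an endomorphism of \<open>T\<^sub>qN\<close>.\<close>

definition shape_operator ::
    "('a, 'e::euclidean_space) riem \<Rightarrow> ('a, 'f::euclidean_space) riem \<Rightarrow> ('a \<Rightarrow> 'e) \<Rightarrow> 'a \<Rightarrow> 'f \<Rightarrow> 'f" where
  "shape_operator M N \<xi> q u = (THE w. d_incl M N q w = - nabla_along M N \<xi> q u)"

definition endo_trace :: "('f::euclidean_space \<Rightarrow> 'f) \<Rightarrow> real" where
  "endo_trace A = (\<Sum>b\<in>Basis. A b \<bullet> b)"

definition mean_curvature ::
    "('a, 'e::euclidean_space) riem \<Rightarrow> ('a, 'f::euclidean_space) riem \<Rightarrow> ('a \<Rightarrow> 'e) \<Rightarrow> 'a \<Rightarrow> real" where
  "mean_curvature M N \<xi> q = endo_trace (shape_operator M N \<xi> q) / DIM('f)"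

end

theory Submission
  imports Defs
begin

text \<open>Let \<open>\<rho>\<close> be half the squared distance from \<open>p\<close> and \<open>T\<close> its gradient, that is, the field of the
  velocities at time \<open>1\<close> of the geodesics that start at \<open>p\<close>. By the Gauss lemma \<open>T/R\<close> is a unit normal of
  \<open>G(p,R)\<close>, whose shape operator is \<open>- B/R\<close> with \<open>B = \<nabla>T\<close>. A unit speed curve in \<open>G(p,R)\<close> with velocity
  \<open>v\<close> and intrinsic acceleration \<open>a\<close> has \<open>\<kappa>\<^sup>2 = \<bar>a\<bar>\<^sup>2 + (g(Bv,v)/R)\<^sup>2\<close>.

  If the curvature is constant, the Jacobi equation reduces to a scalar one and \<open>B = \<mu> id\<close> on the tangent
  spaces of the sphere, so that \<open>\<bar>H\<bar> = \<bar>\<mu>\<bar>/R\<close> and \<open>\<kappa>\<^sup>2 = \<bar>a\<bar>\<^sup>2 + H\<^sup>2\<close>.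

  Conversely, every unit tangent vector \<open>v\<close> of the sphere is the velocity of a curve with \<open>a = 0\<close> at one
  point, so that \<open>\<bar>H\<bar> \<le> \<bar>g(Bv,v)\<bar>/R\<close>. Since \<open>B\<close> is the identity at \<open>p\<close>, it is positive on small
  spheres; hence \<open>B - (tr B/m) id\<close> is positive semidefinite with trace \<open>0\<close> there, and vanishes. So small
  spheres are umbilical, orthogonal Jacobi fields along a radial geodesic stay orthogonal, and their
  expansion at \<open>p\<close> gives \<open>g(R(w,a)a,w') = 0\<close> for orthogonal triples. Thus the sectional curvature is
  constant at each point, and Schur's lemma applies. As the metric is only of class \<open>C\<^sup>2\<close>, the curvature
  tensor cannot be differentiated, and Schur's lemma is proved in a weak form, by integration against
  test functions.\<close>

section \<open>Maps of class \<open>C\<^sup>k\<close>\<close>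

text \<open>With a metric of class C^2 the Christoffel symbols, the geodesic flow and the
  exponential map are only of class C^1, so a sphere described as an image under the exponential map
  would be a C^1 hypersurface, without a second fundamental form. The way out is that the gradient T
  of \<rho> is itself of class C^1, being the end velocity of the flow. Hence \<rho> is of class
  C^2, spheres are treated as its level sets, and B is symmetric because it is a Hessian. The
  inequality for curves speaks of absolute values only, which is why the sign of B has to be known
  before traces can be compared. Umbilicity supplies, for each radial geodesic, a factor
  \<lambda>(t) with DJ = \<lambda>(t) J, but no information on how \<lambda> depends on t; it is
  eliminated by quotients of inner products. Dimension at least 3 enters twice: through orthogonal
  triples and through the three directions of the weak Bianchi identity. The chart chosen at a point
  jumps from point to point, so everything defined by it is first compared with one fixed
  chart.\<close>

abbreviation FD :: "('b::real_normed_vector \<Rightarrow> 'c::real_normed_vector) \<Rightarrow> 'b \<Rightarrow> 'b \<Rightarrow> 'c" where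
  "FD f x \<equiv> frechet_derivative f (at x)"

lemma FD_eq: "(f has_derivative f') (at x) \<Longrightarrow> FD f x = f'"
  using frechet_derivative_at by metis

text \<open>No differentiability is required: where it fails, \<open>frechet_derivative\<close> is a
  choice from a predicate that no map satisfies, and the two choices agree because the predicates
  do.\<close>

lemma FD_cong:
  assumes "open S" "x \<in> S" "\<And>y. y \<in> S \<Longrightarrow> f y = g y"
  shows "FD f x = FD g x"
proof (cases "f differentiable (at x)")
  case True
  then have "(g has_derivative FD f x) (at x)"
    using has_derivative_transform_within_open[of f "FD f x" x UNIV S g] assms
    by (auto simp: frechet_derivative_works)
  then show ?thesis by (simp add: FD_eq)
next
  case False
  have "\<not> g differentiable (at x)"
  proof
    assume "g differentiable (at x)"
    then have "(f has_derivative FD g x) (at x)"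
      using has_derivative_transform_within_open[of g "FD g x" x UNIV S f] assms
      by (auto simp: frechet_derivative_works)
    then show False using False by (auto simp: differentiable_def)
  qed
  then have "\<And>f'. (f has_derivative f') (at x) \<longleftrightarrow> (g has_derivative f') (at x)"
    using False by (auto simp: differentiable_def)
  then show ?thesis by (simp add: frechet_derivative_def)
qed

lemma Ck_on_has_derivative:
  "Ck_on (Suc k) f S \<Longrightarrow> open S \<Longrightarrow> x \<in> S \<Longrightarrow> (f has_derivative FD f x) (at x)"
  by (auto simp: differentiable_on_def at_within_open[of _ S] frechet_derivative_works[symmetric])

lemma Ck_on_FD: "Ck_on (Suc k) f S \<Longrightarrow> Ck_on k (\<lambda>x. FD f x v) S"
  by simp

lemma Ck_on_cong:
  fixes S :: "'e::euclidean_space set"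
  assumes "open S" "\<And>x. x \<in> S \<Longrightarrow> f x = g x"
  shows "Ck_on k f S \<longleftrightarrow> Ck_on k g S"
  using assms(2)
proof (induction k arbitrary: f g)
  case 0
  then show ?case by (simp cong: continuous_on_cong)
next
  case (Suc k)
  have 1: "f differentiable_on S \<longleftrightarrow> g differentiable_on S"
    using Suc.prems by (metis differentiable_on_def differentiable_transform_within zero_less_one)
  have "\<And>x. x \<in> S \<Longrightarrow> FD f x = FD g x" using FD_cong[OF assms(1)] Suc.prems by blast
  then have "\<And>v. Ck_on k (\<lambda>x. FD f x v) S \<longleftrightarrow> Ck_on k (\<lambda>x. FD g x v) S"
    by (intro Suc.IH) simp
  then show ?case using 1 by simp
qed

lemma Ck_on_SucI:
  fixes S :: "'e::euclidean_space set"
  assumes "open S" "\<And>x. x \<in> S \<Longrightarrow> (f has_derivative f' x) (at x)"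
    "\<And>v. Ck_on k (\<lambda>x. f' x v) S"
  shows "Ck_on (Suc k) f S"
proof -
  have "\<And>v. Ck_on k (\<lambda>x. FD f x v) S"
    using assms(3) by (subst Ck_on_cong[OF assms(1)]) (auto simp: FD_eq[OF assms(2)])
  then show ?thesis
    using assms by (auto simp: differentiable_on_def at_within_open[of _ S] differentiable_def)
qed

lemma Ck_on_subset: "Ck_on k f S \<Longrightarrow> T \<subseteq> S \<Longrightarrow> Ck_on k f T"
  by (induction k arbitrary: f) (auto intro: continuous_on_subset differentiable_on_subset)

lemma Ck_on_SucD: "Ck_on (Suc k) f S \<Longrightarrow> Ck_on k f S"
  by (induction k arbitrary: f) (auto intro: differentiable_imp_continuous_on)

lemma Ck_on_mono: "Ck_on k f S \<Longrightarrow> l \<le> k \<Longrightarrow> Ck_on l f S"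
proof (induction k)
  case (Suc k)
  then show ?case using Ck_on_SucD by (metis le_Suc_eq)
qed simp

text \<open>Used to extend a product with a test function by zero: the extension is inspected
  separately on the domain and on the complement of the support.\<close>

lemma Ck_on_local:
  fixes S :: "'e::euclidean_space set"
  assumes "\<And>x. x \<in> S \<Longrightarrow> \<exists>T. open T \<and> x \<in> T \<and> Ck_on k f T"
  shows "Ck_on k f S"
  using assms
proof (induction k arbitrary: f)
  case 0
  then show ?case
    unfolding Ck_on.simps continuous_on_eq_continuous_within
    by (metis at_within_open continuous_at_imp_continuous_at_within)
next
  case (Suc k)
  have "f differentiable_on S"
    using Suc.prems unfolding differentiable_on_def
    by (metis Ck_on.simps(2) at_within_open differentiable_at_withinI differentiable_on_def)
  moreover have "Ck_on k (\<lambda>x. FD f x v) S" for v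
    using Suc.prems by (intro Suc.IH) (metis Ck_on_FD)
  ultimately show ?case by simp
qed

lemma Ck_on_const: "open S \<Longrightarrow> Ck_on k (\<lambda>x. c) S"
  by (induction k arbitrary: c) (auto intro: Ck_on_SucI)

lemma Ck_on_bounded_linear:
  fixes S :: "'e::euclidean_space set"
  assumes "bounded_linear L" "open S"
  shows "Ck_on k f S \<Longrightarrow> Ck_on k (\<lambda>x. L (f x)) S"
proof (induction k arbitrary: f)
  case 0
  then show ?case using bounded_linear.continuous_on[OF assms(1)] by auto
next
  case (Suc k)
  show ?case
    by (rule Ck_on_SucI[OF assms(2) bounded_linear.has_derivative[OF assms(1) Ck_on_has_derivative[OF Suc.prems assms(2)]]])
      (use Suc in auto)
qed

lemma Ck_on_id: "open S \<Longrightarrow> Ck_on k (\<lambda>x::'e::euclidean_space. x) S"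
proof (induction k)
  case (Suc k)
  show ?case by (rule Ck_on_SucI[where f'="\<lambda>_ v. v"]) (auto intro: Ck_on_const Suc.prems)
qed auto

lemma Ck_on_add:
  fixes S :: "'e::euclidean_space set"
  shows "open S \<Longrightarrow> Ck_on k f S \<Longrightarrow> Ck_on k g S \<Longrightarrow> Ck_on k (\<lambda>x. f x + g x) S"
proof (induction k arbitrary: f g)
  case (Suc k)
  note d = Ck_on_has_derivative[OF Suc.prems(2,1)] Ck_on_has_derivative[OF Suc.prems(3,1)]
  show ?case
    by (rule Ck_on_SucI[OF Suc.prems(1) has_derivative_add[OF d]])
      (use Suc in auto)
qed (auto intro: continuous_intros)

lemma Ck_on_uminus:
  fixes S :: "'e::euclidean_space set"
  shows "open S \<Longrightarrow> Ck_on k f S \<Longrightarrow> Ck_on k (\<lambda>x. - f x) S"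
  using Ck_on_bounded_linear[OF bounded_linear_minus[OF bounded_linear_ident]] .

lemma Ck_on_diff:
  fixes S :: "'e::euclidean_space set"
  shows "open S \<Longrightarrow> Ck_on k f S \<Longrightarrow> Ck_on k g S \<Longrightarrow> Ck_on k (\<lambda>x. f x - g x) S"
  using Ck_on_add[of S k f "\<lambda>x. - g x"] Ck_on_uminus[of S k g] by simp

lemma Ck_on_sum:
  fixes S :: "'e::euclidean_space set"
  assumes "open S" "\<And>i. i \<in> I \<Longrightarrow> Ck_on k (f i) S"
  shows "Ck_on k (\<lambda>x. \<Sum>i\<in>I. f i x) S"
  using assms(2)
  by (induction I rule: infinite_finite_induct) (auto intro: Ck_on_const Ck_on_add assms(1))

lemma Ck_on_bounded_bilinear:
  fixes S :: "'e::euclidean_space set"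
  assumes "bounded_bilinear b" "open S"
  shows "Ck_on k f S \<Longrightarrow> Ck_on k g S \<Longrightarrow> Ck_on k (\<lambda>x. b (f x) (g x)) S"
proof (induction k arbitrary: f g)
  case 0
  then show ?case using bounded_bilinear.continuous_on[OF assms(1)] by auto
next
  case (Suc k)
  note d = Ck_on_has_derivative[OF Suc.prems(1) assms(2)] Ck_on_has_derivative[OF Suc.prems(2) assms(2)]
  show ?case
    by (rule Ck_on_SucI[OF assms(2) bounded_bilinear.FDERIV[OF assms(1) d]], assumption, assumption)
      (intro Ck_on_add assms(2) Suc.IH Ck_on_SucD[OF Suc.prems(1)] Ck_on_SucD[OF Suc.prems(2)]
        Ck_on_FD[OF Suc.prems(1)] Ck_on_FD[OF Suc.prems(2)])
qed

lemmas Ck_on_scaleR = Ck_on_bounded_bilinear[OF bounded_bilinear_scaleR]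
lemmas Ck_on_mult = Ck_on_bounded_bilinear[OF bounded_bilinear_mult]
lemmas Ck_on_inner = Ck_on_bounded_bilinear[OF bounded_bilinear_inner]

text \<open>Reduces the regularity of a family of linear maps at a moving vector to that of finitely
  many functions with constant arguments, so that \<open>Ck_on\<close> never has to be stated for
  operator-valued maps.\<close>

lemma linear_expand:
  fixes L :: "'u::euclidean_space \<Rightarrow> 'w::real_vector"
  assumes "linear L"
  shows "L u = (\<Sum>b\<in>Basis. (u \<bullet> b) *\<^sub>R L b)"
proof -
  have "L u = L (\<Sum>b\<in>Basis. (u \<bullet> b) *\<^sub>R b)" by (simp only: euclidean_representation)
  also have "\<dots> = (\<Sum>b\<in>Basis. (u \<bullet> b) *\<^sub>R L b)"
    by (simp only: linear_sum[OF assms] linear_scale[OF assms])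
  finally show ?thesis .
qed

text \<open>The derivative \<open>FD g (f x) (FD f x v)\<close> is a moving linear map at a moving
  vector. Expanded in the basis it involves \<open>g\<close> only through
  \<open>FD g (f x) b\<close> with fixed \<open>b\<close>, to which the induction hypothesis
  applies; hence the induction generalises over \<open>g\<close>.\<close>

lemma Ck_on_compose:
  fixes S :: "'e::euclidean_space set" and g :: "'d::euclidean_space \<Rightarrow> 'c::real_normed_vector"
  assumes "open S" "open T"
  shows "Ck_on k g T \<Longrightarrow> Ck_on k f S \<Longrightarrow> f ` S \<subseteq> T \<Longrightarrow> Ck_on k (\<lambda>x. g (f x)) S"
proof (induction k arbitrary: g)
  case 0
  then show ?case by (auto intro: continuous_on_compose2)
next
  case (Suc k)
  have dg: "x \<in> S \<Longrightarrow> (g has_derivative FD g (f x)) (at (f x))" for x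
    using Suc.prems Ck_on_has_derivative[OF Suc.prems(1) assms(2)] by blast
  have df: "x \<in> S \<Longrightarrow> (f has_derivative FD f x) (at x)" for x
    using Ck_on_has_derivative[OF Suc.prems(2) assms(1)] .
  have eq: "FD g (f x) (FD f x v) = (\<Sum>b\<in>Basis. (FD f x v \<bullet> b) *\<^sub>R FD g (f x) b)" if "x \<in> S" for x v
  by (rule linear_expand) (use dg[OF that] has_derivative_linear in blast)
  have "Ck_on k (\<lambda>x. FD g (f x) (FD f x v)) S" for v
  proof -
    have "Ck_on k (\<lambda>x. \<Sum>b\<in>Basis. (FD f x v \<bullet> b) *\<^sub>R FD g (f x) b) S"
      by (intro Ck_on_sum Ck_on_scaleR assms Ck_on_inner Ck_on_const Suc.IH
          Ck_on_FD[OF Suc.prems(1)] Ck_on_FD[OF Suc.prems(2)] Ck_on_SucD[OF Suc.prems(2)] Suc.prems(3))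
    then show ?thesis using Ck_on_cong[OF assms(1) eq] by auto
  qed
  then show ?case
    by (intro Ck_on_SucI[OF assms(1) has_derivative_compose[OF df dg]]) auto
qed

lemma Ck_on_inverse:
  fixes S :: "'e::euclidean_space set" and f :: "'e \<Rightarrow> real"
  assumes "open S" "\<And>x. x \<in> S \<Longrightarrow> f x \<noteq> 0"
  shows "Ck_on k f S \<Longrightarrow> Ck_on k (\<lambda>x. inverse (f x)) S"
proof (induction k)
  case 0
  then show ?case using assms by (auto intro: continuous_intros)
next
  case (Suc k)
  have IH: "Ck_on k (\<lambda>x. inverse (f x)) S" using Suc Ck_on_SucD by blast
  have "Ck_on k (\<lambda>x. - (inverse (f x) * FD f x v * inverse (f x))) S" for v
    using Ck_on_FD[OF Suc.prems, of v] IH assms(1) by (intro Ck_on_uminus Ck_on_mult)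
  then show ?case
    by (intro Ck_on_SucI[where f'="\<lambda>x v. - (inverse (f x) * FD f x v * inverse (f x))", OF assms(1)])
      (simp_all add: has_derivative_inverse Ck_on_has_derivative[OF Suc.prems] assms)
qed

subsection \<open>Families of bilinear maps\<close>

lemma bilinear_expand:
  fixes \<beta> :: "'u::euclidean_space \<Rightarrow> 'v::euclidean_space \<Rightarrow> 'w::real_vector"
  assumes "bilinear \<beta>"
  shows "\<beta> u v = (\<Sum>b\<in>Basis. \<Sum>c\<in>Basis. ((u \<bullet> b) * (v \<bullet> c)) *\<^sub>R \<beta> b c)"
proof -
  have "\<beta> u v = (\<Sum>b\<in>Basis. (u \<bullet> b) *\<^sub>R \<beta> b v)"
    by (rule linear_expand[of "\<lambda>u. \<beta> u v"]) (use assms in \<open>simp add: bilinear_def\<close>)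
  also have "\<dots> = (\<Sum>b\<in>Basis. \<Sum>c\<in>Basis. ((u \<bullet> b) * (v \<bullet> c)) *\<^sub>R \<beta> b c)"
  proof (intro sum.cong refl)
    fix b :: 'u
    have "\<beta> b v = (\<Sum>c\<in>Basis. (v \<bullet> c) *\<^sub>R \<beta> b c)"
      by (rule linear_expand) (use assms in \<open>simp add: bilinear_def\<close>)
    then show "(u \<bullet> b) *\<^sub>R \<beta> b v = (\<Sum>c\<in>Basis. ((u \<bullet> b) * (v \<bullet> c)) *\<^sub>R \<beta> b c)"
      by (simp only: scaleR_sum_right scaleR_scaleR)
  qed
  finally show ?thesis .
qed

text \<open>Metric and Christoffel symbols are known to be regular for constant arguments; this
  passes to arguments that are vector fields, with the base point moving along
  \<open>f\<close>.\<close>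

lemma Ck_on_bilinear_family:
  fixes S :: "'z::euclidean_space set" and f :: "'z \<Rightarrow> 'e::euclidean_space"
    and \<beta> :: "'e \<Rightarrow> 'u::euclidean_space \<Rightarrow> 'v::euclidean_space \<Rightarrow> 'w::real_normed_vector"
  assumes "open S" "open T" "\<And>x. x \<in> T \<Longrightarrow> bilinear (\<beta> x)" "\<And>u v. Ck_on k (\<lambda>x. \<beta> x u v) T"
    "f ` S \<subseteq> T" "Ck_on k f S" "Ck_on k X S" "Ck_on k Y S"
  shows "Ck_on k (\<lambda>x. \<beta> (f x) (X x) (Y x)) S"
proof -
  have "Ck_on k (\<lambda>x. \<Sum>b\<in>Basis. \<Sum>c\<in>Basis. ((X x \<bullet> b) * (Y x \<bullet> c)) *\<^sub>R \<beta> (f x) b c) S"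
    by (intro Ck_on_sum Ck_on_scaleR Ck_on_mult Ck_on_inner Ck_on_const assms
        Ck_on_compose[OF assms(1,2,4)])
  moreover have "\<beta> (f x) (X x) (Y x) = (\<Sum>b\<in>Basis. \<Sum>c\<in>Basis. ((X x \<bullet> b) * (Y x \<bullet> c)) *\<^sub>R \<beta> (f x) b c)"
    if "x \<in> S" for x
    using that assms(3,5) by (intro bilinear_expand) blast
  ultimately show ?thesis using Ck_on_cong[OF assms(1)] by (metis (no_types, lifting))
qed

text \<open>Every linearity relation of \<beta> holds on all of \<open>T\<close>, so its two sides
  have the same derivative at \<open>z\<close>.\<close>

lemma bilinear_derivative_family:
  fixes \<beta> :: "'e::real_normed_vector \<Rightarrow> 'u::real_vector \<Rightarrow> 'v::real_vector \<Rightarrow> 'w::real_normed_vector"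
  assumes T: "open T" "\<And>x. x \<in> T \<Longrightarrow> bilinear (\<beta> x)" "z \<in> T"
    and d\<beta>: "\<And>u v. ((\<lambda>x. \<beta> x u v) has_derivative \<beta>' u v) (at z)"
  shows "bilinear (\<lambda>u v. \<beta>' u v h)"
proof -
  have eq: "\<beta>' u v = D" if "((\<lambda>x. c x) has_derivative D) (at z)" "\<And>x. x \<in> T \<Longrightarrow> \<beta> x u v = c x" for u v c D
    using has_derivative_unique[OF d\<beta>[of u v] has_derivative_transform_within_open[OF that(1) T(1,3)]] that(2)
    by simp
  have "\<beta>' (u1 + u2) v = (\<lambda>h. \<beta>' u1 v h + \<beta>' u2 v h)" "\<beta>' (r *\<^sub>R u1) v = (\<lambda>h. r *\<^sub>R \<beta>' u1 v h)"
    "\<beta>' u1 (v + w) = (\<lambda>h. \<beta>' u1 v h + \<beta>' u1 w h)" "\<beta>' u1 (r *\<^sub>R v) = (\<lambda>h. r *\<^sub>R \<beta>' u1 v h)"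
    for u1 u2 v w r
       apply (rule eq[of "\<lambda>x. \<beta> x u1 v + \<beta> x u2 v"])
        apply (intro derivative_intros d\<beta>)
       apply (simp add: T(2) bilinear_ladd)
      apply (rule eq[of "\<lambda>x. r *\<^sub>R \<beta> x u1 v"])
       apply (intro derivative_intros d\<beta>)
      apply (simp add: T(2) bilinear_lmul)
     apply (rule eq[of "\<lambda>x. \<beta> x u1 v + \<beta> x u1 w"])
      apply (intro derivative_intros d\<beta>)
     apply (simp add: T(2) bilinear_radd)
    apply (rule eq[of "\<lambda>x. r *\<^sub>R \<beta> x u1 v"])
     apply (intro derivative_intros d\<beta>)
    apply (simp add: T(2) bilinear_rmul)
    done
  then show ?thesis by (auto simp: bilinear_def intro!: linearI)
qed

text \<open>Product rule for three moving ingredients. The derivative is taken within a set because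
  the rule is also applied to curves on closed intervals, with one-sided derivatives at the
  endpoints.\<close>

lemma has_derivative_bilinear_family:
  fixes f :: "'z::real_normed_vector \<Rightarrow> 'e::euclidean_space"
    and \<beta> :: "'e \<Rightarrow> 'u::euclidean_space \<Rightarrow> 'v::euclidean_space \<Rightarrow> 'w::real_normed_vector"
  assumes T: "open T" "\<And>x. x \<in> T \<Longrightarrow> bilinear (\<beta> x)"
    and d\<beta>: "\<And>u v. ((\<lambda>x. \<beta> x u v) has_derivative \<beta>' u v) (at (f z))"
    and f: "f z \<in> T" "(f has_derivative f') (at z within S)"
    and X: "(X has_derivative X') (at z within S)" and Y: "(Y has_derivative Y') (at z within S)"
  shows "((\<lambda>x. \<beta> (f x) (X x) (Y x)) has_derivative
     (\<lambda>h. \<beta>' (X z) (Y z) (f' h) + \<beta> (f z) (X' h) (Y z) + \<beta> (f z) (X z) (Y' h))) (at z within S)"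
proof -
  let ?s = "\<lambda>x. \<Sum>b\<in>Basis. \<Sum>c\<in>Basis. ((X x \<bullet> b) * (Y x \<bullet> c)) *\<^sub>R \<beta> (f x) b c"
  have d1: "((\<lambda>x. \<beta> (f x) b c) has_derivative (\<lambda>h. \<beta>' b c (f' h))) (at z within S)" for b c
    using has_derivative_compose[OF f(2) d\<beta>] .
  have D: "(?s has_derivative
     (\<lambda>h. \<Sum>b\<in>Basis. \<Sum>c\<in>Basis. ((X z \<bullet> b) * (Y z \<bullet> c)) *\<^sub>R \<beta>' b c (f' h)
         + ((X z \<bullet> b) * (Y' h \<bullet> c) + (X' h \<bullet> b) * (Y z \<bullet> c)) *\<^sub>R \<beta> (f z) b c)) (at z within S)"
    by (intro has_derivative_sum has_derivative_scaleR has_derivative_mult d1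
        has_derivative_inner_left X Y)
  have bil\<beta>': "bilinear (\<lambda>u v. \<beta>' u v h)" for h
    using bilinear_derivative_family[OF T f(1) d\<beta>] .
  have "(\<Sum>b\<in>Basis. \<Sum>c\<in>Basis. ((X z \<bullet> b) * (Y z \<bullet> c)) *\<^sub>R \<beta>' b c (f' h)
         + ((X z \<bullet> b) * (Y' h \<bullet> c) + (X' h \<bullet> b) * (Y z \<bullet> c)) *\<^sub>R \<beta> (f z) b c)
      = \<beta>' (X z) (Y z) (f' h) + \<beta> (f z) (X' h) (Y z) + \<beta> (f z) (X z) (Y' h)" for h
    unfolding bilinear_expand[OF T(2)[OF f(1)], of "X' h" "Y z"] bilinear_expand[OF T(2)[OF f(1)], of "X z" "Y' h"]
      bilinear_expand[OF bil\<beta>', of "X z" "Y z"]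
    by (simp only: sum.distrib scaleR_left_distrib add_ac)
  then have D': "(?s has_derivative
     (\<lambda>h. \<beta>' (X z) (Y z) (f' h) + \<beta> (f z) (X' h) (Y z) + \<beta> (f z) (X z) (Y' h))) (at z within S)"
    using D by simp
  have "\<forall>\<^sub>F x in at z within S. f x \<in> T"
    using has_derivative_continuous[OF f(2)] T(1) f(1)
    by (auto simp: continuous_within dest: topological_tendstoD)
  then have "\<forall>\<^sub>F x in at z within S. ?s x = \<beta> (f x) (X x) (Y x)"
    by eventually_elim (rule bilinear_expand[OF T(2), symmetric])
  moreover have "?s z = \<beta> (f z) (X z) (Y z)"
    using bilinear_expand[OF T(2)[OF f(1)], of "X z" "Y z"] by simp
  ultimately show ?thesis
    using D' unfolding has_derivative_within
    by (elim conjE, intro conjI) (auto elim!: Lim_transform_eventually elim: eventually_mono)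
qed

lemma bilinear_FD:
  fixes \<beta> :: "'e::euclidean_space \<Rightarrow> 'u::real_vector \<Rightarrow> 'v::real_vector \<Rightarrow> 'w::real_normed_vector"
  assumes "open T" "\<And>x. x \<in> T \<Longrightarrow> bilinear (\<beta> x)" "\<And>u v. Ck_on (Suc k) (\<lambda>x. \<beta> x u v) T" "x \<in> T"
  shows "bilinear (\<lambda>u v. FD (\<lambda>x. \<beta> x u v) x h)"
  by (rule bilinear_derivative_family[OF assms(1,2,4) Ck_on_has_derivative[OF assms(3,1,4)]])

subsection \<open>Symmetry of second derivatives\<close>

lemma has_real_derivative_along_line:
  fixes f :: "'e::euclidean_space \<Rightarrow> real"
  assumes "(f has_derivative f') (at (y + t *\<^sub>R u))"
  shows "((\<lambda>s. f (y + s *\<^sub>R u)) has_real_derivative f' u) (at t)"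
proof -
  have "((\<lambda>s. y + s *\<^sub>R u) has_derivative (\<lambda>s. s *\<^sub>R u)) (at t)"
    by (auto intro!: derivative_eq_intros)
  from has_derivative_compose[OF this assms] show ?thesis
    using linear_scale[OF has_derivative_linear[OF assms]]
    by (simp add: has_field_derivative_def mult_commute_abs)
qed

text \<open>Two applications of the mean value theorem: in direction \<open>u\<close> to the
  increment of \<open>f\<close> in direction \<open>v\<close>, then in direction \<open>v\<close> to
  the derivative \<open>FD f y u\<close>.\<close>

lemma second_difference:
  fixes f :: "'e::euclidean_space \<Rightarrow> real"
  assumes "open S" "Ck_on (Suc (Suc k)) f S" "h > 0"
    "\<And>s t. 0 \<le> s \<Longrightarrow> s \<le> h \<Longrightarrow> 0 \<le> t \<Longrightarrow> t \<le> h \<Longrightarrow> x + s *\<^sub>R u + t *\<^sub>R v \<in> S"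
  obtains s t where "0 \<le> s" "s \<le> h" "0 \<le> t" "t \<le> h"
    "f (x + h *\<^sub>R u + h *\<^sub>R v) - f (x + h *\<^sub>R u) - (f (x + h *\<^sub>R v) - f x)
       = h * (h * FD (\<lambda>y. FD f y u) (x + s *\<^sub>R u + t *\<^sub>R v) v)"
proof -
  have d1: "\<And>y. y \<in> S \<Longrightarrow> (f has_derivative FD f y) (at y)"
    using Ck_on_has_derivative[OF assms(2,1)] .
  have d2: "\<And>y. y \<in> S \<Longrightarrow> ((\<lambda>y. FD f y u) has_derivative FD (\<lambda>y. FD f y u) y) (at y)"
    using Ck_on_has_derivative[OF Ck_on_FD[OF assms(2)] assms(1)] .
  have in1: "x + h *\<^sub>R v + s *\<^sub>R u \<in> S" "x + s *\<^sub>R u \<in> S" if "0 \<le> s" "s \<le> h" for s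
    using assms(4)[of s h] assms(4)[of s 0] that assms(3) by (simp_all add: algebra_simps)
  have "\<exists>s. 0 < s \<and> s < h \<and> (f (x + h *\<^sub>R v + h *\<^sub>R u) - f (x + h *\<^sub>R u)) - (f (x + h *\<^sub>R v + 0 *\<^sub>R u) - f (x + 0 *\<^sub>R u))
     = (h - 0) * (FD f (x + h *\<^sub>R v + s *\<^sub>R u) u - FD f (x + s *\<^sub>R u) u)"
    by (intro MVT2[OF assms(3)] DERIV_diff has_real_derivative_along_line d1 in1)
  then obtain s where s: "0 < s" "s < h" "(f (x + h *\<^sub>R v + h *\<^sub>R u) - f (x + h *\<^sub>R u)) - (f (x + h *\<^sub>R v) - f x)
     = h * (FD f (x + h *\<^sub>R v + s *\<^sub>R u) u - FD f (x + s *\<^sub>R u) u)" by auto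
  have "\<exists>t. 0 < t \<and> t < h \<and> FD f (x + s *\<^sub>R u + h *\<^sub>R v) u - FD f (x + s *\<^sub>R u + 0 *\<^sub>R v) u
     = (h - 0) * FD (\<lambda>y. FD f y u) (x + s *\<^sub>R u + t *\<^sub>R v) v"
    by (intro MVT2[OF assms(3)] has_real_derivative_along_line d2 assms(4)) (use s in auto)
  then obtain t where t: "0 < t" "t < h" "FD f (x + s *\<^sub>R u + h *\<^sub>R v) u - FD f (x + s *\<^sub>R u) u
     = h * FD (\<lambda>y. FD f y u) (x + s *\<^sub>R u + t *\<^sub>R v) v" by auto
  show thesis
    using s t that[of s t] by (simp add: add_ac)
qed

text \<open>The second difference over a parallelogram does not depend on the order of
  \<open>u\<close> and \<open>v\<close>. So a value of one mixed derivative near \<open>x\<close>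
  equals a value of the other near \<open>x\<close>, and continuity does the rest.\<close>

lemma Ck_on_symmetric_real:
  fixes f :: "'e::euclidean_space \<Rightarrow> real"
  assumes "open S" "Ck_on (Suc (Suc k)) f S" "x \<in> S"
  shows "FD (\<lambda>y. FD f y u) x v = FD (\<lambda>y. FD f y v) x u"
proof (rule ccontr)
  define F where "F = (\<lambda>y. FD (\<lambda>y. FD f y u) y v - FD (\<lambda>y. FD f y v) y u)"
  define G1 where "G1 = (\<lambda>y. FD (\<lambda>y. FD f y u) y v)"
  define G2 where "G2 = (\<lambda>y. FD (\<lambda>y. FD f y v) y u)"
  assume "FD (\<lambda>y. FD f y u) x v \<noteq> FD (\<lambda>y. FD f y v) x u"
  then have e: "\<bar>G1 x - G2 x\<bar> / 2 > 0" (is "?e > 0") by (simp add: G1_def G2_def)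
  have "continuous_on S G1" "continuous_on S G2"
    unfolding G1_def G2_def using Ck_on_mono[OF Ck_on_FD[OF Ck_on_FD[OF assms(2)]], of 0] by auto
  then have "isCont G1 x" "isCont G2 x" using assms(1,3) continuous_on_eq_continuous_at by blast+
  then obtain d1 d2 where d: "d1 > 0" "d2 > 0" "\<And>y. dist y x < d1 \<Longrightarrow> dist (G1 y) (G1 x) < ?e"
    "\<And>y. dist y x < d2 \<Longrightarrow> dist (G2 y) (G2 x) < ?e"
    using e unfolding continuous_at_eps_delta by metis
  obtain d3 where d3: "d3 > 0" "ball x d3 \<subseteq> S" using assms openE by blast
  \<comment> \<open>Small enough for the parallelogram with sides \<open>h u\<close> and
    \<open>h v\<close> to lie in all three balls; the summand 1 avoids division by zero.\<close>
  define h where "h = min d1 (min d2 d3) / (2 * (norm u + norm v + 1))"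
  have n: "norm u + norm v + 1 > 0" by (smt (verit) norm_ge_zero)
  have h: "h > 0" using d d3 n unfolding h_def by simp
  have hs: "h * (norm u + norm v + 1) < min d1 (min d2 d3)"
  proof -
    have "m / (2 * c) * c < m" if "m > 0" "c > 0" for m c :: real
      using that by simp
    then show ?thesis unfolding h_def by this (use d d3 n in simp_all)
  qed
  have near: "dist (x + s *\<^sub>R u + t *\<^sub>R v) x < min d1 (min d2 d3)"
    if "0 \<le> s" "s \<le> h" "0 \<le> t" "t \<le> h" for s t
  proof -
    have "dist (x + s *\<^sub>R u + t *\<^sub>R v) x \<le> s * norm u + t * norm v"
      using that by (simp add: dist_norm) (metis abs_of_nonneg norm_scaleR norm_triangle_ineq)
    also have "\<dots> \<le> h * (norm u + norm v + 1)"
      using that h by (simp add: distrib_left add_increasing2 mult_right_mono add_mono)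
    finally show ?thesis using hs by simp
  qed
  have inS: "x + s *\<^sub>R u + t *\<^sub>R v \<in> S" if "0 \<le> s" "s \<le> h" "0 \<le> t" "t \<le> h" for s t
    using near[OF that] d3 by (auto simp: dist_commute)
  have inS': "x + s *\<^sub>R v + t *\<^sub>R u \<in> S" if "0 \<le> s" "s \<le> h" "0 \<le> t" "t \<le> h" for s t
    using inS[OF that(3,4,1,2)] by (simp add: add_ac)
  obtain s t where st: "0 \<le> s" "s \<le> h" "0 \<le> t" "t \<le> h"
    "f (x + h *\<^sub>R u + h *\<^sub>R v) - f (x + h *\<^sub>R u) - (f (x + h *\<^sub>R v) - f x)
       = h * (h * G1 (x + s *\<^sub>R u + t *\<^sub>R v))"
    unfolding G1_def using second_difference[OF assms(1,2) h inS] by blast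
  obtain s' t' where st': "0 \<le> s'" "s' \<le> h" "0 \<le> t'" "t' \<le> h"
    "f (x + h *\<^sub>R v + h *\<^sub>R u) - f (x + h *\<^sub>R v) - (f (x + h *\<^sub>R u) - f x)
       = h * (h * G2 (x + s' *\<^sub>R v + t' *\<^sub>R u))"
    unfolding G2_def using second_difference[OF assms(1,2) h inS'] by blast
  have "h * (h * G1 (x + s *\<^sub>R u + t *\<^sub>R v)) = h * (h * G2 (x + t' *\<^sub>R u + s' *\<^sub>R v))"
    unfolding st(5)[symmetric] using st'(5) by (simp add: add_ac)
  then have "G1 (x + s *\<^sub>R u + t *\<^sub>R v) = G2 (x + t' *\<^sub>R u + s' *\<^sub>R v)" using h by simp
  moreover have "dist (G1 (x + s *\<^sub>R u + t *\<^sub>R v)) (G1 x) < ?e" "dist (G2 (x + t' *\<^sub>R u + s' *\<^sub>R v)) (G2 x) < ?e"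
    using near st st' d by simp_all
  ultimately show False unfolding dist_real_def by (smt (verit) field_sum_of_halves)
qed

lemma FD_inner_left:
  "(f has_derivative f') (at x) \<Longrightarrow> FD (\<lambda>y. f y \<bullet> c) x v = f' v \<bullet> c"
  using FD_eq[OF has_derivative_inner_left] by metis

lemma Ck_on_symmetric:
  fixes f :: "'e::euclidean_space \<Rightarrow> 'c::euclidean_space"
  assumes "open S" "Ck_on (Suc (Suc k)) f S" "x \<in> S"
  shows "FD (\<lambda>y. FD f y u) x v = FD (\<lambda>y. FD f y v) x u"
proof (rule euclidean_eqI)
  fix c :: 'c
  have C: "Ck_on (Suc (Suc k)) (\<lambda>y. f y \<bullet> c) S"
    by (intro Ck_on_inner Ck_on_const assms)
  have *: "FD (\<lambda>y. FD (\<lambda>y. f y \<bullet> c) y w) x z = FD (\<lambda>y. FD f y w) x z \<bullet> c" for w z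
  proof -
    have "FD (\<lambda>y. FD (\<lambda>y. f y \<bullet> c) y w) x = FD (\<lambda>y. FD f y w \<bullet> c) x"
      by (rule FD_cong[OF assms(1,3)]) (rule FD_inner_left[OF Ck_on_has_derivative[OF assms(2,1)]])
    then show ?thesis
      using FD_inner_left[OF Ck_on_has_derivative[OF Ck_on_FD[OF assms(2)] assms(1,3)]] by metis
  qed
  show "FD (\<lambda>y. FD f y u) x v \<bullet> c = FD (\<lambda>y. FD f y v) x u \<bullet> c"
    using Ck_on_symmetric_real[OF assms(1) C assms(3)] by (metis *)
qed

text \<open>The operator-valued form of the derivative, as the inverse function theorem and the
  local Lipschitz criterion use it; in finite dimension continuity can be checked on each basis
  vector.\<close>

lemma continuous_on_blinfun_FD:
  fixes f :: "'e::euclidean_space \<Rightarrow> 'c::euclidean_space"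
  assumes "open S" "Ck_on (Suc k) f S"
  shows "continuous_on S (\<lambda>x. Blinfun (FD f x))"
proof (rule continuous_on_blinfun_componentwise)
  fix b :: 'e
  have "x \<in> S \<Longrightarrow> bounded_linear (FD f x)" for x
    using Ck_on_has_derivative[OF assms(2,1)] has_derivative_bounded_linear by blast
  moreover have "continuous_on S (\<lambda>x. FD f x b)"
    using Ck_on_mono[OF Ck_on_FD[OF assms(2)], of 0] by simp
  ultimately show "continuous_on S (\<lambda>x. blinfun_apply (Blinfun (FD f x)) b)"
    by (simp add: bounded_linear_Blinfun_apply cong: continuous_on_cong)
qed

section \<open>Ordinary differential equations\<close>

text \<open>Replaces Gronwall's inequality on the unit interval: where the norm of \<open>d\<close>
  attains its maximum m, the mean value inequality gives m \<le> norm (d 0) + m/2 + e. All estimates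
  for the flow take this form, since time is rescaled until the Lipschitz constant is 1/2.\<close>

lemma half_contraction_bound:
  fixes d :: "real \<Rightarrow> 'b::real_normed_vector"
  assumes d: "\<And>t. t \<in> {0..1} \<Longrightarrow> (d has_vector_derivative d' t) (at t within {0..1})"
    and b: "\<And>t. t \<in> {0..1} \<Longrightarrow> norm (d' t) \<le> norm (d t) / 2 + e" and t: "t \<in> {0..1}"
  shows "norm (d t) \<le> 2 * (norm (d 0) + e)"
proof -
  have "continuous_on {0..1} d"
    using d has_vector_derivative_continuous continuous_on_eq_continuous_within by blast
  then have c: "continuous_on {0..1} (\<lambda>t. norm (d t))" by (intro continuous_intros)
  obtain s where s: "s \<in> {0..1}" "\<And>t. t \<in> {0..1} \<Longrightarrow> norm (d t) \<le> norm (d s)"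
    using continuous_attains_sup[OF compact_Icc _ c] by auto
  have "norm (d s - d 0) \<le> (norm (d s) / 2 + e) * norm (s - 0)"
  proof (rule differentiable_bound[where S="{0..1}"])
    show "(d has_derivative (\<lambda>h. h *\<^sub>R d' x)) (at x within {0..1})" if "x \<in> {0..1}" for x
      using d[OF that] by (simp add: has_vector_derivative_def)
    show "onorm (\<lambda>h. h *\<^sub>R d' x) \<le> norm (d s) / 2 + e" if "x \<in> {0..1}" for x
    proof -
      have "norm (h *\<^sub>R d' x) \<le> (norm (d s) / 2 + e) * norm h" for h
        using b[OF that] s(2)[OF that] by (simp add: mult.commute mult_left_mono)
      then show ?thesis by (rule onorm_le)
    qed
  qed (use s in auto)
  also have "\<dots> \<le> norm (d s) / 2 + e"
  proof -
    have "0 \<le> norm (d s) / 2 + e" using b[OF s(1)] norm_ge_zero order_trans by blast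
    then show ?thesis using s(1) by (simp add: mult_left_le)
  qed
  finally have "norm (d s) \<le> 2 * (norm (d 0) + e)"
    using norm_triangle_ineq2[of "d s" "d 0"] by simp
  then show ?thesis using s(2)[OF t] by simp
qed

text \<open>Fixed point of the integral operator, a contraction with factor 1/2 in the supremum norm
  because the interval has length 1. The set \<open>C\<close> is a closed ball for the flow and the
  whole space for the linearised equation.\<close>

lemma picard:
  fixes F :: "real \<Rightarrow> 'b::euclidean_space \<Rightarrow> 'b"
  assumes cF: "continuous_on ({0..1} \<times> C) (\<lambda>(t, x). F t x)"
    and C: "closed C" "z \<in> C"
    and lip: "\<And>t x y. t \<in> {0..1} \<Longrightarrow> x \<in> C \<Longrightarrow> y \<in> C \<Longrightarrow> norm (F t x - F t y) \<le> norm (x - y) / 2"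
    and inv: "\<And>c t. continuous_on {0..1} c \<Longrightarrow> c ` {0..1} \<subseteq> C \<Longrightarrow> t \<in> {0..1} \<Longrightarrow>
      z + integral {0..t} (\<lambda>s. F s (c s)) \<in> C"
  obtains x where "x 0 = z" "\<And>t. t \<in> {0..1} \<Longrightarrow> x t \<in> C"
    "\<And>t. t \<in> {0..1} \<Longrightarrow> (x has_vector_derivative F t (x t)) (at t within {0..1})"
proof -
  have cont: "continuous_on {0..1} (\<lambda>s. F s (c s))" if "continuous_on {0..1} c" "c ` {0..1} \<subseteq> C" for c
  proof -
    have "continuous_on {0..1} (\<lambda>s. (\<lambda>(t, x). F t x) (s, c s))"
      by (rule continuous_on_compose2[OF cF]) (use that in \<open>auto intro!: continuous_intros\<close>)
    then show ?thesis by simp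
  qed
  define I where "I c t = z + integral {0..t} (\<lambda>s. F s (c s))" for c t
  \<comment> \<open>Bounded continuous functions live on the whole line, so time is clamped to the
    unit interval.\<close>
  define cl where "cl t = max 0 (min 1 (t::real))" for t
  have cl: "cl t \<in> {0..1}" "t \<in> {0..1} \<Longrightarrow> cl t = t" for t by (auto simp: cl_def)
  have ccl: "continuous_on UNIV cl" unfolding cl_def by (intro continuous_intros)
  define S where "S = {c :: real \<Rightarrow>\<^sub>C 'b. \<forall>t. apply_bcontfun c t \<in> C}"
  have S: "continuous_on {0..1} (apply_bcontfun c)" "apply_bcontfun c ` {0..1} \<subseteq> C" if "c \<in> S" for c
    using that by (auto simp: S_def)
  define P where "P c = Bcontfun (\<lambda>t. I (apply_bcontfun c) (cl t))" for c
  have cI: "continuous_on {0..1} (I c)" if "continuous_on {0..1} c" "c ` {0..1} \<subseteq> C" for c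
    unfolding I_def using cont[OF that]
    by (intro continuous_intros indefinite_integral_continuous_1 integrable_continuous_real)
  have P: "apply_bcontfun (P c) = (\<lambda>t. I (apply_bcontfun c) (cl t))" if "c \<in> S" for c
  proof -
    have "(\<lambda>t. I (apply_bcontfun c) (cl t)) \<in> bcontfun"
    proof (unfold bcontfun_def, safe)
      show "continuous_on UNIV (\<lambda>t. I (apply_bcontfun c) (cl t))"
        by (rule continuous_on_compose2[OF cI[OF S[OF that]] ccl]) (use cl in auto)
      have "range (\<lambda>t. I (apply_bcontfun c) (cl t)) \<subseteq> I (apply_bcontfun c) ` {0..1}" using cl by auto
      then show "bounded (range (\<lambda>t. I (apply_bcontfun c) (cl t)))"
        using bounded_subset[OF compact_imp_bounded[OF compact_continuous_image[OF cI[OF S[OF that]] compact_Icc]]] by simp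
    qed
    then show ?thesis unfolding P_def by (simp add: Bcontfun_inverse)
  qed
  have "\<exists>!c. c \<in> S \<and> P c = c"
  proof (rule Banach_fix[of S "1/2"])
    have "closed S"
    proof -
      have "S = PiC UNIV (\<lambda>_. C)" by (auto simp: S_def mem_PiC_iff Pi_iff)
      then show ?thesis using closed_PiC[of UNIV "\<lambda>_. C"] C(1) by simp
    qed
    then show "complete S" by (simp add: complete_eq_closed)
    have "const_bcontfun z \<in> S" using C by (simp add: S_def)
    then show "S \<noteq> {}" by auto
    show "P ` S \<subseteq> S"
      using inv S cl by (auto simp: S_def[THEN eqset_imp_iff] P I_def)
    show "dist (P c) (P d) \<le> 1/2 * dist c d" if "c \<in> S" "d \<in> S" for c d
    proof (rule dist_bound)
      fix t
      have i: "(\<lambda>s. F s (apply_bcontfun c s)) integrable_on {0..cl t}" "(\<lambda>s. F s (apply_bcontfun d s)) integrable_on {0..cl t}"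
        using cont[OF S[OF that(1)]] cont[OF S[OF that(2)]] cl(1)[of t]
        by (auto intro!: integrable_continuous_real elim: continuous_on_subset)
      have "norm (integral {0..cl t} (\<lambda>s. F s (apply_bcontfun c s) - F s (apply_bcontfun d s)))
          \<le> (1/2 * dist c d) * (cl t - 0)"
      proof (rule integral_bound)
        show "continuous_on {0..cl t} (\<lambda>s. F s (apply_bcontfun c s) - F s (apply_bcontfun d s))"
          using cont[OF S[OF that(1)]] cont[OF S[OF that(2)]] cl(1)[of t]
          by (auto intro!: continuous_intros elim: continuous_on_subset)
        show "norm (F s (apply_bcontfun c s) - F s (apply_bcontfun d s)) \<le> 1/2 * dist c d" if "s \<in> {0..cl t}" for s
        proof -
          have "norm (F s (apply_bcontfun c s) - F s (apply_bcontfun d s)) \<le> norm (apply_bcontfun c s - apply_bcontfun d s) / 2"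
            using that cl(1)[of t] \<open>c \<in> S\<close> \<open>d \<in> S\<close> by (intro lip) (auto simp: S_def)
          then show ?thesis using dist_bounded[of c s d] by (simp add: dist_norm)
        qed
      qed (use cl(1)[of t] in auto)
      also have "\<dots> \<le> 1/2 * dist c d" using cl(1)[of t] by (auto simp: mult_left_le)
      finally show "dist (apply_bcontfun (P c) t) (apply_bcontfun (P d) t) \<le> 1/2 * dist c d"
        using i by (simp add: P that I_def dist_norm integral_diff)
    qed
  qed auto
  then obtain c where c: "c \<in> S" "P c = c" by blast
  have eq: "apply_bcontfun c t = I (apply_bcontfun c) t" if "t \<in> {0..1}" for t
    using P[OF c(1)] c(2) cl(2)[OF that] by metis
  show thesis
  proof
    show "apply_bcontfun c 0 = z" using eq[of 0] by (simp add: I_def)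
    show "apply_bcontfun c t \<in> C" for t using c(1) by (simp add: S_def)
    fix t :: real assume t: "t \<in> {0..1}"
    have "(I (apply_bcontfun c) has_vector_derivative 0 + F t (apply_bcontfun c t)) (at t within {0..1})"
      unfolding I_def
      by (intro has_vector_derivative_add has_vector_derivative_const
          integral_has_vector_derivative[OF cont[OF S[OF c(1)]] t])
    then show "(apply_bcontfun c has_vector_derivative F t (apply_bcontfun c t)) (at t within {0..1})"
      using has_vector_derivative_transform[OF t eq] by simp
  qed
qed

text \<open>On a compact ball the operator-valued derivative is bounded and uniformly continuous,
  and convexity allows the mean value inequality along segments. The last conclusion is
  differentiability with a modulus that is uniform in the base point.\<close>

lemma C1_uniform_on_cball:
  fixes f :: "'b::euclidean_space \<Rightarrow> 'c::euclidean_space"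
  assumes W: "open W" "Ck_on 1 f W" "cball z0 r \<subseteq> W"
  obtains L where "L > 0" "\<And>x h. x \<in> cball z0 r \<Longrightarrow> norm (FD f x h) \<le> L * norm h"
    "\<And>x y. x \<in> cball z0 r \<Longrightarrow> y \<in> cball z0 r \<Longrightarrow> norm (f x - f y) \<le> L * norm (x - y)"
    "\<And>\<eta>. \<eta> > 0 \<Longrightarrow> \<exists>\<kappa>>0. \<forall>x\<in>cball z0 r. \<forall>y\<in>cball z0 r. dist y x < \<kappa> \<longrightarrow>
      norm (f y - f x - FD f x (y - x)) \<le> \<eta> * norm (y - x) \<and> (\<forall>h. norm (FD f y h - FD f x h) \<le> \<eta> * norm h)"
proof -
  define A where "A x = Blinfun (FD f x)" for x
  have W': "Ck_on (Suc 0) f W" using W(2) by simp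
  have d: "(f has_derivative FD f x) (at x)" if "x \<in> cball z0 r" for x
    using Ck_on_has_derivative[OF W' W(1)] W(3) that by blast
  have A: "blinfun_apply (A x) = FD f x" if "x \<in> cball z0 r" for x
    unfolding A_def using d[OF that] has_derivative_bounded_linear bounded_linear_Blinfun_apply by blast
  have cA: "continuous_on (cball z0 r) A"
    unfolding A_def using continuous_on_blinfun_FD[OF W(1) W'] W(3) continuous_on_subset by blast
  then have "bounded (A ` cball z0 r)"
    by (rule compact_imp_bounded[OF compact_continuous_image[OF _ compact_cball]])
  then obtain L where L: "L > 0" "\<And>x. x \<in> cball z0 r \<Longrightarrow> norm (A x) \<le> L"
    unfolding bounded_pos by auto
  show thesis
  proof
    show "L > 0" by fact
    show b: "norm (FD f x h) \<le> L * norm h" if "x \<in> cball z0 r" for x h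
      using order_trans[OF norm_blinfun[of "A x" h] mult_right_mono[OF L(2)[OF that] norm_ge_zero]] A[OF that]
      by simp
    show "norm (f x - f y) \<le> L * norm (x - y)" if "x \<in> cball z0 r" "y \<in> cball z0 r" for x y
      by (rule differentiable_bound[of "cball z0 r" f "FD f"])
        (use that d b in \<open>auto intro: has_derivative_at_withinI onorm_le\<close>)
    fix \<eta> :: real assume "\<eta> > 0"
    then obtain \<kappa> where \<kappa>: "\<kappa> > 0" "\<And>x y. x \<in> cball z0 r \<Longrightarrow> y \<in> cball z0 r \<Longrightarrow> dist y x < \<kappa> \<Longrightarrow> dist (A y) (A x) < \<eta>"
      using compact_uniformly_continuous[OF cA compact_cball] unfolding uniformly_continuous_on_def by metis
    have 2: "norm (FD f y h - FD f x h) \<le> \<eta> * norm h" if "x \<in> cball z0 r" "y \<in> cball z0 r" "dist y x < \<kappa>" for x y h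
    proof -
      have "norm (FD f y h - FD f x h) = norm (blinfun_apply (A y - A x) h)"
        using A that by (simp add: blinfun.diff_left)
      also have "\<dots> \<le> norm (A y - A x) * norm h" by (rule norm_blinfun)
      also have "\<dots> \<le> \<eta> * norm h" using \<kappa>(2)[OF that] by (intro mult_right_mono) (auto simp: dist_norm)
      finally show ?thesis .
    qed
    have "norm (f y - f x - FD f x (y - x)) \<le> norm (y - x) * \<eta>"
      if xy: "x \<in> cball z0 r" "y \<in> cball z0 r" "dist y x < \<kappa>" for x y
    proof (rule differentiable_bound_linearization[where S="cball z0 r \<inter> ball x \<kappa>"])
      show "(f has_derivative FD f w) (at w within cball z0 r \<inter> ball x \<kappa>)" if "w \<in> cball z0 r \<inter> ball x \<kappa>" for w
        using d that has_derivative_at_withinI by blast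
      have "convex (cball z0 r \<inter> ball x \<kappa>)" by (intro convex_Int convex_cball convex_ball)
      then have "closed_segment x y \<subseteq> cball z0 r \<inter> ball x \<kappa>"
        using xy \<kappa>(1) by (intro closed_segment_subset) (auto simp: dist_commute)
      moreover have "x + t *\<^sub>R (y - x) \<in> closed_segment x y" if "t \<in> {0..1}" for t
        using that unfolding closed_segment_def by (auto intro!: exI[of _ t] simp: algebra_simps)
      ultimately show "x + t *\<^sub>R (y - x) \<in> cball z0 r \<inter> ball x \<kappa>" if "t \<in> {0..1}" for t
        using that by blast
      show "onorm (FD f w - FD f x) \<le> \<eta>" if "w \<in> cball z0 r \<inter> ball x \<kappa>" for w
        using 2[OF xy(1), of w] that by (intro onorm_le) (auto simp: dist_commute)
      show "x \<in> cball z0 r \<inter> ball x \<kappa>" using xy \<kappa>(1) by simp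
    qed
    then show "\<exists>\<kappa>>0. \<forall>x\<in>cball z0 r. \<forall>y\<in>cball z0 r. dist y x < \<kappa> \<longrightarrow>
      norm (f y - f x - FD f x (y - x)) \<le> \<eta> * norm (y - x) \<and> (\<forall>h. norm (FD f y h - FD f x h) \<le> \<eta> * norm h)"
      using \<kappa>(1) 2 by (metis mult.commute)
  qed
qed

text \<open>The map \<Psi> is built on its own, from solutions of the linearised equation along each
  trajectory, and only then recognised as the derivative of \<Phi> in the initial value, by
  comparing the two equations with \<open>half_contraction_bound\<close>. Time is rescaled to the
  unit interval, \<epsilon> being the original lifetime.\<close>

theorem local_flow:
  fixes f :: "'b::euclidean_space \<Rightarrow> 'b"
  assumes W: "open W" "Ck_on 1 f W" "z0 \<in> W"
  obtains \<epsilon> \<delta> \<Phi> \<Psi> where "\<epsilon> > 0" "\<delta> > 0"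
    "\<And>z t. z \<in> ball z0 \<delta> \<Longrightarrow> t \<in> {0..1} \<Longrightarrow> \<Phi> z t \<in> W"
    "\<And>z. z \<in> ball z0 \<delta> \<Longrightarrow> \<Phi> z 0 = z"
    "\<And>z t. z \<in> ball z0 \<delta> \<Longrightarrow> t \<in> {0..1} \<Longrightarrow> (\<Phi> z has_vector_derivative \<epsilon> *\<^sub>R f (\<Phi> z t)) (at t within {0..1})"
    "\<And>z t. z \<in> ball z0 \<delta> \<Longrightarrow> t \<in> {0..1} \<Longrightarrow> ((\<lambda>z. \<Phi> z t) has_derivative \<Psi> z t) (at z)"
    "\<And>z t h. z \<in> ball z0 \<delta> \<Longrightarrow> t \<in> {0..1} \<Longrightarrow>
      ((\<lambda>t. \<Psi> z t h) has_vector_derivative \<epsilon> *\<^sub>R FD f (\<Phi> z t) (\<Psi> z t h)) (at t within {0..1})"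
    "\<And>z h. z \<in> ball z0 \<delta> \<Longrightarrow> \<Psi> z 0 h = h"
    "\<And>t h. t \<in> {0..1} \<Longrightarrow> continuous_on (ball z0 \<delta>) (\<lambda>z. \<Psi> z t h)"
proof -
  obtain r where r: "r > 0" "cball z0 r \<subseteq> W"
    using W open_contains_cball by blast
  obtain L where L: "L > 0" "\<And>x h. x \<in> cball z0 r \<Longrightarrow> norm (FD f x h) \<le> L * norm h"
    "\<And>x y. x \<in> cball z0 r \<Longrightarrow> y \<in> cball z0 r \<Longrightarrow> norm (f x - f y) \<le> L * norm (x - y)"
    "\<And>\<eta>. \<eta> > 0 \<Longrightarrow> \<exists>\<kappa>>0. \<forall>x\<in>cball z0 r. \<forall>y\<in>cball z0 r. dist y x < \<kappa> \<longrightarrow>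
      norm (f y - f x - FD f x (y - x)) \<le> \<eta> * norm (y - x) \<and> (\<forall>h. norm (FD f y h - FD f x h) \<le> \<eta> * norm h)"
    using C1_uniform_on_cball[OF W(1,2) r(2)] by blast
  have cf: "continuous_on W f" using W(2) Ck_on_mono[of 1 f W 0] by simp
  then have "bounded (f ` cball z0 r)"
    by (intro compact_imp_bounded compact_continuous_image compact_cball continuous_on_subset[OF _ r(2)])
  then obtain B where B: "B > 0" "\<And>x. x \<in> cball z0 r \<Longrightarrow> norm (f x) \<le> B"
    unfolding bounded_pos by auto
  \<comment> \<open>The first bound makes the rescaled field Lipschitz with constant 1/2; the second
    keeps trajectories that start within r/2 of \<open>z0\<close> inside the ball of radius
    \<open>r\<close>.\<close>
  define \<epsilon> where "\<epsilon> = min (1 / (2 * L)) (r / (2 * B))"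
  define \<delta> where "\<delta> = r / 2"
  have \<epsilon>: "\<epsilon> > 0" "\<epsilon> * L \<le> 1 / 2" "\<epsilon> * B \<le> r / 2"
  proof -
    show "\<epsilon> > 0" using L(1) B(1) r(1) by (simp add: \<epsilon>_def)
    have "\<epsilon> \<le> 1 / (2 * L)" "\<epsilon> \<le> r / (2 * B)" by (simp_all add: \<epsilon>_def)
    then have "\<epsilon> * L \<le> 1 / (2 * L) * L" "\<epsilon> * B \<le> r / (2 * B) * B"
      using L(1) B(1) by (simp_all only: mult_right_mono less_imp_le)
    moreover have "1 / (2 * L) * L = 1 / 2" "r / (2 * B) * B = r / 2" using L(1) B(1) by auto
    ultimately show "\<epsilon> * L \<le> 1 / 2" "\<epsilon> * B \<le> r / 2" by linarith+
  qed
  have \<epsilon>L: "x \<le> L * y \<Longrightarrow> 0 \<le> y \<Longrightarrow> \<epsilon> * x \<le> y / 2" for x y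
  proof -
    assume a: "x \<le> L * y" "0 \<le> y"
    have "\<epsilon> * x \<le> \<epsilon> * (L * y)" using a(1) \<epsilon>(1) by (simp add: mult_left_mono)
    also have "\<dots> = (\<epsilon> * L) * y" by simp
    also have "\<dots> \<le> 1/2 * y" using \<epsilon>(2) a(2) by (intro mult_right_mono) auto
    finally show ?thesis by simp
  qed
  have "\<exists>x. x 0 = z \<and> (\<forall>t\<in>{0..1}. x t \<in> cball z0 r \<and> (x has_vector_derivative \<epsilon> *\<^sub>R f (x t)) (at t within {0..1}))"
    if z: "z \<in> ball z0 \<delta>" for z
  proof -
    have c: "continuous_on {0..1} (\<lambda>s. \<epsilon> *\<^sub>R f (c s))" if "continuous_on {0..1} c" "c ` {0..1} \<subseteq> cball z0 r" for c
      by (intro continuous_intros continuous_on_compose2[OF cf that(1)]) (use that r in auto)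
    show ?thesis
    proof (rule picard[of "cball z0 r" "\<lambda>_ x. \<epsilon> *\<^sub>R f x" z])
      show "continuous_on ({0..1} \<times> cball z0 r) (\<lambda>(t, x). \<epsilon> *\<^sub>R f x)"
        unfolding split_beta
        by (intro continuous_intros continuous_on_compose2[OF cf]) (use r in auto)
      show "z \<in> cball z0 r" using z r by (auto simp: \<delta>_def)
      show "norm (\<epsilon> *\<^sub>R f x - \<epsilon> *\<^sub>R f y) \<le> norm (x - y) / 2" if "x \<in> cball z0 r" "y \<in> cball z0 r" for x y
        using \<epsilon>L[OF L(3)[OF that]] \<epsilon>(1) by (simp flip: scaleR_diff_right)
      show "z + integral {0..t} (\<lambda>s. \<epsilon> *\<^sub>R f (c s)) \<in> cball z0 r"
        if "continuous_on {0..1} c" "c ` {0..1} \<subseteq> cball z0 r" "t \<in> {0..1}" for c and t :: real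
      proof -
        have "norm (integral {0..t} (\<lambda>s. \<epsilon> *\<^sub>R f (c s))) \<le> (\<epsilon> * B) * (t - 0)"
        proof (rule integral_bound)
          show "continuous_on {0..t} (\<lambda>s. \<epsilon> *\<^sub>R f (c s))"
            using c[OF that(1,2)] that(3) by (auto elim: continuous_on_subset)
          show "norm (\<epsilon> *\<^sub>R f (c s)) \<le> \<epsilon> * B" if "s \<in> {0..t}" for s
            using B(2)[of "c s"] that \<open>c ` {0..1} \<subseteq> cball z0 r\<close> \<open>t \<in> {0..1}\<close> \<epsilon>(1)
            by (auto simp: image_subset_iff)
        qed (use that(3) in auto)
        also have "\<dots> \<le> \<epsilon> * B" using that(3) \<epsilon>(1) B(1) by (auto simp: mult_left_le)
        also have "\<dots> \<le> r / 2" by fact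
        finally have "norm (integral {0..t} (\<lambda>s. \<epsilon> *\<^sub>R f (c s))) \<le> r / 2" .
        moreover have "dist z0 (z + w) \<le> dist z0 z + norm w" for w
          using dist_triangle[of z0 "z + w" z] by (simp add: dist_norm[of z])
        moreover have "dist z0 z < r / 2" using z by (simp add: \<delta>_def)
        ultimately show ?thesis unfolding mem_cball by (smt (verit) field_sum_of_halves)
      qed
    qed auto
  qed
  then obtain \<Phi> where \<Phi>: "\<And>z. z \<in> ball z0 \<delta> \<Longrightarrow> \<Phi> z 0 = z"
    "\<And>z t. z \<in> ball z0 \<delta> \<Longrightarrow> t \<in> {0..1} \<Longrightarrow> \<Phi> z t \<in> cball z0 r"
    "\<And>z t. z \<in> ball z0 \<delta> \<Longrightarrow> t \<in> {0..1} \<Longrightarrow> (\<Phi> z has_vector_derivative \<epsilon> *\<^sub>R f (\<Phi> z t)) (at t within {0..1})"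
    by metis
  have c\<Phi>: "continuous_on {0..1} (\<Phi> z)" if "z \<in> ball z0 \<delta>" for z
    using \<Phi>(3)[OF that] has_vector_derivative_continuous continuous_on_eq_continuous_within by blast
  have W': "Ck_on (Suc 0) f W" using W(2) by simp
  have lin: "linear (FD f x)" if "x \<in> cball z0 r" for x
    using Ck_on_has_derivative[OF W' W(1)] that r(2) has_derivative_linear by blast
  have "\<exists>y. y 0 = h \<and> (\<forall>t\<in>{0..1}. (y has_vector_derivative \<epsilon> *\<^sub>R FD f (\<Phi> z t) (y t)) (at t within {0..1}))"
    if z: "z \<in> ball z0 \<delta>" for z h
  proof (rule picard[of UNIV "\<lambda>t x. \<epsilon> *\<^sub>R FD f (\<Phi> z t) x" h])
    have cD: "continuous_on W (\<lambda>x. FD f x b)" for b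
      using Ck_on_FD[OF W'] by simp
    have "continuous_on ({0..1} \<times> UNIV) (\<lambda>w. \<epsilon> *\<^sub>R (\<Sum>b\<in>Basis. (snd w \<bullet> b) *\<^sub>R FD f (\<Phi> z (fst w)) b))"
      by (intro continuous_intros continuous_on_compose2[OF cD] continuous_on_compose2[OF c\<Phi>[OF z]])
        (use \<Phi>(2)[OF z] r(2) in auto)
    then show "continuous_on ({0..1} \<times> UNIV) (\<lambda>(t, x). \<epsilon> *\<^sub>R FD f (\<Phi> z t) x)"
      by (rule continuous_on_eq) (auto simp: linear_expand[OF lin[OF \<Phi>(2)[OF z]], symmetric])
    show "norm (\<epsilon> *\<^sub>R FD f (\<Phi> z t) x - \<epsilon> *\<^sub>R FD f (\<Phi> z t) y) \<le> norm (x - y) / 2" if "t \<in> {0..1}" for t x y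
      using \<epsilon>L[OF L(2)[OF \<Phi>(2)[OF z that]], of "x - y"] \<epsilon>(1)
      by (simp flip: scaleR_diff_right add: linear_diff[OF lin[OF \<Phi>(2)[OF z that]]])
  qed auto
  then obtain \<Psi> where \<Psi>: "\<And>z h. z \<in> ball z0 \<delta> \<Longrightarrow> \<Psi> z 0 h = h"
    "\<And>z h t. z \<in> ball z0 \<delta> \<Longrightarrow> t \<in> {0..1} \<Longrightarrow>
      ((\<lambda>t. \<Psi> z t h) has_vector_derivative \<epsilon> *\<^sub>R FD f (\<Phi> z t) (\<Psi> z t h)) (at t within {0..1})"
  proof -
    assume a: "\<And>\<Psi>. \<lbrakk>\<And>z h. z \<in> ball z0 \<delta> \<Longrightarrow> \<Psi> z 0 h = h;
     \<And>z h t. \<lbrakk>z \<in> ball z0 \<delta>; t \<in> {0..1}\<rbrakk>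
       \<Longrightarrow> ((\<lambda>t. \<Psi> z t h) has_vector_derivative \<epsilon> *\<^sub>R FD f (\<Phi> z t) (\<Psi> z t h)) (at t within {0..1})\<rbrakk> \<Longrightarrow> thesis"
    assume "\<And>z h. z \<in> ball z0 \<delta> \<Longrightarrow> \<exists>y. y 0 = h \<and> (\<forall>t\<in>{0..1}. (y has_vector_derivative \<epsilon> *\<^sub>R FD f (\<Phi> z t) (y t)) (at t within {0..1}))"
    then obtain Y where "\<And>z h. z \<in> ball z0 \<delta> \<Longrightarrow> Y z h 0 = h \<and> (\<forall>t\<in>{0..1}. (Y z h has_vector_derivative \<epsilon> *\<^sub>R FD f (\<Phi> z t) (Y z h t)) (at t within {0..1}))"
      by metis
    then show thesis by (intro a[of "\<lambda>z t h. Y z h t"]) auto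
  qed
  have lip\<Phi>: "norm (\<Phi> y t - \<Phi> z t) \<le> 2 * norm (y - z)" if "y \<in> ball z0 \<delta>" "z \<in> ball z0 \<delta>" "t \<in> {0..1}" for y z t
  proof -
    have "norm (\<Phi> y t - \<Phi> z t) \<le> 2 * (norm (\<Phi> y 0 - \<Phi> z 0) + 0)"
    proof (rule half_contraction_bound[where d="\<lambda>t. \<Phi> y t - \<Phi> z t"])
      show "((\<lambda>t. \<Phi> y t - \<Phi> z t) has_vector_derivative \<epsilon> *\<^sub>R (f (\<Phi> y t) - f (\<Phi> z t))) (at t within {0..1})"
        if "t \<in> {0..1}" for t
        using has_vector_derivative_diff[OF \<Phi>(3)[OF \<open>y \<in> _\<close> that] \<Phi>(3)[OF \<open>z \<in> _\<close> that]]
        by (simp add: scaleR_diff_right)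
      show "norm (\<epsilon> *\<^sub>R (f (\<Phi> y t) - f (\<Phi> z t))) \<le> norm (\<Phi> y t - \<Phi> z t) / 2 + 0" if "t \<in> {0..1}" for t
        using \<epsilon>L[OF L(3)[OF \<Phi>(2)[OF \<open>y \<in> _\<close> that] \<Phi>(2)[OF \<open>z \<in> _\<close> that]]] \<epsilon>(1) by simp
    qed fact
    then show ?thesis using \<Phi>(1) that by simp
  qed
  have lin\<Psi>: "linear (\<Psi> z t)" if z: "z \<in> ball z0 \<delta>" and t: "t \<in> {0..1}" for z t
  proof -
    have *: "\<Psi> z t (a *\<^sub>R h + k) = a *\<^sub>R \<Psi> z t h + \<Psi> z t k" for a h k
    proof -
      let ?d = "\<lambda>t. \<Psi> z t (a *\<^sub>R h + k) - (a *\<^sub>R \<Psi> z t h + \<Psi> z t k)"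
      have "norm (?d t) \<le> 2 * (norm (?d 0) + 0)"
      proof (rule half_contraction_bound[where d="?d"])
        show "(?d has_vector_derivative \<epsilon> *\<^sub>R FD f (\<Phi> z t) (?d t)) (at t within {0..1})" if "t \<in> {0..1}" for t
        proof -
          have "(?d has_vector_derivative \<epsilon> *\<^sub>R FD f (\<Phi> z t) (\<Psi> z t (a *\<^sub>R h + k)) -
            (a *\<^sub>R (\<epsilon> *\<^sub>R FD f (\<Phi> z t) (\<Psi> z t h)) + \<epsilon> *\<^sub>R FD f (\<Phi> z t) (\<Psi> z t k))) (at t within {0..1})"
            by (intro has_vector_derivative_diff has_vector_derivative_add \<Psi>(2) z that
                bounded_linear.has_vector_derivative[OF bounded_linear_scaleR_right])
          then show ?thesis
            by (simp add: linear_diff[OF lin[OF \<Phi>(2)[OF z that]]] linear_add[OF lin[OF \<Phi>(2)[OF z that]]]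
                linear_scale[OF lin[OF \<Phi>(2)[OF z that]]] algebra_simps)
        qed
        show "norm (\<epsilon> *\<^sub>R FD f (\<Phi> z t) (?d t)) \<le> norm (?d t) / 2 + 0" if "t \<in> {0..1}" for t
          using \<epsilon>L[OF L(2)[OF \<Phi>(2)[OF z that]]] \<epsilon>(1) by simp
      qed fact
      then show ?thesis using \<Psi>(1)[OF z] by simp
    qed
    show ?thesis using *[of 1] *[of _ _ 0] *[of "-1" 0 0] by (intro linearI) auto
  qed
  have b\<Psi>: "norm (\<Psi> z t h) \<le> 2 * norm h" if z: "z \<in> ball z0 \<delta>" and t: "t \<in> {0..1}" for z t h
  proof -
    have "norm (\<Psi> z t h) \<le> 2 * (norm (\<Psi> z 0 h) + 0)"
      by (rule half_contraction_bound[where d="\<lambda>t. \<Psi> z t h", OF \<Psi>(2)[OF z] _ t])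
        (use \<epsilon>L[OF L(2)[OF \<Phi>(2)[OF z]]] \<epsilon>(1) in auto)
    then show ?thesis using \<Psi>(1)[OF z] by simp
  qed
  show thesis
  proof (rule that[of \<epsilon> \<delta> \<Phi> \<Psi>])
    show "\<epsilon> > 0" "\<delta> > 0" using \<epsilon> r by (auto simp: \<delta>_def)
    show "\<Phi> z t \<in> W" if "z \<in> ball z0 \<delta>" "t \<in> {0..1}" for z t using \<Phi>(2)[OF that] r(2) by blast
    show "((\<lambda>z. \<Phi> z t) has_derivative \<Psi> z t) (at z)" if z: "z \<in> ball z0 \<delta>" and t: "t \<in> {0..1}" for z t
      unfolding has_derivative_at_alt
    proof (intro conjI allI impI)
      show "bounded_linear (\<Psi> z t)" using lin\<Psi>[OF z t] by (simp add: linear_conv_bounded_linear)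
      fix e :: real assume e: "e > 0"
      \<comment> \<open>The estimate below ends with 4 \<epsilon> \<eta> norm (y - z): one factor 2
        comes from the contraction bound, the other from the Lipschitz bound of the flow.\<close>
      define \<eta> where "\<eta> = e / (4 * \<epsilon>)"
      have "\<eta> > 0" using e \<epsilon>(1) by (simp add: \<eta>_def)
      then obtain \<kappa> where \<kappa>: "\<kappa> > 0" "\<forall>x\<in>cball z0 r. \<forall>y\<in>cball z0 r. dist y x < \<kappa> \<longrightarrow>
        norm (f y - f x - FD f x (y - x)) \<le> \<eta> * norm (y - x) \<and> (\<forall>h. norm (FD f y h - FD f x h) \<le> \<eta> * norm h)"
        using L(4) by blast
      obtain d0 where d0: "d0 > 0" "ball z d0 \<subseteq> ball z0 \<delta>" using z open_ball openE by blast
      show "\<exists>d>0. \<forall>y. norm (y - z) < d \<longrightarrow> norm (\<Phi> y t - \<Phi> z t - \<Psi> z t (y - z)) \<le> e * norm (y - z)"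
      proof (intro exI[of _ "min d0 (\<kappa> / 2)"] conjI allI impI)
        show "min d0 (\<kappa> / 2) > 0" using d0 \<kappa> by simp
        fix y assume y: "norm (y - z) < min d0 (\<kappa> / 2)"
        then have "y \<in> ball z d0" by (simp add: dist_norm norm_minus_commute)
        then have yb: "y \<in> ball z0 \<delta>" using d0(2) by blast
        let ?d = "\<lambda>t. \<Phi> y t - \<Phi> z t - \<Psi> z t (y - z)"
        have "norm (?d t) \<le> 2 * (norm (?d 0) + \<epsilon> * \<eta> * (2 * norm (y - z)))"
        proof (rule half_contraction_bound[where d="?d", OF _ _ t])
          fix t :: real assume t: "t \<in> {0..1}"
          note l = lin[OF \<Phi>(2)[OF z t]]
          show "(?d has_vector_derivative \<epsilon> *\<^sub>R f (\<Phi> y t) - \<epsilon> *\<^sub>R f (\<Phi> z t) - \<epsilon> *\<^sub>R FD f (\<Phi> z t) (\<Psi> z t (y - z))) (at t within {0..1})"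
            by (intro has_vector_derivative_diff \<Phi>(3) \<Psi>(2) z yb t)
          \<comment> \<open>Splits into the Taylor remainder of \<open>f\<close> and the linearised
            equation for the error itself.\<close>
          have eq: "\<epsilon> *\<^sub>R f (\<Phi> y t) - \<epsilon> *\<^sub>R f (\<Phi> z t) - \<epsilon> *\<^sub>R FD f (\<Phi> z t) (\<Psi> z t (y - z)) =
            \<epsilon> *\<^sub>R (f (\<Phi> y t) - f (\<Phi> z t) - FD f (\<Phi> z t) (\<Phi> y t - \<Phi> z t)) + \<epsilon> *\<^sub>R FD f (\<Phi> z t) (?d t)"
            by (simp add: linear_diff[OF l] linear_add[OF l] algebra_simps)
          have lp: "norm (\<Phi> y t - \<Phi> z t) \<le> 2 * norm (y - z)" by (rule lip\<Phi>[OF yb z t])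
          then have "dist (\<Phi> y t) (\<Phi> z t) < \<kappa>" using y by (simp add: dist_norm)
          then have "norm (f (\<Phi> y t) - f (\<Phi> z t) - FD f (\<Phi> z t) (\<Phi> y t - \<Phi> z t)) \<le> \<eta> * norm (\<Phi> y t - \<Phi> z t)"
            using \<kappa>(2) \<Phi>(2)[OF z t] \<Phi>(2)[OF yb t] by blast
          also have "\<dots> \<le> \<eta> * (2 * norm (y - z))" using lp \<open>\<eta> > 0\<close> by (intro mult_left_mono) auto
          finally have 1: "norm (\<epsilon> *\<^sub>R (f (\<Phi> y t) - f (\<Phi> z t) - FD f (\<Phi> z t) (\<Phi> y t - \<Phi> z t))) \<le> \<epsilon> * \<eta> * (2 * norm (y - z))"
            using \<epsilon>(1) by simp
          have 2: "norm (\<epsilon> *\<^sub>R FD f (\<Phi> z t) (?d t)) \<le> norm (?d t) / 2"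
            using \<epsilon>L[OF L(2)[OF \<Phi>(2)[OF z t]]] \<epsilon>(1) by simp
          show "norm (\<epsilon> *\<^sub>R f (\<Phi> y t) - \<epsilon> *\<^sub>R f (\<Phi> z t) - \<epsilon> *\<^sub>R FD f (\<Phi> z t) (\<Psi> z t (y - z)))
            \<le> norm (?d t) / 2 + \<epsilon> * \<eta> * (2 * norm (y - z))"
            unfolding eq by (rule order_trans[OF norm_triangle_ineq]) (use 1 2 in linarith)
        qed
        also have "\<dots> = e * norm (y - z)" using \<Phi>(1)[OF z] \<Phi>(1)[OF yb] \<Psi>(1)[OF z] \<epsilon>(1) by (simp add: \<eta>_def)
        finally show "norm (?d t) \<le> e * norm (y - z)" .
      qed
    qed
    show "continuous_on (ball z0 \<delta>) (\<lambda>z. \<Psi> z t h)" if t: "t \<in> {0..1}" for t h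
      unfolding continuous_on_iff
    proof (intro ballI allI impI)
      fix z and e :: real assume z: "z \<in> ball z0 \<delta>" and e: "e > 0"
      \<comment> \<open>Here the final bound is 4 \<epsilon> \<eta> norm h, which this choice keeps
        at most e/2; the summand 1 covers \<open>h = 0\<close>.\<close>
      define \<eta> where "\<eta> = e / (8 * \<epsilon> * (norm h + 1))"
      have "\<eta> > 0" using e \<epsilon>(1) by (auto simp: \<eta>_def intro!: divide_pos_pos mult_pos_pos add_nonneg_pos)
      then obtain \<kappa> where \<kappa>: "\<kappa> > 0" "\<forall>x\<in>cball z0 r. \<forall>y\<in>cball z0 r. dist y x < \<kappa> \<longrightarrow>
        norm (f y - f x - FD f x (y - x)) \<le> \<eta> * norm (y - x) \<and> (\<forall>h. norm (FD f y h - FD f x h) \<le> \<eta> * norm h)"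
        using L(4) by blast
      show "\<exists>d>0. \<forall>y\<in>ball z0 \<delta>. dist y z < d \<longrightarrow> dist (\<Psi> y t h) (\<Psi> z t h) < e"
      proof (intro exI[of _ "\<kappa> / 2"] conjI ballI impI)
        show "\<kappa> / 2 > 0" using \<kappa> by simp
        fix y assume yb: "y \<in> ball z0 \<delta>" and y: "dist y z < \<kappa> / 2"
        let ?d = "\<lambda>t. \<Psi> y t h - \<Psi> z t h"
        have "norm (?d t) \<le> 2 * (norm (?d 0) + \<epsilon> * \<eta> * (2 * norm h))"
        proof (rule half_contraction_bound[where d="?d", OF _ _ t])
          fix t :: real assume t: "t \<in> {0..1}"
          note l = lin[OF \<Phi>(2)[OF yb t]]
          show "(?d has_vector_derivative \<epsilon> *\<^sub>R FD f (\<Phi> y t) (\<Psi> y t h) - \<epsilon> *\<^sub>R FD f (\<Phi> z t) (\<Psi> z t h)) (at t within {0..1})"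
            by (intro has_vector_derivative_diff \<Psi>(2) z yb t)
          have eq: "\<epsilon> *\<^sub>R FD f (\<Phi> y t) (\<Psi> y t h) - \<epsilon> *\<^sub>R FD f (\<Phi> z t) (\<Psi> z t h) =
            \<epsilon> *\<^sub>R FD f (\<Phi> y t) (?d t) + \<epsilon> *\<^sub>R (FD f (\<Phi> y t) (\<Psi> z t h) - FD f (\<Phi> z t) (\<Psi> z t h))"
            by (simp add: linear_diff[OF l] algebra_simps)
          have "norm (\<Phi> y t - \<Phi> z t) \<le> 2 * norm (y - z)" by (rule lip\<Phi>[OF yb z t])
          then have "dist (\<Phi> y t) (\<Phi> z t) < \<kappa>" using y by (simp add: dist_norm)
          then have "norm (FD f (\<Phi> y t) (\<Psi> z t h) - FD f (\<Phi> z t) (\<Psi> z t h)) \<le> \<eta> * norm (\<Psi> z t h)"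
            using \<kappa>(2) \<Phi>(2)[OF z t] \<Phi>(2)[OF yb t] by blast
          also have "\<dots> \<le> \<eta> * (2 * norm h)" using b\<Psi>[OF z t] \<open>\<eta> > 0\<close> by (intro mult_left_mono) auto
          finally have 1: "norm (\<epsilon> *\<^sub>R (FD f (\<Phi> y t) (\<Psi> z t h) - FD f (\<Phi> z t) (\<Psi> z t h))) \<le> \<epsilon> * \<eta> * (2 * norm h)"
            using \<epsilon>(1) by simp
          have 2: "norm (\<epsilon> *\<^sub>R FD f (\<Phi> y t) (?d t)) \<le> norm (?d t) / 2"
            using \<epsilon>L[OF L(2)[OF \<Phi>(2)[OF yb t]]] \<epsilon>(1) by simp
          show "norm (\<epsilon> *\<^sub>R FD f (\<Phi> y t) (\<Psi> y t h) - \<epsilon> *\<^sub>R FD f (\<Phi> z t) (\<Psi> z t h))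
            \<le> norm (?d t) / 2 + \<epsilon> * \<eta> * (2 * norm h)"
            unfolding eq by (rule order_trans[OF norm_triangle_ineq]) (use 1 2 in linarith)
        qed
        also have "\<dots> = e / 2 * (norm h / (norm h + 1))"
        proof -
          have "2 * (0 + \<epsilon> * (e / (8 * \<epsilon> * c)) * (2 * n)) = e / 2 * (n / c)" if "c > 0" for c n
            using \<epsilon>(1) that by (simp add: field_simps)
          moreover have "norm h + 1 > 0" by (simp add: add_nonneg_pos)
          ultimately show ?thesis unfolding \<eta>_def \<Psi>(1)[OF z] \<Psi>(1)[OF yb] by simp
        qed
        also have "\<dots> \<le> e / 2 * 1"
          using e by (intro mult_left_mono) (auto simp: divide_le_eq_1 add_nonneg_pos)
        also have "\<dots> < e" using e by simp
        finally show "dist (\<Psi> y t h) (\<Psi> z t h) < e" by (simp add: dist_norm)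
      qed
    qed
  qed (use \<Phi> \<Psi> in auto)
qed

text \<open>The squared distance of the solutions, weighted by exp (-2Lt), does not increase when
  \<open>L\<close> is a Lipschitz constant of \<open>f\<close> on the union of the two trajectories,
  which is compact. This works for every length \<open>b\<close>.\<close>

lemma ode_unique:
  fixes f :: "'b::euclidean_space \<Rightarrow> 'b"
  assumes W: "open W" "Ck_on 1 f W"
    and x: "\<And>t. t \<in> {0..b} \<Longrightarrow> x t \<in> W" "\<And>t. t \<in> {0..b} \<Longrightarrow> (x has_vector_derivative f (x t)) (at t within {0..b})"
    and y: "\<And>t. t \<in> {0..b} \<Longrightarrow> y t \<in> W" "\<And>t. t \<in> {0..b} \<Longrightarrow> (y has_vector_derivative f (y t)) (at t within {0..b})"
    and "x 0 = y 0" "t \<in> {0..b}"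
  shows "x t = y t"
proof -
  define K where "K = x ` {0..b} \<union> y ` {0..b}"
  have "continuous_on {0..b} x" "continuous_on {0..b} y"
    using x(2) y(2) has_vector_derivative_continuous continuous_on_eq_continuous_within by blast+
  then have K: "compact K" "K \<subseteq> W"
    using x(1) y(1) by (auto simp: K_def intro!: compact_Un compact_continuous_image)
  have W': "Ck_on (Suc 0) f W" using W(2) by simp
  have "local_lipschitz UNIV W (\<lambda>_::real. f)"
  proof (rule c1_implies_local_lipschitz[where f'="\<lambda>p. Blinfun (FD f (snd p))"])
    show "(f has_derivative blinfun_apply (Blinfun (FD f (snd (t, x))))) (at x)" if "x \<in> W" for t :: real and x
      using Ck_on_has_derivative[OF W' W(1) that]
      by (simp add: bounded_linear_Blinfun_apply has_derivative_bounded_linear)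
    show "continuous_on (UNIV \<times> W) (\<lambda>p::real \<times> 'b. Blinfun (FD f (snd p)))"
      by (rule continuous_on_compose2[OF continuous_on_blinfun_FD[OF W(1) W']]) (auto intro: continuous_intros)
  qed (use W in auto)
  then have "local_lipschitz {0::real} K (\<lambda>_::real. f)"
    by (rule local_lipschitz_subset) (use K in auto)
  then obtain L where L: "L-lipschitz_on K f"
    using local_lipschitz_compact_implies_lipschitz[where X=K and T="{0::real}" and f="\<lambda>_. f"] K(1) by auto
  define \<phi> where "\<phi> t = exp (- (2 * L * t)) * ((x t - y t) \<bullet> (x t - y t))" for t
  have d\<phi>: "(\<phi> has_real_derivative exp (- (2 * L * s)) *
      (2 * ((x s - y s) \<bullet> (f (x s) - f (y s))) - 2 * L * ((x s - y s) \<bullet> (x s - y s)))) (at s within {0..b})"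
    if s: "s \<in> {0..b}" for s
  proof -
    have 1: "((\<lambda>t. x t - y t) has_vector_derivative f (x s) - f (y s)) (at s within {0..b})"
      by (intro has_vector_derivative_diff x y s)
    have 2: "((\<lambda>t. (x t - y t) \<bullet> (x t - y t)) has_real_derivative 2 * ((x s - y s) \<bullet> (f (x s) - f (y s)))) (at s within {0..b})"
      using bounded_bilinear.has_vector_derivative[OF bounded_bilinear_inner 1 1]
      by (simp add: has_real_derivative_iff_has_vector_derivative inner_commute)
    have 3: "((\<lambda>t. exp (- (2 * L * t))) has_real_derivative exp (- (2 * L * s)) * - (2 * L)) (at s within {0..b})"
      by (auto intro!: derivative_eq_intros)
    show ?thesis unfolding \<phi>_def
      by (rule DERIV_cong[OF DERIV_mult[OF 3 2]]) (simp add: algebra_simps)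
  qed
  have "\<phi> t \<le> \<phi> 0"
  proof (cases "t = 0")
    case False
    show ?thesis
    proof (rule DERIV_nonpos_imp_decreasing_open[of 0 t])
      show "0 \<le> t" using False \<open>t \<in> _\<close> by auto
      have "continuous_on {0..b} \<phi>"
        using d\<phi> DERIV_continuous continuous_on_eq_continuous_within by blast
      then show "continuous_on {0..t} \<phi>" using \<open>t \<in> _\<close> by (auto elim: continuous_on_subset)
      fix s assume s: "0 < s" "s < t"
      then have sb: "s \<in> {0<..<b}" "s \<in> {0..b}" using \<open>t \<in> _\<close> by auto
      let ?D = "exp (- (2 * L * s)) *
        (2 * ((x s - y s) \<bullet> (f (x s) - f (y s))) - 2 * L * ((x s - y s) \<bullet> (x s - y s)))"
      have "(\<phi> has_real_derivative ?D) (at s)"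
        using DERIV_subset[OF d\<phi>[OF sb(2)], of "{0<..<b}"]
        unfolding at_within_open[OF sb(1) open_greaterThanLessThan] by fastforce
      moreover have "?D \<le> 0"
      proof -
        have "(x s - y s) \<bullet> (f (x s) - f (y s)) \<le> norm (x s - y s) * norm (f (x s) - f (y s))"
          by (rule norm_cauchy_schwarz)
        also have "\<dots> \<le> norm (x s - y s) * (L * norm (x s - y s))"
          using lipschitz_onD[OF L, of "x s" "y s"] sb
          by (intro mult_left_mono) (auto simp: K_def dist_norm)
        also have "\<dots> = L * ((x s - y s) \<bullet> (x s - y s))"
          by (simp add: dot_square_norm power2_eq_square)
        finally show ?thesis by (simp add: mult_le_0_iff)
      qed
      ultimately show "\<exists>y. DERIV \<phi> s :> y \<and> y \<le> 0" by blast
    qed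
  qed simp
  then have "(x t - y t) \<bullet> (x t - y t) \<le> 0"
    using \<open>x 0 = y 0\<close> by (simp add: \<phi>_def mult_le_0_iff)
  then have "(x t - y t) \<bullet> (x t - y t) = 0" using inner_ge_zero order_antisym by blast
  then show ?thesis by simp
qed

section \<open>Inverse functions and linear equations\<close>

text \<open>The lower bound of \<open>M y0\<close> survives a perturbation of at most half its size
  and then controls the difference of the two preimages of \<open>v\<close>.\<close>

lemma continuous_on_inv_linear:
  fixes M :: "'z::metric_space \<Rightarrow> 'a::euclidean_space \<Rightarrow> 'a"
  assumes lin: "\<And>y. y \<in> V \<Longrightarrow> linear (M y)" "\<And>y. y \<in> V \<Longrightarrow> bij (M y)"
    and c: "\<And>w. continuous_on V (\<lambda>y. M y w)"
  shows "continuous_on V (\<lambda>y. inv (M y) v)"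
  unfolding continuous_on_iff
proof (intro ballI allI impI)
  fix y0 and e :: real assume y0: "y0 \<in> V" and e: "e > 0"
  obtain B where B: "B > 0" "\<And>w. B * norm w \<le> norm (M y0 w)"
    using linear_inj_bounded_below_pos[OF lin(1)[OF y0] bij_is_inj[OF lin(2)[OF y0]]] by blast
  define u where "u = inv (M y0) v"
  have u: "M y0 u = v" unfolding u_def by (rule surj_f_inv_f[OF bij_is_surj[OF lin(2)[OF y0]]])
  \<comment> \<open>The bound B/2 lets the perturbation term be absorbed on the left; the second
    bound leaves a distance of at most e/2.\<close>
  define \<eta> where "\<eta> = min (B / 2) (B * e / (4 * (norm u + 1)))"
  have n: "norm u + 1 > 0" by (simp add: add_nonneg_pos)
  have \<eta>: "\<eta> > 0" using B(1) e n by (simp add: \<eta>_def)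
  have \<eta>1: "\<eta> \<le> B / 2" and \<eta>2: "\<eta> \<le> B * e / (4 * (norm u + 1))"
    unfolding \<eta>_def by (rule min.cobounded1, rule min.cobounded2)
  have "\<exists>d>0. \<forall>y\<in>V. dist y y0 < d \<longrightarrow> (\<forall>b\<in>Basis. norm (M y b - M y0 b) < \<eta> / DIM('a))"
  proof -
    have "\<forall>b\<in>Basis. \<exists>d>0. \<forall>y\<in>V. dist y y0 < d \<longrightarrow> norm (M y b - M y0 b) < \<eta> / DIM('a)"
    proof
      fix b :: 'a
      have "\<eta> / DIM('a) > 0" using \<eta> by simp
      then show "\<exists>d>0. \<forall>y\<in>V. dist y y0 < d \<longrightarrow> norm (M y b - M y0 b) < \<eta> / DIM('a)"
        using c[of b] y0 unfolding continuous_on_iff dist_norm by blast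
    qed
    then obtain d where d: "\<And>b. b \<in> Basis \<Longrightarrow> d b > 0 \<and> (\<forall>y\<in>V. dist y y0 < d b \<longrightarrow> norm (M y b - M y0 b) < \<eta> / DIM('a))"
      by metis
    show ?thesis
      by (rule exI[of _ "Min (d ` Basis)"]) (use d in auto)
  qed
  then obtain d where d: "d > 0" "\<And>y b. y \<in> V \<Longrightarrow> dist y y0 < d \<Longrightarrow> b \<in> Basis \<Longrightarrow> norm (M y b - M y0 b) < \<eta> / DIM('a)"
    by blast
  have close: "norm (M y w - M y0 w) \<le> \<eta> * norm w" if y: "y \<in> V" "dist y y0 < d" for y w
  proof -
    have "M y w - M y0 w = (\<Sum>b\<in>Basis. (w \<bullet> b) *\<^sub>R (M y b - M y0 b))"
      unfolding linear_expand[OF lin(1)[OF y(1)], of w] linear_expand[OF lin(1)[OF y0], of w]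
      by (simp add: scaleR_diff_right sum_subtractf)
    also have "norm \<dots> \<le> (\<Sum>b\<in>(Basis :: 'a set). norm w * (\<eta> / DIM('a)))"
    proof (rule sum_norm_le)
      fix b :: 'a assume b: "b \<in> Basis"
      have "\<bar>w \<bullet> b\<bar> * norm (M y b - M y0 b) \<le> norm w * (\<eta> / DIM('a))"
        using d(2)[OF y b] Basis_le_norm[OF b] by (intro mult_mono) auto
      then show "norm ((w \<bullet> b) *\<^sub>R (M y b - M y0 b)) \<le> norm w * (\<eta> / DIM('a))" by simp
    qed
    also have "\<dots> = \<eta> * norm w" by simp
    finally show ?thesis .
  qed
  have "dist (inv (M y) v) (inv (M y0) v) < e" if y: "y \<in> V" "dist y y0 < d" for y
  proof -
    define w where "w = inv (M y) v"
    have w: "M y w = v" unfolding w_def by (rule surj_f_inv_f[OF bij_is_surj[OF lin(2)[OF y(1)]]])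
    have "M y (w - u) = - (M y u - M y0 u)" using w u by (simp add: linear_diff[OF lin(1)[OF y(1)]])
    then have 1: "norm (M y (w - u)) \<le> \<eta> * norm u" using close[OF y, of u] by (metis norm_minus_cancel)
    have "B * norm (w - u) \<le> norm (M y0 (w - u))" by (rule B(2))
    also have "\<dots> \<le> norm (M y (w - u)) + norm (M y (w - u) - M y0 (w - u))"
      using norm_triangle_ineq4[of "M y (w - u)" "M y (w - u) - M y0 (w - u)"] by simp
    also have "\<dots> \<le> \<eta> * norm u + B / 2 * norm (w - u)"
    proof -
      have "\<eta> * norm (w - u) \<le> B / 2 * norm (w - u)" by (intro mult_right_mono \<eta>1) simp
      then show ?thesis using 1 close[OF y, of "w - u"] by linarith
    qed
    finally have "B / 2 * norm (w - u) \<le> \<eta> * norm u" by simp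
    also have "\<dots> \<le> \<eta> * (norm u + 1)" using \<eta> by simp
    also have "\<dots> \<le> B * e / (4 * (norm u + 1)) * (norm u + 1)" using n by (intro mult_right_mono \<eta>2) simp
    also have "\<dots> = B * e / 4"
    proof -
      have "B * e / (4 * c) * c = B * e / 4" if "c > 0" for c using that by simp
      then show ?thesis by this (rule n)
    qed
    also have "\<dots> < B / 2 * e" using B(1) e by simp
    finally show ?thesis using B(1) unfolding w_def u_def dist_norm by simp
  qed
  then show "\<exists>d>0. \<forall>y\<in>V. dist y y0 < d \<longrightarrow> dist (inv (M y) v) (inv (M y0) v) < e"
    using d(1) by blast
qed

text \<open>The inverse function theorem in terms of \<open>FD\<close>, supplemented by the C^1
  class of the inverse: its derivative is the inverse of a continuously varying bijection.\<close>

lemma C1_inverse_function: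
  fixes f :: "'a::euclidean_space \<Rightarrow> 'a"
  assumes U: "open U" "Ck_on 1 f U" "x0 \<in> U" and inj: "inj (FD f x0)"
  obtains U' V h where "open U'" "U' \<subseteq> U" "x0 \<in> U'" "open V" "f x0 \<in> V" "homeomorphism U' V f h"
    "\<And>y. y \<in> V \<Longrightarrow> (h has_derivative inv (FD f (h y))) (at y)" "\<And>y. y \<in> V \<Longrightarrow> bij (FD f (h y))"
    "Ck_on (Suc 0) h V"
proof -
  have U': "Ck_on (Suc 0) f U" using U(2) by simp
  have d: "(f has_derivative FD f x) (at x)" if "x \<in> U" for x
    using Ck_on_has_derivative[OF U' U(1) that] .
  have app: "blinfun_apply (Blinfun (FD f x)) = FD f x" if "x \<in> U" for x
    using d[OF that] has_derivative_bounded_linear bounded_linear_Blinfun_apply by blast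
  obtain L where L: "linear L" "L \<circ> FD f x0 = id"
    using linear_injective_left_inverse[OF has_derivative_linear[OF d[OF U(3)]] inj] by blast
  have appL: "blinfun_apply (Blinfun L) = L"
    using L(1) bounded_linear_Blinfun_apply linear_conv_bounded_linear by blast
  have LF: "L (FD f x0 v) = v" for v using L(2) by (metis comp_apply id_apply)
  have inv: "Blinfun L o\<^sub>L Blinfun (FD f x0) = id_blinfun"
    by (rule blinfun_eqI) (simp add: app[OF U(3)] appL LF)
  have d': "(f has_derivative blinfun_apply (Blinfun (FD f x))) (at x)" if "x \<in> U" for x
    using d app that by simp
  obtain U' V h h' where *: "open U'" "U' \<subseteq> U" "x0 \<in> U'" "open V" "f x0 \<in> V" "homeomorphism U' V f h"
    "\<And>y. y \<in> V \<Longrightarrow> (h has_derivative (h' y)) (at y)"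
    "\<And>y. y \<in> V \<Longrightarrow> h' y = inv (blinfun_apply (Blinfun (FD f (h y))))"
    "\<And>y. y \<in> V \<Longrightarrow> bij (blinfun_apply (Blinfun (FD f (h y))))"
    by (rule inverse_function_theorem[OF U(1) d' continuous_on_blinfun_FD[OF U(1) U'] U(3) inv]) blast+
  have hU: "h y \<in> U" if "y \<in> V" for y
    using *(2,6) that unfolding homeomorphism_def by blast
  have bij: "bij (FD f (h y))" and dh: "(h has_derivative inv (FD f (h y))) (at y)" if "y \<in> V" for y
    using *(7-9)[OF that] app[OF hU[OF that]] by auto
  have "continuous_on V h" using *(6) unfolding homeomorphism_def by blast
  then have "continuous_on V (\<lambda>y. FD f (h y) w)" for w
    using Ck_on_FD[OF U', of w] hU by (auto intro: continuous_on_compose2)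
  then have "continuous_on V (\<lambda>y. inv (FD f (h y)) v)" for v
    using has_derivative_linear[OF d[OF hU]] bij by (intro continuous_on_inv_linear)
  then have "Ck_on (Suc 0) h V" by (intro Ck_on_SucI[OF *(4) dh]) simp_all
  then show thesis using that[OF *(1-6) dh bij] by blast
qed

section \<open>Positive definite forms, orthonormal bases and traces\<close>

definition posdef :: "('e::real_vector \<Rightarrow> 'e \<Rightarrow> real) \<Rightarrow> bool" where
  "posdef g \<longleftrightarrow> bilinear g \<and> (\<forall>u v. g u v = g v u) \<and> (\<forall>u. u \<noteq> 0 \<longrightarrow> g u u > 0)"

lemma posdefD:
  assumes "posdef g"
  shows "bilinear g" "g u v = g v u" "u \<noteq> 0 \<Longrightarrow> g u u > 0" "g u u \<ge> 0" "g u u = 0 \<longleftrightarrow> u = 0"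
proof -
  show 1: "bilinear g" "g u v = g v u" "u \<noteq> 0 \<Longrightarrow> g u u > 0" using assms unfolding posdef_def by blast+
  have "g 0 0 = 0" using bilinear_lzero[OF 1(1)] .
  then show "g u u \<ge> 0" "g u u = 0 \<longleftrightarrow> u = 0" using 1(3) by (metis less_eq_real_def, metis less_irrefl)
qed

lemma posdef_nondegenerate:
  assumes "posdef g" "\<And>w. g u w = g v w"
  shows "u = v"
proof -
  have "g (u - v) (u - v) = 0"
    using assms(2)[of "u - v"] bilinear_lsub[OF posdefD(1)[OF assms(1)]] by simp
  then show ?thesis using posdefD(5)[OF assms(1)] by simp
qed

text \<open>The map sending \<open>u\<close> to the vector of its pairings with the basis is linear
  and injective, hence surjective in finite dimension.\<close>

lemma posdef_riesz:
  fixes g :: "'e::euclidean_space \<Rightarrow> 'e \<Rightarrow> real"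
  assumes "posdef g" "linear L"
  obtains u where "\<And>w. g u w = L w"
proof -
  note b = posdefD(1)[OF assms(1)]
  have lg: "linear (g u)" "linear (\<lambda>u. g u w)" for u w using b by (auto simp: bilinear_def)
  define G where "G u = (\<Sum>b\<in>Basis. g u b *\<^sub>R b)" for u
  have Gb: "G u \<bullet> b = g u b" if "b \<in> Basis" for u b
    unfolding G_def using that by (rule inner_sum_left_Basis)
  have "linear G"
    unfolding G_def by (intro linearI) (simp_all only: bilinear_ladd[OF b] bilinear_lmul[OF b]
        scaleR_left_distrib sum.distrib scaleR_sum_right scaleR_scaleR real_scaleR_def)
  moreover have "inj G"
  proof (rule injI)
    fix u v assume "G u = G v"
    then have "g u b = g v b" if "b \<in> Basis" for b
      using that Gb by metis
    then have "g u w = g v w" for w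
      using linear_eq_on_span[of "g u" "g v" Basis w] lg by (simp add: span_Basis)
    then show "u = v" using posdef_nondegenerate[OF assms(1)] by blast
  qed
  ultimately have "surj G" using linear_injective_imp_surjective by blast
  then obtain u where "G u = (\<Sum>b\<in>Basis. L b *\<^sub>R b)" by (metis surjD)
  then have "g u b = L b" if "b \<in> Basis" for b
    using Gb[OF that, of u] inner_sum_left_Basis[OF that, of L] by simp
  then have "g u w = L w" for w
    using linear_eq_on_span[of "g u" L Basis w] lg assms(2) by (simp add: span_Basis)
  then show thesis using that by blast
qed

text \<open>One Gram-Schmidt step at a time: while fewer than DIM vectors are present, some
  \<open>x\<close> lies outside their span, and its orthogonal remainder is normalised.\<close>

lemma posdef_orthonormal:
  fixes g :: "'e::euclidean_space \<Rightarrow> 'e \<Rightarrow> real"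
  assumes g: "posdef g" and "n \<le> DIM('e)"
  shows "\<exists>E. finite E \<and> card E = n \<and> (\<forall>e\<in>E. g e e = 1) \<and> (\<forall>e\<in>E. \<forall>f\<in>E. e \<noteq> f \<longrightarrow> g e f = 0)"
  using assms(2)
proof (induction n)
  case (Suc n)
  note b = posdefD(1)[OF g]
  obtain E where E: "finite E" "card E = n" "\<forall>e\<in>E. g e e = 1" "\<forall>e\<in>E. \<forall>f\<in>E. e \<noteq> f \<longrightarrow> g e f = 0"
    using Suc by auto
  have "dim (span E) < DIM('e)" using E Suc.prems dim_le_card'[of E] by (simp add: dim_span)
  then have "span E \<noteq> UNIV" by (metis dim_UNIV less_irrefl)
  then obtain x where x: "x \<notin> span E" by blast
  define y where "y = x - (\<Sum>e\<in>E. g x e *\<^sub>R e)"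
  have "(\<Sum>e\<in>E. g x e *\<^sub>R e) \<in> span E" by (intro span_sum span_scale span_base)
  then have y: "y \<noteq> 0" using x unfolding y_def by auto
  have yE: "g y f = 0" if "f \<in> E" for f
  proof -
    have lin: "linear (\<lambda>u. g u f)" using b by (simp add: bilinear_def)
    have "g (\<Sum>e\<in>E. g x e *\<^sub>R e) f = (\<Sum>e\<in>E. g x e * g e f)"
      by (simp add: linear_sum[OF lin] linear_scale[OF lin])
    also have "\<dots> = (\<Sum>e\<in>E. if e = f then g x f else 0)"
      by (rule sum.cong) (use E that in auto)
    also have "\<dots> = g x f" using E(1) that by simp
    finally show ?thesis unfolding y_def by (simp add: bilinear_lsub[OF b])
  qed
  define z where "z = (1 / sqrt (g y y)) *\<^sub>R y"
  have pos: "g y y > 0" using posdefD(3)[OF g y] .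
  have z: "g z z = 1" "\<And>f. f \<in> E \<Longrightarrow> g z f = 0" "\<And>f. f \<in> E \<Longrightarrow> g f z = 0"
    using pos yE posdefD(2)[OF g] by (auto simp: z_def bilinear_lmul[OF b] bilinear_rmul[OF b])
  then have "z \<notin> E" by force
  then show ?case
    using E z by (intro exI[of _ "insert z E"]) auto
qed auto

text \<open>\<open>endo_trace\<close> is taken in the standard basis, the positivity arguments in an
  orthonormal basis of \<open>g\<close>. Expanding each standard basis vector in \<open>E\<close>
  and exchanging the sums identifies the two.\<close>

lemma endo_trace_posdef:
  fixes g :: "'e::euclidean_space \<Rightarrow> 'e \<Rightarrow> real"
  assumes g: "posdef g" and S: "linear S"
    and E: "finite E" "card E = DIM('e)" "\<forall>e\<in>E. g e e = 1" "\<forall>e\<in>E. \<forall>f\<in>E. e \<noteq> f \<longrightarrow> g e f = 0"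
  shows "endo_trace S = (\<Sum>e\<in>E. g (S e) e)" and "(\<Sum>e\<in>E. g u e *\<^sub>R e) = u"
proof -
  note b = posdefD(1)[OF g]
  have lr: "linear (g u)" and ll: "linear (\<lambda>u. g u w)" for u w using b by (auto simp: bilinear_def)
  have orth: "(\<Sum>e\<in>E. c e * g e f) = c f" if "f \<in> E" for c f
  proof -
    have "(\<Sum>e\<in>E. c e * g e f) = (\<Sum>e\<in>E. if e = f then c f else 0)"
      by (rule sum.cong) (use E that in auto)
    then show ?thesis using E(1) that by simp
  qed
  have "independent E"
  proof (rule independent_if_scalars_zero[OF E(1)])
    fix c f assume "(\<Sum>e\<in>E. c e *\<^sub>R e) = 0" and f: "f \<in> E"
    then have "g (\<Sum>e\<in>E. c e *\<^sub>R e) f = 0" by (simp add: bilinear_lzero[OF b])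
    then show "c f = 0" using orth[OF f, of c] by (simp add: linear_sum[OF ll] linear_scale[OF ll])
  qed
  then have span: "span E = UNIV"
    using card_ge_dim_independent[of E UNIV] E(2) by auto
  have rep: "(\<Sum>e\<in>E. g u e *\<^sub>R e) = u" for u
  proof (rule posdef_nondegenerate[OF g])
    fix w
    have "g (\<Sum>e\<in>E. g u e *\<^sub>R e) f = g u f" if "f \<in> E" for f
      using orth[OF that, of "g u"] by (simp add: linear_sum[OF ll] linear_scale[OF ll])
    then show "g (\<Sum>e\<in>E. g u e *\<^sub>R e) w = g u w"
      using linear_eq_on_span[OF lr lr, of E] span by blast
  qed
  then show "(\<Sum>e\<in>E. g u e *\<^sub>R e) = u" .
  have "S b' \<bullet> b' = (\<Sum>e\<in>E. g b' e * (S e \<bullet> b'))" for b'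
    using arg_cong[OF rep[of b'], of "\<lambda>v. S v \<bullet> b'", symmetric]
    by (simp add: linear_sum[OF S] linear_scale[OF S] inner_sum_left)
  then have "endo_trace S = (\<Sum>b\<in>Basis. \<Sum>e\<in>E. g b e * (S e \<bullet> b))"
    unfolding endo_trace_def by (rule sum.cong[OF refl])
  also have "\<dots> = (\<Sum>e\<in>E. \<Sum>b\<in>Basis. (S e \<bullet> b) * g b e)"
    by (subst sum.swap) (simp only: mult.commute)
  also have "\<dots> = (\<Sum>e\<in>E. g (S e) e)"
    using linear_expand[OF ll, symmetric] by (simp only: real_scaleR_def)
  finally show "endo_trace S = (\<Sum>e\<in>E. g (S e) e)" .
qed

text \<open>Along \<open>v + t e\<close> the form is affine in \<open>t\<close>, because its
  quadratic coefficient vanishes; a nonzero slope would make it negative somewhere.\<close>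

lemma psd_null:
  fixes \<beta> :: "'e::real_vector \<Rightarrow> 'e \<Rightarrow> real"
  assumes b: "bilinear \<beta>" and sym: "\<And>u v. \<beta> u v = \<beta> v u" and psd: "\<And>u. \<beta> u u \<ge> 0" and "\<beta> e e = 0"
  shows "\<beta> e v = 0"
proof (rule ccontr)
  assume n: "\<beta> e v \<noteq> 0"
  \<comment> \<open>Chosen so that the form takes the value -1.\<close>
  define t where "t = - (\<beta> v v + 1) / (2 * \<beta> e v)"
  have "\<beta> (v + t *\<^sub>R e) (v + t *\<^sub>R e) = \<beta> v v + 2 * t * \<beta> e v"
    using assms(4) sym[of v e]
    by (simp add: bilinear_ladd[OF b] bilinear_radd[OF b] bilinear_lmul[OF b] bilinear_rmul[OF b])
  also have "\<dots> = -1" using n by (simp add: t_def field_simps)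
  finally show False using psd[of "v + t *\<^sub>R e"] by simp
qed

text \<open>In an orthonormal basis the diagonal entries are nonnegative with sum zero, so each
  vanishes, and a null vector of a semidefinite form is orthogonal to everything.\<close>

lemma trace_zero_psd:
  fixes g :: "'e::euclidean_space \<Rightarrow> 'e \<Rightarrow> real"
  assumes g: "posdef g" and S: "linear S" and sym: "\<And>u v. g (S u) v = g u (S v)"
    and psd: "\<And>u. g (S u) u \<ge> 0" and tr: "endo_trace S = 0"
  shows "S u = 0"
proof -
  note b = posdefD(1)[OF g]
  obtain E where E: "finite E" "card E = DIM('e)" "\<forall>e\<in>E. g e e = 1" "\<forall>e\<in>E. \<forall>f\<in>E. e \<noteq> f \<longrightarrow> g e f = 0"
    using posdef_orthonormal[OF g order_refl] by blast
  note tr' = endo_trace_posdef[OF g S E]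
  have z: "g (S e) e = 0" if "e \<in> E" for e
    using tr tr'(1) psd sum_nonneg_eq_0_iff[OF E(1), of "\<lambda>e. g (S e) e"] that by auto
  have bS: "bilinear (\<lambda>u v. g (S u) v)"
    using b linear_compose[OF S] unfolding bilinear_def comp_def by blast
  have "g (S e) v = 0" if "e \<in> E" for e v
    by (rule psd_null[OF bS _ psd z[OF that]]) (metis sym posdefD(2)[OF g])
  then have "S e = 0" if "e \<in> E" for e
    using posdefD(5)[OF g] that by blast
  moreover have "S u = (\<Sum>e\<in>E. g u e *\<^sub>R S e)"
    using arg_cong[OF tr'(2)[of u], of S] by (simp add: linear_sum[OF S] linear_scale[OF S])
  ultimately show ?thesis by simp
qed

section \<open>Regularity of solutions of linear equations with varying coefficients\<close>

lemma Ck_on_Pair: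
  fixes S :: "'e::euclidean_space set" and f :: "'e \<Rightarrow> 'c::euclidean_space" and h :: "'e \<Rightarrow> 'd::euclidean_space"
  assumes "open S" "Ck_on k f S" "Ck_on k h S"
  shows "Ck_on k (\<lambda>x. (f x, h x)) S"
proof -
  have "Ck_on k (\<lambda>x. (f x, 0::'d) + (0::'c, h x)) S"
    by (intro Ck_on_add assms Ck_on_bounded_linear[where L="\<lambda>x. (x, 0)"] Ck_on_bounded_linear[where L="\<lambda>x. (0, x)"]
        bounded_linear_Pair bounded_linear_ident bounded_linear_zero)
  then show ?thesis by simp
qed

text \<open>Instead of inverting a matrix, the equation is read as a fibrewise linear map F(x,u) =
  (x, g x u) with a C^1 local inverse; \<open>y\<close> is the second component of this inverse at
  (x, L x). Continuity and differentiability of \<open>L\<close> at \<open>x0\<close> therefore pass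
  to \<open>y\<close>.\<close>

lemma linear_equation_solution:
  fixes g :: "'e::euclidean_space \<Rightarrow> 'd::euclidean_space \<Rightarrow> 'd \<Rightarrow> real" and y :: "'e \<Rightarrow> 'd"
  assumes U: "open U" "\<And>x. x \<in> U \<Longrightarrow> posdef (g x)" "\<And>u v. Ck_on 1 (\<lambda>x. g x u v) U"
    and y: "\<And>x w. x \<in> U \<Longrightarrow> g x (y x) w = L x w" and x: "x0 \<in> U"
    and c: "\<And>w. w \<in> Basis \<Longrightarrow> isCont (\<lambda>x. L x w) x0"
  shows "isCont y x0"
    and "(\<And>w. w \<in> Basis \<Longrightarrow> (\<lambda>x. L x w) differentiable (at x0)) \<Longrightarrow> y differentiable (at x0)"
proof -
  define G where "G p = (\<Sum>b\<in>Basis. g (fst p) (snd p) b *\<^sub>R b)" for p :: "'e \<times> 'd"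
  define F where "F p = (fst p, G p)" for p
  define rh where "rh x = (\<Sum>b\<in>Basis. L x b *\<^sub>R b)" for x
  have b: "bilinear (g x)" if "x \<in> U" for x using posdefD(1)[OF U(2)[OF that]] .
  have oU: "open (U \<times> (UNIV :: 'd set))" using U(1) by (simp add: open_Times)
  have CF: "Ck_on 1 F (U \<times> UNIV)"
    unfolding F_def G_def
    by (intro Ck_on_Pair Ck_on_sum Ck_on_scaleR Ck_on_const oU Ck_on_bounded_linear[OF bounded_linear_fst]
        Ck_on_bilinear_family[OF oU U(1) b U(3)] Ck_on_bounded_linear[OF bounded_linear_snd] Ck_on_id) auto
  have Gb: "G p \<bullet> b = g (fst p) (snd p) b" if "b \<in> Basis" for p b
    unfolding G_def using that by (rule inner_sum_left_Basis)
  have Ginj: "u = v" if "G (x, u) = G (x, v)" "x \<in> U" for x u v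
  proof (rule posdef_nondegenerate[OF U(2)[OF that(2)]])
    have "g x u b = g x v b" if "b \<in> Basis" for b
      using \<open>G (x, u) = G (x, v)\<close> Gb[OF that, of "(x, u)"] Gb[OF that, of "(x, v)"] by simp
    then show "g x u w = g x v w" for w
      using linear_eq_on_span[of "g x u" "g x v" Basis w] b[OF that(2)] by (simp add: span_Basis bilinear_def)
  qed
  have p0: "(x0, y x0) \<in> U \<times> UNIV" using x by simp
  have dF: "(F has_derivative FD F (x0, y x0)) (at (x0, y x0))"
    using Ck_on_has_derivative[of 0 F, OF _ oU p0] CF by simp
  \<comment> \<open>The derivative is block triangular: the identity in the base direction and the
    injective map \<open>G (x0, _)\<close> in the fibre.\<close>
  have inj: "inj (FD F (x0, y x0))"
  proof -
    have l: "linear (FD F (x0, y x0))" using has_derivative_linear[OF dF] .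
    have f: "fst (FD F (x0, y x0) p) = fst p" for p
    proof -
      have "((\<lambda>q. fst (F q)) has_derivative (\<lambda>p. fst (FD F (x0, y x0) p))) (at (x0, y x0))"
        using has_derivative_fst[OF dF] .
      moreover have "((\<lambda>q. fst (F q)) has_derivative fst) (at (x0, y x0))"
        by (simp add: F_def has_derivative_fst[OF has_derivative_ident])
      ultimately show ?thesis using has_derivative_unique by metis
    qed
    have s: "snd (FD F (x0, y x0) (0, k)) = G (x0, k)" for k
    proof -
      have lin: "linear (\<lambda>v. G (x0, v))"
        unfolding G_def fst_conv snd_conv
        by (intro linearI) (simp_all only: bilinear_ladd[OF b[OF x]] bilinear_lmul[OF b[OF x]]
        scaleR_left_distrib sum.distrib scaleR_sum_right scaleR_scaleR real_scaleR_def)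
      have 1: "((\<lambda>v. snd (F (x0, v))) has_derivative (\<lambda>k. snd (FD F (x0, y x0) (0, k)))) (at (y x0))"
        by (rule has_derivative_compose[OF has_derivative_Pair[OF has_derivative_const has_derivative_ident] has_derivative_snd[OF dF]])
      have 2: "((\<lambda>v. snd (F (x0, v))) has_derivative (\<lambda>k. G (x0, k))) (at (y x0))"
        using linear_imp_has_derivative[OF lin] by (simp add: F_def)
      show ?thesis using has_derivative_unique[OF 1 2] by metis
    qed
    have "p = 0" if "FD F (x0, y x0) p = 0" for p
    proof -
      have 0: "fst p = 0" using f[of p] that by simp
      then have "G (x0, snd p) = 0" using s[of "snd p"] that by (metis prod.collapse snd_zero)
      moreover have "G (x0, 0) = 0" by (simp add: G_def bilinear_lzero[OF b[OF x]])
      ultimately have "snd p = 0" using Ginj[OF _ x] by metis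
      then show ?thesis using 0 by (simp add: prod_eq_iff)
    qed
    then show ?thesis using linear_injective_0[OF l] by blast
  qed
  obtain U' V h where V: "open U'" "U' \<subseteq> U \<times> UNIV" "(x0, y x0) \<in> U'" "open V" "F (x0, y x0) \<in> V" "homeomorphism U' V F h"
    "\<And>y. y \<in> V \<Longrightarrow> (h has_derivative inv (FD F (h y))) (at y)" "\<And>y. y \<in> V \<Longrightarrow> bij (FD F (h y))"
    by (rule C1_inverse_function[OF oU CF p0 inj]) (rule that)
  have Gy: "G (x, y x) = rh x" if "x \<in> U" for x
    using y[OF that] by (simp add: G_def rh_def)
  have V0: "(x0, rh x0) \<in> V" using V(5) Gy[OF x] by (simp add: F_def)
  have yh: "y x = snd (h (x, rh x))" if "x \<in> U" "(x, rh x) \<in> V" for x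
  proof -
    have "F (h (x, rh x)) = (x, rh x)" using V(6) that(2) unfolding homeomorphism_def by blast
    then have "fst (h (x, rh x)) = x" "G (h (x, rh x)) = G (x, y x)" using Gy[OF that(1)] by (auto simp: F_def)
    then show ?thesis using Ginj[OF _ that(1)] by (metis prod.collapse)
  qed
  have dh: "(h has_derivative inv (FD F (h (x0, rh x0)))) (at (x0, rh x0))" using V(7)[OF V0] .
  have crh: "isCont (\<lambda>x. (x, rh x)) x0"
    unfolding rh_def by (intro isCont_Pair continuous_ident continuous_sum continuous_scaleR c continuous_const)
  then have "\<forall>\<^sub>F x in nhds x0. (x, rh x) \<in> V"
    using topological_tendstoD[OF tendsto_at_iff_tendsto_nhds[THEN iffD1, OF crh[unfolded isCont_def]] V(4) V0] by simp
  then have ev: "\<forall>\<^sub>F x in nhds x0. y x = snd (h (x, rh x))"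
    using eventually_nhds_in_open[OF U(1) x] by eventually_elim (rule yh)
  have "isCont (\<lambda>x. snd (h (x, rh x))) x0"
    by (intro continuous_snd isCont_o2[OF crh] has_derivative_continuous[OF dh])
  then show "isCont y x0" using isCont_cong[OF ev] by blast
  show "y differentiable (at x0)" if d: "\<And>w. w \<in> Basis \<Longrightarrow> (\<lambda>x. L x w) differentiable (at x0)"
  proof -
    have "rh differentiable (at x0)"
      unfolding rh_def by (intro differentiable_sum ballI differentiable_scaleR d differentiable_const finite_Basis)
    then have l: "(rh has_derivative FD rh x0) (at x0)" by (simp add: frechet_derivative_works)
    have D: "((\<lambda>x. snd (h (x, rh x))) has_derivative (\<lambda>v. snd (inv (FD F (h (x0, rh x0))) (v, FD rh x0 v)))) (at x0)"
      by (rule has_derivative_compose[OF has_derivative_Pair[OF has_derivative_ident l] has_derivative_snd[OF dh]])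
    have "\<forall>\<^sub>F x in at x0. snd (h (x, rh x)) = y x"
      using ev by (auto simp: eventually_at_filter elim: eventually_mono)
    then have "(y has_derivative (\<lambda>v. snd (inv (FD F (h (x0, rh x0))) (v, FD rh x0 v)))) (at x0)"
      using yh[OF x V0] by (intro has_derivative_transform_eventually[OF D]) auto
    then show ?thesis by (auto simp: differentiable_def)
  qed
qed

text \<open>Differentiating g(y,w) = L w shows that \<open>FD y v\<close> solves an equation with
  the same left-hand side and a right-hand side of one class less. This right-hand side contains
  \<open>y\<close> itself, whose lower class is known by then.\<close>

lemma Ck_on_linear_equation:
  fixes g :: "'e::euclidean_space \<Rightarrow> 'd::euclidean_space \<Rightarrow> 'd \<Rightarrow> real"
  assumes U: "open U" "\<And>x. x \<in> U \<Longrightarrow> posdef (g x)"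
    and g1: "\<And>u v. Ck_on 1 (\<lambda>x. g x u v) U"
  shows "(\<And>u v. Ck_on k (\<lambda>x. g x u v) U) \<Longrightarrow> (\<And>w. Ck_on k (\<lambda>x. L x w) U) \<Longrightarrow>
    (\<And>x w. x \<in> U \<Longrightarrow> g x (y x) w = L x w) \<Longrightarrow> Ck_on k y U"
proof (induction k arbitrary: L y)
  case 0
  then have "isCont (\<lambda>x. L x w) x" if "x \<in> U" for x w
    using that by (simp add: continuous_on_eq_continuous_at[OF U(1)])
  then have "isCont y x" if "x \<in> U" for x
    using linear_equation_solution(1)[OF U g1 0(3) that] that by blast
  then show ?case by (simp add: continuous_on_eq_continuous_at[OF U(1)])
next
  case (Suc k)
  have b: "bilinear (g x)" if "x \<in> U" for x using posdefD(1)[OF U(2)[OF that]] .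
  have dL: "((\<lambda>x. L x w) has_derivative FD (\<lambda>x. L x w) x) (at x)" if "x \<in> U" for x w
    using Ck_on_has_derivative[OF Suc.prems(2) U(1) that] .
  have dg: "((\<lambda>x. g x u v) has_derivative FD (\<lambda>x. g x u v) x) (at x)" if "x \<in> U" for x u v
    using Ck_on_has_derivative[OF Suc.prems(1) U(1) that] .
  have "y differentiable (at x)" if "x \<in> U" for x
    using linear_equation_solution(2)[OF U g1 Suc.prems(3) that] dL[OF that]
      has_derivative_continuous[OF dL[OF that]] by (auto simp: differentiable_def)
  then have dy: "(y has_derivative FD y x) (at x)" if "x \<in> U" for x
    using that by (simp add: frechet_derivative_works)
  have y: "Ck_on k y U"
    by (rule Suc.IH[OF Ck_on_SucD[OF Suc.prems(1)] Ck_on_SucD[OF Suc.prems(2)] Suc.prems(3)])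
  have "Ck_on k (\<lambda>x. FD y x v) U" for v
  proof (rule Suc.IH[of "\<lambda>x w. FD (\<lambda>x. L x w) x v - FD (\<lambda>z. g z (y x) w) x v"])
    show "Ck_on k (\<lambda>x. g x u w) U" for u w using Ck_on_SucD[OF Suc.prems(1)] .
    show "Ck_on k (\<lambda>x. FD (\<lambda>x. L x w) x v - FD (\<lambda>z. g z (y x) w) x v) U" for w
    proof (rule Ck_on_diff[OF U(1) Ck_on_FD[OF Suc.prems(2)]])
      have "Ck_on k (\<lambda>x. (\<lambda>x u w. FD (\<lambda>z. g z u w) x v) x (y x) w) U"
        by (rule Ck_on_bilinear_family[OF U(1) U(1) bilinear_FD[OF U(1) b Suc.prems(1)] Ck_on_FD[OF Suc.prems(1)]
            _ Ck_on_id[OF U(1)] y Ck_on_const[OF U(1)]]) auto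
      then show "Ck_on k (\<lambda>x. FD (\<lambda>z. g z (y x) w) x v) U" by simp
    qed
    fix x w assume x: "x \<in> U"
    have 1: "((\<lambda>z. g z (y z) w) has_derivative
        (\<lambda>h. FD (\<lambda>z. g z (y x) w) x h + g x (FD y x h) w + g x (y x) 0)) (at x)"
      by (rule has_derivative_bilinear_family[OF U(1) b dg[OF x] x has_derivative_ident dy[OF x] has_derivative_const])
    have 2: "((\<lambda>z. g z (y z) w) has_derivative FD (\<lambda>x. L x w) x) (at x)"
      by (rule has_derivative_transform_within_open[OF dL[OF x] U(1) x]) (simp add: Suc.prems(3))
    show "g x (FD y x v) w = FD (\<lambda>x. L x w) x v - FD (\<lambda>z. g z (y x) w) x v"
      using has_derivative_unique[OF 1 2, THEN fun_cong, of v] by (simp add: bilinear_rzero[OF b[OF x]])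
  qed
  then show ?case using Ck_on_SucI[OF U(1) dy] by blast
qed

section \<open>Metrics on open subsets of a Euclidean space\<close>

definition levi_civita :: "('e::euclidean_space \<Rightarrow> 'e \<Rightarrow> 'e \<Rightarrow> real) \<Rightarrow> 'e \<Rightarrow> ('e \<Rightarrow> 'e \<Rightarrow> 'e) \<Rightarrow> bool" where
  "levi_civita g x \<Gamma> \<longleftrightarrow> bilinear \<Gamma> \<and> (\<forall>u v. \<Gamma> u v = \<Gamma> v u) \<and>
     (\<forall>u v w. FD (\<lambda>y. g y u v) x w = g x (\<Gamma> w u) v + g x u (\<Gamma> w v))"

text \<open>Depends on the local expression of a metric only, so that the same facts serve charts of
  the manifold, charts of a hypersurface and changes of coordinates.\<close>

definition chris :: "('e::euclidean_space \<Rightarrow> 'e \<Rightarrow> 'e \<Rightarrow> real) \<Rightarrow> 'e \<Rightarrow> 'e \<Rightarrow> 'e \<Rightarrow> 'e" where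
  "chris g x = (THE \<Gamma>. levi_civita g x \<Gamma>)"

lemma christoffel_chris: "christoffel M c = chris (metric M c)"
  by (simp add: christoffel_def chris_def levi_civita_def fun_eq_iff)

definition curv :: "('e::euclidean_space \<Rightarrow> 'e \<Rightarrow> 'e \<Rightarrow> 'e) \<Rightarrow> 'e \<Rightarrow> 'e \<Rightarrow> 'e \<Rightarrow> 'e \<Rightarrow> 'e" where
  "curv \<Gamma> x u v w = FD (\<lambda>y. \<Gamma> y v w) x u + \<Gamma> x u (\<Gamma> x v w) - (FD (\<lambda>y. \<Gamma> y u w) x v + \<Gamma> x v (\<Gamma> x u w))"

text \<open>The cyclic combination of three compatibility equations, in which symmetry cancels all
  terms but one. It yields the uniqueness of the connection and, read as a linear equation for
  \<Gamma>, its regularity.\<close>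

lemma levi_civita_koszul:
  assumes "posdef (g x)" "levi_civita g x \<Gamma>"
  shows "g x (\<Gamma> u v) w = (FD (\<lambda>y. g y v w) x u + FD (\<lambda>y. g y u w) x v - FD (\<lambda>y. g y u v) x w) / 2"
proof -
  have c: "FD (\<lambda>y. g y u v) x w = g x (\<Gamma> w u) v + g x u (\<Gamma> w v)" and s: "\<Gamma> u v = \<Gamma> v u" for u v w
    using assms(2) unfolding levi_civita_def by blast+
  note sg = posdefD(2)[OF assms(1)]
  show ?thesis
    unfolding c s[of w u] s[of w v] s[of v u]
    using sg[of v "\<Gamma> u w"] sg[of u "\<Gamma> v w"] by simp
qed

lemma levi_civita_unique:
  assumes "posdef (g x)" "levi_civita g x \<Gamma>" "levi_civita g x \<Gamma>'"
  shows "\<Gamma> = \<Gamma>'"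
proof (intro ext)
  fix u v show "\<Gamma> u v = \<Gamma>' u v"
    by (rule posdef_nondegenerate[OF assms(1)])
      (simp only: levi_civita_koszul[OF assms(1,2)] levi_civita_koszul[OF assms(1,3)])
qed

lemma chris_eqI: "posdef (g x) \<Longrightarrow> levi_civita g x \<Gamma> \<Longrightarrow> chris g x = \<Gamma>"
  unfolding chris_def by (rule the_equality) (auto intro: levi_civita_unique)

locale local_metric =
  fixes U :: "'e::euclidean_space set" and g :: "'e \<Rightarrow> 'e \<Rightarrow> 'e \<Rightarrow> real"
  assumes open_U: "open U" and posdef_g: "\<And>x. x \<in> U \<Longrightarrow> posdef (g x)"
    and C2_g: "\<And>u v. Ck_on 2 (\<lambda>x. g x u v) U"
begin

lemma g_bil: "x \<in> U \<Longrightarrow> bilinear (g x)"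
  and g_sym: "x \<in> U \<Longrightarrow> g x u v = g x v u"
  using posdefD(1,2)[OF posdef_g] by blast+

lemma g_pos: "x \<in> U \<Longrightarrow> u \<noteq> 0 \<Longrightarrow> g x u u > 0"
  and g_ge: "x \<in> U \<Longrightarrow> g x u u \<ge> 0"
  and g_zero: "x \<in> U \<Longrightarrow> g x u u = 0 \<longleftrightarrow> u = 0"
  using posdefD(3-5)[OF posdef_g] by blast+

lemmas g_add = bilinear_ladd[OF g_bil] bilinear_radd[OF g_bil]
lemmas g_diff = bilinear_lsub[OF g_bil] bilinear_rsub[OF g_bil]
lemmas g_scale = bilinear_lmul[OF g_bil] bilinear_rmul[OF g_bil]
lemmas g_neg = bilinear_lneg[OF g_bil] bilinear_rneg[OF g_bil]
lemmas g_0 = bilinear_lzero[OF g_bil] bilinear_rzero[OF g_bil]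
lemmas g_lin = g_add g_diff g_scale g_neg g_0

lemma g2: "Ck_on (Suc (Suc 0)) (\<lambda>x. g x u v) U"
  using C2_g[of u v] by (simp only: numeral_2_eq_2)

lemma g1: "Ck_on 1 (\<lambda>x. g x u v) U"
  using Ck_on_SucD[OF g2] by simp

lemma dg: "x \<in> U \<Longrightarrow> ((\<lambda>x. g x u v) has_derivative FD (\<lambda>x. g x u v) x) (at x)"
  by (rule Ck_on_has_derivative[OF g2 open_U])

text \<open>The right-hand side of the Koszul formula is linear in the last argument, so a vector
  represents it; the required properties are inherited from the formula since the metric is
  nondegenerate.\<close>

lemma levi_civita_exists:
  assumes x: "x \<in> U"
  shows "\<exists>\<Gamma>. levi_civita g x \<Gamma>"
proof -
  define d where "d w u v = FD (\<lambda>y. g y u v) x w" for u v w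
  have db: "bilinear (d w)" for w
    unfolding d_def using bilinear_FD[OF open_U g_bil g2 x] .
  have dl: "linear (\<lambda>w. d w u v)" for u v
    unfolding d_def using has_derivative_linear[OF dg[OF x]] .
  have ds: "d w u v = d w v u" for u v w
  proof -
    have "FD (\<lambda>y. g y u v) x = FD (\<lambda>y. g y v u) x"
      by (rule FD_cong[OF open_U x]) (rule g_sym)
    then show ?thesis unfolding d_def by simp
  qed
  define K where "K u v w = (d u v w + d v u w - d w u v) / 2" for u v w
  note dsimps = bilinear_ladd[OF db] bilinear_radd[OF db] bilinear_lmul[OF db] bilinear_rmul[OF db]
    linear_add[OF dl] linear_scale[OF dl]
  have Kl: "linear (K u v)" for u v
    unfolding K_def by (intro linearI) (simp_all add: dsimps algebra_simps add_divide_distrib diff_divide_distrib)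
  have K: "K (u + u') v w = K u v w + K u' v w" "K (r *\<^sub>R u) v w = r * K u v w" "K u v w = K v u w" for u u' v w r
    unfolding K_def using ds by (simp_all add: dsimps algebra_simps add_divide_distrib diff_divide_distrib)
  have "\<exists>y. \<forall>w. g x y w = K u v w" for u v
    using posdef_riesz[OF posdef_g[OF x] Kl[of u v]] by blast
  then obtain \<Gamma> where \<Gamma>: "\<And>u v w. g x (\<Gamma> u v) w = K u v w" by metis
  note eqI = posdef_nondegenerate[OF posdef_g[OF x]]
  have sym: "\<Gamma> u v = \<Gamma> v u" for u v
    by (rule eqI) (simp add: \<Gamma> K(3))
  have l: "linear (\<lambda>u. \<Gamma> u v)" for v
    by (intro linearI eqI) (simp_all add: g_add[OF x] g_scale[OF x] \<Gamma> K(1,2))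
  have "\<Gamma> u = (\<lambda>v. \<Gamma> v u)" for u by (rule ext) (rule sym)
  from this[symmetric] have "linear (\<Gamma> u)" for u using l[of u] by (simp only:)
  then have "bilinear \<Gamma>"
    unfolding bilinear_def using l by blast
  moreover have "d w u v = g x (\<Gamma> w u) v + g x u (\<Gamma> w v)" for u v w
    unfolding g_sym[OF x, of u "\<Gamma> w v"] \<Gamma> K_def using ds[of w u v] ds[of u w v] ds[of v w u] by (simp add: field_simps)
  ultimately show ?thesis
    using sym unfolding levi_civita_def d_def by blast
qed

abbreviation "\<Gamma> \<equiv> chris g"
abbreviation "Rm \<equiv> curv \<Gamma>"

lemma levi_civita_chris:
  assumes "x \<in> U"
  shows "levi_civita g x (\<Gamma> x)"
proof -
  obtain \<Gamma>' where "levi_civita g x \<Gamma>'" using levi_civita_exists[OF assms] by blast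
  then show ?thesis using chris_eqI[of g, OF posdef_g[OF assms]] by simp
qed

lemma \<Gamma>_bil: "x \<in> U \<Longrightarrow> bilinear (\<Gamma> x)"
  and \<Gamma>_sym: "x \<in> U \<Longrightarrow> \<Gamma> x u v = \<Gamma> x v u"
  and \<Gamma>_compat: "x \<in> U \<Longrightarrow> FD (\<lambda>y. g y u v) x w = g x (\<Gamma> x w u) v + g x u (\<Gamma> x w v)"
  using levi_civita_chris unfolding levi_civita_def by blast+

lemmas \<Gamma>_lin = bilinear_ladd[OF \<Gamma>_bil] bilinear_radd[OF \<Gamma>_bil] bilinear_lsub[OF \<Gamma>_bil] bilinear_rsub[OF \<Gamma>_bil]
  bilinear_lmul[OF \<Gamma>_bil] bilinear_rmul[OF \<Gamma>_bil] bilinear_lneg[OF \<Gamma>_bil] bilinear_rneg[OF \<Gamma>_bil]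
  bilinear_lzero[OF \<Gamma>_bil] bilinear_rzero[OF \<Gamma>_bil]

lemma C1_\<Gamma>: "Ck_on (Suc 0) (\<lambda>x. \<Gamma> x u v) U"
proof (rule Ck_on_linear_equation[OF open_U posdef_g g1 Ck_on_SucD[OF g2]])
  show "g x (\<Gamma> x u v) w = (FD (\<lambda>y. g y v w) x u + FD (\<lambda>y. g y u w) x v - FD (\<lambda>y. g y u v) x w) * (1/2)"
    if "x \<in> U" for x w
    using levi_civita_koszul[OF posdef_g[OF that] levi_civita_chris[OF that]] by simp
  show "Ck_on (Suc 0) (\<lambda>x. (FD (\<lambda>y. g y v w) x u + FD (\<lambda>y. g y u w) x v - FD (\<lambda>y. g y u v) x w) * (1/2)) U" for w
    by (intro Ck_on_mult Ck_on_const Ck_on_add Ck_on_diff open_U Ck_on_FD[OF g2])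
qed

lemma d\<Gamma>: "x \<in> U \<Longrightarrow> ((\<lambda>x. \<Gamma> x u v) has_derivative FD (\<lambda>x. \<Gamma> x u v) x) (at x)"
  by (rule Ck_on_has_derivative[OF C1_\<Gamma> open_U])

lemma d\<Gamma>_bil: "x \<in> U \<Longrightarrow> bilinear (\<lambda>u v. FD (\<lambda>x. \<Gamma> x u v) x h)"
  by (rule bilinear_FD[OF open_U \<Gamma>_bil C1_\<Gamma>])

lemma d\<Gamma>_lin: "x \<in> U \<Longrightarrow> linear (FD (\<lambda>x. \<Gamma> x u v) x)"
  using has_derivative_linear[OF d\<Gamma>] .

lemma d\<Gamma>_sym: "x \<in> U \<Longrightarrow> FD (\<lambda>x. \<Gamma> x u v) x = FD (\<lambda>x. \<Gamma> x v u) x"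
  by (rule FD_cong[OF open_U]) (auto intro: \<Gamma>_sym)

lemma has_derivative_\<Gamma>:
  assumes "q z \<in> U" "(q has_derivative q') (at z within S)"
    "(X has_derivative X') (at z within S)" "(Y has_derivative Y') (at z within S)"
  shows "((\<lambda>z. \<Gamma> (q z) (X z) (Y z)) has_derivative
    (\<lambda>h. FD (\<lambda>x. \<Gamma> x (X z) (Y z)) (q z) (q' h) + \<Gamma> (q z) (X' h) (Y z) + \<Gamma> (q z) (X z) (Y' h))) (at z within S)"
  by (rule has_derivative_bilinear_family[OF open_U \<Gamma>_bil d\<Gamma>[OF assms(1)] assms])

text \<open>Compatibility absorbs the derivative of \<open>g\<close> into the two Christoffel terms,
  so that only the covariant derivatives of \<open>X\<close> and \<open>Y\<close> along
  \<open>q\<close> appear.\<close>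

lemma has_derivative_g:
  assumes q: "q z \<in> U" "(q has_derivative q') (at z within S)"
    and X: "(X has_derivative X') (at z within S)" and Y: "(Y has_derivative Y') (at z within S)"
  shows "((\<lambda>z. g (q z) (X z) (Y z)) has_derivative
    (\<lambda>h. g (q z) (X' h + \<Gamma> (q z) (q' h) (X z)) (Y z) + g (q z) (X z) (Y' h + \<Gamma> (q z) (q' h) (Y z)))) (at z within S)"
proof -
  have "FD (\<lambda>x. g x (X z) (Y z)) (q z) (q' h) + g (q z) (X' h) (Y z) + g (q z) (X z) (Y' h) =
    g (q z) (X' h + \<Gamma> (q z) (q' h) (X z)) (Y z) + g (q z) (X z) (Y' h + \<Gamma> (q z) (q' h) (Y z))" for h
    by (simp add: \<Gamma>_compat[OF q(1)] g_add[OF q(1)])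
  then show ?thesis
    using has_derivative_bilinear_family[OF open_U g_bil dg[OF q(1)] q X Y] by simp
qed

lemma has_vector_derivative_g:
  assumes q: "q s \<in> U" "(q has_vector_derivative q') (at s within S)"
    and X: "(X has_vector_derivative X') (at s within S)" and Y: "(Y has_vector_derivative Y') (at s within S)"
  shows "((\<lambda>s. g (q s) (X s) (Y s)) has_real_derivative
    g (q s) (X' + \<Gamma> (q s) q' (X s)) (Y s) + g (q s) (X s) (Y' + \<Gamma> (q s) q' (Y s))) (at s within S)"
  unfolding has_field_derivative_def
  by (rule has_derivative_eq_rhs[OF has_derivative_g[OF q(1) assms(2-4)[unfolded has_vector_derivative_def]]])
    (simp add: fun_eq_iff g_lin[OF q(1)] \<Gamma>_lin[OF q(1)] algebra_simps)

lemma continuous_g: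
  assumes "continuous_on S q" "q ` S \<subseteq> U" "continuous_on S X" "continuous_on S Y"
  shows "continuous_on S (\<lambda>s. g (q s) (X s) (Y s))"
proof -
  have c: "continuous_on U (\<lambda>x. g x u v)" for u v
    using Ck_on_mono[OF g1[of u v], of 0] by simp
  have "continuous_on S (\<lambda>s. \<Sum>b\<in>Basis. \<Sum>c\<in>Basis. ((X s \<bullet> b) * (Y s \<bullet> c)) *\<^sub>R g (q s) b c)"
    by (intro continuous_intros assms continuous_on_compose2[OF c assms(1,2)])
  moreover have "g (q s) (X s) (Y s) = (\<Sum>b\<in>Basis. \<Sum>c\<in>Basis. ((X s \<bullet> b) * (Y s \<bullet> c)) *\<^sub>R g (q s) b c)"
    if "s \<in> S" for s
    using that assms(2) by (intro bilinear_expand g_bil) auto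
  ultimately show ?thesis by (simp cong: continuous_on_cong)
qed

lemma Rm_lin:
  assumes x: "x \<in> U"
  shows "linear (\<lambda>u. Rm x u v w)" "linear (\<lambda>v. Rm x u v w)" "linear (\<lambda>w. Rm x u v w)"
  unfolding curv_def
  by (intro linearI; simp add: \<Gamma>_lin[OF x] bilinear_ladd[OF d\<Gamma>_bil[OF x]] bilinear_radd[OF d\<Gamma>_bil[OF x]]
      bilinear_lmul[OF d\<Gamma>_bil[OF x]] bilinear_rmul[OF d\<Gamma>_bil[OF x]]
      linear_add[OF d\<Gamma>_lin[OF x]] linear_scale[OF d\<Gamma>_lin[OF x]] algebra_simps)+

lemma continuous_Rm_const: "continuous_on U (\<lambda>x. Rm x u v w)"
proof -
  have c: "continuous_on U (\<lambda>x. FD (\<lambda>y. \<Gamma> y u v) x h)" for u v h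
    using Ck_on_FD[OF C1_\<Gamma>] by simp
  have "Ck_on (Suc 0) (\<lambda>x. \<Gamma> x u (\<Gamma> x v w)) U" for u v w
    by (rule Ck_on_bilinear_family[OF open_U open_U \<Gamma>_bil C1_\<Gamma> _ Ck_on_id[OF open_U] Ck_on_const[OF open_U] C1_\<Gamma>]) auto
  then have "continuous_on U (\<lambda>x. \<Gamma> x u (\<Gamma> x v w))" for u v w
    using Ck_on_SucD by (metis Ck_on.simps(1))
  then show ?thesis unfolding curv_def by (intro continuous_intros c)
qed

lemma continuous_Rm:
  assumes "continuous_on S q" "q ` S \<subseteq> U" "continuous_on S X" "continuous_on S Y" "continuous_on S Z"
  shows "continuous_on S (\<lambda>s. Rm (q s) (X s) (Y s) (Z s))"
proof -
  have "continuous_on S (\<lambda>s. \<Sum>d\<in>Basis. (Z s \<bullet> d) *\<^sub>R (\<Sum>b\<in>Basis. \<Sum>c\<in>Basis. ((X s \<bullet> b) * (Y s \<bullet> c)) *\<^sub>R Rm (q s) b c d))"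
    by (intro continuous_intros assms continuous_on_compose2[OF continuous_Rm_const assms(1,2)])
  moreover have "Rm (q s) (X s) (Y s) (Z s) =
      (\<Sum>d\<in>Basis. (Z s \<bullet> d) *\<^sub>R (\<Sum>b\<in>Basis. \<Sum>c\<in>Basis. ((X s \<bullet> b) * (Y s \<bullet> c)) *\<^sub>R Rm (q s) b c d))"
    if "s \<in> S" for s
  proof -
    have q: "q s \<in> U" using that assms(2) by blast
    have "bilinear (\<lambda>u v. Rm (q s) u v d)" for d
      using Rm_lin(1,2)[OF q] unfolding bilinear_def by blast
    from bilinear_expand[OF this, of "X s" "Y s"] show ?thesis
      by (subst linear_expand[OF Rm_lin(3)[OF q]]) simp
  qed
  ultimately show ?thesis by (simp cong: continuous_on_cong)
qed

subsection \<open>Symmetries of the curvature tensor\<close>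

lemma Rm_antisym: "Rm x u v w = - Rm x v u w"
  by (simp add: curv_def)

lemma Rm_bianchi:
  assumes x: "x \<in> U"
  shows "Rm x u v w + Rm x v w u + Rm x w u v = 0"
  unfolding curv_def
  by (simp add: d\<Gamma>_sym[OF x, of w u] d\<Gamma>_sym[OF x, of w v] d\<Gamma>_sym[OF x, of v u]
      \<Gamma>_sym[OF x, of w u] \<Gamma>_sym[OF x, of w v] \<Gamma>_sym[OF x, of v u])

text \<open>The second derivatives of the function g(w,z) commute; written covariantly, the mixed
  terms cancel and the curvature acting on each argument remains. This uses both derivatives of the
  metric.\<close>

lemma Rm_skew:
  assumes x: "x \<in> U"
  shows "g x (Rm x u v w) z = - g x w (Rm x u v z)"
proof -
  have *: "FD (\<lambda>y. FD (\<lambda>y. g y w z) y v) x u =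
      g x (FD (\<lambda>y. \<Gamma> y v w) x u + \<Gamma> x u (\<Gamma> x v w)) z + g x (\<Gamma> x v w) (\<Gamma> x u z) +
      g x (\<Gamma> x u w) (\<Gamma> x v z) + g x w (FD (\<lambda>y. \<Gamma> y v z) x u + \<Gamma> x u (\<Gamma> x v z))" for u v
  proof -
    have c: "FD (\<lambda>y. FD (\<lambda>y. g y w z) y v) x = FD (\<lambda>y. g y (\<Gamma> y v w) z + g y w (\<Gamma> y v z)) x"
      by (rule FD_cong[OF open_U x]) (rule \<Gamma>_compat)
    have "((\<lambda>y. g y (\<Gamma> y v w) z + g y w (\<Gamma> y v z)) has_derivative (\<lambda>h.
        (g x (FD (\<lambda>y. \<Gamma> y v w) x h + \<Gamma> x h (\<Gamma> x v w)) z + g x (\<Gamma> x v w) (0 + \<Gamma> x h z)) +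
        (g x (0 + \<Gamma> x h w) (\<Gamma> x v z) + g x w (FD (\<lambda>y. \<Gamma> y v z) x h + \<Gamma> x h (\<Gamma> x v z))))) (at x)"
      by (intro has_derivative_add has_derivative_g[of "\<lambda>y. y"] x has_derivative_ident d\<Gamma> has_derivative_const)
    then show ?thesis unfolding c by (simp add: FD_eq)
  qed
  have "FD (\<lambda>y. FD (\<lambda>y. g y w z) y v) x u = FD (\<lambda>y. FD (\<lambda>y. g y w z) y u) x v"
    by (rule Ck_on_symmetric[OF open_U g2 x])
  then show ?thesis
    unfolding * curv_def by (simp add: g_lin[OF x])
qed

text \<open>Four Bianchi identities, for the cyclic shifts of the arguments, combined with skewness
  in the first and in the last pair.\<close>

lemma Rm_pair_sym:
  assumes x: "x \<in> U"
  shows "g x (Rm x u v w) z = g x (Rm x w z u) v"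
proof -
  have a: "g x (Rm x u v w) z = - g x (Rm x v u w) z" for u v w z
    using Rm_antisym[of x u v w] by (simp add: g_lin[OF x])
  have s: "g x (Rm x u v w) z = - g x (Rm x u v z) w" for u v w z
    using Rm_skew[OF x, of u v w z] g_sym[OF x] by simp
  have b: "g x (Rm x u v w) z + g x (Rm x v w u) z + g x (Rm x w u v) z = 0" for u v w z
    using arg_cong[OF Rm_bianchi[OF x, of u v w], of "\<lambda>y. g x y z"] by (simp add: g_lin[OF x])
  show ?thesis
    using b[of u v w z] b[of v w z u] b[of w z u v] b[of z u v w]
      a[of u v w z] a[of v w u z] a[of w u v z] a[of w z u v] a[of z u v w] a[of v z u w] a[of u w v z]
      s[of u v w z] s[of v w u z] s[of w u v z] s[of w z v u] s[of z u v w] s[of v z w u] s[of u w z v]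
      s[of u v z w] s[of w z u v] a[of w z v u] a[of z v w u] s[of z v w u]
    by (smt (verit) a s)
qed

definition curv_const :: "real \<Rightarrow> 'e \<Rightarrow> bool" where
  "curv_const k x \<longleftrightarrow> (\<forall>u v w. Rm x u v w = k *\<^sub>R (g x v w *\<^sub>R u - g x u w *\<^sub>R v))"

text \<open>Polarisation determines the part of R(u,v)w that is symmetric in \<open>v\<close> and
  \<open>w\<close>; the Bianchi identity recovers the rest, which produces the factor 3.\<close>

lemma curv_constI:
  assumes x: "x \<in> U" and r: "\<And>u v. Rm x u v v = k *\<^sub>R (g x v v *\<^sub>R u - g x u v *\<^sub>R v)"
  shows "curv_const k x"
  unfolding curv_const_def
proof (intro allI)
  fix u v w
  note lin = linear_add[OF Rm_lin(2)[OF x]] linear_add[OF Rm_lin(3)[OF x]]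
  have p: "Rm x u v w + Rm x u w v = k *\<^sub>R ((2 * g x v w) *\<^sub>R u - g x u v *\<^sub>R w - g x u w *\<^sub>R v)" for u v w
    using r[of u "v + w"] r[of u v] r[of u w] g_sym[OF x, of w v]
    by (simp add: lin g_lin[OF x] algebra_simps)
  have b: "Rm x v w u = - Rm x u v w - Rm x w u v"
    using Rm_bianchi[OF x, of u v w] by (simp add: algebra_simps add_eq_0_iff)
  have "3 *\<^sub>R Rm x u v w = (Rm x u v w + Rm x u w v) - (Rm x v u w + Rm x v w u)
      + (Rm x u v w + Rm x v w u + Rm x w u v)"
    using Rm_antisym[of x v u w] Rm_antisym[of x w u v] scaleR_add_left[of 1 2 "Rm x u v w"]
    by (simp add: scaleR_2)
  also have "\<dots> = 3 *\<^sub>R (k *\<^sub>R (g x v w *\<^sub>R u - g x u w *\<^sub>R v))"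
    unfolding p Rm_bianchi[OF x] g_sym[OF x, of v u]
    by (rule euclidean_eqI) (simp add: inner_simps algebra_simps)
  finally show "Rm x u v w = k *\<^sub>R (g x v w *\<^sub>R u - g x u w *\<^sub>R v)"
    by (rule real_vector.scale_left_imp_eq[rotated]) simp
qed

text \<open>Up to the factor g(v,v) this is the squared length of the component of \<open>u\<close>
  orthogonal to \<open>v\<close>.\<close>

lemma gram_pos:
  assumes x: "x \<in> U" and uv: "u \<noteq> v" "independent {u, v}"
  shows "g x u u * g x v v - (g x u v)\<^sup>2 > 0"
proof -
  have v0: "v \<noteq> 0" using uv dependent_zero by blast
  have u: "u \<noteq> c *\<^sub>R v" for c
    using uv by (auto simp: independent_insert span_singleton)
  define c where "c = g x u v / g x v v"
  have v: "g x v v > 0" using v0 g_pos[OF x] by blast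
  have "u - c *\<^sub>R v \<noteq> 0" using u[of c] by auto
  then have "0 < g x (u - c *\<^sub>R v) (u - c *\<^sub>R v) * g x v v" using g_pos[OF x] v by simp
  also have "\<dots> = g x u u * g x v v - (g x u v)\<^sup>2"
    using v g_sym[OF x, of v u] by (simp add: g_lin[OF x] c_def field_simps power2_eq_square)
  finally show ?thesis .
qed

text \<open>Let \<open>T\<close> be the difference of the curvature and its model. The quadratic
  form g(T(u,v)v,u) in \<open>u\<close> vanishes on independent pairs by hypothesis and on dependent
  pairs by skewness; its bilinear form is symmetric, hence zero by polarisation.\<close>

lemma sectional_const:
  assumes x: "x \<in> U"
    and sec: "\<And>u v. u \<noteq> v \<Longrightarrow> independent {u, v} \<Longrightarrow>
      g x (Rm x u v v) u / (g x u u * g x v v - (g x u v)\<^sup>2) = k"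
  shows "curv_const k x"
proof (rule curv_constI[OF x])
  fix u v
  define T where "T u v w = Rm x u v w - k *\<^sub>R (g x v w *\<^sub>R u - g x u w *\<^sub>R v)" for u v w
  have q: "g x (T u v v) u = 0" for u v
  proof (cases "v = 0 \<or> (\<exists>c. u = c *\<^sub>R v)")
    case True
    have "Rm x v v v = 0" using Rm_antisym[of x v v v] by (simp add: eq_neg_iff_add_eq_0 flip: scaleR_2)
    then show ?thesis
      using True linear_0[OF Rm_lin(2)[OF x]] linear_scale[OF Rm_lin(1)[OF x]]
      by (auto simp: T_def g_lin[OF x])
  next
    case False
    then have "u \<noteq> v" "independent {u, v}"
      by (auto simp: independent_insert span_singleton dependent_single) (metis scaleR_one)
    then have "g x (Rm x u v v) u = k * (g x u u * g x v v - (g x u v)\<^sup>2)"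
      using sec[of u v] gram_pos[OF x, of u v] by (simp add: divide_eq_eq)
    then show ?thesis
      using g_sym[OF x, of v u] by (simp add: T_def g_lin[OF x] power2_eq_square algebra_simps)
  qed
  have Tl: "linear (\<lambda>u. T u v v)" for v
    unfolding T_def using linear_add[OF Rm_lin(1)[OF x]] linear_scale[OF Rm_lin(1)[OF x]]
    by (intro linearI) (simp_all add: g_lin[OF x] algebra_simps)
  have Ts: "g x (T u v v) w = g x (T w v v) u" for u v w
    using Rm_pair_sym[OF x, of u v v w] Rm_skew[OF x, of v w u v] Rm_antisym[of x v w v] 
      g_sym[OF x] by (simp add: T_def g_lin[OF x] algebra_simps)
  have "g x (T u v v) w = 0" for w
    using q[of "u + w" v] q[of u v] q[of w v] Ts[of u v w] by (simp add: linear_add[OF Tl] g_lin[OF x])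
  then have "T u v v = 0" using g_zero[OF x] by blast
  then show "Rm x u v v = k *\<^sub>R (g x v v *\<^sub>R u - g x u v *\<^sub>R v)" by (simp add: T_def)
qed

lemma curv_const_sectional:
  assumes x: "x \<in> U" "curv_const k x" and "u \<noteq> v" "independent {u, v}"
  shows "g x (Rm x u v v) u / (g x u u * g x v v - (g x u v)\<^sup>2) = k"
proof -
  have "g x (Rm x u v v) u = k * (g x u u * g x v v - (g x u v)\<^sup>2)"
    using x(2)[unfolded curv_const_def, rule_format, of u v v] g_sym[OF x(1), of v u]
    by (simp add: g_lin[OF x(1)] power2_eq_square right_diff_distrib)
  then show ?thesis using gram_pos[OF x(1) assms(3,4)] by simp
qed

end

section \<open>Schur's lemma for metrics of class \<open>C\<^sup>2\<close>\<close>

lemma integrable_compact_support: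
  fixes f :: "'e::euclidean_space \<Rightarrow> real"
  assumes "compact K" "continuous_on K f" "\<And>x. x \<notin> K \<Longrightarrow> f x = 0"
  shows "integrable lborel f"
proof -
  have "integrable lborel (\<lambda>x. indicator K x *\<^sub>R f x)" by (rule borel_integrable_compact[OF assms(1,2)])
  moreover have "(\<lambda>x. indicator K x *\<^sub>R f x) = f" using assms(3) by (auto simp: fun_eq_iff indicator_def)
  ultimately show ?thesis by simp
qed

lemma FD_zero_off_compact:
  fixes f :: "'e::euclidean_space \<Rightarrow> 'c::real_normed_vector"
  assumes "compact K" "\<And>x. x \<notin> K \<Longrightarrow> f x = 0" "x \<notin> K"
  shows "FD f x = (\<lambda>_. 0)"
proof -
  have "FD f x = FD (\<lambda>_. 0) x"
    by (rule FD_cong[OF open_Compl[OF compact_imp_closed[OF assms(1)]]]) (use assms in auto)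
  then show ?thesis by simp
qed

text \<open>Near the support the derivative is uniformly continuous on a large ball; away from it
  all three terms vanish. Uniformity in \<open>x\<close> is what allows the error to be
  integrated.\<close>

lemma uniform_difference_quotient:
  fixes F :: "'e::euclidean_space \<Rightarrow> real"
  assumes F: "Ck_on (Suc 0) F UNIV" and K: "compact K" "\<And>x. x \<notin> K \<Longrightarrow> F x = 0" and e: "e > 0"
  obtains d where "d > 0" "\<And>t x. \<bar>t\<bar> < d \<Longrightarrow> \<bar>F (x + t *\<^sub>R w) - F x - t * FD F x w\<bar> \<le> e * \<bar>t\<bar>"
proof -
  have dF: "(F has_derivative FD F x) (at x)" for x using Ck_on_has_derivative[OF F] by simp
  have c: "continuous_on UNIV (\<lambda>x. FD F x w)" using Ck_on_FD[OF F] by simp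
  obtain B where B: "\<And>x. x \<in> K \<Longrightarrow> norm x \<le> B" "B > 0"
    using compact_imp_bounded[OF K(1)] unfolding bounded_pos by auto
  \<comment> \<open>Contains x + s w whenever norm x \<le> B + norm w and \<bar>s\<bar> \<le>
    1.\<close>
  define C where "C = B + 2 * norm w + 1"
  have "uniformly_continuous_on (cball 0 C) (\<lambda>x. FD F x w)"
    by (rule compact_uniformly_continuous[OF continuous_on_subset[OF c]]) auto
  then obtain d0 where d0: "d0 > 0" "\<And>x y. x \<in> cball 0 C \<Longrightarrow> y \<in> cball 0 C \<Longrightarrow> dist y x < d0 \<Longrightarrow> dist (FD F y w) (FD F x w) < e"
    using e unfolding uniformly_continuous_on_def by metis
  define d where "d = min 1 (d0 / (norm w + 1))"
  have d: "d > 0" "d \<le> 1" "d * norm w \<le> d0"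
  proof -
    have n: "norm w + 1 > 0" by (simp add: add_nonneg_pos)
    show "d > 0" using d0(1) n by (simp add: d_def)
    have "d * norm w \<le> d * (norm w + 1)" using \<open>d > 0\<close> by simp
    also have "\<dots> \<le> d0 / (norm w + 1) * (norm w + 1)" unfolding d_def using n by (intro mult_right_mono) auto
    also have "\<dots> = d0" using n by simp
    finally show "d * norm w \<le> d0" .
  qed (simp add: d_def)
  have "\<bar>F (x + t *\<^sub>R w) - F x - t * FD F x w\<bar> \<le> e * \<bar>t\<bar>" if t: "\<bar>t\<bar> < d" for t x
  proof (cases "norm x \<le> B + norm w")
    case True
    have s: "dist (FD F (x + s *\<^sub>R w) w) (FD F x w) < e" if "\<bar>s\<bar> \<le> \<bar>t\<bar>" for s
    proof (rule d0(2))
      have "\<bar>s\<bar> * norm w \<le> 1 * norm w" using that t d(2) by (intro mult_right_mono) auto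
      then show "x + s *\<^sub>R w \<in> cball 0 C" "x \<in> cball 0 C"
        using True norm_triangle_ineq[of x "s *\<^sub>R w"] norm_ge_zero[of w] by (auto simp: C_def simp del: norm_ge_zero)
      have "\<bar>s\<bar> * norm w < d0 \<or> norm w = 0"
        using that t d(3) by (metis le_less_trans less_le_trans mult_strict_right_mono norm_ge_zero order_le_less)
      then show "dist (x + s *\<^sub>R w) x < d0" using d0(1) by (auto simp: dist_norm)
    qed
    have "norm (F (x + t *\<^sub>R w) - F (x + 0 *\<^sub>R w) - (t - 0) *\<^sub>R FD F (x + 0 *\<^sub>R w) w) \<le> norm (t - 0) * e"
    proof (rule vector_differentiable_bound_linearization[where S="{s. \<bar>s\<bar> \<le> \<bar>t\<bar>}" and f="\<lambda>s. F (x + s *\<^sub>R w)" and ?x0.0=0 and a=0 and b=t])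
      show "((\<lambda>s. F (x + s *\<^sub>R w)) has_vector_derivative FD F (x + s *\<^sub>R w) w) (at s within {s. \<bar>s\<bar> \<le> \<bar>t\<bar>})" for s
        using has_real_derivative_along_line[OF dF, where y=x and t=s and u=w]
        by (auto simp: has_real_derivative_iff_has_vector_derivative intro: has_vector_derivative_at_within)
      show "closed_segment 0 t \<subseteq> {s. \<bar>s\<bar> \<le> \<bar>t\<bar>}" by (auto simp: closed_segment_eq_real_ivl)
      show "norm (FD F (x + s *\<^sub>R w) w - FD F (x + 0 *\<^sub>R w) w) \<le> e" if "s \<in> {s. \<bar>s\<bar> \<le> \<bar>t\<bar>}" for s
        using s[of s] that by (simp add: dist_norm)
    qed simp
    then show ?thesis by (simp add: mult.commute)
  next
    case False
    have n: "x + s *\<^sub>R w \<notin> K" if "\<bar>s\<bar> < d" for s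
    proof
      assume "x + s *\<^sub>R w \<in> K"
      then have "norm (x + s *\<^sub>R w) \<le> B" by (rule B)
      moreover have "norm x \<le> norm (x + s *\<^sub>R w) + \<bar>s\<bar> * norm w"
        using norm_triangle_ineq4[of "x + s *\<^sub>R w" "s *\<^sub>R w"] by simp
      moreover have "\<bar>s\<bar> * norm w \<le> 1 * norm w" using that d(2) by (intro mult_right_mono) auto
      ultimately show False using False by simp
    qed
    have "FD F x = (\<lambda>_. 0)" using FD_zero_off_compact[OF K] n[of 0] d(1) by simp
    then show ?thesis using K(2)[OF n[OF t]] K(2)[OF n[of 0]] d(1) e by simp
  qed
  then show thesis using that d(1) by blast
qed

lemma lborel_translate:
  fixes F :: "'e::euclidean_space \<Rightarrow> real"
  assumes "integrable lborel F"
  shows "integrable lborel (\<lambda>x. F (x + v))" "(\<integral>x. F (x + v) \<partial>lborel) = (\<integral>x. F x \<partial>lborel)"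
proof -
  have "(\<lambda>x. x + v) = (+) v" by (auto simp: add.commute)
  then have d: "distr lborel borel (\<lambda>x. x + v) = lborel" using lborel_distr_plus[of v] by simp
  have bm: "F \<in> borel_measurable borel" using borel_measurable_integrable[OF assms] by simp
  show "integrable lborel (\<lambda>x. F (x + v))"
    using assms integrable_distr_eq[of "\<lambda>x. x + v" lborel borel F] bm d by simp
  show "(\<integral>x. F (x + v) \<partial>lborel) = (\<integral>x. F x \<partial>lborel)"
    using integral_distr[of "\<lambda>x. x + v" lborel borel F] bm d by simp
qed

text \<open>By translation invariance the integral of F(x + t w) - F(x) vanishes. The linearisation
  error is at most e t on a ball of fixed volume m, so the integral of the derivative is at most e m
  in absolute value, for every e.\<close>

lemma integral_derivative_compact_support:
  fixes F :: "'e::euclidean_space \<Rightarrow> real"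
  assumes F: "Ck_on (Suc 0) F UNIV" and K: "compact K" "\<And>x. x \<notin> K \<Longrightarrow> F x = 0"
  shows "integrable lborel (\<lambda>x. FD F x w)" "(\<integral>x. FD F x w \<partial>lborel) = 0"
proof -
  have c: "continuous_on UNIV (\<lambda>x. FD F x w)" "continuous_on UNIV F"
    using Ck_on_FD[OF F] Ck_on_SucD[OF F] by auto
  have FD0: "FD F x w = 0" if "x \<notin> K" for x
    using FD_zero_off_compact[OF K that] by simp
  show i: "integrable lborel (\<lambda>x. FD F x w)"
    by (rule integrable_compact_support[OF K(1) continuous_on_subset[OF c(1)]]) (auto intro: FD0)
  have iF: "integrable lborel F"
    by (rule integrable_compact_support[OF K(1) continuous_on_subset[OF c(2)]]) (auto intro: K(2))
  obtain B where B: "\<And>x. x \<in> K \<Longrightarrow> norm x \<le> B" "B > 0"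
    using compact_imp_bounded[OF K(1)] unfolding bounded_pos by auto
  \<comment> \<open>Contains every \<open>x\<close> for which the segment from x to x + w meets
    \<open>K\<close>.\<close>
  define C where "C = cball (0::'e) (B + norm w)"
  have iC: "integrable lborel (\<lambda>x. indicator C x :: real)"
    unfolding C_def by (rule integrable_real_indicator[OF _ emeasure_lborel_cball_finite]) simp
  define m where "m = measure lborel C"
  note trans = lborel_translate[OF iF]
  have "\<bar>\<integral>x. FD F x w \<partial>lborel\<bar> \<le> e * m" if e: "e > 0" for e
  proof -
    obtain d where d: "d > 0" "\<And>t x. \<bar>t\<bar> < d \<Longrightarrow> \<bar>F (x + t *\<^sub>R w) - F x - t * FD F x w\<bar> \<le> e * \<bar>t\<bar>"
      using uniform_difference_quotient[OF F K e] by blast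
    define t where "t = min 1 (d / 2)"
    have t: "0 < t" "t \<le> 1" "t < d" using d(1) by (auto simp: t_def)
    have "t * (\<integral>x. FD F x w \<partial>lborel) = - (\<integral>x. F (x + t *\<^sub>R w) - F x - t * FD F x w \<partial>lborel)"
      using trans[of "t *\<^sub>R w"] iF i by simp
    also have "\<bar>\<dots>\<bar> \<le> (\<integral>x. e * t * indicator C x \<partial>lborel)"
      unfolding abs_minus_cancel
    proof (rule integral_abs_bound_integral)
      show "integrable lborel (\<lambda>x. F (x + t *\<^sub>R w) - F x - t * FD F x w)" using trans[of "t *\<^sub>R w"] iF i by auto
      show "integrable lborel (\<lambda>x. e * t * indicator C x)" using iC by auto
      fix x
      show "\<bar>F (x + t *\<^sub>R w) - F x - t * FD F x w\<bar> \<le> e * t * indicator C x"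
      proof (cases "x \<in> C")
        case False
        then have x: "norm x > B + norm w" by (simp add: C_def)
        have n: "x + s *\<^sub>R w \<notin> K" if "0 \<le> s" "s \<le> 1" for s
        proof
          assume "x + s *\<^sub>R w \<in> K"
          then have "norm (x + s *\<^sub>R w) \<le> B" by (rule B)
          moreover have "norm x \<le> norm (x + s *\<^sub>R w) + s * norm w"
            using norm_triangle_ineq4[of "x + s *\<^sub>R w" "s *\<^sub>R w"] that by simp
          moreover have "s * norm w \<le> 1 * norm w" using that by (intro mult_right_mono) auto
          ultimately show False using x by simp
        qed
        show ?thesis using K(2)[OF n[of t]] K(2)[OF n[of 0]] FD0[OF n[of 0]] t False by simp
      qed (use d(2)[of t x] t in auto)
    qed
    also have "\<dots> = e * t * m" by (simp add: m_def C_def)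
    finally have "t * \<bar>\<integral>x. FD F x w \<partial>lborel\<bar> \<le> t * (e * m)" using t by (simp add: abs_mult mult_ac)
    then show ?thesis using t by simp
  qed
  note b = this
  show "(\<integral>x. FD F x w \<partial>lborel) = 0"
  proof (rule ccontr)
    assume n: "(\<integral>x. FD F x w \<partial>lborel) \<noteq> 0"
    have m: "m \<ge> 0" by (simp add: m_def)
    define e where "e = \<bar>\<integral>x. FD F x w \<partial>lborel\<bar> / (2 * (m + 1))"
    have e: "e > 0" using n m by (simp add: e_def)
    have "e * m \<le> e * (m + 1)" using e by simp
    also have "\<dots> = \<bar>\<integral>x. FD F x w \<partial>lborel\<bar> / 2" using m by (simp add: e_def field_simps)
    finally show False using b[OF e] n by simp
  qed
qed

text \<open>The product of \<open>A\<close> and \<psi>, extended by zero, is of class C^1 on the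
  whole space because \<open>U\<close> and the complement of \<open>K\<close> cover it; the integral
  of its derivative vanishes.\<close>

lemma integral_by_parts:
  fixes A \<psi> :: "'e::euclidean_space \<Rightarrow> real"
  assumes U: "open U" "Ck_on (Suc 0) A U" and \<psi>: "Ck_on (Suc 0) \<psi> UNIV"
    and K: "compact K" "K \<subseteq> U" "\<And>x. x \<notin> K \<Longrightarrow> \<psi> x = 0"
  shows "integrable lborel (\<lambda>x. if x \<in> U then FD A x w * \<psi> x + A x * FD \<psi> x w else 0)" (is "integrable _ ?f")
    and "(\<integral>x. (if x \<in> U then FD A x w * \<psi> x + A x * FD \<psi> x w else 0) \<partial>lborel) = 0"
proof -
  define F where "F x = (if x \<in> U then A x * \<psi> x else 0)" for x
  have 1: "Ck_on (Suc 0) F U"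
    using Ck_on_mult[OF U Ck_on_subset[OF \<psi>]]
    by (subst Ck_on_cong[OF U(1), of _ "\<lambda>x. A x * \<psi> x"]) (auto simp: F_def simp del: Ck_on.simps)
  have oK: "open (- K)" using open_Compl[OF compact_imp_closed[OF K(1)]] .
  have 2: "Ck_on (Suc 0) F (- K)"
    using Ck_on_const[OF oK, of "Suc 0" 0] K(3) by (subst Ck_on_cong[OF oK, of _ "\<lambda>x. 0"]) (auto simp: F_def simp del: Ck_on.simps)
  have F: "Ck_on (Suc 0) F UNIV"
    using 1 2 U(1) oK K(2) by (intro Ck_on_local) blast
  have F0: "F x = 0" if "x \<notin> K" for x using K(3)[OF that] by (simp add: F_def)
  have eq: "FD F x w = ?f x" for x
  proof (cases "x \<in> U")
    case True
    have "FD F x = FD (\<lambda>x. A x * \<psi> x) x" by (rule FD_cong[OF U(1) True]) (simp add: F_def)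
    also have "\<dots> = (\<lambda>h. A x * FD \<psi> x h + FD A x h * \<psi> x)"
      by (intro FD_eq has_derivative_mult Ck_on_has_derivative[OF U(2,1) True] Ck_on_has_derivative[OF \<psi>]) auto
    finally show ?thesis using True by simp
  next
    case False
    then have "FD F x = FD (\<lambda>_. 0) x" using K(2) F0 by (intro FD_cong[OF oK]) auto
    then show ?thesis using False by simp
  qed
  show "integrable lborel ?f" "(\<integral>x. ?f x \<partial>lborel) = 0"
    using integral_derivative_compact_support[OF F K(1) F0, of w] unfolding eq by auto
qed

section \<open>A test function of class C^2\<close>

lemma has_real_derivative_max_power:
  "((\<lambda>t::real. max 0 t ^ Suc (Suc n)) has_real_derivative real (Suc (Suc n)) * max 0 t ^ Suc n) (at t)"
proof (cases t "0::real" rule: linorder_cases)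
  case less
  have "((\<lambda>t::real. 0) has_real_derivative 0) (at t)" by simp
  then have "((\<lambda>t::real. max 0 t ^ Suc (Suc n)) has_real_derivative 0) (at t)"
    by (rule has_field_derivative_transform_within_open[of _ _ _ "{..<0}"]) (use less in auto)
  then show ?thesis using less by simp
next
  case greater
  have "((\<lambda>t::real. t ^ Suc (Suc n)) has_real_derivative real (Suc (Suc n)) * t ^ Suc n) (at t)"
    using DERIV_pow[of "Suc (Suc n)" t] by simp
  then have "((\<lambda>t::real. max 0 t ^ Suc (Suc n)) has_real_derivative real (Suc (Suc n)) * t ^ Suc n) (at t)"
    by (rule has_field_derivative_transform_within_open[of _ _ _ "{0<..}"]) (use greater in auto)
  then show ?thesis using greater by simp
next
  case equal
  have "((\<lambda>h::real. max 0 h ^ Suc n) \<longlongrightarrow> max 0 0 ^ Suc n) (at 0)"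
    by (intro tendsto_intros)
  moreover have "\<forall>\<^sub>F h::real in at 0. max 0 h ^ Suc n = (max 0 (0 + h) ^ Suc (Suc n) - max 0 0 ^ Suc (Suc n)) / h"
    by (auto simp: eventually_at_filter max_def intro!: always_eventually)
  ultimately have "((\<lambda>h::real. (max 0 (0 + h) ^ Suc (Suc n) - max 0 0 ^ Suc (Suc n)) / h) \<longlongrightarrow> 0) (at 0)"
    using Lim_transform_eventually by fastforce
  then show ?thesis using equal by (simp add: DERIV_def)
qed

text \<open>The third is the lowest power that makes the truncation of class C^2, as the weak
  Bianchi identity requires of its test functions.\<close>

definition bump :: "real \<Rightarrow> 'e::euclidean_space \<Rightarrow> real" where
  "bump h x = max 0 (h\<^sup>2 - x \<bullet> x) ^ 3"

lemma C2_bump: "Ck_on (Suc (Suc 0)) (\<lambda>x. bump h (x - y)) UNIV"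
proof -
  have c: "continuous_on UNIV (\<lambda>t::real. max 0 t)" by (intro continuous_intros)
  have 1: "Ck_on (Suc 0) (\<lambda>t::real. max 0 t ^ 2) UNIV"
  proof (rule Ck_on_SucI)
    show "((\<lambda>t::real. max 0 t ^ 2) has_derivative (*) (2 * max 0 t)) (at t)" for t
      using has_real_derivative_max_power[of 0 t] by (simp add: has_field_derivative_def numeral_2_eq_2)
  qed (auto intro!: continuous_intros)
  have "Ck_on (Suc (Suc 0)) (\<lambda>t::real. max 0 t ^ 3) UNIV"
  proof (rule Ck_on_SucI)
    show "((\<lambda>t::real. max 0 t ^ 3) has_derivative (*) (3 * max 0 t ^ 2)) (at t)" for t
      using has_real_derivative_max_power[of 1 t] by (simp add: has_field_derivative_def numeral_3_eq_3 numeral_2_eq_2)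
    show "Ck_on (Suc 0) (\<lambda>t::real. 3 * max 0 t ^ 2 * v) UNIV" for v
      by (intro Ck_on_mult Ck_on_const 1) auto
  qed auto
  from Ck_on_compose[OF _ _ this, of UNIV "\<lambda>x. h\<^sup>2 - (x - y) \<bullet> (x - y)"]
  show ?thesis unfolding bump_def
    by (simp add: Ck_on_diff Ck_on_inner Ck_on_const Ck_on_id del: Ck_on.simps(2))
qed

lemma bump_props:
  shows "bump h x \<ge> 0" "norm x \<ge> h \<Longrightarrow> h \<ge> 0 \<Longrightarrow> bump h x = 0"
    "norm x \<le> h / 2 \<Longrightarrow> h > 0 \<Longrightarrow> bump h x \<ge> (h\<^sup>2 / 2) ^ 3"
proof -
  show "bump h x \<ge> 0" by (simp add: bump_def)
  show "bump h x = 0" if "norm x \<ge> h" "h \<ge> 0"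
    using power_mono[OF that, of 2] by (simp add: bump_def dot_square_norm)
  show "bump h x \<ge> (h\<^sup>2 / 2) ^ 3" if "norm x \<le> h / 2" "h > 0"
  proof -
    have "x \<bullet> x \<le> h\<^sup>2 / 4"
      using power_mono[OF that(1), of 2] by (simp add: dot_square_norm power_divide)
    then have "h\<^sup>2 / 2 \<le> max 0 (h\<^sup>2 - x \<bullet> x)" using zero_le_power2[of h] by linarith
    then show ?thesis unfolding bump_def by (intro power_mono) auto
  qed
qed

section \<open>The weak Bianchi identity and Schur's lemma\<close>

context local_metric
begin

text \<open>The second Bianchi identity without derivatives of the curvature. Let \<open>z\<close> be the field with
  \<open>g(z,y) = y \<bullet> v\<close>, and \<open>N = \<nabla>z\<close>. Then \<open>R z\<close> is the exterior derivative of \<open>N\<close> plus a term \<open>Q\<close> of class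
  \<open>C\<^sup>1\<close> whose cyclic derivative vanishes, so that \<open>k d\<phi>\<close> is a sum of integrable total derivatives.\<close>

lemma schur_weak:
  assumes k: "\<And>x. x \<in> U \<Longrightarrow> curv_const (k x) x"
    and b: "u \<in> Basis" "v \<in> Basis" "w \<in> Basis" "u \<noteq> v" "v \<noteq> w" "w \<noteq> u"
    and \<phi>: "Ck_on (Suc (Suc 0)) \<phi> UNIV"
    and K: "compact K" "K \<subseteq> U" "\<And>x. x \<notin> K \<Longrightarrow> \<phi> x = 0"
  shows "(\<integral>x. (if x \<in> U then k x * FD \<phi> x w else 0) \<partial>lborel) = 0"
proof -
  \<comment> \<open>The gradient of a coordinate function. Its pairing with constant fields is
    constant, so that the components of its covariant derivative are given by \<Gamma>
    alone.\<close>
  define z where "z x = (SOME y. \<forall>a. g x y a = a \<bullet> v)" for x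
  have z: "g x (z x) y = y \<bullet> v" if x: "x \<in> U" for x y
  proof -
    have "linear (\<lambda>a. a \<bullet> v)" by (intro linearI) (auto simp: inner_add_left)
    then have "\<exists>y. \<forall>a. g x y a = a \<bullet> v" using posdef_riesz[OF posdef_g[OF x]] by blast
    then show ?thesis unfolding z_def by (rule someI2_ex) simp
  qed
  have z2: "Ck_on (Suc (Suc 0)) z U"
    by (rule Ck_on_linear_equation[OF open_U posdef_g g1 g2 Ck_on_const[OF open_U] z])
  have dz: "x \<in> U \<Longrightarrow> (z has_derivative FD z x) (at x)" for x
    using Ck_on_has_derivative[OF z2 open_U] .
  have ddz: "x \<in> U \<Longrightarrow> ((\<lambda>x. FD z x j) has_derivative FD (\<lambda>x. FD z x j) x) (at x)" for x j
    using Ck_on_has_derivative[OF Ck_on_FD[OF z2] open_U] .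
  define N where "N j x = FD z x j + \<Gamma> x j (z x)" for j x
  have gN: "g x (N j x) y = - (\<Gamma> x j y \<bullet> v)" if x: "x \<in> U" for j x y
  proof -
    have d1: "((\<lambda>x. g x (z x) y) has_derivative (\<lambda>h. g x (FD z x h + \<Gamma> x h (z x)) y + g x (z x) (0 + \<Gamma> x h y))) (at x)"
      by (rule has_derivative_g[OF x has_derivative_ident dz[OF x] has_derivative_const])
    have d2: "((\<lambda>x. g x (z x) y) has_derivative (\<lambda>h. 0)) (at x)"
      by (rule has_derivative_transform_within_open[OF has_derivative_const open_U x]) (simp add: z)
    have "g x (FD z x j + \<Gamma> x j (z x)) y + g x (z x) (0 + \<Gamma> x j y) = 0"
      by (rule has_derivative_unique[OF d1 d2, THEN fun_cong])
    then show ?thesis by (simp add: N_def z[OF x])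
  qed
  have CN: "Ck_on (Suc 0) (N j) U" for j
    unfolding N_def
    by (intro Ck_on_add open_U Ck_on_FD[OF z2] Ck_on_bilinear_family[OF open_U open_U \<Gamma>_bil C1_\<Gamma> _
          Ck_on_id[OF open_U] Ck_on_const[OF open_U] Ck_on_SucD[OF z2]]) auto
  have dN: "x \<in> U \<Longrightarrow> (N j has_derivative FD (N j) x) (at x)" for x j
    using Ck_on_has_derivative[OF CN open_U] .
  have FDN: "FD (N j) x i = FD (\<lambda>y. FD z y j) x i + (FD (\<lambda>y. \<Gamma> y j (z x)) x i + \<Gamma> x j (FD z x i))"
    if x: "x \<in> U" for i j x
  proof -
    have "(N j has_derivative (\<lambda>h. FD (\<lambda>y. FD z y j) x h +
        (FD (\<lambda>y. \<Gamma> y j (z x)) x h + \<Gamma> x 0 (z x) + \<Gamma> x j (FD z x h)))) (at x)"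
      unfolding N_def[abs_def]
      by (rule has_derivative_add[OF ddz[OF x] has_derivative_\<Gamma>[OF x has_derivative_ident has_derivative_const dz[OF x]]])
    then show ?thesis by (simp add: FD_eq \<Gamma>_lin[OF x])
  qed
  \<comment> \<open>The second derivatives of \<open>z\<close> commute and drop out, leaving the
    curvature.\<close>
  have dNR: "FD (N j) x i - FD (N i) x j = Rm x i j (z x) - \<Gamma> x i (N j x) + \<Gamma> x j (N i x)"
    if x: "x \<in> U" for i j x
    unfolding FDN[OF x] curv_def N_def Ck_on_symmetric[OF open_U z2 x, of i j]
    by (simp add: \<Gamma>_lin[OF x])
  define Q where "Q i j x = \<Gamma> x i (N j x) - \<Gamma> x j (N i x)" for i j x
  have CQ: "Ck_on (Suc 0) (Q i j) U" for i j
    unfolding Q_def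
    by (intro Ck_on_diff open_U Ck_on_bilinear_family[OF open_U open_U \<Gamma>_bil C1_\<Gamma> _
          Ck_on_id[OF open_U] Ck_on_const[OF open_U] CN]) auto
  have FDQ: "FD (Q i j) x h = FD (\<lambda>y. \<Gamma> y i (N j x)) x h + \<Gamma> x i (FD (N j) x h)
      - (FD (\<lambda>y. \<Gamma> y j (N i x)) x h + \<Gamma> x j (FD (N i) x h))" if x: "x \<in> U" for i j h x
  proof -
    have "(Q i j has_derivative (\<lambda>h. (FD (\<lambda>y. \<Gamma> y i (N j x)) x h + \<Gamma> x 0 (N j x) + \<Gamma> x i (FD (N j) x h))
      - (FD (\<lambda>y. \<Gamma> y j (N i x)) x h + \<Gamma> x 0 (N i x) + \<Gamma> x j (FD (N i) x h)))) (at x)"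
      unfolding Q_def[abs_def]
      by (rule has_derivative_diff[OF has_derivative_\<Gamma>[OF x has_derivative_ident has_derivative_const dN[OF x]]
          has_derivative_\<Gamma>[OF x has_derivative_ident has_derivative_const dN[OF x]]])
    then show ?thesis by (simp add: FD_eq \<Gamma>_lin[OF x])
  qed
  have Rz: "Rm x i j (z x) = k x *\<^sub>R ((j \<bullet> v) *\<^sub>R i - (i \<bullet> v) *\<^sub>R j)" if x: "x \<in> U" for i j x
    using k[OF x] g_sym[OF x, of _ "z x"] unfolding curv_const_def by (simp add: z[OF x])
  have RN: "Rm x i j (N l x) = k x *\<^sub>R ((\<Gamma> x l i \<bullet> v) *\<^sub>R j - (\<Gamma> x l j \<bullet> v) *\<^sub>R i)" if x: "x \<in> U" for i j l x
    using k[OF x] g_sym[OF x, of _ "N l x"] unfolding curv_const_def by (simp add: gN[OF x])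
  \<comment> \<open>Derivatives of \<Gamma> and of \<open>N\<close> are exchanged at the price of
    curvature terms; once the constant-curvature form of these terms is inserted, the cyclic sum
    collapses. No derivative of \<open>k\<close> occurs.\<close>
  have cyc: "FD (Q u v) x w + FD (Q v w) x u + FD (Q w u) x v = 0" if x: "x \<in> U" for x
  proof -
    have e1: "FD (\<lambda>y. \<Gamma> y j n) x i = Rm x i j n - \<Gamma> x i (\<Gamma> x j n) + \<Gamma> x j (\<Gamma> x i n) + FD (\<lambda>y. \<Gamma> y i n) x j" for i j n
      by (simp add: curv_def)
    have e2: "FD (N j) x i = FD (N i) x j + (Rm x i j (z x) - \<Gamma> x i (N j x) + \<Gamma> x j (N i x))" for i j
      using dNR[OF x, of j i] by (simp add: algebra_simps)
    show ?thesis
      unfolding FDQ[OF x] e1[where i=w and j=u] e1[where i=u and j=v] e1[where i=v and j=w]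
        e2[of v w] e2[of w u] e2[of u v] RN[OF x] Rz[OF x] \<Gamma>_sym[OF x, of w u] \<Gamma>_sym[OF x, of w v] \<Gamma>_sym[OF x, of v u]
      by (simp add: \<Gamma>_lin[OF x] algebra_simps \<Gamma>_sym[OF x, of w u] \<Gamma>_sym[OF x, of w v] \<Gamma>_sym[OF x, of v u])
  qed
  \<comment> \<open>The derivative of A \<psi> in direction \<open>d\<close>, extended by zero; its
    integral vanishes.\<close>
  define T where "T A \<psi> d x = (if x \<in> U then FD A x d * \<psi> x + A x * FD \<psi> x d else 0)"
    for A \<psi> :: "'e \<Rightarrow> real" and d x
  define P where "P j x = N j x \<bullet> u" for j x
  define q where "q i j x = Q i j x \<bullet> u" for i j x
  have CP: "Ck_on (Suc 0) (P j) U" and Cq: "Ck_on (Suc 0) (q i j) U" for i j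
    unfolding P_def q_def by (intro Ck_on_inner open_U CN CQ Ck_on_const)+
  have FDP: "FD (P j) x i = FD (N j) x i \<bullet> u" if "x \<in> U" for i j x
    unfolding P_def[abs_def] by (rule FD_inner_left[OF dN[OF that]])
  have FDq: "FD (q i j) x h = FD (Q i j) x h \<bullet> u" if "x \<in> U" for i j x h
    unfolding q_def[abs_def] by (rule FD_inner_left[OF Ck_on_has_derivative[OF CQ open_U that]])
  define \<phi>' where "\<phi>' d x = FD \<phi> x d" for d x
  have C\<phi>': "Ck_on (Suc 0) (\<phi>' d) UNIV" for d unfolding \<phi>'_def using Ck_on_FD[OF \<phi>] .
  have \<phi>'0: "\<phi>' d x = 0" if "x \<notin> K" for d x
    using FD_zero_off_compact[OF K(1,3) that] by (simp add: \<phi>'_def)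
  have \<phi>'': "FD (\<phi>' i) x j = FD (\<phi>' j) x i" for i j x
    unfolding \<phi>'_def[abs_def] by (rule Ck_on_symmetric[OF open_UNIV \<phi>]) simp
  have TP: "integrable lborel (T (P j) (\<phi>' i) d)" "integral\<^sup>L lborel (T (P j) (\<phi>' i) d) = 0" for i j d
    unfolding T_def[abs_def] using integral_by_parts[OF open_U CP C\<phi>' K(1,2) \<phi>'0] by blast+
  have Tq: "integrable lborel (T (q i j) \<phi> d)" "integral\<^sup>L lborel (T (q i j) \<phi> d) = 0" for i j d
    unfolding T_def[abs_def] using integral_by_parts[OF open_U Cq Ck_on_SucD[OF \<phi>] K] by blast+
  \<comment> \<open>Only the plane of \<open>u\<close> and \<open>v\<close> contributes
    \<open>k\<close>; the other two cyclic terms are zero and are added to complete the total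
    derivatives. The terms with second derivatives of \<phi> cancel by symmetry.\<close>
  have eq: "(if x \<in> U then k x * FD \<phi> x w else 0) =
      (T (P v) (\<phi>' w) u x - T (P u) (\<phi>' w) v x + T (q u v) \<phi> w x)
    + (T (P w) (\<phi>' u) v x - T (P v) (\<phi>' u) w x + T (q v w) \<phi> u x)
    + (T (P u) (\<phi>' v) w x - T (P w) (\<phi>' v) u x + T (q w u) \<phi> v x)" for x
  proof (cases "x \<in> U")
    case True
    note x = True
    have R: "Rm x i j (z x) \<bullet> u = FD (P j) x i - FD (P i) x j + q i j x" for i j
      using arg_cong[OF dNR[OF x, of j i], of "\<lambda>y. y \<bullet> u"]
      by (simp add: FDP[OF x] q_def Q_def inner_simps)
    have n: "u \<bullet> v = 0" "v \<bullet> v = 1" "w \<bullet> v = 0" "u \<bullet> u = 1" "v \<bullet> u = 0" "w \<bullet> u = 0"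
      using b by (auto simp: inner_Basis)
    have 1: "k x = FD (P v) x u - FD (P u) x v + q u v x"
      unfolding R[symmetric] Rz[OF x] by (simp add: inner_simps n)
    have 2: "0 = FD (P w) x v - FD (P v) x w + q v w x"
      unfolding R[symmetric] Rz[OF x] by (simp add: inner_simps n)
    have 3: "0 = FD (P u) x w - FD (P w) x u + q w u x"
      unfolding R[symmetric] Rz[OF x] by (simp add: inner_simps n)
    have 4: "FD (q u v) x w + FD (q v w) x u + FD (q w u) x v = 0"
      unfolding FDq[OF x] inner_add_left[symmetric] cyc[OF x] by simp
    have "(FD (q u v) x w + FD (q v w) x u + FD (q w u) x v) * \<phi> x = 0" using 4 by simp
    moreover have "k x * FD \<phi> x w = (FD (P v) x u - FD (P u) x v + q u v x) * \<phi>' w x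
      + (FD (P w) x v - FD (P v) x w + q v w x) * \<phi>' u x + (FD (P u) x w - FD (P w) x u + q w u x) * \<phi>' v x"
      using 1 2 3 by (simp add: \<phi>'_def)
    ultimately show ?thesis
      using x \<phi>''[of w x u] \<phi>''[of w x v] \<phi>''[of u x v]
      by (simp add: T_def \<phi>'_def[symmetric] algebra_simps)
  qed (simp add: T_def)
  show ?thesis unfolding eq by (simp add: TP Tq)
qed

text \<open>In dimension at least 3 every basis vector belongs to a triple of distinct basis
  vectors, and other directions follow by linearity of the derivative. Continuity of
  \<open>k\<close> makes the summands integrable.\<close>

lemma schur_weak_all:
  assumes dim: "DIM('e) \<ge> 3" and k: "\<And>x. x \<in> U \<Longrightarrow> curv_const (k x) x"
    and \<phi>: "Ck_on (Suc (Suc 0)) \<phi> UNIV"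
    and K: "compact K" "K \<subseteq> U" "\<And>x. x \<notin> K \<Longrightarrow> \<phi> x = 0" and ck: "continuous_on U k"
  shows "(\<integral>x. (if x \<in> U then k x * FD \<phi> x w else 0) \<partial>lborel) = 0"
proof -
  have "\<exists>u v. u \<in> Basis \<and> v \<in> Basis \<and> u \<noteq> v \<and> v \<noteq> b \<and> b \<noteq> u" for b :: 'e
  proof -
    have "card ((Basis :: 'e set) - {b}) \<ge> 2"
      using dim by (cases "b \<in> Basis") (auto simp: card_Diff_singleton)
    then obtain u v where "u \<in> Basis - {b}" "v \<in> Basis - {b}" "u \<noteq> v"
      by (meson card_2_iff' ex_card subset_iff)
    then show ?thesis by blast
  qed
  then have z: "(\<integral>x. (if x \<in> U then k x * FD \<phi> x b else 0) \<partial>lborel) = 0" if "b \<in> Basis" for b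
    using schur_weak[OF k _ _ that _ _ _ \<phi> K] by blast
  have d: "(\<phi> has_derivative FD \<phi> x) (at x)" for x using Ck_on_has_derivative[OF \<phi>] by simp
  have FD0: "FD \<phi> x = (\<lambda>_. 0)" if "x \<notin> K" for x
    by (rule FD_zero_off_compact[OF K(1,3) that])
  have i: "integrable lborel (\<lambda>x. if x \<in> U then k x * FD \<phi> x b else 0)" for b
  proof (rule integrable_compact_support[OF K(1)])
    have "continuous_on K (\<lambda>x. k x * FD \<phi> x b)"
      using continuous_on_subset[OF ck K(2)] Ck_on_mono[OF Ck_on_FD[OF \<phi>], of 0 b]
      by (intro continuous_on_mult) (auto elim: continuous_on_subset)
    then show "continuous_on K (\<lambda>x. if x \<in> U then k x * FD \<phi> x b else 0)"
      by (rule continuous_on_eq) (use K(2) in auto)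
  qed (simp add: FD0)
  have "(if x \<in> U then k x * FD \<phi> x w else 0) = (\<Sum>b\<in>Basis. (w \<bullet> b) * (if x \<in> U then k x * FD \<phi> x b else 0))" for x
    using linear_expand[OF has_derivative_linear[OF d], of x w]
    by (simp add: sum_distrib_left mult_ac)
  then have "(\<integral>x. (if x \<in> U then k x * FD \<phi> x w else 0) \<partial>lborel) =
      (\<Sum>b\<in>Basis. (w \<bullet> b) * (\<integral>x. (if x \<in> U then k x * FD \<phi> x b else 0) \<partial>lborel))"
    using i by (simp add: Bochner_Integration.integral_sum)
  then show ?thesis using z by simp
qed

text \<open>The integral of \<open>k\<close> against a bump that slides from \<open>x0\<close> to
  \<open>y\<close> has derivative zero by the weak identity, so it is the same at both ends. For a
  narrow bump these two integrals are close to k(x0) and k(y) times its mass.\<close>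

theorem schur:
  assumes dim: "DIM('e) \<ge> 3" and k: "\<And>x. x \<in> U \<Longrightarrow> curv_const (k x) x"
    and ck: "continuous_on U k" and r: "ball x0 r \<subseteq> U" and y: "y \<in> ball x0 r"
  shows "k y = k x0"
proof (rule ccontr)
  assume n: "k y \<noteq> k x0"
  define w where "w = y - x0"
  \<comment> \<open>Two errors of a third of the difference cannot bridge it.\<close>
  define e where "e = \<bar>k y - k x0\<bar> / 3"
  have e: "e > 0" using n by (simp add: e_def)
  have x0: "x0 \<in> U" "y \<in> U" using r y le_less_trans[OF zero_le_dist, of x0 y r] by auto
  have "isCont k x0" "isCont k y" using ck x0 open_U continuous_on_eq_continuous_at by blast+
  then obtain d1 d2 where d: "d1 > 0" "d2 > 0" "\<And>x. dist x x0 < d1 \<Longrightarrow> \<bar>k x - k x0\<bar> < e"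
    "\<And>x. dist x y < d2 \<Longrightarrow> \<bar>k x - k y\<bar> < e"
    using e unfolding continuous_at_eps_delta dist_real_def by metis
  \<comment> \<open>Narrow enough for both continuity estimates and for the bump to stay in the ball
    along the whole segment.\<close>
  define h where "h = min (min d1 d2) (r - dist x0 y) / 2"
  have h: "h > 0" "h < d1" "h < d2" "dist x0 y + h < r" using d y by (auto simp: h_def min_def field_simps)
  define L where "L s = x0 + s *\<^sub>R w" for s
  define K where "K = cball x0 (norm w + h)"
  have K: "compact K" "K \<subseteq> U"
    using h(4) r by (auto simp: K_def w_def dist_norm norm_minus_commute)
  have bump0: "bump h (x - L s) = 0" if "x \<notin> K" "s \<in> {0..1}" for x s
  proof (rule bump_props(2))
    have "norm (x - x0) > norm w + h" using that by (simp add: K_def dist_norm norm_minus_commute)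
    moreover have "norm (x - x0) \<le> norm (x - L s) + \<bar>s\<bar> * norm w"
      using norm_triangle_ineq[of "x - L s" "s *\<^sub>R w"] by (simp add: L_def)
    moreover have "\<bar>s\<bar> * norm w \<le> 1 * norm w" using that by (intro mult_right_mono) auto
    ultimately show "norm (x - L s) \<ge> h" by simp
  qed (use h in simp)
  define J where "J s = (\<integral>x. (if x \<in> U then k x * bump h (x - L s) else 0) \<partial>lborel)" for s
  have cb: "continuous_on UNIV (\<lambda>x. bump h (x - p))" for p :: 'e
    using Ck_on_mono[OF C2_bump, of 0] by simp
  have ck': "continuous_on K k" using ck K(2) continuous_on_subset by blast
  have iJ: "integrable lborel (\<lambda>x. if x \<in> U then k x * bump h (x - L s) else 0)" if "s \<in> {0..1}" for s
  proof (rule integrable_compact_support[OF K(1)])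
    have "continuous_on K (\<lambda>x. k x * bump h (x - L s))"
      by (intro continuous_on_mult ck' continuous_on_subset[OF cb]) simp
    then show "continuous_on K (\<lambda>x. if x \<in> U then k x * bump h (x - L s) else 0)"
      by (rule continuous_on_eq) (use K(2) in auto)
  qed (use bump0[OF _ that] in simp)
  define m where "m = measure lborel K"
  obtain B where B: "B > 0" "\<And>x. x \<in> K \<Longrightarrow> \<bar>k x\<bar> \<le> B"
    using compact_imp_bounded[OF compact_continuous_image[OF ck' K(1)]] unfolding bounded_pos by auto
  have iK: "integrable lborel (\<lambda>x. indicator K x :: real)"
    unfolding K_def by (rule integrable_real_indicator[OF _ emeasure_lborel_cball_finite]) simp
  have dJ: "(J has_real_derivative 0) (at s within {0..1})" if s: "s \<in> {0..1}" for s
  proof -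
    have "\<exists>\<delta>>0. \<forall>t\<in>{0..1}. norm (t - s) < \<delta> \<longrightarrow> norm (J t - J s - 0) \<le> \<epsilon> * norm (t - s)" if \<epsilon>: "\<epsilon> > 0" for \<epsilon>
    proof -
      \<comment> \<open>The error is at most B \<eta> \<bar>t - s\<bar> on \<open>K\<close>, hence B
        m \<eta> \<bar>t - s\<bar> after integration.\<close>
      define \<eta> where "\<eta> = \<epsilon> / (B * (m + 1))"
      have m: "m \<ge> 0" by (simp add: m_def)
      have \<eta>: "\<eta> > 0" using \<epsilon> B(1) m by (simp add: \<eta>_def)
      have sup: "bump h (x - 0) = 0" if "x \<notin> cball (0::'e) h" for x
        using that h(1) by (intro bump_props(2)) auto
      obtain \<delta> where \<delta>: "\<delta> > 0" "\<And>t x. \<bar>t\<bar> < \<delta> \<Longrightarrow>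
         \<bar>bump h (x + t *\<^sub>R - w - 0) - bump h (x - 0) - t * FD (\<lambda>x. bump h (x - 0)) x (- w)\<bar> \<le> \<eta> * \<bar>t\<bar>"
        using uniform_difference_quotient[OF Ck_on_SucD[OF C2_bump] compact_cball sup \<eta>] by blast
      have "norm (J t - J s) \<le> \<epsilon> * norm (t - s)" if t: "t \<in> {0..1}" "norm (t - s) < \<delta>" for t
      proof -
        define b where "b x = bump h (x - L s)" for x
        have Cb: "Ck_on (Suc (Suc 0)) b UNIV" unfolding b_def by (rule C2_bump)
        have db: "FD b x v = FD (\<lambda>x. bump h (x - 0)) (x - L s) v" for x v
        proof -
          have 1: "((\<lambda>x. x - L s) has_derivative (\<lambda>v. v)) (at x)"
            by (auto intro!: derivative_eq_intros)
          have 2: "((\<lambda>x. bump h (x - 0)) has_derivative FD (\<lambda>x. bump h (x - 0)) (x - L s)) (at (x - L s))"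
            by (rule Ck_on_has_derivative[OF C2_bump open_UNIV UNIV_I])
          have "(b has_derivative FD (\<lambda>x. bump h (x - 0)) (x - L s)) (at x)"
            using has_derivative_compose[OF 1 2] by (simp add: b_def[abs_def])
          then show ?thesis by (simp add: FD_eq)
        qed
        have z: "(\<integral>x. (if x \<in> U then k x * FD b x (- w) else 0) \<partial>lborel) = 0"
          by (rule schur_weak_all[OF dim k Cb K _ ck]) (use bump0[OF _ s] in \<open>auto simp: b_def\<close>)
        have FD0: "FD b x = (\<lambda>_. 0)" if "x \<notin> K" for x
          by (rule FD_zero_off_compact[OF K(1) _ that]) (simp add: b_def bump0[OF _ s])
        have ib: "integrable lborel (\<lambda>x. if x \<in> U then k x * FD b x (- w) else 0)"
        proof (rule integrable_compact_support[OF K(1)])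
          have "continuous_on K (\<lambda>x. k x * FD b x (- w))"
            using Ck_on_mono[OF Ck_on_FD[OF Cb], of 0 "-w"]
            by (intro continuous_on_mult ck') (auto elim: continuous_on_subset)
          then show "continuous_on K (\<lambda>x. if x \<in> U then k x * FD b x (- w) else 0)"
            by (rule continuous_on_eq) (use K(2) in auto)
        qed (simp add: FD0)
        let ?D = "\<lambda>x. (if x \<in> U then k x * bump h (x - L t) else 0) - (if x \<in> U then k x * bump h (x - L s) else 0)
            - (t - s) * (if x \<in> U then k x * FD b x (- w) else 0)"
        have "\<bar>J t - J s\<bar> = \<bar>\<integral>x. ?D x \<partial>lborel\<bar>"
          unfolding J_def using iJ[OF t(1)] iJ[OF s] ib z by simp
        also have "\<dots> \<le> (\<integral>x. B * (\<eta> * \<bar>t - s\<bar>) * indicator K x \<partial>lborel)"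
        proof (rule integral_abs_bound_integral)
          show "integrable lborel ?D" using iJ[OF t(1)] iJ[OF s] ib by simp
          show "integrable lborel (\<lambda>x. B * (\<eta> * \<bar>t - s\<bar>) * indicator K x)" using iK by simp
          fix x
          show "\<bar>?D x\<bar> \<le> B * (\<eta> * \<bar>t - s\<bar>) * indicator K x"
          proof (cases "x \<in> K")
            case False
            then show ?thesis using bump0[OF False s] bump0[OF False t(1)] FD0[OF False] by simp
          next
            case True
            have e: "x - L s + (t - s) *\<^sub>R - w - 0 = x - L t" by (simp add: L_def algebra_simps)
            have "\<bar>bump h (x - L t) - bump h (x - L s) - (t - s) * FD b x (- w)\<bar> \<le> \<eta> * \<bar>t - s\<bar>"
              using \<delta>(2)[of "t - s" "x - L s"] t(2) unfolding e by (simp add: db)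
            then have "\<bar>k x\<bar> * \<bar>bump h (x - L t) - bump h (x - L s) - (t - s) * FD b x (- w)\<bar> \<le> B * (\<eta> * \<bar>t - s\<bar>)"
              using B(2)[OF True] B(1) \<eta> by (intro mult_mono) auto
            moreover have "?D x = k x * (bump h (x - L t) - bump h (x - L s) - (t - s) * FD b x (- w))"
              using True K(2) by (auto simp: algebra_simps)
            ultimately show ?thesis using True by (simp add: abs_mult)
          qed
        qed
        also have "\<dots> = (B * m) * \<eta> * \<bar>t - s\<bar>" using K(1) by (simp add: m_def)
        also have "\<dots> \<le> \<epsilon> * \<bar>t - s\<bar>"
        proof (intro mult_right_mono)
          have "B * m * \<eta> \<le> B * (m + 1) * \<eta>" using B(1) m \<eta> by simp
          also have "\<dots> = \<epsilon>" using B(1) m by (simp add: \<eta>_def)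
          finally show "B * m * \<eta> \<le> \<epsilon>" .
        qed simp
        finally show ?thesis by simp
      qed
      then show ?thesis using \<delta>(1) by auto
    qed
    then have "(J has_derivative (\<lambda>_. 0)) (at s within {0..1})"
      unfolding has_derivative_within_alt by (auto simp: bounded_linear_zero)
    moreover have "(\<lambda>_::real. 0::real) = (*) 0" by (simp add: fun_eq_iff)
    ultimately show ?thesis by (simp add: has_field_derivative_def)
  qed
  have J: "J 1 = J 0"
  proof -
    obtain c where "\<And>x. x \<in> {0..1} \<Longrightarrow> J x = c"
      by (rule has_vector_derivative_zero_constant[of "{0..1::real}" J])
        (use dJ in \<open>auto simp: has_real_derivative_iff_has_vector_derivative\<close>)
    then show ?thesis by simp
  qed
  define c where "c = (\<integral>x. bump h (x :: 'e) \<partial>lborel)"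
  have ib: "integrable lborel (bump h :: 'e \<Rightarrow> real)"
  proof (rule integrable_compact_support[OF compact_cball[of 0 h]])
    show "continuous_on (cball 0 h) (bump h :: 'e \<Rightarrow> real)"
      using cb[of 0] by (auto elim: continuous_on_subset)
    show "bump h x = 0" if "x \<notin> cball (0::'e) h" for x
      using that h(1) by (intro bump_props(2)) auto
  qed
  have c: "c > 0"
  proof -
    have "0 < (h\<^sup>2 / 2) ^ 3 * measure lborel (cball (0::'e) (h / 2))"
      using h(1) content_cball_pos[of "h / 2" "0::'e"] by (simp add: measure_def)
    also have "\<dots> = (\<integral>x. (h\<^sup>2 / 2) ^ 3 * indicator (cball (0::'e) (h / 2)) x \<partial>lborel)" by simp
    also have "\<dots> \<le> c" unfolding c_def
    proof (rule integral_mono)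
      show "integrable lborel (\<lambda>x. (h\<^sup>2 / 2) ^ 3 * indicator (cball (0::'e) (h / 2)) x)"
        by (intro integrable_mult_right integrable_real_indicator emeasure_lborel_cball_finite) auto
      show "(h\<^sup>2 / 2) ^ 3 * indicator (cball (0::'e) (h / 2)) x \<le> bump h x" for x
        using bump_props(1)[of h x] bump_props(3)[of x h] h(1) by (auto simp: indicator_def)
    qed (rule ib)
    finally show ?thesis .
  qed
  have close: "\<bar>J s - k (L s) * c\<bar> \<le> e * c" if s: "s \<in> {0..1}" and ke: "\<And>x. dist x (L s) < h \<Longrightarrow> \<bar>k x - k (L s)\<bar> < e" for s
  proof -
    have tr: "integrable lborel (\<lambda>x. bump h (x - L s))" "(\<integral>x. bump h (x - L s) \<partial>lborel) = c"
      using lborel_translate[OF ib, of "- L s"] by (simp_all add: c_def)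
    have "J s - k (L s) * c = (\<integral>x. (if x \<in> U then k x * bump h (x - L s) else 0) - k (L s) * bump h (x - L s) \<partial>lborel)"
      unfolding J_def using iJ[OF s] tr by simp
    also have "\<bar>\<dots>\<bar> \<le> (\<integral>x. e * bump h (x - L s) \<partial>lborel)"
    proof (rule integral_abs_bound_integral)
      show "integrable lborel (\<lambda>x. (if x \<in> U then k x * bump h (x - L s) else 0) - k (L s) * bump h (x - L s))"
        using iJ[OF s] tr by simp
      show "integrable lborel (\<lambda>x. e * bump h (x - L s))" using tr by simp
      fix x
      show "\<bar>(if x \<in> U then k x * bump h (x - L s) else 0) - k (L s) * bump h (x - L s)\<bar> \<le> e * bump h (x - L s)"
      proof (cases "dist x (L s) < h")
        case True
        have "x \<in> K" using bump0[OF _ s, of x] bump_props(2) True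
        proof -
          have "norm (L s - x0) \<le> norm w" using s by (simp add: L_def mult_left_le_one_le)
          then show ?thesis using True norm_triangle_ineq[of "x - L s" "L s - x0"] by (simp add: K_def dist_norm norm_minus_commute)
        qed
        then have "x \<in> U" using K(2) by blast
        moreover have "\<bar>k x - k (L s)\<bar> * bump h (x - L s) \<le> e * bump h (x - L s)"
          using ke[OF True] bump_props(1) by (intro mult_right_mono) auto
        ultimately show ?thesis using bump_props(1)[of h "x - L s"] by (simp add: abs_mult flip: left_diff_distrib)
      next
        case False
        then show ?thesis using bump_props(2)[of h "x - L s"] h(1) by (simp add: dist_norm)
      qed
    qed
    also have "\<dots> = e * c" using tr by simp
    finally show ?thesis .
  qed
  have "\<bar>J 0 - k x0 * c\<bar> \<le> e * c" using close[of 0] d(3) h by (simp add: L_def)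
  moreover have "\<bar>J 0 - k y * c\<bar> \<le> e * c" using close[of 1] d(4) h J by (simp add: L_def w_def)
  ultimately have "\<bar>k y * c - k x0 * c\<bar> \<le> 2 * (e * c)" by linarith
  also have "\<bar>k y * c - k x0 * c\<bar> = 3 * (e * c)" using c by (simp add: e_def abs_mult flip: left_diff_distrib)
  finally show False using e c by simp
qed

end

section \<open>The geodesic flow\<close>

text \<open>The minimum of the form on the compact unit sphere is positive; homogeneity extends the
  bound to all vectors.\<close>

lemma posdef_lower_bound:
  fixes g :: "'e::euclidean_space \<Rightarrow> 'e \<Rightarrow> real"
  assumes "posdef g"
  obtains c where "c > 0" "\<And>v. c * (norm v)\<^sup>2 \<le> g v v"
proof -
  note b = posdefD(1)[OF assms]
  have bb: "bounded_bilinear g" using bilinear_conv_bounded_bilinear b by blast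
  have "continuous_on (sphere 0 1) (\<lambda>v. g v v)"
    by (intro bounded_bilinear.continuous_on[OF bb] continuous_on_id)
  moreover have "sphere (0::'e) 1 \<noteq> {}" by simp
  ultimately obtain v0 where v0: "v0 \<in> sphere 0 1" "\<And>v. v \<in> sphere 0 1 \<Longrightarrow> g v0 v0 \<le> g v v"
    using continuous_attains_inf[OF compact_sphere] by blast
  have "g v0 v0 > 0" using v0(1) posdefD(3)[OF assms, of v0] by (cases "v0 = 0") auto
  moreover have "g v0 v0 * (norm v)\<^sup>2 \<le> g v v" for v
  proof (cases "v = 0")
    case True
    then show ?thesis by (simp add: bilinear_lzero[OF b])
  next
    case False
    then have "g v0 v0 \<le> g ((1 / norm v) *\<^sub>R v) ((1 / norm v) *\<^sub>R v)" by (intro v0(2)) simp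
    also have "\<dots> = g v v / (norm v)\<^sup>2"
      by (simp add: bilinear_lmul[OF b] bilinear_rmul[OF b] power2_eq_square)
    finally show ?thesis using False by (simp add: field_simps)
  qed
  ultimately show thesis using that by blast
qed

lemma vanishing_derivative_constant:
  fixes f :: "real \<Rightarrow> real"
  assumes "\<And>t. t \<in> {0..1} \<Longrightarrow> (f has_real_derivative 0) (at t within {0..1})" "t \<in> {0..1}"
  shows "f t = f 0"
proof -
  obtain c where "\<And>x. x \<in> {0..1} \<Longrightarrow> f x = c"
    by (rule has_vector_derivative_zero_constant[of "{0..1::real}" f])
      (use assms in \<open>auto simp: has_real_derivative_iff_has_vector_derivative\<close>)
  then show ?thesis using assms(2) by simp
qed

lemma has_vector_derivative_Pair_iff:
  "((\<lambda>t. (x t, y t)) has_vector_derivative (x', y')) (at s within S) \<longleftrightarrow>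
    (x has_vector_derivative x') (at s within S) \<and> (y has_vector_derivative y') (at s within S)"
    (is "?l \<longleftrightarrow> ?r")
proof
  assume a: ?l
  show ?r
    using bounded_linear.has_vector_derivative[OF bounded_linear_fst a]
      bounded_linear.has_vector_derivative[OF bounded_linear_snd a] by simp
qed (auto simp: has_vector_derivative_def intro: has_derivative_Pair)

context local_metric
begin

definition spray :: "'e \<times> 'e \<Rightarrow> 'e \<times> 'e" where
  "spray z = (snd z, - \<Gamma> (fst z) (snd z) (snd z))"

lemma open_phase: "open (U \<times> (UNIV :: 'e set))"
  using open_U by (simp add: open_Times)

lemma C1_spray: "Ck_on (Suc 0) spray (U \<times> UNIV)"
  unfolding spray_def
  by (intro Ck_on_Pair Ck_on_uminus open_phase Ck_on_bounded_linear[OF bounded_linear_snd]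
      Ck_on_bilinear_family[OF open_phase open_U \<Gamma>_bil C1_\<Gamma> _ Ck_on_bounded_linear[OF bounded_linear_fst]] Ck_on_id) auto

text \<open>The linearised geodesic equation, that is, the Jacobi equation before it is written
  covariantly.\<close>

lemma FD_spray:
  assumes "fst z \<in> U"
  shows "FD spray z w = (snd w, - (FD (\<lambda>x. \<Gamma> x (snd z) (snd z)) (fst z) (fst w) + 2 *\<^sub>R \<Gamma> (fst z) (snd w) (snd z)))"
proof -
  have "(spray has_derivative (\<lambda>h. (snd h, - (FD (\<lambda>x. \<Gamma> x (snd z) (snd z)) (fst z) (fst h)
     + \<Gamma> (fst z) (snd h) (snd z) + \<Gamma> (fst z) (snd z) (snd h))))) (at z)"
    unfolding spray_def[abs_def]
    by (intro has_derivative_Pair has_derivative_snd has_derivative_minus has_derivative_ident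
        has_derivative_\<Gamma>[where q=fst and X=snd and Y=snd] has_derivative_fst assms)
  then show ?thesis
    by (simp add: FD_eq \<Gamma>_sym[OF assms, of "snd z" "snd w"] scaleR_2)
qed

lemma geodesic_unique:
  assumes "\<And>t. t \<in> {0..b} \<Longrightarrow> x t \<in> U" "\<And>t. t \<in> {0..b} \<Longrightarrow> y t \<in> U"
    and "\<And>t. t \<in> {0..b} \<Longrightarrow> (x has_vector_derivative v t) (at t within {0..b})"
      "\<And>t. t \<in> {0..b} \<Longrightarrow> (v has_vector_derivative - \<Gamma> (x t) (v t) (v t)) (at t within {0..b})"
    and "\<And>t. t \<in> {0..b} \<Longrightarrow> (y has_vector_derivative w t) (at t within {0..b})"
      "\<And>t. t \<in> {0..b} \<Longrightarrow> (w has_vector_derivative - \<Gamma> (y t) (w t) (w t)) (at t within {0..b})"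
    and "x 0 = y 0" "v 0 = w 0" "t \<in> {0..b}"
  shows "x t = y t" "v t = w t"
proof -
  have "(\<lambda>t. (x t, v t)) t = (\<lambda>t. (y t, w t)) t"
    by (rule ode_unique[OF open_phase _ _ _ _ _ _ \<open>t \<in> {0..b}\<close>])
      (use assms C1_spray in \<open>auto simp: spray_def has_vector_derivative_Pair_iff\<close>)
  then show "x t = y t" "v t = w t" by auto
qed

end

text \<open>\<open>q a t\<close> is \<open>exp(ta)\<close> for the exponential map at \<open>x0\<close>, \<open>p a t\<close> the velocity of this geodesic, and
  \<open>J a t\<close>, \<open>K a t\<close> are the differentials of \<open>q\<close> and \<open>p\<close> with respect to \<open>a\<close>, so that \<open>J\<close> consists of
  Jacobi fields.\<close>

locale geodesic_flow = local_metric +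
  fixes x0 :: 'a and \<delta> :: real and q p :: "'a \<Rightarrow> real \<Rightarrow> 'a" and J K :: "'a \<Rightarrow> real \<Rightarrow> 'a \<Rightarrow> 'a"
  assumes \<delta>: "\<delta> > 0"
    and qU: "\<And>a t. a \<in> ball 0 \<delta> \<Longrightarrow> t \<in> {0..1} \<Longrightarrow> q a t \<in> U"
    and init: "\<And>a. a \<in> ball 0 \<delta> \<Longrightarrow> q a 0 = x0" "\<And>a. a \<in> ball 0 \<delta> \<Longrightarrow> p a 0 = a"
      "\<And>a w. a \<in> ball 0 \<delta> \<Longrightarrow> J a 0 w = 0" "\<And>a w. a \<in> ball 0 \<delta> \<Longrightarrow> K a 0 w = w"
    and dq: "\<And>a t. a \<in> ball 0 \<delta> \<Longrightarrow> t \<in> {0..1} \<Longrightarrow> (q a has_vector_derivative p a t) (at t within {0..1})"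
    and dp: "\<And>a t. a \<in> ball 0 \<delta> \<Longrightarrow> t \<in> {0..1} \<Longrightarrow>
      (p a has_vector_derivative - chris g (q a t) (p a t) (p a t)) (at t within {0..1})"
    and Dq: "\<And>a t. a \<in> ball 0 \<delta> \<Longrightarrow> t \<in> {0..1} \<Longrightarrow> ((\<lambda>a. q a t) has_derivative J a t) (at a)"
    and Dp: "\<And>a t. a \<in> ball 0 \<delta> \<Longrightarrow> t \<in> {0..1} \<Longrightarrow> ((\<lambda>a. p a t) has_derivative K a t) (at a)"
    and dJ: "\<And>a t w. a \<in> ball 0 \<delta> \<Longrightarrow> t \<in> {0..1} \<Longrightarrow> ((\<lambda>t. J a t w) has_vector_derivative K a t w) (at t within {0..1})"
    and dK: "\<And>a t w. a \<in> ball 0 \<delta> \<Longrightarrow> t \<in> {0..1} \<Longrightarrow> ((\<lambda>t. K a t w) has_vector_derivative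
      - (FD (\<lambda>x. chris g x (p a t) (p a t)) (q a t) (J a t w) + 2 *\<^sub>R chris g (q a t) (K a t w) (p a t))) (at t within {0..1})"
    and cJ: "\<And>t w. t \<in> {0..1} \<Longrightarrow> continuous_on (ball 0 \<delta>) (\<lambda>a. J a t w)"
    and cK: "\<And>t w. t \<in> {0..1} \<Longrightarrow> continuous_on (ball 0 \<delta>) (\<lambda>a. K a t w)"

text \<open>Near the resting state \<open>(x0, 0)\<close> the flow of the spray is available for a
  time \<epsilon>; by homogeneity of the geodesic equation this is traded for small initial
  velocities with geodesics defined up to time 1.\<close>

lemma (in local_metric) geodesic_flow_exists:
  assumes x0: "x0 \<in> U"
  obtains \<delta> q p J K where "geodesic_flow U g x0 \<delta> q p J K"
proof -
  have z0: "(x0, 0) \<in> U \<times> UNIV" using x0 by simp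
  have C: "Ck_on 1 spray (U \<times> UNIV)" using C1_spray by simp
  obtain \<epsilon> \<delta> \<Phi> \<Psi> where f: "\<epsilon> > 0" "\<delta> > 0"
    "\<And>z t. z \<in> ball (x0, 0) \<delta> \<Longrightarrow> t \<in> {0..1} \<Longrightarrow> \<Phi> z t \<in> U \<times> UNIV"
    "\<And>z. z \<in> ball (x0, 0) \<delta> \<Longrightarrow> \<Phi> z 0 = z"
    "\<And>z t. z \<in> ball (x0, 0) \<delta> \<Longrightarrow> t \<in> {0..1} \<Longrightarrow> (\<Phi> z has_vector_derivative \<epsilon> *\<^sub>R spray (\<Phi> z t)) (at t within {0..1})"
    "\<And>z t. z \<in> ball (x0, 0) \<delta> \<Longrightarrow> t \<in> {0..1} \<Longrightarrow> ((\<lambda>z. \<Phi> z t) has_derivative \<Psi> z t) (at z)"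
    "\<And>z t h. z \<in> ball (x0, 0) \<delta> \<Longrightarrow> t \<in> {0..1} \<Longrightarrow>
      ((\<lambda>t. \<Psi> z t h) has_vector_derivative \<epsilon> *\<^sub>R FD spray (\<Phi> z t) (\<Psi> z t h)) (at t within {0..1})"
    "\<And>z h. z \<in> ball (x0, 0) \<delta> \<Longrightarrow> \<Psi> z 0 h = h"
    "\<And>t h. t \<in> {0..1} \<Longrightarrow> continuous_on (ball (x0, 0) \<delta>) (\<lambda>z. \<Psi> z t h)"
    by (rule local_flow[OF open_phase C z0]) (rule that)
  \<comment> \<open>Initial velocity a/\<epsilon> for a flow run at speed \<epsilon>; the velocity
    of the rescaled geodesic is recovered by the factor \<epsilon> below.\<close>
  define i where "i a = (x0, (1 / \<epsilon>) *\<^sub>R a)" for a :: 'e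
  have i: "i a \<in> ball (x0, 0) \<delta>" if "a \<in> ball 0 (\<epsilon> * \<delta>)" for a
  proof -
    have "norm ((1 / \<epsilon>) *\<^sub>R a) < \<delta>" using that f(1) by (simp add: divide_less_eq mult.commute)
    then show ?thesis by (simp add: i_def dist_Pair_Pair)
  qed
  have di: "(i has_derivative (\<lambda>w. (0, (1 / \<epsilon>) *\<^sub>R w))) (at a)" for a
    unfolding i_def by (auto intro!: derivative_eq_intros)
  have ci: "continuous_on S i" for S unfolding i_def by (intro continuous_intros)
  show thesis
  proof (rule that, unfold_locales)
    show "\<epsilon> * \<delta> > 0" using f by simp
    fix a :: 'e assume a: "a \<in> ball 0 (\<epsilon> * \<delta>)"
    note ia = i[OF a]
    show "fst (\<Phi> (i a) 0) = x0" "\<epsilon> *\<^sub>R snd (\<Phi> (i a) 0) = a" using f(4)[OF ia] f(1) by (auto simp: i_def)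
    show "fst (\<Psi> (i a) 0 (0, (1 / \<epsilon>) *\<^sub>R w)) = 0" "\<epsilon> *\<^sub>R snd (\<Psi> (i a) 0 (0, (1 / \<epsilon>) *\<^sub>R w)) = w" for w
      using f(8)[OF ia] f(1) by auto
    fix t :: real assume t: "t \<in> {0..1}"
    have U: "fst (\<Phi> (i a) t) \<in> U" using f(3)[OF ia t] by auto
    show "fst (\<Phi> (i a) t) \<in> U" by (rule U)
    show "((\<lambda>t. fst (\<Phi> (i a) t)) has_vector_derivative \<epsilon> *\<^sub>R snd (\<Phi> (i a) t)) (at t within {0..1})"
      using bounded_linear.has_vector_derivative[OF bounded_linear_fst f(5)[OF ia t]] by (simp add: spray_def)
    show "((\<lambda>t. \<epsilon> *\<^sub>R snd (\<Phi> (i a) t)) has_vector_derivative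
       - \<Gamma> (fst (\<Phi> (i a) t)) (\<epsilon> *\<^sub>R snd (\<Phi> (i a) t)) (\<epsilon> *\<^sub>R snd (\<Phi> (i a) t))) (at t within {0..1})"
      using bounded_linear.has_vector_derivative[OF bounded_linear_scaleR_right
          bounded_linear.has_vector_derivative[OF bounded_linear_snd f(5)[OF ia t]], of \<epsilon>]
      by (simp add: spray_def \<Gamma>_lin[OF U])
    show "((\<lambda>a. fst (\<Phi> (i a) t)) has_derivative (\<lambda>w. fst (\<Psi> (i a) t (0, (1 / \<epsilon>) *\<^sub>R w)))) (at a)"
      by (rule has_derivative_compose[OF di has_derivative_fst[OF f(6)[OF ia t]]])
    show "((\<lambda>a. \<epsilon> *\<^sub>R snd (\<Phi> (i a) t)) has_derivative (\<lambda>w. \<epsilon> *\<^sub>R snd (\<Psi> (i a) t (0, (1 / \<epsilon>) *\<^sub>R w)))) (at a)"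
      by (intro has_derivative_scaleR_right has_derivative_compose[OF di has_derivative_snd[OF f(6)[OF ia t]]])
    fix w
    show "((\<lambda>t. fst (\<Psi> (i a) t (0, (1 / \<epsilon>) *\<^sub>R w))) has_vector_derivative \<epsilon> *\<^sub>R snd (\<Psi> (i a) t (0, (1 / \<epsilon>) *\<^sub>R w))) (at t within {0..1})"
      using bounded_linear.has_vector_derivative[OF bounded_linear_fst f(7)[OF ia t]] by (simp add: FD_spray[OF U])
    have l: "FD (\<lambda>x. \<Gamma> x (r *\<^sub>R u) (r *\<^sub>R u)) y h = (r * r) *\<^sub>R FD (\<lambda>x. \<Gamma> x u u) y h" if "y \<in> U" for r u y h
      using bilinear_lmul[OF d\<Gamma>_bil[OF that], of r u "r *\<^sub>R u" h] bilinear_rmul[OF d\<Gamma>_bil[OF that], of u r u h] by simp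
    show "((\<lambda>t. \<epsilon> *\<^sub>R snd (\<Psi> (i a) t (0, (1 / \<epsilon>) *\<^sub>R w))) has_vector_derivative
      - (FD (\<lambda>x. \<Gamma> x (\<epsilon> *\<^sub>R snd (\<Phi> (i a) t)) (\<epsilon> *\<^sub>R snd (\<Phi> (i a) t))) (fst (\<Phi> (i a) t)) (fst (\<Psi> (i a) t (0, (1 / \<epsilon>) *\<^sub>R w)))
        + 2 *\<^sub>R \<Gamma> (fst (\<Phi> (i a) t)) (\<epsilon> *\<^sub>R snd (\<Psi> (i a) t (0, (1 / \<epsilon>) *\<^sub>R w))) (\<epsilon> *\<^sub>R snd (\<Phi> (i a) t)))) (at t within {0..1})"
      using bounded_linear.has_vector_derivative[OF bounded_linear_scaleR_right
          bounded_linear.has_vector_derivative[OF bounded_linear_snd f(7)[OF ia t]], of \<epsilon>]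
      by (simp add: FD_spray[OF U] \<Gamma>_lin[OF U] l[OF U] algebra_simps)
  next
    fix t :: real and w :: 'e assume t: "t \<in> {0..1}"
    have c: "continuous_on (ball 0 (\<epsilon> * \<delta>)) (\<lambda>a. \<Psi> (i a) t (0, (1 / \<epsilon>) *\<^sub>R w))"
      by (rule continuous_on_compose2[OF f(9)[OF t] ci]) (use i in blast)
    show "continuous_on (ball 0 (\<epsilon> * \<delta>)) (\<lambda>a. fst (\<Psi> (i a) t (0, (1 / \<epsilon>) *\<^sub>R w)))"
      "continuous_on (ball 0 (\<epsilon> * \<delta>)) (\<lambda>a. \<epsilon> *\<^sub>R snd (\<Psi> (i a) t (0, (1 / \<epsilon>) *\<^sub>R w)))"
      using c by (auto intro: continuous_intros)
  qed
qed

section \<open>Energy, Gauss lemma and Jacobi fields\<close>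

context geodesic_flow
begin

lemma x0U: "x0 \<in> U"
  using qU[of 0 0] init(1)[of 0] \<delta> by simp

text \<open>The covariant derivative of the Jacobi field \<open>J a t w\<close> along its geodesic;
  \<open>K\<close> is the derivative in coordinates.\<close>

definition DJ :: "'a \<Rightarrow> real \<Rightarrow> 'a \<Rightarrow> 'a" where
  "DJ a t w = K a t w + \<Gamma> (q a t) (p a t) (J a t w)"

lemma linJ: "a \<in> ball 0 \<delta> \<Longrightarrow> t \<in> {0..1} \<Longrightarrow> linear (J a t)"
  and linK: "a \<in> ball 0 \<delta> \<Longrightarrow> t \<in> {0..1} \<Longrightarrow> linear (K a t)"
  using Dq Dp has_derivative_linear by blast+

lemma energy:
  assumes a: "a \<in> ball 0 \<delta>" and t: "t \<in> {0..1}"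
  shows "g (q a t) (p a t) (p a t) = g x0 a a"
proof -
  have "((\<lambda>t. g (q a t) (p a t) (p a t)) has_real_derivative 0) (at t within {0..1})" if t: "t \<in> {0..1}" for t
    using has_vector_derivative_g[OF qU[OF a t] dq[OF a t] dp[OF a t] dp[OF a t]]
    by (simp add: g_0[OF qU[OF a t]])
  from vanishing_derivative_constant[OF this t] show ?thesis using init(1,2)[OF a] by simp
qed

text \<open>Differentiating the constant energy in the initial velocity gives g(p, DJ w) = g(a,w);
  since \<open>p\<close> is parallel, this is also the derivative of g(p, J w) in time.\<close>

lemma gauss:
  assumes a: "a \<in> ball 0 \<delta>" and t: "t \<in> {0..1}"
  shows "g (q a t) (p a t) (J a t w) = t * g x0 a w"
proof -
  have pDJ: "g (q a t) (p a t) (DJ a t w) = g x0 a w" if t: "t \<in> {0..1}" for t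
  proof -
    note u = qU[OF a t]
    have 1: "((\<lambda>a. g (q a t) (p a t) (p a t)) has_derivative
        (\<lambda>h. g (q a t) (K a t h + \<Gamma> (q a t) (J a t h) (p a t)) (p a t) + g (q a t) (p a t) (K a t h + \<Gamma> (q a t) (J a t h) (p a t)))) (at a)"
      by (rule has_derivative_g[OF u Dq[OF a t] Dp[OF a t] Dp[OF a t]])
    have bb: "bounded_bilinear (g x0)" using bilinear_conv_bounded_bilinear g_bil[OF x0U] by blast
    have 2: "((\<lambda>a. g x0 a a) has_derivative (\<lambda>h. g x0 a h + g x0 h a)) (at a)"
      by (rule bounded_bilinear.FDERIV[OF bb has_derivative_ident has_derivative_ident])
    have 3: "((\<lambda>a. g (q a t) (p a t) (p a t)) has_derivative (\<lambda>h. g x0 a h + g x0 h a)) (at a)"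
      by (rule has_derivative_transform_within_open[OF 2 open_ball a]) (simp add: energy[OF _ t])
    show ?thesis
      using has_derivative_unique[OF 1 3, THEN fun_cong, of w] g_sym[OF u, of _ "p a t"] g_sym[OF x0U, of w a]
        \<Gamma>_sym[OF u, of "J a t w" "p a t"] by (simp add: DJ_def)
  qed
  let ?f = "\<lambda>t. g (q a t) (p a t) (J a t w) - t * g x0 a w"
  have "(?f has_real_derivative 0) (at t within {0..1})" if t: "t \<in> {0..1}" for t
  proof -
    have "((\<lambda>t. g (q a t) (p a t) (J a t w)) has_real_derivative g x0 a w) (at t within {0..1})"
      using has_vector_derivative_g[OF qU[OF a t] dq[OF a t] dp[OF a t] dJ[OF a t, of w]] pDJ[OF t]
      by (simp add: g_0[OF qU[OF a t]] DJ_def)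
    then show ?thesis by (auto intro!: derivative_eq_intros)
  qed
  from vanishing_derivative_constant[OF this t] show ?thesis using init[OF a] by (simp add: g_0[OF x0U])
qed

text \<open>The derivatives of \<Gamma> in the linearised equation and those that arise from the
  Christoffel term of \<open>DJ\<close> combine to the curvature tensor.\<close>

lemma jacobi:
  assumes a: "a \<in> ball 0 \<delta>" and t: "t \<in> {0..1}"
  shows "((\<lambda>t. DJ a t w) has_vector_derivative
     (- Rm (q a t) (J a t w) (p a t) (p a t) - \<Gamma> (q a t) (p a t) (DJ a t w))) (at t within {0..1})"
proof -
  note u = qU[OF a t]
  have "((\<lambda>t. \<Gamma> (q a t) (p a t) (J a t w)) has_vector_derivative
      (FD (\<lambda>x. \<Gamma> x (p a t) (J a t w)) (q a t) (p a t) + \<Gamma> (q a t) (- \<Gamma> (q a t) (p a t) (p a t)) (J a t w)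
       + \<Gamma> (q a t) (p a t) (K a t w))) (at t within {0..1})"
    unfolding has_vector_derivative_def
    by (rule has_derivative_eq_rhs[OF has_derivative_\<Gamma>[OF u dq[OF a t, unfolded has_vector_derivative_def]
            dp[OF a t, unfolded has_vector_derivative_def] dJ[OF a t, unfolded has_vector_derivative_def]]])
      (simp add: fun_eq_iff linear_scale[OF d\<Gamma>_lin[OF u]] \<Gamma>_lin[OF u] algebra_simps)
  from has_vector_derivative_add[OF dK[OF a t] this]
  show ?thesis
    unfolding DJ_def curv_def
    by (rule has_vector_derivative_eq_rhs)
      (simp add: \<Gamma>_lin[OF u] algebra_simps scaleR_2 \<Gamma>_sym[OF u, of "K a t w" "p a t"] \<Gamma>_sym[OF u, of "J a t w" "p a t"]
        \<Gamma>_sym[OF u, of "\<Gamma> (q a t) (p a t) (p a t)" "J a t w"] d\<Gamma>_sym[OF u, of "J a t w" "p a t"])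
qed

lemma scaled:
  fixes a :: 'a
  assumes a: "a \<in> ball 0 \<delta>" and s: "s \<in> {0..1}"
  shows "s *\<^sub>R a \<in> ball 0 \<delta>"
proof -
  have "\<bar>s\<bar> * norm a \<le> 1 * norm a" using s by (intro mult_right_mono) auto
  then show ?thesis using a by simp
qed

text \<open>Both sides are geodesics with the same initial data, and geodesics are unique.\<close>

lemma homogeneous:
  assumes a: "a \<in> ball 0 \<delta>" and s: "s \<in> {0..1}" and t: "t \<in> {0..1}"
  shows "q (s *\<^sub>R a) t = q a (s * t)" "p (s *\<^sub>R a) t = s *\<^sub>R p a (s * t)"
proof -
  note sa = scaled[OF a s]
  have st: "s * t \<in> {0..1}" if "t \<in> {0..1}" for t using s that by (auto simp: mult_le_one)
  have im: "(\<lambda>t. s * t) ` {0..1} \<subseteq> {0..1}" using st by blast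
  have l: "((\<lambda>t. s * t) has_vector_derivative s) (at t within {0..1})" for t
    by (auto intro!: derivative_eq_intros)
  have 1: "((\<lambda>t. f (s * t)) has_vector_derivative s *\<^sub>R f') (at t within {0..1})"
    if "(f has_vector_derivative f') (at (s * t) within {0..1})" for f :: "real \<Rightarrow> 'a" and f' t
    using vector_diff_chain_within[OF l has_vector_derivative_within_subset[OF that im]] by (simp add: o_def)
  have d: "((\<lambda>t. q a (s * t)) has_vector_derivative s *\<^sub>R p a (s * t)) (at t within {0..1})"
    "((\<lambda>t. s *\<^sub>R p a (s * t)) has_vector_derivative
      - \<Gamma> (q a (s * t)) (s *\<^sub>R p a (s * t)) (s *\<^sub>R p a (s * t))) (at t within {0..1})" if t: "t \<in> {0..1}" for t
  proof -
    show "((\<lambda>t. q a (s * t)) has_vector_derivative s *\<^sub>R p a (s * t)) (at t within {0..1})"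
      by (rule 1[OF dq[OF a st[OF t]]])
    show "((\<lambda>t. s *\<^sub>R p a (s * t)) has_vector_derivative
      - \<Gamma> (q a (s * t)) (s *\<^sub>R p a (s * t)) (s *\<^sub>R p a (s * t))) (at t within {0..1})"
      using bounded_linear.has_vector_derivative[OF bounded_linear_scaleR_right 1[OF dp[OF a st[OF t]]], of s]
      by (simp add: \<Gamma>_lin[OF qU[OF a st[OF t]]])
  qed
  note u = geodesic_unique[where b=1 and x="q (s *\<^sub>R a)" and v="p (s *\<^sub>R a)" and y="\<lambda>t. q a (s * t)" and w="\<lambda>t. s *\<^sub>R p a (s * t)"]
  show "q (s *\<^sub>R a) t = q a (s * t)" "p (s *\<^sub>R a) t = s *\<^sub>R p a (s * t)"
    by (rule u; use qU[OF sa] qU[OF a st] dq[OF sa] dp[OF sa] d init[OF sa] init[OF a] t in simp)+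
qed

lemma homogeneous_J:
  assumes a: "a \<in> ball 0 \<delta>" and s: "s \<in> {0..1}"
  shows "J (s *\<^sub>R a) 1 (s *\<^sub>R w) = J a s w" "K (s *\<^sub>R a) 1 (s *\<^sub>R w) = s *\<^sub>R K a s w"
proof -
  note sa = scaled[OF a s]
  have l: "((\<lambda>a. s *\<^sub>R a) has_derivative (\<lambda>w. s *\<^sub>R w)) (at a)"
    by (auto intro!: derivative_eq_intros)
  have 1: "((\<lambda>a. q (s *\<^sub>R a) 1) has_derivative (\<lambda>w. J (s *\<^sub>R a) 1 (s *\<^sub>R w))) (at a)"
    "((\<lambda>a. p (s *\<^sub>R a) 1) has_derivative (\<lambda>w. K (s *\<^sub>R a) 1 (s *\<^sub>R w))) (at a)"
    using has_derivative_compose[OF l Dq[OF sa]] has_derivative_compose[OF l Dp[OF sa]] by simp_all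
  have 2: "((\<lambda>a. q (s *\<^sub>R a) 1) has_derivative J a s) (at a)"
    by (rule has_derivative_transform_within_open[OF Dq[OF a s] open_ball a]) (use homogeneous(1)[OF _ s, of _ 1] in simp)
  have 3: "((\<lambda>a. p (s *\<^sub>R a) 1) has_derivative (\<lambda>w. s *\<^sub>R K a s w)) (at a)"
    by (rule has_derivative_transform_within_open[OF has_derivative_scaleR_right[OF Dp[OF a s]] open_ball a])
      (use homogeneous(2)[OF _ s, of _ 1] in simp)
  show "J (s *\<^sub>R a) 1 (s *\<^sub>R w) = J a s w" by (rule has_derivative_unique[OF 1(1) 2, THEN fun_cong])
  show "K (s *\<^sub>R a) 1 (s *\<^sub>R w) = s *\<^sub>R K a s w" by (rule has_derivative_unique[OF 1(2) 3, THEN fun_cong])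
qed

text \<open>The geodesic with initial velocity 0 rests at \<open>x0\<close>, so the linearised
  equation is trivial there. At time 1 this says that the differential of the exponential map at 0
  is the identity.\<close>

lemma at_zero:
  assumes t: "t \<in> {0..1}"
  shows "q 0 t = x0" "p 0 t = 0" "J 0 t w = t *\<^sub>R w" "K 0 t w = w"
proof -
  have 0: "0 \<in> ball (0::'a) \<delta>" using \<delta> by simp
  have q: "q 0 t = x0" and p: "p 0 t = 0" if "t \<in> {0..1}" for t
    using homogeneous[OF 0 _ that, of 0] init[OF 0] by auto
  have dK': "((\<lambda>t. K 0 t w) has_vector_derivative 0) (at t within {0..1})" if t: "t \<in> {0..1}" for t
  proof -
    have "FD (\<lambda>x. \<Gamma> x 0 0) (q 0 t) h = 0" for h
      using bilinear_lzero[OF d\<Gamma>_bil[OF qU[OF 0 t]]] .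
    then show ?thesis using dK[OF 0 t, of w] p[OF t] by (simp add: \<Gamma>_lin[OF qU[OF 0 t]])
  qed
  have K: "K 0 t w = w" if t: "t \<in> {0..1}" for t
  proof -
    obtain c where "\<And>x. x \<in> {0..1} \<Longrightarrow> K 0 x w = c"
      using has_vector_derivative_zero_constant[OF _ dK'] by auto
    then show ?thesis using init(4)[OF 0, of w] t by (metis atLeastAtMost_iff order_refl zero_le_one)
  qed
  have "((\<lambda>t. J 0 t w - t *\<^sub>R w) has_vector_derivative 0) (at t within {0..1})" if t: "t \<in> {0..1}" for t
    using dJ[OF 0 t, of w] K[OF t] by (auto intro!: derivative_eq_intros)
  then obtain c where c: "\<And>x. x \<in> {0..1} \<Longrightarrow> J 0 x w - x *\<^sub>R w = c"
    using has_vector_derivative_zero_constant[of "{0..1::real}" "\<lambda>t. J 0 t w - t *\<^sub>R w"] by auto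
  show "J 0 t w = t *\<^sub>R w" using c[of 0] c[OF t] init(3)[OF 0] by simp
  show "q 0 t = x0" "p 0 t = 0" "K 0 t w = w" using q[OF t] p[OF t] K[OF t] by auto
qed

end

section \<open>Normal neighbourhoods\<close>

text \<open>\<open>V\<close> is the geodesic ball of radius \<open>r\<close> around
  \<open>x0\<close> and \<open>h\<close> the inverse of the exponential map on it. The radius is
  measured by the metric at \<open>x0\<close>, so that spheres are level sets of
  \<open>g x0 (h x) (h x)\<close>.\<close>

locale normal_nbhd = geodesic_flow +
  fixes r :: real and V :: "'a set" and h :: "'a \<Rightarrow> 'a"
  assumes r: "r > 0" and rball: "\<And>a. g x0 a a < r\<^sup>2 \<Longrightarrow> a \<in> ball 0 \<delta>"
    and openV: "open V"
    and hV: "\<And>x. x \<in> V \<Longrightarrow> g x0 (h x) (h x) < r\<^sup>2" "\<And>x. x \<in> V \<Longrightarrow> q (h x) 1 = x"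
    and qV: "\<And>a. g x0 a a < r\<^sup>2 \<Longrightarrow> q a 1 \<in> V" "\<And>a. g x0 a a < r\<^sup>2 \<Longrightarrow> h (q a 1) = a"
    and bijJ: "\<And>a. g x0 a a < r\<^sup>2 \<Longrightarrow> bij (J a 1)"
    and dh: "\<And>x. x \<in> V \<Longrightarrow> (h has_derivative inv (J (h x) 1)) (at x)"
    and C1_h: "Ck_on (Suc 0) h V"

lemma (in geodesic_flow) normal_nbhd_exists:
  obtains r V h where "normal_nbhd U g x0 \<delta> q p J K r V h"
proof -
  have 1: "(1::real) \<in> {0..1}" and 0: "0 \<in> ball (0::'a) \<delta>" using \<delta> by auto
  have fd: "FD (\<lambda>a. q a 1) a = J a 1" if "a \<in> ball 0 \<delta>" for a
    using FD_eq[OF Dq[OF that 1]] .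
  have C: "Ck_on 1 (\<lambda>a. q a 1) (ball 0 \<delta>)"
    unfolding One_nat_def
    by (rule Ck_on_SucI[OF open_ball Dq[OF _ 1]]) (use cJ[OF 1] in auto)
  have "FD (\<lambda>a. q a 1) 0 = (\<lambda>w. w)" using fd[OF 0] at_zero(3)[OF 1] by (simp add: fun_eq_iff)
  then have inj: "inj (FD (\<lambda>a. q a 1) 0)" by (simp add: inj_def)
  obtain U' V h where V: "open U'" "U' \<subseteq> ball 0 \<delta>" "0 \<in> U'" "open V" "q 0 1 \<in> V" "homeomorphism U' V (\<lambda>a. q a 1) h"
    "\<And>y. y \<in> V \<Longrightarrow> (h has_derivative inv (FD (\<lambda>a. q a 1) (h y))) (at y)" "\<And>y. y \<in> V \<Longrightarrow> bij (FD (\<lambda>a. q a 1) (h y))"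
    "Ck_on (Suc 0) h V"
    by (rule C1_inverse_function[OF open_ball C 0 inj]) (rule that)
  have h: "h x \<in> U'" "q (h x) 1 = x" if "x \<in> V" for x
    using V(6) that unfolding homeomorphism_def by blast+
  have qh: "q a 1 \<in> V" "h (q a 1) = a" if "a \<in> U'" for a
    using V(6) that unfolding homeomorphism_def by blast+
  obtain c where c: "c > 0" "\<And>v. c * (norm v)\<^sup>2 \<le> g x0 v v"
    using posdef_lower_bound[OF posdef_g[OF x0U]] by blast
  obtain d where d: "d > 0" "ball 0 d \<subseteq> U'" using V(1,3) openE by blast
  \<comment> \<open>The metric at \<open>x0\<close> dominates c times the Euclidean square norm, so
    vectors of metric length below \<open>r\<close> have Euclidean norm below
    \<open>d\<close>.\<close>
  define r where "r = sqrt c * d"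
  have r: "r > 0" using c d by (simp add: r_def)
  have rU: "a \<in> U'" if "g x0 a a < r\<^sup>2" for a
  proof -
    have "c * (norm a)\<^sup>2 < c * d\<^sup>2"
      by (rule le_less_trans[OF c(2)]) (use that c(1) in \<open>simp add: r_def power_mult_distrib\<close>)
    then have "(norm a)\<^sup>2 < d\<^sup>2" by (simp only: mult_less_cancel_left_pos[OF c(1)])
    then have "norm a < d" using d(1) by (rule power_less_imp_less_base[OF _ less_imp_le])
    then show ?thesis using d(2) by auto
  qed
  define V' where "V' = {x\<in>V. g x0 (h x) (h x) < r\<^sup>2}"
  have ch: "continuous_on V h" using V(6) by (rule homeomorphism_cont2)
  have V': "V' \<subseteq> V" by (auto simp: V'_def)
  have "continuous_on V (\<lambda>x. g x0 (h x) (h x))"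
    by (rule continuous_g[OF continuous_on_const _ ch ch]) (use x0U in auto)
  from continuous_open_preimage[OF this V(4) open_lessThan]
  have "open (V \<inter> (\<lambda>x. g x0 (h x) (h x)) -` {..<r\<^sup>2})" .
  moreover have "V \<inter> (\<lambda>x. g x0 (h x) (h x)) -` {..<r\<^sup>2} = V'" by (auto simp: V'_def)
  ultimately have "open V'" by simp
  then have "normal_nbhd U g x0 \<delta> q p J K r V' h"
  proof unfold_locales
    fix a assume a: "g x0 a a < r\<^sup>2"
    note aU = rU[OF a]
    show "a \<in> ball 0 \<delta>" using aU V(2) by blast
    show "q a 1 \<in> V'" "h (q a 1) = a" using qh[OF aU] a by (auto simp: V'_def)
    show "bij (J a 1)" using V(8)[OF qh(1)[OF aU]] qh(2)[OF aU] fd[of a] aU V(2) by auto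
  next
    fix x assume x: "x \<in> V'"
    show "g x0 (h x) (h x) < r\<^sup>2" "q (h x) 1 = x" using x h(2) by (auto simp: V'_def)
    have xV: "x \<in> V" using x V' by blast
    then have hb: "h x \<in> ball 0 \<delta>" using h(1) V(2) by blast
    show "(h has_derivative inv (J (h x) 1)) (at x)"
      using V(7)[OF xV] unfolding fd[OF hb] .
  next
    show "Ck_on (Suc 0) h V'" by (rule Ck_on_subset[OF V(9) V'])
  qed (use r in auto)
  then show thesis by (rule that)
qed

context normal_nbhd
begin

definition T :: "'a \<Rightarrow> 'a" where "T x = p (h x) 1"
definition rho :: "'a \<Rightarrow> real" where "rho x = g x0 (h x) (h x) / 2"
definition B :: "'a \<Rightarrow> 'a \<Rightarrow> 'a" where "B x v = FD T x v + \<Gamma> x v (T x)"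

lemma one: "(1::real) \<in> {0..1}" by simp

lemma hball: "x \<in> V \<Longrightarrow> h x \<in> ball 0 \<delta>"
  using rball hV(1) by blast

lemma VU: "x \<in> V \<Longrightarrow> x \<in> U"
  using qU[OF hball one] hV(2) by metis

lemma V_subset: "V \<subseteq> U"
  using VU by blast

lemma x0V: "x0 \<in> V" "h x0 = 0"
proof -
  have "g x0 0 0 < r\<^sup>2" using r by (simp add: g_0[OF x0U])
  from qV[OF this] show "x0 \<in> V" "h x0 = 0" using at_zero(1)[OF one] by auto
qed

lemma surj_J: "x \<in> V \<Longrightarrow> J (h x) 1 (inv (J (h x) 1) v) = v"
  by (rule surj_f_inv_f[OF bij_is_surj[OF bijJ[OF hV(1)]]])

lemma dT: "x \<in> V \<Longrightarrow> (T has_derivative (\<lambda>v. K (h x) 1 (inv (J (h x) 1) v))) (at x)"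
  unfolding T_def by (rule has_derivative_compose[OF dh Dp[OF hball one]])

lemma C1_T: "Ck_on (Suc 0) T V"
proof -
  have "Ck_on (Suc 0) (\<lambda>a. p a 1) (ball 0 \<delta>)"
    by (rule Ck_on_SucI[OF open_ball Dp[OF _ one]]) (use cK[OF one] in auto)
  from Ck_on_compose[OF openV open_ball this C1_h] hball show ?thesis
    unfolding T_def by blast
qed

lemma g_T: "x \<in> V \<Longrightarrow> g x (T x) (T x) = 2 * rho x"
  using energy[OF hball one] hV(2) by (simp add: T_def rho_def)

text \<open>The Gauss lemma at time 1, read through \<open>h\<close>: the gradient of
  \<open>rho\<close> is \<open>T\<close>.\<close>

lemma drho: "x \<in> V \<Longrightarrow> (rho has_derivative (\<lambda>v. g x (T x) v)) (at x)"
proof -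
  assume x: "x \<in> V"
  have bb: "bounded_bilinear (g x0)" using bilinear_conv_bounded_bilinear g_bil[OF x0U] by blast
  have "(rho has_derivative (\<lambda>v. (1/2) * (g x0 (h x) (inv (J (h x) 1) v) + g x0 (inv (J (h x) 1) v) (h x)))) (at x)"
    using has_derivative_mult_right[OF bounded_bilinear.FDERIV[OF bb dh[OF x] dh[OF x]], of "1/2"]
    by (simp add: rho_def[abs_def])
  moreover have "(1/2) * (g x0 (h x) (inv (J (h x) 1) v) + g x0 (inv (J (h x) 1) v) (h x)) = g x (T x) v" for v
    using gauss[OF hball[OF x] one, of "inv (J (h x) 1) v"] surj_J[OF x] hV(2)[OF x] g_sym[OF x0U, of _ "h x"]
    by (simp add: T_def)
  ultimately show ?thesis by simp
qed

text \<open>\<open>h\<close> is only of class C^1, but the gradient \<open>T\<close> is of class C^1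
  as well; one derivative is gained over what the definition of \<open>rho\<close> shows.\<close>

lemma C2_rho: "Ck_on (Suc (Suc 0)) rho V"
proof (rule Ck_on_SucI[OF openV drho])
  show "Ck_on (Suc 0) (\<lambda>x. g x (T x) v) V" for v
    by (rule Ck_on_bilinear_family[OF openV open_U g_bil Ck_on_SucD[OF g2] _ Ck_on_id[OF openV] C1_T Ck_on_const[OF openV]])
      (use VU in auto)
qed

lemma FD_T: "x \<in> V \<Longrightarrow> (T has_derivative FD T x) (at x)"
  by (rule Ck_on_has_derivative[OF C1_T openV])

lemma lin_B: "x \<in> V \<Longrightarrow> linear (B x)"
  unfolding B_def using linear_add[OF has_derivative_linear[OF FD_T]] linear_scale[OF has_derivative_linear[OF FD_T]]
  by (intro linearI) (simp_all add: \<Gamma>_lin[OF VU] algebra_simps)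

text \<open>Up to the symmetric term g(T, \<Gamma> u v), the form g(Bu,v) is the second derivative
  of \<open>rho\<close>.\<close>

lemma B_sym:
  assumes x: "x \<in> V"
  shows "g x (B x u) v = g x u (B x v)"
proof -
  have *: "FD (\<lambda>y. FD rho y v) x u = g x (B x u) v + g x (T x) (\<Gamma> x u v)" for u v
  proof -
    have "FD (\<lambda>y. FD rho y v) x = FD (\<lambda>y. g y (T y) v) x"
      by (rule FD_cong[OF openV x]) (simp add: FD_eq[OF drho])
    moreover have "((\<lambda>y. g y (T y) v) has_derivative (\<lambda>w. g x (FD T x w + \<Gamma> x w (T x)) v + g x (T x) (0 + \<Gamma> x w v))) (at x)"
      by (rule has_derivative_g[OF VU[OF x] has_derivative_ident FD_T[OF x] has_derivative_const])
    ultimately show ?thesis by (simp add: FD_eq B_def)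
  qed
  have "FD (\<lambda>y. FD rho y v) x u = FD (\<lambda>y. FD rho y u) x v"
    by (rule Ck_on_symmetric[OF openV C2_rho x])
  then show ?thesis unfolding * using \<Gamma>_sym[OF VU[OF x], of u v] g_sym[OF VU[OF x], of u "B x v"] by simp
qed

text \<open>Differentiate |T|^2 = 2 rho, using that the gradient of \<open>rho\<close> is
  \<open>T\<close>. Together with symmetry this means B T = T, so \<open>B\<close> preserves the
  orthogonal complement of \<open>T\<close>.\<close>

lemma B_T:
  assumes x: "x \<in> V"
  shows "g x (B x v) (T x) = g x (T x) v"
proof -
  have 1: "((\<lambda>y. g y (T y) (T y)) has_derivative (\<lambda>w. g x (B x w) (T x) + g x (T x) (B x w))) (at x)"
    unfolding B_def by (rule has_derivative_g[OF VU[OF x] has_derivative_ident FD_T[OF x] FD_T[OF x]])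
  have "((\<lambda>y. 2 * rho y) has_derivative (\<lambda>w. 2 * g x (T x) w)) (at x)"
    by (rule has_derivative_mult_right[OF drho[OF x]])
  then have 2: "((\<lambda>y. g y (T y) (T y)) has_derivative (\<lambda>w. 2 * g x (T x) w)) (at x)"
    by (rule has_derivative_transform_within_open[OF _ openV x]) (simp add: g_T)
  show ?thesis
    using has_derivative_unique[OF 1 2, THEN fun_cong, of v] g_sym[OF VU[OF x], of "T x" "B x v"] by simp
qed

lemma B_center: "B x0 v = v"
proof -
  have "FD T x0 v = K 0 1 (inv (J 0 1) v)" using FD_eq[OF dT[OF x0V(1)]] x0V(2) by simp
  also have "\<dots> = v" using surj_J[OF x0V(1), of v] x0V(2) at_zero(3,4)[OF one] by simp
  finally show ?thesis
    using at_zero(2)[OF one] x0V(2) by (simp add: B_def T_def \<Gamma>_lin[OF x0U])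
qed

lemma continuous_B: "continuous_on V (\<lambda>x. B x v)"
proof -
  have "Ck_on (Suc 0) (\<lambda>x. \<Gamma> x v (T x)) V"
    by (rule Ck_on_bilinear_family[OF openV open_U \<Gamma>_bil C1_\<Gamma> _ Ck_on_id[OF openV] Ck_on_const[OF openV] C1_T])
      (use VU in auto)
  from Ck_on_SucD[OF this] show ?thesis
    unfolding B_def using Ck_on_FD[OF C1_T, of v] by (auto intro: continuous_intros)
qed

text \<open>At the end points of radial geodesics \<open>T\<close> equals \<open>p\<close>, so
  differentiating in the initial velocity relates \<open>FD T\<close> to \<open>K\<close>. Through
  this identity Jacobi fields compute \<open>B\<close>.\<close>

lemma B_J:
  assumes a: "g x0 a a < r\<^sup>2"
  shows "B (q a 1) (J a 1 w) = DJ a 1 w"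
proof -
  note V = qV[OF a]
  have "inv (J a 1) (J a 1 w) = w" using bijJ[OF a] by (simp add: bij_is_inj)
  then have "FD T (q a 1) (J a 1 w) = K a 1 w" using FD_eq[OF dT[OF V(1)]] V(2) by simp
  then show ?thesis
    using V(2) \<Gamma>_sym[OF VU[OF V(1)], of "p a 1"] by (simp add: B_def DJ_def T_def)
qed

subsection \<open>Constant curvature makes geodesic spheres umbilical\<close>

text \<open>The solutions are a sine, the identity and a hyperbolic sine. For 0 < c \<le> 1 the sine
  does not vanish at time 1 because sqrt c \<le> 1 < \<pi>; this is the origin of the bound on the
  radius.\<close>

lemma jacobi_scalar:
  assumes "c \<le> (1::real)"
  obtains s s' where "s 0 = 0" "s 1 \<noteq> (0::real)" "\<And>t. (s has_real_derivative s' t) (at t)"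
    "\<And>t. (s' has_real_derivative - c * s t) (at t)"
proof -
  consider "c > 0" | "c = 0" | "c < 0" by linarith
  then show thesis
  proof cases
    case 1
    have "sin (sqrt c) > 0" using 1 assms pi_gt3 by (intro sin_gt_zero) (auto simp: real_sqrt_le_1_iff intro: le_less_trans[of _ 1])
    moreover have "((\<lambda>t. sqrt c * cos (sqrt c * t)) has_real_derivative - c * sin (sqrt c * t)) (at t)" for t
      using 1 by (auto intro!: derivative_eq_intros)
    moreover have "((\<lambda>t. sin (sqrt c * t)) has_real_derivative sqrt c * cos (sqrt c * t)) (at t)" for t
      by (auto intro!: derivative_eq_intros)
    ultimately show ?thesis by (intro that[of "\<lambda>t. sin (sqrt c * t)"]) auto
  next
    case 2
    show ?thesis by (rule that[of "\<lambda>t. t" "\<lambda>_. 1"]) (use 2 in auto)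
  next
    case 3
    have e: "y * sqrt (- c) * sqrt (- c) = - (c * y)" for y
      using 3 by (simp add: mult.assoc)
    have "((\<lambda>t. sqrt (- c) * cosh (sqrt (- c) * t)) has_real_derivative - c * sinh (sqrt (- c) * t)) (at t)" for t
      by (auto intro!: derivative_eq_intros simp: e)
    moreover have "((\<lambda>t. sinh (sqrt (- c) * t)) has_real_derivative sqrt (- c) * cosh (sqrt (- c) * t)) (at t)" for t
      by (auto intro!: derivative_eq_intros)
    ultimately show ?thesis using 3 by (intro that[of "\<lambda>t. sinh (sqrt (- c) * t)"]) auto
  qed
qed

text \<open>Since R(J,p)p = k g(a,a) J for fields orthogonal to the geodesic, the field s DJ - s' J
  is parallel, and it vanishes at time 0. At time 1 this gives the factor s'/s, with a single
  division at the very end.\<close>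

lemma curv_const_umbilic:
  assumes k: "\<And>x. x \<in> U \<Longrightarrow> curv_const k x" and x: "x \<in> V" and small: "k * (2 * rho x) \<le> 1"
  obtains \<mu> where "\<And>v. g x (T x) v = 0 \<Longrightarrow> B x v = \<mu> *\<^sub>R v"
proof -
  define a where "a = h x"
  have a: "a \<in> ball 0 \<delta>" and ar: "g x0 a a < r\<^sup>2" and qa: "q a 1 = x"
    using hball[OF x] hV[OF x] by (auto simp: a_def)
  have c: "k * g x0 a a \<le> 1" using small by (simp add: rho_def a_def)
  obtain s s' where s: "s 0 = 0" "s 1 \<noteq> (0::real)" "\<And>t. (s has_real_derivative s' t) (at t)"
    "\<And>t. (s' has_real_derivative - (k * g x0 a a) * s t) (at t)"
    using jacobi_scalar[OF c] by blast
  have *: "s 1 *\<^sub>R DJ a 1 w = s' 1 *\<^sub>R J a 1 w" if w: "g x0 a w = 0" for w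
  proof -
    define W where "W t = s t *\<^sub>R DJ a t w - s' t *\<^sub>R J a t w" for t
    have dW: "(W has_vector_derivative - \<Gamma> (q a t) (p a t) (W t)) (at t within {0..1})" if t: "t \<in> {0..1}" for t
    proof -
      note u = qU[OF a t]
      have R: "Rm (q a t) (J a t w) (p a t) (p a t) = k *\<^sub>R (g x0 a a *\<^sub>R J a t w)"
        using k[OF u] energy[OF a t] gauss[OF a t, of w] w g_sym[OF u, of "J a t w" "p a t"]
        by (simp add: curv_const_def)
      have "(W has_vector_derivative
         (s t *\<^sub>R (- Rm (q a t) (J a t w) (p a t) (p a t) - \<Gamma> (q a t) (p a t) (DJ a t w)) + s' t *\<^sub>R DJ a t w)
         - (s' t *\<^sub>R K a t w + (- (k * g x0 a a) * s t) *\<^sub>R J a t w)) (at t within {0..1})"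
        unfolding W_def
        by (intro has_vector_derivative_diff has_vector_derivative_scaleR jacobi[OF a t] dJ[OF a t]
            has_field_derivative_at_within[OF s(3)] has_field_derivative_at_within[OF s(4)])
      then show ?thesis
        by (rule has_vector_derivative_eq_rhs)
          (simp add: R W_def DJ_def \<Gamma>_lin[OF u] algebra_simps)
    qed
    have "((\<lambda>t. g (q a t) (W t) (W t)) has_real_derivative 0) (at t within {0..1})" if t: "t \<in> {0..1}" for t
      using has_vector_derivative_g[OF qU[OF a t] dq[OF a t] dW[OF t] dW[OF t]] by (simp add: g_0[OF qU[OF a t]])
    from vanishing_derivative_constant[OF this, of 1]
    have "g (q a 1) (W 1) (W 1) = 0"
      using init[OF a] s(1) by (simp add: W_def g_0[OF x0U])
    then have "W 1 = 0" using g_zero[OF qU[OF a one]] by simp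
    then show ?thesis by (simp add: W_def)
  qed
  show thesis
  proof (rule that[of "s' 1 / s 1"])
    fix v assume v: "g x (T x) v = 0"
    define w where "w = inv (J a 1) v"
    have Jw: "J a 1 w = v" using surj_J[OF x] by (simp add: w_def a_def)
    have "g x0 a w = 0" using gauss[OF a one, of w] v unfolding Jw qa T_def a_def[symmetric] by simp
    from *[OF this] have "s 1 *\<^sub>R B x v = s' 1 *\<^sub>R v" using B_J[OF ar, of w] by (simp add: Jw qa)
    then have "(1 / s 1) *\<^sub>R (s 1 *\<^sub>R B x v) = (1 / s 1) *\<^sub>R (s' 1 *\<^sub>R v)" by simp
    then show "B x v = (s' 1 / s 1) *\<^sub>R v" using s(2) by simp
  qed
qed

subsection \<open>Umbilical geodesic spheres force constant curvature\<close>

text \<open>For fixed \<open>a\<close> umbilicity gives DJ u = \<lambda>(t) J u for all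
  \<open>u\<close> orthogonal to \<open>a\<close>, so the products g(J w1, J u) all solve \<phi>' =
  2 \<lambda> \<phi>. Hence J w1 and J w2 stay orthogonal, and differentiating g(DJ w1, J w2) = 0
  leaves g(R(J w1,p)p, J w2) = 0. Divide by t^2 and let t tend to 0.\<close>

lemma umbilic_orthogonal_triple:
  assumes umb: "\<And>x. x \<in> V \<Longrightarrow> rho x > 0 \<Longrightarrow> rho x < r1 \<Longrightarrow> \<exists>\<mu>. \<forall>v. g x (T x) v = 0 \<longrightarrow> B x v = \<mu> *\<^sub>R v"
    and r1: "r1 > 0"
    and w: "g x0 a w1 = 0" "g x0 a w2 = 0" "g x0 w1 w2 = 0"
  shows "g x0 (Rm x0 w1 a a) w2 = 0"
proof (cases "a = 0 \<or> w1 = 0")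
  case True
  then show ?thesis using linear_0[OF Rm_lin(3)[OF x0U]] linear_0[OF Rm_lin(1)[OF x0U]] by (auto simp: g_0[OF x0U])
next
  case False
  have small: "g x0 (Rm x0 w1 a a) w2 = 0"
    if a: "g x0 a a < r\<^sup>2" "g x0 a a < 2 * r1" "a \<noteq> 0" and w: "g x0 a w1 = 0" "g x0 a w2 = 0" for a
  proof -
    have ab: "a \<in> ball 0 \<delta>" using rball[OF a(1)] .
    have pos: "g x0 a a > 0" using g_pos[OF x0U a(3)] .
    have sc: "g x0 (t *\<^sub>R a) (t *\<^sub>R a) = t\<^sup>2 * g x0 a a" for t by (simp add: g_scale[OF x0U] power2_eq_square)
    have sc2: "g x0 (t *\<^sub>R a) (t *\<^sub>R a) \<le> g x0 a a" if "t \<in> {0..1}" for t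
    proof -
      have "t\<^sup>2 * g x0 a a \<le> 1 * g x0 a a" using that pos by (intro mult_right_mono) (auto simp: power_le_one)
      then show ?thesis unfolding sc by simp
    qed
    \<comment> \<open>The point reached at time \<open>t\<close> is the exponential of
      \<open>t a\<close>. Homogeneity turns the Jacobi fields of \<open>t a\<close> at time 1 into
      those of \<open>a\<close> at time \<open>t\<close>, and the factor 1/t compensates the scaled
      velocity.\<close>
    have "\<exists>\<mu>. \<forall>w. g x0 a w = 0 \<longrightarrow> DJ a t w = \<mu> *\<^sub>R J a t w" if t: "t \<in> {0<..1}" for t
    proof -
      have t': "t \<in> {0..1}" using t by simp
      define b where "b = t *\<^sub>R a"
      have b: "g x0 b b < r\<^sup>2" "g x0 b b > 0" "g x0 b b < 2 * r1"
        using sc2[OF t'] a pos t by (auto simp: b_def) (simp add: sc)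
      note V = qV[OF b(1)]
      have "rho (q b 1) = g x0 b b / 2" by (simp add: rho_def V(2))
      then obtain \<mu> where \<mu>: "\<And>v. g (q b 1) (T (q b 1)) v = 0 \<Longrightarrow> B (q b 1) v = \<mu> *\<^sub>R v"
        using umb[OF V(1)] b by auto
      have "t *\<^sub>R DJ a t w = \<mu> *\<^sub>R J a t w" if w: "g x0 a w = 0" for w
      proof -
        have Jb: "J b 1 (t *\<^sub>R w) = J a t w" and Kb: "K b 1 (t *\<^sub>R w) = t *\<^sub>R K a t w"
          using homogeneous_J[OF ab t'] by (auto simp: b_def)
        have qb: "q b 1 = q a t" and pb: "p b 1 = t *\<^sub>R p a t" using homogeneous[OF ab t' one] by (auto simp: b_def)
        have "g (q b 1) (T (q b 1)) (J b 1 (t *\<^sub>R w)) = 0"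
          using gauss[OF rball[OF b(1)] one, of "t *\<^sub>R w"] w V(2) by (simp add: T_def b_def g_scale[OF x0U])
        from \<mu>[OF this] have "DJ b 1 (t *\<^sub>R w) = \<mu> *\<^sub>R J a t w" using B_J[OF b(1), of "t *\<^sub>R w"] Jb by simp
        moreover have "DJ b 1 (t *\<^sub>R w) = t *\<^sub>R DJ a t w"
          by (simp add: DJ_def Jb Kb pb qb \<Gamma>_lin[OF qU[OF ab t']] algebra_simps)
        ultimately show ?thesis by simp
      qed
      have "DJ a t w = (\<mu> / t) *\<^sub>R J a t w" if "g x0 a w = 0" for w
      proof -
        have "(1 / t) *\<^sub>R (t *\<^sub>R DJ a t w) = (1 / t) *\<^sub>R (\<mu> *\<^sub>R J a t w)"
          using \<open>\<And>w. g x0 a w = 0 \<Longrightarrow> t *\<^sub>R DJ a t w = \<mu> *\<^sub>R J a t w\<close>[OF that] by simp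
        then show ?thesis using t by simp
      qed
      then show ?thesis by blast
    qed
    then obtain lam where lam: "\<And>t w. t \<in> {0<..1} \<Longrightarrow> g x0 a w = 0 \<Longrightarrow> DJ a t w = lam t *\<^sub>R J a t w" by metis
    \<comment> \<open>\<open>J\<close> vanishes to first order at time 0; \<open>j\<close> is the
      continuous quotient J/t, with value \<open>w\<close> at 0.\<close>
    define j where "j w t = J (t *\<^sub>R a) 1 w" for w t
    have Jj: "J a t w = t *\<^sub>R j w t" if "t \<in> {0..1}" for t w
      using homogeneous_J(1)[OF ab that, of w] linear_scale[OF linJ[OF scaled[OF ab that] one]] by (simp add: j_def)
    have cj: "continuous_on {0..1} (j w)" for w
      unfolding j_def by (rule continuous_on_compose2[OF cJ[OF one]]) (use scaled[OF ab] in \<open>auto intro!: continuous_intros\<close>)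
    have j0: "j w 0 = w" for w using at_zero(3)[OF one] by (simp add: j_def)
    have jn: "j w t \<noteq> 0" if "w \<noteq> 0" "t \<in> {0..1}" for w t
    proof -
      have "g x0 (t *\<^sub>R a) (t *\<^sub>R a) < r\<^sup>2" using sc2[OF that(2)] a(1) by simp
      from bij_is_inj[OF bijJ[OF this]] linear_0[OF linJ[OF scaled[OF ab that(2)] one]] that(1)
      show ?thesis unfolding j_def by (metis injD)
    qed
    have cq: "continuous_on {0..1} (q a)" and cp: "continuous_on {0..1} (p a)"
      using dq[OF ab] dp[OF ab] has_vector_derivative_continuous continuous_on_eq_continuous_within by blast+
    have qS: "q a ` {0..1} \<subseteq> U" using qU[OF ab] by blast
    have w1: "w1 \<noteq> 0" using False by simp
    have interior: "(f has_real_derivative D) (at t)" if "(f has_real_derivative D) (at t within {0..1})" "t \<in> {0<..<1}" for f D and t :: real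
      using DERIV_subset[OF that(1), of "{0<..<1}"] unfolding at_within_open[OF that(2) open_greaterThanLessThan]
      by fastforce
    define \<phi> where "\<phi> u t = g (q a t) (J a t w1) (J a t u)" for u t
    have d\<phi>: "(\<phi> u has_real_derivative 2 * lam t * \<phi> u t) (at t)" if u: "g x0 a u = 0" and t: "t \<in> {0<..<1}" for u t
    proof (rule interior[OF _ t])
      have t': "t \<in> {0..1}" "t \<in> {0<..1}" using t by auto
      show "(\<phi> u has_real_derivative 2 * lam t * \<phi> u t) (at t within {0..1})"
        unfolding \<phi>_def
        by (rule DERIV_cong[OF has_vector_derivative_g[OF qU[OF ab t'(1)] dq[OF ab t'(1)] dJ[OF ab t'(1)] dJ[OF ab t'(1)]]])
          (simp add: DJ_def[symmetric] lam[OF t'(2) w(1)] lam[OF t'(2) u] g_scale[OF qU[OF ab t'(1)]])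
    qed
    define f where "f u t = g (q a t) (j w1 t) (j u t)" for u t
    have cf: "continuous_on {0..1} (f u)" for u
      unfolding f_def by (rule continuous_g[OF cq qS cj cj])
    have f\<phi>: "\<phi> u t = t\<^sup>2 * f u t" if "t \<in> {0..1}" for u t
      by (simp add: \<phi>_def f_def Jj[OF that] g_scale[OF qU[OF ab that]] power2_eq_square)
    have fpos: "f w1 t > 0" if "t \<in> {0..1}" for t
      unfolding f_def by (rule g_pos[OF qU[OF ab that] jn[OF w1 that]])
    have f0: "f w2 t = 0" if t: "t \<in> {0<..<1}" for t
    proof -
      \<comment> \<open>Nothing is known about how \<open>lam\<close> depends on time; in the
        quotient its contributions cancel.\<close>
      have "f w2 t / f w1 t = f w2 0 / f w1 0"
      proof (rule DERIV_isconst_end[of 0 t "\<lambda>t. f w2 t / f w1 t"])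
        show "0 < t" using t by simp
        have "f w1 s \<noteq> 0" if "s \<in> {0..t}" for s using fpos[of s] that t by auto
        then show "continuous_on {0..t} (\<lambda>t. f w2 t / f w1 t)"
          using t by (intro continuous_on_divide continuous_on_subset[OF cf]) auto
        fix s assume "0 < s" "s < t"
        then have s: "s \<in> {0<..<1}" "s \<in> {0..1}" using t by auto
        have p1: "\<phi> w1 s \<noteq> 0" using f\<phi>[OF s(2)] fpos[OF s(2)] s(1) by simp
        have "((\<lambda>t. \<phi> w2 t / \<phi> w1 t) has_real_derivative 0) (at s)"
          by (rule DERIV_cong[OF DERIV_divide[OF d\<phi>[OF w(2) s(1)] d\<phi>[OF w(1) s(1)] p1]]) simp
        then show "((\<lambda>t. f w2 t / f w1 t) has_real_derivative 0) (at s)"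
          by (rule has_field_derivative_transform_within_open[of _ _ _ "{0<..<1}"]) (use s f\<phi> in auto)
      qed
      then show ?thesis
        using fpos[of t] t \<open>g x0 w1 w2 = 0\<close> init(1)[OF ab] by (simp add: f_def j0)
    qed
    define F where "F t = g (q a t) (Rm (q a t) (j w1 t) (p a t) (p a t)) (j w2 t)" for t
    have F0: "F t = 0" if t: "t \<in> {0<..<1}" for t
    proof -
      have t': "t \<in> {0..1}" "t \<in> {0<..1}" using t by auto
      note u = qU[OF ab t'(1)]
      let ?\<psi> = "\<lambda>t. g (q a t) (DJ a t w1) (J a t w2)"
      have p0: "\<phi> w2 s = 0" if "s \<in> {0<..<1}" for s using f0[OF that] f\<phi>[of s] that by simp
      have z: "?\<psi> s = 0" if s: "s \<in> {0<..<1}" for s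
        using p0[OF s] lam[of s w1] s w(1) g_scale[OF qU[OF ab]] by (simp add: \<phi>_def)
      have "(?\<psi> has_real_derivative
          g (q a t) ((- Rm (q a t) (J a t w1) (p a t) (p a t) - \<Gamma> (q a t) (p a t) (DJ a t w1)) + \<Gamma> (q a t) (p a t) (DJ a t w1)) (J a t w2)
          + g (q a t) (DJ a t w1) (K a t w2 + \<Gamma> (q a t) (p a t) (J a t w2))) (at t)"
        by (rule interior[OF has_vector_derivative_g[OF u dq[OF ab t'(1)] jacobi[OF ab t'(1)] dJ[OF ab t'(1)]] t])
      moreover have "(?\<psi> has_real_derivative 0) (at t)"
        by (rule has_field_derivative_transform_within_open[of "\<lambda>_. 0" _ _ "{0<..<1}"]) (use t z in auto)
      ultimately have "- g (q a t) (Rm (q a t) (J a t w1) (p a t) (p a t)) (J a t w2) + g (q a t) (DJ a t w1) (DJ a t w2) = 0"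
        using DERIV_unique by (fastforce simp: DJ_def[symmetric] g_neg[OF u])
      moreover have "g (q a t) (DJ a t w1) (DJ a t w2) = 0"
        using p0[OF t] by (simp add: lam[OF t'(2) w(1)] lam[OF t'(2) w(2)] g_scale[OF u] \<phi>_def)
      ultimately have "t\<^sup>2 * F t = 0"
        by (simp add: F_def Jj[OF t'(1)] linear_scale[OF Rm_lin(1)[OF u]] g_scale[OF u] power2_eq_square)
      then show ?thesis using t by simp
    qed
    \<comment> \<open>\<open>F\<close> vanishes on the open interval and is continuous up to 0,
      where its value is the curvature term at \<open>x0\<close>.\<close>
    have "continuous_on (closure {0<..<1}) F"
      unfolding F_def by (simp add: continuous_g[OF cq qS continuous_Rm[OF cq qS cj cp cp] cj])
    from continuous_constant_on_closure[OF this F0, of 0]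
    have "F 0 = 0" by simp
    then show ?thesis using init[OF ab] by (simp add: F_def j0)
  qed
  \<comment> \<open>The claim is homogeneous in \<open>a\<close>, which is scaled until its squared
    length is half of the smaller of the two bounds.\<close>
  define s where "s = sqrt (min (r\<^sup>2) (2 * r1) / (2 * g x0 a a))"
  have pos: "g x0 a a > 0" using False g_pos[OF x0U] by blast
  have m: "min (r\<^sup>2) (2 * r1) > 0" using r r1 by simp
  have s: "s > 0" unfolding s_def using pos m by (simp del: min_less_iff_conj)
  have s2: "s\<^sup>2 = min (r\<^sup>2) (2 * r1) / (2 * g x0 a a)"
    unfolding s_def using pos m by (intro real_sqrt_pow2) (simp del: min_less_iff_conj)
  have "g x0 (s *\<^sub>R a) (s *\<^sub>R a) = s\<^sup>2 * g x0 a a" by (simp add: g_scale[OF x0U] power2_eq_square)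
  also have "\<dots> = min (r\<^sup>2) (2 * r1) / 2" unfolding s2 using pos by simp
  also have "\<dots> < min (r\<^sup>2) (2 * r1)" using m by linarith
  finally have "g x0 (Rm x0 w1 (s *\<^sub>R a) (s *\<^sub>R a)) w2 = 0"
    using False s w by (intro small) (auto simp: g_scale[OF x0U])
  then show ?thesis
    using s by (simp add: linear_scale[OF Rm_lin(2)[OF x0U]] linear_scale[OF Rm_lin(3)[OF x0U]] g_scale[OF x0U])
qed

end

section \<open>Algebra of the curvature tensor at one point\<close>

context local_metric
begin

text \<open>The conditions are Euclidean orthogonality to the two vectors that represent g(a,_) and
  g(b,_), which span at most a plane.\<close>

lemma g_orthogonal_exists:
  assumes x: "x \<in> U" and dim: "DIM('e) \<ge> 3"
  obtains c where "c \<noteq> 0" "g x a c = 0" "g x b c = 0"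
proof -
  define G where "G u = (\<Sum>b\<in>Basis. g x u b *\<^sub>R b)" for u
  have G: "g x u w = G u \<bullet> w" for u w
  proof -
    have "linear (g x u)" using g_bil[OF x] by (simp add: bilinear_def)
    from linear_expand[OF this, of w] show ?thesis
      unfolding G_def inner_sum_left by (simp add: inner_commute[of _ w] mult.commute)
  qed
  have "dim {G a, G b} \<le> card {G a, G b}" by (intro dim_le_card') simp
  also have "\<dots> \<le> 2" by (simp add: card_insert_if)
  finally have "dim {G a, G b} < DIM('e)" using dim by simp
  then obtain c where "c \<noteq> 0" "\<And>y. y \<in> span {G a, G b} \<Longrightarrow> orthogonal c y"
    using orthogonal_to_subspace_exists by blast
  moreover have "G a \<in> span {G a, G b}" "G b \<in> span {G a, G b}" by (simp_all add: span_base)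
  ultimately have "orthogonal c (G a)" "orthogonal c (G b)" by blast+
  then show thesis
    using that[OF \<open>c \<noteq> 0\<close>] by (simp add: G orthogonal_def inner_commute[of c])
qed

text \<open>On the complement of \<open>a\<close> the self-adjoint operator R(_,a)a has, by
  hypothesis, every nonzero vector as an eigenvector, hence a single eigenvalue. Divided by g(a,a)
  it is symmetric in orthogonal pairs, and in dimension at least 3 any two vectors have a common
  orthogonal one.\<close>

lemma curv_const_of_triples:
  assumes x: "x \<in> U" and dim: "DIM('e) \<ge> 3"
    and tr: "\<And>a w1 w2. g x a w1 = 0 \<Longrightarrow> g x a w2 = 0 \<Longrightarrow> g x w1 w2 = 0 \<Longrightarrow> g x (Rm x w1 a a) w2 = 0"
  shows "\<exists>k. curv_const k x"
proof -
  have skew: "g x (Rm x w a a) a = 0" for w a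
    using Rm_skew[OF x, of w a a a] g_sym[OF x, of a "Rm x w a a"] by simp
  have self: "g x (Rm x w a a) w' = g x w (Rm x w' a a)" for w w' a
    using Rm_pair_sym[OF x, of w a a w'] Rm_skew[OF x, of a w' w a] Rm_antisym[of x a w' a]
    by (simp add: g_lin[OF x])
  have swap: "g x (Rm x w a a) w = g x (Rm x a w w) a" for w a
    using Rm_skew[OF x, of w a a w] Rm_antisym[of x w a w] g_sym[OF x, of a] by (simp add: g_lin[OF x])
  define l where "l a w = g x (Rm x w a a) w / g x w w" for a w
  have eig: "Rm x w a a = l a w *\<^sub>R w" if "g x a w = 0" "w \<noteq> 0" for a w
  proof -
    \<comment> \<open>The part of R(w,a)a orthogonal to \<open>w\<close>; the hypothesis for the
      pair \<open>w\<close>, \<open>z\<close> shows that it is null.\<close>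
    define z where "z = Rm x w a a - l a w *\<^sub>R w"
    have wz: "g x w z = 0"
      using g_pos[OF x that(2)] g_sym[OF x, of w "Rm x w a a"] by (simp add: z_def g_lin[OF x] l_def)
    have "g x a z = 0" using skew[of w a] g_sym[OF x, of a "Rm x w a a"] that(1) by (simp add: z_def g_lin[OF x])
    from tr[OF that(1) this wz] have "g x (z + l a w *\<^sub>R w) z = 0" by (simp add: z_def)
    then have "g x z z = 0" using wz by (simp add: g_lin[OF x])
    then show ?thesis using g_zero[OF x] by (simp add: z_def)
  qed
  have l1: "l a w = l a w'" if "g x a w = 0" "w \<noteq> 0" "g x a w' = 0" "w' \<noteq> 0" "g x w w' \<noteq> 0" for a w w'
    using self[of w a w'] that by (simp add: eig g_lin[OF x])
  \<comment> \<open>Orthogonal eigenvectors are compared through their sum, which is orthogonal to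
    neither.\<close>
  have l2: "l a w = l a w'" if "g x a w = 0" "w \<noteq> 0" "g x a w' = 0" "w' \<noteq> 0" for a w w'
  proof (cases "g x w w' = 0")
    case True
    have *: "g x w (w + w') \<noteq> 0" "g x (w + w') w' \<noteq> 0" "g x a (w + w') = 0"
      using True that g_pos[OF x that(2)] g_pos[OF x that(4)] by (auto simp: g_lin[OF x])
    then have "w + w' \<noteq> 0" by (auto simp: g_0[OF x])
    then show ?thesis using l1[of a w "w + w'"] l1[of a "w + w'" w'] * that by simp
  qed (use l1 that in blast)
  define \<kappa> where "\<kappa> a = l a (SOME w. w \<noteq> 0 \<and> g x a w = 0) / g x a a" for a
  have \<kappa>: "Rm x w a a = (\<kappa> a * g x a a) *\<^sub>R w" if "g x a w = 0" "a \<noteq> 0" for a w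
  proof (cases "w = 0")
    case True
    then show ?thesis using linear_0[OF Rm_lin(1)[OF x]] by simp
  next
    case False
    have "\<exists>w. w \<noteq> 0 \<and> g x a w = 0" using False that by blast
    from someI_ex[OF this] have "l a w = \<kappa> a * g x a a"
      using l2[of a w "SOME w. w \<noteq> 0 \<and> g x a w = 0"] that False g_pos[OF x that(2)] by (simp add: \<kappa>_def)
    then show ?thesis using eig[OF that(1) False] by simp
  qed
  have \<kappa>1: "\<kappa> a = \<kappa> b" if "g x a b = 0" "a \<noteq> 0" "b \<noteq> 0" for a b
    using swap[of b a] \<kappa>[OF that(1,2)] \<kappa>[of b a] that g_sym[OF x, of b a] g_pos[OF x that(2)] g_pos[OF x that(3)]
    by (simp add: g_lin[OF x])
  have \<kappa>2: "\<kappa> a = \<kappa> b" if "a \<noteq> 0" "b \<noteq> 0" for a b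
  proof -
    obtain c where c: "c \<noteq> 0" "g x a c = 0" "g x b c = 0" using g_orthogonal_exists[OF x dim] by blast
    then show ?thesis using \<kappa>1[of a c] \<kappa>1[of b c] that by simp
  qed
  obtain b0 :: 'e where b0: "b0 \<noteq> 0" using nonzero_Basis nonempty_Basis by blast
  show ?thesis
  proof (intro exI curv_constI[OF x])
    fix u v
    show "Rm x u v v = \<kappa> b0 *\<^sub>R (g x v v *\<^sub>R u - g x u v *\<^sub>R v)"
    proof (cases "v = 0")
      case True
      then show ?thesis using linear_0[OF Rm_lin(3)[OF x]] by (simp add: g_0[OF x])
    next
      case False
      define c where "c = g x u v / g x v v"
      have pos: "g x v v > 0" using g_pos[OF x False] .
      have "g x v (u - c *\<^sub>R v) = 0" using pos g_sym[OF x, of v u] by (simp add: g_lin[OF x] c_def)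
      from \<kappa>[OF this False] have 1: "Rm x (u - c *\<^sub>R v) v v = (\<kappa> b0 * g x v v) *\<^sub>R (u - c *\<^sub>R v)"
        using \<kappa>2[OF False b0] by simp
      have "Rm x v v v = 0" using Rm_antisym[of x v v v] by (simp add: eq_neg_iff_add_eq_0 flip: scaleR_2)
      then have "Rm x (u - c *\<^sub>R v) v v = Rm x u v v"
        by (simp add: linear_diff[OF Rm_lin(1)[OF x]] linear_scale[OF Rm_lin(1)[OF x]])
      moreover have "(\<kappa> b0 * g x v v) *\<^sub>R (u - c *\<^sub>R v) = \<kappa> b0 *\<^sub>R (g x v v *\<^sub>R u - g x u v *\<^sub>R v)"
        using pos by (simp add: c_def scaleR_diff_right)
      ultimately show ?thesis using 1 by simp
    qed
  qed
qed

end

section \<open>Charts and curves\<close>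

text \<open>The topological part of being a chart, shared by the atlas of a manifold and by the
  charts of a hypersurface in its subspace topology.\<close>

definition top_chart :: "'a topology \<Rightarrow> ('a, 'e::euclidean_space) chart \<Rightarrow> bool" where
  "top_chart X c \<longleftrightarrow> openin X (chart_dom c) \<and> open (chart_range c) \<and>
     homeomorphic_map (subtopology X (chart_dom c)) (top_of_set (chart_range c)) (chart_map c)"

context
  fixes X :: "'a topology" and c :: "('a, 'e::euclidean_space) chart"
  assumes c: "top_chart X c"
begin

lemma dom_subset: "chart_dom c \<subseteq> topspace X"
  using c openin_subset unfolding top_chart_def by blast

lemma topspace_dom: "topspace (subtopology X (chart_dom c)) = chart_dom c"
  using dom_subset by auto

lemma chart_inj: "inj_on (chart_map c) (chart_dom c)"
  using c homeomorphic_imp_injective_map topspace_dom unfolding top_chart_def by metis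

lemma chart_inv_left: "p \<in> chart_dom c \<Longrightarrow> chart_inv c (chart_map c p) = p"
  unfolding chart_inv_def by (rule inv_into_f_f[OF chart_inj])

lemma chart_inv_right:
  assumes "y \<in> chart_range c"
  shows "chart_inv c y \<in> chart_dom c" "chart_map c (chart_inv c y) = y"
  unfolding chart_inv_def using assms by (rule inv_into_into, rule f_inv_into_f)

lemma open_chart_image:
  assumes "openin X W"
  shows "open (chart_map c ` (chart_dom c \<inter> W))"
proof -
  have "open_map (subtopology X (chart_dom c)) (top_of_set (chart_range c)) (chart_map c)"
    using c homeomorphic_imp_open_map unfolding top_chart_def by blast
  moreover have "openin (subtopology X (chart_dom c)) (chart_dom c \<inter> W)"
    using assms by (metis inf_commute openin_subtopology_Int)
  ultimately have "openin (top_of_set (chart_range c)) (chart_map c ` (chart_dom c \<inter> W))"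
    unfolding open_map_def by blast
  then show ?thesis using c openin_open_trans unfolding top_chart_def by blast
qed

lemma continuous_chart_map: "continuous_map (subtopology X (chart_dom c)) euclidean (chart_map c)"
  using c homeomorphic_imp_continuous_map continuous_map_into_fulltopology unfolding top_chart_def by blast

lemma continuous_chart_inv: "continuous_map (top_of_set (chart_range c)) X (chart_inv c)"
proof -
  obtain f where f: "homeomorphic_maps (subtopology X (chart_dom c)) (top_of_set (chart_range c)) (chart_map c) f"
    using c homeomorphic_map_maps unfolding top_chart_def by blast
  have cf: "continuous_map (top_of_set (chart_range c)) (subtopology X (chart_dom c)) f"
    using f unfolding homeomorphic_maps_def by blast
  have eq: "f y = chart_inv c y" if "y \<in> topspace (top_of_set (chart_range c))" for y
  proof -
    have y: "y \<in> chart_range c" using that by simp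
    then have "f (chart_map c (chart_inv c y)) = chart_inv c y"
      using f chart_inv_right(1)[OF y] topspace_dom unfolding homeomorphic_maps_def by blast
    then show ?thesis using chart_inv_right(2)[OF y] by simp
  qed
  show ?thesis
    by (rule continuous_map_into_fulltopology[OF continuous_map_eq[OF cf eq]])
qed

text \<open>Preimages of open sets are relatively open in \<open>I\<close>, so the germ of the curve
  at \<open>s\<close> can be computed in one chart, also at an endpoint.\<close>

lemma curve_in_chart:
  assumes "continuous_map (top_of_set I) X \<alpha>" "s \<in> I" "\<alpha> s \<in> chart_dom c"
  shows "\<forall>\<^sub>F t in at s within I. t \<in> I \<and> \<alpha> t \<in> chart_dom c"
    and "((\<lambda>t. chart_map c (\<alpha> t)) \<longlongrightarrow> chart_map c (\<alpha> s)) (at s within I)"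
proof -
  have "openin X (chart_dom c)" using c unfolding top_chart_def by blast
  from openin_continuous_map_preimage[OF assms(1) this]
  have o: "openin (top_of_set I) {t \<in> I. \<alpha> t \<in> chart_dom c}" by simp
  then obtain T where T: "open T" "{t \<in> I. \<alpha> t \<in> chart_dom c} = I \<inter> T" unfolding openin_open by blast
  then have sT: "s \<in> T" using assms by blast
  have "\<forall>\<^sub>F t in at s within I. t \<in> I \<inter> T"
    using T(1) sT by (auto simp: eventually_at_topological)
  then show 1: "\<forall>\<^sub>F t in at s within I. t \<in> I \<and> \<alpha> t \<in> chart_dom c"
    by eventually_elim (use T(2) in blast)
  define A where "A = I \<inter> T"
  have "continuous_map (top_of_set A) (subtopology X (chart_dom c)) \<alpha>"
  proof (rule continuous_map_into_subtopology)
    show "continuous_map (top_of_set A) X \<alpha>"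
      using continuous_map_from_subtopology[OF assms(1), of A] by (simp add: subtopology_subtopology A_def inf.assoc[symmetric])
    show "\<alpha> \<in> topspace (top_of_set A) \<rightarrow> chart_dom c" using T(2) by (auto simp: A_def)
  qed
  from continuous_map_compose[OF this continuous_chart_map]
  have "continuous_on A (\<lambda>t. chart_map c (\<alpha> t))" by (simp add: o_def)
  then have "((\<lambda>t. chart_map c (\<alpha> t)) \<longlongrightarrow> chart_map c (\<alpha> s)) (at s within A)"
    using sT assms(2) unfolding continuous_on_def A_def by blast
  moreover have "at s within A = at s within I"
    unfolding A_def by (rule at_within_nhd[OF sT T(1)]) auto
  ultimately show "((\<lambda>t. chart_map c (\<alpha> t)) \<longlongrightarrow> chart_map c (\<alpha> s)) (at s within I)" by simp
qed

end

lemma nondegenerate_at_within: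
  assumes "nondegenerate_interval I" "s \<in> I"
  shows "at s within I \<noteq> bot"
proof -
  have "connected I" using assms is_interval_connected unfolding nondegenerate_interval_def by blast
  moreover have "I \<noteq> {x}" for x using assms unfolding nondegenerate_interval_def by force
  ultimately have "s islimpt I" using connected_imp_perfect assms(2) by blast
  then show ?thesis by (simp add: trivial_limit_within)
qed

text \<open>Just enough structure to compute velocities and accelerations in charts. It covers both
  the manifold and the atlas of a hypersurface, where only differentiability of the transitions has
  to be verified.\<close>

locale diff_atlas =
  fixes X :: "('a, 'e::euclidean_space) riem"
  assumes chart: "\<And>c. c \<in> atlas X \<Longrightarrow> top_chart (mtop X) c"
    and cover: "\<And>p. p \<in> points X \<Longrightarrow> \<exists>c\<in>atlas X. p \<in> chart_dom c"
    and trans_diff: "\<And>c d p. c \<in> atlas X \<Longrightarrow> d \<in> atlas X \<Longrightarrow> p \<in> chart_dom c \<Longrightarrow> p \<in> chart_dom d \<Longrightarrow>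
      transition c d differentiable (at (chart_map c p))"
begin

lemma chart_at: "p \<in> points X \<Longrightarrow> chart_at X p \<in> atlas X" "p \<in> points X \<Longrightarrow> p \<in> chart_dom (chart_at X p)"
  unfolding chart_at_def using someI_ex[of "\<lambda>c. c \<in> atlas X \<and> p \<in> chart_dom c"] cover by blast+

lemma transition_at: "c \<in> atlas X \<Longrightarrow> p \<in> chart_dom c \<Longrightarrow> transition c d (chart_map c p) = chart_map d p"
  by (simp add: transition_def chart_inv_left[OF chart])

lemma dtrans:
  "c \<in> atlas X \<Longrightarrow> d \<in> atlas X \<Longrightarrow> p \<in> chart_dom c \<Longrightarrow> p \<in> chart_dom d \<Longrightarrow>
    (transition c d has_derivative FD (transition c d) (chart_map c p)) (at (chart_map c p))"
  using trans_diff frechet_derivative_works by blast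

lemma FD_trans_compose:
  assumes c: "c \<in> atlas X" "d \<in> atlas X" "e \<in> atlas X" and p: "p \<in> chart_dom c" "p \<in> chart_dom d" "p \<in> chart_dom e"
  shows "FD (transition d e) (chart_map d p) (FD (transition c d) (chart_map c p) v) = FD (transition c e) (chart_map c p) v"
proof -
  have "openin (mtop X) (chart_dom d)" using chart[OF c(2)] unfolding top_chart_def by blast
  then have o: "open (chart_map c ` (chart_dom c \<inter> chart_dom d))" by (rule open_chart_image[OF chart[OF c(1)]])
  have "((\<lambda>x. transition d e (transition c d x)) has_derivative
    (\<lambda>v. FD (transition d e) (chart_map d p) (FD (transition c d) (chart_map c p) v))) (at (chart_map c p))"
    using dtrans[OF c(2,3) p(2,3)] transition_at[OF c(1) p(1), of d]
    by (intro has_derivative_compose[OF dtrans[OF c(1,2) p(1,2)]]) simp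
  then have "(transition c e has_derivative
    (\<lambda>v. FD (transition d e) (chart_map d p) (FD (transition c d) (chart_map c p) v))) (at (chart_map c p))"
    by (rule has_derivative_transform_within_open[OF _ o])
      (use p in \<open>auto simp: transition_at[OF c(1)] transition_at[OF c(2)]\<close>)
  then show ?thesis by (simp add: FD_eq)
qed

lemma FD_trans_self:
  assumes c: "c \<in> atlas X" and p: "p \<in> chart_dom c"
  shows "FD (transition c c) (chart_map c p) v = v"
proof -
  have "open (chart_range c)" using chart[OF c] unfolding top_chart_def by blast
  then have "(transition c c has_derivative (\<lambda>v. v)) (at (chart_map c p))"
    by (rule has_derivative_transform_within_open[OF has_derivative_ident]) (use p in \<open>auto simp: transition_at[OF c]\<close>)
  then show ?thesis by (simp add: FD_eq)
qed

lemma FD_trans_inverse: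
  assumes c: "c \<in> atlas X" "d \<in> atlas X" and p: "p \<in> chart_dom c" "p \<in> chart_dom d"
  shows "FD (transition d c) (chart_map d p) (FD (transition c d) (chart_map c p) v) = v"
  using FD_trans_compose[OF c c(1) p p(1)] FD_trans_self[OF c(1) p(1)] by simp

lemma components_chart:
  assumes "c \<in> atlas X" "d \<in> atlas X" "p \<in> chart_dom c" "p \<in> chart_dom d"
  shows "components X d p (FD (transition c (chart_at X p)) (chart_map c p) v) = FD (transition c d) (chart_map c p) v"
proof -
  have "p \<in> points X" using dom_subset[OF chart[OF assms(1)]] assms(3) by blast
  then show ?thesis
    unfolding components_def coords_def using FD_trans_compose[OF assms(1) chart_at(1) assms(2,3) chart_at(2) assms(4)] by simp
qed

context
  fixes I \<alpha>
  assumes I: "nondegenerate_interval I" and \<alpha>: "C2_curve X I \<alpha>"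
begin

lemma curve_points: "s \<in> I \<Longrightarrow> \<alpha> s \<in> points X"
  using \<alpha> continuous_map_funspace[of "top_of_set I" "mtop X" \<alpha>] unfolding C2_curve_def by auto

lemma curve_derivatives:
  assumes "c \<in> atlas X"
  obtains v a where "\<And>s. s \<in> I \<Longrightarrow> \<alpha> s \<in> chart_dom c \<Longrightarrow> ((\<lambda>t. chart_map c (\<alpha> t)) has_vector_derivative v s) (at s within I)"
    "\<And>s. s \<in> I \<Longrightarrow> \<alpha> s \<in> chart_dom c \<Longrightarrow> (v has_vector_derivative a s) (at s within I)"
    "continuous_on {s \<in> I. \<alpha> s \<in> chart_dom c} a"
proof -
  from \<alpha> assms obtain v a where "\<forall>s\<in>I. \<alpha> s \<in> chart_dom c \<longrightarrow>
           ((chart_map c \<circ> \<alpha>) has_vector_derivative v s) (at s within I) \<and>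
           (v has_vector_derivative a s) (at s within I)" "continuous_on {s\<in>I. \<alpha> s \<in> chart_dom c} a"
    unfolding C2_curve_def by blast
  then show thesis by (intro that[of v a]) (auto simp: o_def)
qed

text \<open>\<open>velocity\<close> refers to the chart chosen at each point, which jumps along the
  curve; this passes to a fixed chart, where the velocity is the derivative of the
  coordinates.\<close>

lemma components_velocity:
  assumes c: "c \<in> atlas X" and s: "s \<in> I" "\<alpha> s \<in> chart_dom c"
    and v: "((\<lambda>t. chart_map c (\<alpha> t)) has_vector_derivative v) (at s within I)"
  shows "components X c (\<alpha> s) (velocity X I \<alpha> s) = v"
    and "velocity X I \<alpha> s = FD (transition c (chart_at X (\<alpha> s))) (chart_map c (\<alpha> s)) v"
proof -
  note p = curve_points[OF s(1)]
  note d = chart_at[OF p]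
  have ca: "continuous_map (top_of_set I) (mtop X) \<alpha>" using \<alpha> unfolding C2_curve_def by blast
  have "((\<lambda>t. transition c (chart_at X (\<alpha> s)) (chart_map c (\<alpha> t))) has_vector_derivative
      FD (transition c (chart_at X (\<alpha> s))) (chart_map c (\<alpha> s)) v) (at s within I)"
    using has_derivative_compose[OF v[unfolded has_vector_derivative_def] dtrans[OF c d(1) s(2) d(2)]]
      linear_scale[OF has_derivative_linear[OF dtrans[OF c d(1) s(2) d(2)]]]
    by (simp add: has_vector_derivative_def)
  moreover have "\<forall>\<^sub>F t in at s within I. transition c (chart_at X (\<alpha> s)) (chart_map c (\<alpha> t)) = chart_map (chart_at X (\<alpha> s)) (\<alpha> t)"
    using curve_in_chart(1)[OF chart[OF c] ca s] by eventually_elim (simp add: transition_at[OF c])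
  ultimately have "((\<lambda>t. chart_map (chart_at X (\<alpha> s)) (\<alpha> t)) has_vector_derivative
      FD (transition c (chart_at X (\<alpha> s))) (chart_map c (\<alpha> s)) v) (at s within I)"
    unfolding has_vector_derivative_def
    by (rule has_derivative_transform_eventually) (use s in \<open>auto simp: transition_at[OF c]\<close>)
  from vector_derivative_within[OF nondegenerate_at_within[OF I s(1)] this]
  show vel: "velocity X I \<alpha> s = FD (transition c (chart_at X (\<alpha> s))) (chart_map c (\<alpha> s)) v"
    unfolding velocity_def o_def .
  show "components X c (\<alpha> s) (velocity X I \<alpha> s) = v"
    unfolding vel using components_chart[OF c c s(2) s(2)] FD_trans_self[OF c s(2)] by simp
qed

text \<open>All nearby velocities are converted into the single chart chosen at \<alpha> s, where
  they form the coordinate derivative \<open>v\<close>.\<close>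

lemma acceleration_chart_at:
  assumes s: "s \<in> I" and c: "c = chart_at X (\<alpha> s)"
    and v: "\<And>t. t \<in> I \<Longrightarrow> \<alpha> t \<in> chart_dom c \<Longrightarrow> ((\<lambda>t. chart_map c (\<alpha> t)) has_vector_derivative v t) (at t within I)"
    and a: "(v has_vector_derivative a) (at s within I)"
  shows "acceleration X I \<alpha> s = a + christoffel X c (chart_map c (\<alpha> s)) (v s) (v s)"
    and "velocity X I \<alpha> s = v s"
proof -
  note p = curve_points[OF s]
  have ca: "c \<in> atlas X" "\<alpha> s \<in> chart_dom c" using chart_at[OF p] c by auto
  have cont: "continuous_map (top_of_set I) (mtop X) \<alpha>" using \<alpha> unfolding C2_curve_def by blast
  have "\<forall>\<^sub>F t in at s within I. v t = components X c (\<alpha> t) (velocity X I \<alpha> t)"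
    using curve_in_chart(1)[OF chart[OF ca(1)] cont s ca(2)]
    by eventually_elim (rule components_velocity(1)[OF ca(1) _ _ v, symmetric], auto)
  with a have "((\<lambda>t. components X c (\<alpha> t) (velocity X I \<alpha> t)) has_vector_derivative a) (at s within I)"
    unfolding has_vector_derivative_def
    by (elim has_derivative_transform_eventually) (use s components_velocity(1)[OF ca(1) s ca(2) v[OF s ca(2)]] in auto)
  from vector_derivative_within[OF nondegenerate_at_within[OF I s] this]
  have 1: "vector_derivative (\<lambda>t. components X c (\<alpha> t) (velocity X I \<alpha> t)) (at s within I) = a" .
  show 2: "velocity X I \<alpha> s = v s"
    using components_velocity(2)[OF ca(1) s ca(2) v[OF s ca(2)]] FD_trans_self[OF ca] c by simp
  show "acceleration X I \<alpha> s = a + christoffel X c (chart_map c (\<alpha> s)) (v s) (v s)"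
    unfolding covariant_derivative_def Let_def coords_def c[symmetric] 1 2 ..
qed

end

end

section \<open>Change of coordinates\<close>

text \<open>A transition map between charts, seen as a local isometry of Euclidean domains. Class
  C^3 allows the transformation law of \<Gamma>, which contains second derivatives of \<tau>, to be
  differentiated once more, as the law for the curvature requires.\<close>

locale isometry = A: local_metric U g + B: local_metric U' g'
  for U U' :: "'e::euclidean_space set" and g g' +
  fixes W :: "'e set" and \<tau> :: "'e \<Rightarrow> 'e"
  assumes openW: "open W" and WU: "W \<subseteq> U" and \<tau>U': "\<tau> ` W \<subseteq> U'"
    and C3: "Ck_on (Suc (Suc (Suc 0))) \<tau> W"
    and iso: "\<And>x u v. x \<in> W \<Longrightarrow> g x u v = g' (\<tau> x) (FD \<tau> x u) (FD \<tau> x v)"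
begin

lemma dt: "x \<in> W \<Longrightarrow> (\<tau> has_derivative FD \<tau> x) (at x)"
  by (rule Ck_on_has_derivative[OF C3 openW])

lemma ddt: "x \<in> W \<Longrightarrow> ((\<lambda>x. FD \<tau> x u) has_derivative FD (\<lambda>x. FD \<tau> x u) x) (at x)"
  by (rule Ck_on_has_derivative[OF Ck_on_FD[OF C3] openW])

lemma inU: "x \<in> W \<Longrightarrow> x \<in> U" "x \<in> W \<Longrightarrow> \<tau> x \<in> U'"
  using WU \<tau>U' by blast+

lemma lin: "x \<in> W \<Longrightarrow> linear (FD \<tau> x)"
  using has_derivative_linear[OF dt] .

lemma inj: "x \<in> W \<Longrightarrow> inj (FD \<tau> x)"
proof -
  assume x: "x \<in> W"
  have "v = 0" if "FD \<tau> x v = 0" for v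
    using iso[OF x, of v v] that A.g_zero[OF inU(1)[OF x]] B.g_0[OF inU(2)[OF x]] by simp
  then show ?thesis using linear_injective_0[OF lin[OF x]] by blast
qed

lemma bij: "x \<in> W \<Longrightarrow> bij (FD \<tau> x)"
  using inj linear_injective_imp_surjective[OF lin inj] by (simp add: bij_def)

lemma D2_sym: "x \<in> W \<Longrightarrow> FD (\<lambda>y. FD \<tau> y u) x v = FD (\<lambda>y. FD \<tau> y v) x u"
  by (rule Ck_on_symmetric[OF openW C3])

lemma D2_bil: "x \<in> W \<Longrightarrow> bilinear (\<lambda>u v. FD (\<lambda>y. FD \<tau> y u) x v)"
proof -
  assume x: "x \<in> W"
  have l: "linear (\<lambda>v. FD (\<lambda>y. FD \<tau> y u) x v)" for u using has_derivative_linear[OF ddt[OF x]] .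
  have "linear (\<lambda>u. FD (\<lambda>y. FD \<tau> y u) x v)" for v
  proof -
    have "(\<lambda>u. FD (\<lambda>y. FD \<tau> y u) x v) = (\<lambda>u. FD (\<lambda>y. FD \<tau> y v) x u)"
      by (rule ext) (rule D2_sym[OF x])
    then show ?thesis using l[of v] by (simp only:)
  qed
  then show ?thesis using l unfolding bilinear_def by blast
qed

text \<open>The pulled back connection \<open>G\<close>, including the inhomogeneous term with the
  second derivative of \<tau>, has the three defining properties for \<open>g\<close>; uniqueness
  identifies it.\<close>

lemma chris_transform:
  assumes x: "x \<in> W"
  shows "FD \<tau> x (A.\<Gamma> x u v) = B.\<Gamma> (\<tau> x) (FD \<tau> x u) (FD \<tau> x v) + FD (\<lambda>y. FD \<tau> y v) x u"
proof -
  note lf = lin[OF x] and y = inU(2)[OF x]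
  define G where "G u v = inv (FD \<tau> x) (B.\<Gamma> (\<tau> x) (FD \<tau> x u) (FD \<tau> x v) + FD (\<lambda>y. FD \<tau> y v) x u)" for u v
  have G: "FD \<tau> x (G u v) = B.\<Gamma> (\<tau> x) (FD \<tau> x u) (FD \<tau> x v) + FD (\<lambda>y. FD \<tau> y v) x u" for u v
    unfolding G_def by (rule surj_f_inv_f[OF bij_is_surj[OF bij[OF x]]])
  have eqI: "a = b" if "FD \<tau> x a = FD \<tau> x b" for a b using inj[OF x] that by (rule injD)
  note bl = bilinear_ladd[OF D2_bil[OF x]] bilinear_radd[OF D2_bil[OF x]] bilinear_lmul[OF D2_bil[OF x]] bilinear_rmul[OF D2_bil[OF x]]
  have "bilinear G"
    unfolding bilinear_def
    by (intro conjI allI linearI; rule eqI;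
        simp add: G linear_add[OF lf] linear_scale[OF lf] B.\<Gamma>_lin[OF y] bl algebra_simps)
  moreover have "G u v = G v u" for u v
    by (rule eqI) (simp add: G B.\<Gamma>_sym[OF y, of "FD \<tau> x u"] D2_sym[OF x, of u v])
  moreover have "FD (\<lambda>y. g y u v) x w = g x (G w u) v + g x u (G w v)" for u v w
  proof -
    have "FD (\<lambda>y. g y u v) x = FD (\<lambda>y. g' (\<tau> y) (FD \<tau> y u) (FD \<tau> y v)) x"
      by (rule FD_cong[OF openW x iso])
    moreover have "((\<lambda>y. g' (\<tau> y) (FD \<tau> y u) (FD \<tau> y v)) has_derivative (\<lambda>w.
        g' (\<tau> x) (FD (\<lambda>y. FD \<tau> y u) x w + B.\<Gamma> (\<tau> x) (FD \<tau> x w) (FD \<tau> x u)) (FD \<tau> x v)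
        + g' (\<tau> x) (FD \<tau> x u) (FD (\<lambda>y. FD \<tau> y v) x w + B.\<Gamma> (\<tau> x) (FD \<tau> x w) (FD \<tau> x v)))) (at x)"
      by (rule B.has_derivative_g[OF y dt[OF x] ddt[OF x] ddt[OF x]])
    ultimately show ?thesis by (simp add: FD_eq iso[OF x] G add.commute)
  qed
  ultimately have "levi_civita g x G" unfolding levi_civita_def by blast
  then have "A.\<Gamma> x = G" by (rule chris_eqI[of g, OF A.posdef_g[OF inU(1)[OF x]]])
  then show ?thesis by (simp add: G)
qed

text \<open>Push-forward of a field along a map commutes with covariant differentiation. The second
  derivative of \<tau> is eliminated by \<open>chris_transform\<close>, so only Christoffel symbols
  appear.\<close>

lemma covariant_derivative_transform:
  assumes x: "X z \<in> W" "(X has_derivative X') (at z within S)" and V: "(V has_derivative V') (at z within S)"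
  shows "((\<lambda>z. FD \<tau> (X z) (V z)) has_derivative
    (\<lambda>h. FD \<tau> (X z) (V' h + A.\<Gamma> (X z) (X' h) (V z)) - B.\<Gamma> (\<tau> (X z)) (FD \<tau> (X z) (X' h)) (FD \<tau> (X z) (V z)))) (at z within S)"
proof -
  \<comment> \<open>The dummy real argument turns the family of linear maps into one of bilinear
    maps, to which the product rule applies.\<close>
  have bil: "bilinear (\<lambda>v (r::real). r *\<^sub>R FD \<tau> x v)" if "x \<in> W" for x
    unfolding bilinear_def using lin[OF that]
    by (auto intro!: linearI simp: linear_add linear_scale scaleR_add_left scaleR_add_right)
  have d: "((\<lambda>x. (r::real) *\<^sub>R FD \<tau> x v) has_derivative (\<lambda>h. r *\<^sub>R FD (\<lambda>y. FD \<tau> y v) (X z) h)) (at (X z))" for r v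
    by (rule has_derivative_scaleR_right[OF ddt[OF x(1)]])
  have "((\<lambda>z. (1::real) *\<^sub>R FD \<tau> (X z) (V z)) has_derivative
     (\<lambda>h. (1::real) *\<^sub>R FD (\<lambda>y. FD \<tau> y (V z)) (X z) (X' h) + (1::real) *\<^sub>R FD \<tau> (X z) (V' h) + (0::real) *\<^sub>R FD \<tau> (X z) (V z))) (at z within S)"
    by (rule has_derivative_bilinear_family[OF openW bil d x V has_derivative_const])
  then show ?thesis
    by (simp add: linear_add[OF lin[OF x(1)]] chris_transform[OF x(1)] algebra_simps)
qed

text \<open>All terms with derivatives of \<tau> of order two or three form an expression symmetric
  in \<open>u\<close> and \<open>v\<close> and cancel on antisymmetrisation.\<close>

lemma Rm_transform:
  assumes x: "x \<in> W"
  shows "FD \<tau> x (A.Rm x u v w) = B.Rm (\<tau> x) (FD \<tau> x u) (FD \<tau> x v) (FD \<tau> x w)"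
proof -
  note lf = lin[OF x] and y = inU(2)[OF x]
  define D2 where "D2 u v x = FD (\<lambda>y. FD \<tau> y v) x u" for u v x
  have D2: "D2 u v x = FD (\<lambda>y. FD \<tau> y v) x u" for u v by (simp add: D2_def)
  have C2D: "Ck_on (Suc 0) (D2 u v) W" for u v
    unfolding D2_def by (rule Ck_on_FD[OF Ck_on_FD[OF C3]])
  have dD2: "(D2 u v has_derivative FD (D2 u v) x) (at x)" for u v
    by (rule Ck_on_has_derivative[OF C2D openW x])
  have third: "FD (D2 v w) x u = FD (D2 u w) x v" for u v w
    unfolding D2_def[abs_def] by (rule Ck_on_symmetric[OF openW Ck_on_FD[OF C3] x])
  have 1: "FD \<tau> x (FD (\<lambda>y. A.\<Gamma> y v w) x u + A.\<Gamma> x u (A.\<Gamma> x v w)) - B.\<Gamma> (\<tau> x) (FD \<tau> x u) (FD \<tau> x (A.\<Gamma> x v w))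
     = FD (\<lambda>y. B.\<Gamma> y (FD \<tau> x v) (FD \<tau> x w)) (\<tau> x) (FD \<tau> x u) + B.\<Gamma> (\<tau> x) (D2 u v x) (FD \<tau> x w)
        + B.\<Gamma> (\<tau> x) (FD \<tau> x v) (D2 u w x) + FD (D2 v w) x u" for u v w
  proof -
    have a: "((\<lambda>y. FD \<tau> y (A.\<Gamma> y v w)) has_derivative
      (\<lambda>h. FD \<tau> x (FD (\<lambda>y. A.\<Gamma> y v w) x h + A.\<Gamma> x h (A.\<Gamma> x v w)) - B.\<Gamma> (\<tau> x) (FD \<tau> x h) (FD \<tau> x (A.\<Gamma> x v w)))) (at x)"
      by (rule covariant_derivative_transform[OF x has_derivative_ident A.d\<Gamma>[OF inU(1)[OF x]]])
    have "((\<lambda>y. B.\<Gamma> (\<tau> y) (FD \<tau> y v) (FD \<tau> y w) + D2 v w y) has_derivative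
      (\<lambda>h. (FD (\<lambda>y. B.\<Gamma> y (FD \<tau> x v) (FD \<tau> x w)) (\<tau> x) (FD \<tau> x h) + B.\<Gamma> (\<tau> x) (FD (\<lambda>y. FD \<tau> y v) x h) (FD \<tau> x w)
        + B.\<Gamma> (\<tau> x) (FD \<tau> x v) (FD (\<lambda>y. FD \<tau> y w) x h)) + FD (D2 v w) x h)) (at x)"
      by (intro has_derivative_add B.has_derivative_\<Gamma>[OF y dt[OF x] ddt[OF x] ddt[OF x]] dD2)
    then have b: "((\<lambda>y. FD \<tau> y (A.\<Gamma> y v w)) has_derivative
      (\<lambda>h. (FD (\<lambda>y. B.\<Gamma> y (FD \<tau> x v) (FD \<tau> x w)) (\<tau> x) (FD \<tau> x h) + B.\<Gamma> (\<tau> x) (FD (\<lambda>y. FD \<tau> y v) x h) (FD \<tau> x w)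
        + B.\<Gamma> (\<tau> x) (FD \<tau> x v) (FD (\<lambda>y. FD \<tau> y w) x h)) + FD (D2 v w) x h)) (at x)"
      by (rule has_derivative_transform_within_open[OF _ openW x]) (simp add: chris_transform D2_def)
    show ?thesis using has_derivative_unique[OF a b, THEN fun_cong, of u] by (simp add: D2)
  qed
  have s: "D2 u v x = D2 v u x" for u v unfolding D2 by (rule D2_sym[OF x])
  have e: "FD \<tau> x (FD (\<lambda>y. A.\<Gamma> y v w) x u + A.\<Gamma> x u (A.\<Gamma> x v w)) =
     FD (\<lambda>y. B.\<Gamma> y (FD \<tau> x v) (FD \<tau> x w)) (\<tau> x) (FD \<tau> x u) + B.\<Gamma> (\<tau> x) (FD \<tau> x u) (B.\<Gamma> (\<tau> x) (FD \<tau> x v) (FD \<tau> x w))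
     + (B.\<Gamma> (\<tau> x) (FD \<tau> x u) (D2 v w x) + B.\<Gamma> (\<tau> x) (FD \<tau> x v) (D2 u w x) + B.\<Gamma> (\<tau> x) (D2 u v x) (FD \<tau> x w) + FD (D2 v w) x u)" for u v w
    using 1[of v w u] unfolding chris_transform[OF x, of v w] D2[symmetric] B.\<Gamma>_lin[OF y] by (simp add: algebra_simps)
  have "FD \<tau> x (A.Rm x u v w) = FD \<tau> x (FD (\<lambda>y. A.\<Gamma> y v w) x u + A.\<Gamma> x u (A.\<Gamma> x v w))
      - FD \<tau> x (FD (\<lambda>y. A.\<Gamma> y u w) x v + A.\<Gamma> x v (A.\<Gamma> x u w))"
    unfolding curv_def linear_diff[OF lf] ..
  also have "\<dots> = B.Rm (\<tau> x) (FD \<tau> x u) (FD \<tau> x v) (FD \<tau> x w)"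
    unfolding e curv_def s[of v u] third[of v w u] by (simp add: algebra_simps)
  finally show ?thesis .
qed

lemma curv_const_transform:
  assumes x: "x \<in> W"
  shows "A.curv_const k x \<longleftrightarrow> B.curv_const k (\<tau> x)"
proof -
  note lf = lin[OF x]
  have *: "A.Rm x u v w = k *\<^sub>R (g x v w *\<^sub>R u - g x u w *\<^sub>R v) \<longleftrightarrow>
      B.Rm (\<tau> x) (FD \<tau> x u) (FD \<tau> x v) (FD \<tau> x w) =
        k *\<^sub>R (g' (\<tau> x) (FD \<tau> x v) (FD \<tau> x w) *\<^sub>R FD \<tau> x u - g' (\<tau> x) (FD \<tau> x u) (FD \<tau> x w) *\<^sub>R FD \<tau> x v)" for u v w
    using inj[OF x] unfolding Rm_transform[OF x, symmetric] iso[OF x, symmetric]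
    by (simp add: inj_eq flip: linear_scale[OF lf] linear_diff[OF lf])
  have "\<exists>u. FD \<tau> x u = u'" for u' using bij_is_surj[OF bij[OF x]] by (metis surjD)
  then show ?thesis
    unfolding A.curv_const_def B.curv_const_def by (metis *)
qed

end

lemma continuous_linear_family:
  fixes \<beta> :: "'e::topological_space \<Rightarrow> 'u::euclidean_space \<Rightarrow> 'w::real_normed_vector"
  assumes "\<And>x. x \<in> T \<Longrightarrow> linear (\<beta> x)" "\<And>u. continuous_on T (\<lambda>x. \<beta> x u)"
    "continuous_on S f" "f ` S \<subseteq> T" "continuous_on S X"
  shows "continuous_on S (\<lambda>s. \<beta> (f s) (X s))"
proof -
  have "continuous_on S (\<lambda>s. \<Sum>b\<in>Basis. (X s \<bullet> b) *\<^sub>R \<beta> (f s) b)"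
    by (intro continuous_intros assms continuous_on_compose2[OF assms(2,3,4)])
  moreover have "\<beta> (f s) (X s) = (\<Sum>b\<in>Basis. (X s \<bullet> b) *\<^sub>R \<beta> (f s) b)" if "s \<in> S" for s
    using that assms(1,4) by (intro linear_expand) blast
  ultimately show ?thesis by (simp cong: continuous_on_cong)
qed

lemma continuous_bilinear_family:
  fixes \<beta> :: "'e::topological_space \<Rightarrow> 'u::euclidean_space \<Rightarrow> 'v::euclidean_space \<Rightarrow> 'w::real_normed_vector"
  assumes "\<And>x. x \<in> T \<Longrightarrow> bilinear (\<beta> x)" "\<And>u v. continuous_on T (\<lambda>x. \<beta> x u v)"
    "continuous_on S f" "f ` S \<subseteq> T" "continuous_on S X" "continuous_on S Y"
  shows "continuous_on S (\<lambda>s. \<beta> (f s) (X s) (Y s))"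
proof -
  have "continuous_on S (\<lambda>s. \<Sum>b\<in>Basis. \<Sum>c\<in>Basis. ((X s \<bullet> b) * (Y s \<bullet> c)) *\<^sub>R \<beta> (f s) b c)"
    by (intro continuous_intros assms continuous_on_compose2[OF assms(2,3,4)])
  moreover have "\<beta> (f s) (X s) (Y s) = (\<Sum>b\<in>Basis. \<Sum>c\<in>Basis. ((X s \<bullet> b) * (Y s \<bullet> c)) *\<^sub>R \<beta> (f s) b c)"
    if "s \<in> S" for s
    using that assms(1,4) by (intro bilinear_expand) blast
  ultimately show ?thesis by (simp cong: continuous_on_cong)
qed

context isometry
begin

lemma second_derivative_transform:
  assumes x: "X s \<in> W" "(X has_vector_derivative X') (at s within S)" and V: "(V has_vector_derivative V') (at s within S)"
  shows "((\<lambda>s. FD \<tau> (X s) (V s)) has_vector_derivative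
    (FD \<tau> (X s) (V' + A.\<Gamma> (X s) X' (V s)) - B.\<Gamma> (\<tau> (X s)) (FD \<tau> (X s) X') (FD \<tau> (X s) (V s)))) (at s within S)"
  unfolding has_vector_derivative_def
  by (rule has_derivative_eq_rhs[OF covariant_derivative_transform[OF x(1) x(2)[unfolded has_vector_derivative_def] V[unfolded has_vector_derivative_def]]])
    (simp add: fun_eq_iff A.\<Gamma>_lin[OF inU(1)[OF x(1)]] B.\<Gamma>_lin[OF inU(2)[OF x(1)]] linear_scale[OF lin[OF x(1)]]
      linear_add[OF lin[OF x(1)]] algebra_simps)

lemma first_derivative_transform:
  assumes "X s \<in> W" "(X has_vector_derivative X') (at s within S)"
  shows "((\<lambda>s. \<tau> (X s)) has_vector_derivative FD \<tau> (X s) X') (at s within S)"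
  using has_derivative_compose[OF assms(2)[unfolded has_vector_derivative_def] dt[OF assms(1)]]
    linear_scale[OF lin[OF assms(1)]] by (simp add: has_vector_derivative_def)

end

section \<open>Riemannian manifolds\<close>

locale riemannian =
  fixes M :: "('a, 'e::euclidean_space) riem"
  assumes M: "riemannian_manifold M"
begin

lemma hausdorff: "Hausdorff_space (mtop M)"
  using M unfolding riemannian_manifold_def by blast

lemma open_overlap:
  assumes "c \<in> atlas M" "d \<in> atlas M"
  shows "open (chart_map c ` (chart_dom c \<inter> chart_dom d))"
proof -
  have "top_chart (mtop M) c" "openin (mtop M) (chart_dom d)"
    using M assms unfolding riemannian_manifold_def top_chart_def by blast+
  then show ?thesis by (rule open_chart_image)
qed

lemma C3_transition:
  "c \<in> atlas M \<Longrightarrow> d \<in> atlas M \<Longrightarrow> Ck_on (Suc (Suc (Suc 0))) (transition c d) (chart_map c ` (chart_dom c \<inter> chart_dom d))"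
  using M unfolding riemannian_manifold_def numeral_3_eq_3 by blast

sublocale diff_atlas M
proof
  show "top_chart (mtop M) c" if "c \<in> atlas M" for c
    using M that unfolding riemannian_manifold_def top_chart_def by blast
  show "\<exists>c\<in>atlas M. p \<in> chart_dom c" if "p \<in> points M" for p
    using M that unfolding riemannian_manifold_def by blast
  show "transition c d differentiable (at (chart_map c p))"
    if "c \<in> atlas M" "d \<in> atlas M" "p \<in> chart_dom c" "p \<in> chart_dom d" for c d p
    using Ck_on_has_derivative[OF C3_transition[OF that(1,2)] open_overlap[OF that(1,2)], of "chart_map c p"] that(3,4)
    by (auto simp: differentiable_def)
qed

lemma local_metric_chart: "c \<in> atlas M \<Longrightarrow> local_metric (chart_range c) (metric M c)"
  using M unfolding riemannian_manifold_def local_metric_def posdef_def by blast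

lemma isometry_chart:
  assumes c: "c \<in> atlas M" "d \<in> atlas M"
  shows "isometry (chart_range c) (chart_range d) (metric M c) (metric M d)
    (chart_map c ` (chart_dom c \<inter> chart_dom d)) (transition c d)"
proof -
  have "metric M c x u v = metric M d (transition c d x) (FD (transition c d) x u) (FD (transition c d) x v)"
    if "x \<in> chart_map c ` (chart_dom c \<inter> chart_dom d)" for x u v
    using M c that unfolding riemannian_manifold_def by blast
  moreover have "transition c d ` chart_map c ` (chart_dom c \<inter> chart_dom d) \<subseteq> chart_range d"
  proof
    fix y assume "y \<in> transition c d ` chart_map c ` (chart_dom c \<inter> chart_dom d)"
    then obtain p where p: "p \<in> chart_dom c" "p \<in> chart_dom d" "y = transition c d (chart_map c p)" by blast
    then show "y \<in> chart_range d" unfolding transition_at[OF c(1) p(1)] by blast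
  qed
  ultimately show ?thesis
    unfolding isometry_def isometry_axioms_def
    using local_metric_chart c open_overlap[OF c] C3_transition[OF c] by auto
qed

lemma inner_at_chart:
  assumes c: "c \<in> atlas M" and p: "p \<in> chart_dom c"
  shows "inner_at M p (FD (transition c (chart_at M p)) (chart_map c p) u) (FD (transition c (chart_at M p)) (chart_map c p) v)
    = metric M c (chart_map c p) u v"
proof -
  have pM: "p \<in> points M" using dom_subset[OF chart[OF c]] p by blast
  note d = chart_at[OF pM]
  have "chart_map c p \<in> chart_map c ` (chart_dom c \<inter> chart_dom (chart_at M p))" using p d(2) by blast
  from isometry.iso[OF isometry_chart[OF c d(1)] this] show ?thesis
    unfolding inner_at_def coords_def transition_at[OF c p] by simp
qed

lemma transition_bij:
  assumes c: "c \<in> atlas M" "d \<in> atlas M" and p: "p \<in> chart_dom c" "p \<in> chart_dom d"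
  shows "bij (FD (transition c d) (chart_map c p))" "linear (FD (transition c d) (chart_map c p))"
  using isometry.bij[OF isometry_chart[OF c]] isometry.lin[OF isometry_chart[OF c]] p by blast+

text \<open>\<open>sectional_curvature\<close> is evaluated in the chart chosen at \<open>p\<close>,
  while the analysis uses one chart for many points; the tensor identity \<open>curv_const\<close>
  transfers between the two.\<close>

lemma curvature_tensor_chart:
  assumes p: "p \<in> points M" and c: "c \<in> atlas M" "p \<in> chart_dom c"
  shows "(\<forall>u v. u \<noteq> v \<and> independent {u, v} \<longrightarrow> sectional_curvature M p u v = K) \<longleftrightarrow>
    local_metric.curv_const (metric M c) K (chart_map c p)"
proof -
  note d = chart_at[OF p]
  interpret D: local_metric "chart_range (chart_at M p)" "metric M (chart_at M p)" by (rule local_metric_chart[OF d(1)])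
  interpret I: isometry "chart_range c" "chart_range (chart_at M p)" "metric M c" "metric M (chart_at M p)"
    "chart_map c ` (chart_dom c \<inter> chart_dom (chart_at M p))" "transition c (chart_at M p)"
    by (rule isometry_chart[OF c(1) d(1)])
  have x: "coords M p \<in> chart_range (chart_at M p)" using d(2) by (simp add: coords_def)
  have r: "riemann M p u v w = D.Rm (coords M p) u v w" for u v w
    unfolding riemann_def curv_def Let_def christoffel_chris ..
  have "(\<forall>u v. u \<noteq> v \<and> independent {u, v} \<longrightarrow> sectional_curvature M p u v = K) \<longleftrightarrow> D.curv_const K (coords M p)"
    unfolding sectional_curvature_def r inner_at_def
  proof
    assume *: "\<forall>u v. u \<noteq> v \<and> independent {u, v} \<longrightarrow> metric M (chart_at M p) (coords M p) (D.Rm (coords M p) u v v) u /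
      (metric M (chart_at M p) (coords M p) u u * metric M (chart_at M p) (coords M p) v v - (metric M (chart_at M p) (coords M p) u v)\<^sup>2) = K"
    show "D.curv_const K (coords M p)" by (rule D.sectional_const[OF x *[rule_format]]) simp
  next
    assume K: "D.curv_const K (coords M p)"
    show "\<forall>u v. u \<noteq> v \<and> independent {u, v} \<longrightarrow> metric M (chart_at M p) (coords M p) (D.Rm (coords M p) u v v) u /
      (metric M (chart_at M p) (coords M p) u u * metric M (chart_at M p) (coords M p) v v - (metric M (chart_at M p) (coords M p) u v)\<^sup>2) = K"
      by (intro allI impI, elim conjE) (rule D.curv_const_sectional[OF x K])
  qed
  also have "\<dots> \<longleftrightarrow> I.A.curv_const K (chart_map c p)"
    unfolding coords_def transition_at[OF c, of "chart_at M p", symmetric]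
    by (rule I.curv_const_transform[symmetric]) (use c(2) d(2) in blast)
  finally show ?thesis .
qed

subsection \<open>Curves in an arbitrary chart\<close>

context
  fixes I \<alpha>
  assumes I: "nondegenerate_interval I" and \<alpha>: "C2_curve M I \<alpha>"
begin

lemma acceleration_chart:
  assumes s: "s \<in> I" and c: "c \<in> atlas M" "\<alpha> s \<in> chart_dom c"
    and v: "\<And>t. t \<in> I \<Longrightarrow> \<alpha> t \<in> chart_dom c \<Longrightarrow> ((\<lambda>t. chart_map c (\<alpha> t)) has_vector_derivative v t) (at t within I)"
    and a: "(v has_vector_derivative a) (at s within I)"
  shows "acceleration M I \<alpha> s = FD (transition c (chart_at M (\<alpha> s))) (chart_map c (\<alpha> s)) (a + christoffel M c (chart_map c (\<alpha> s)) (v s) (v s))"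
proof -
  define d where "d = chart_at M (\<alpha> s)"
  have d: "d \<in> atlas M" "\<alpha> s \<in> chart_dom d" using chart_at[OF curve_points[OF I \<alpha> s]] by (auto simp: d_def)
  interpret Is: isometry "chart_range c" "chart_range d" "metric M c" "metric M d"
    "chart_map c ` (chart_dom c \<inter> chart_dom d)" "transition c d" by (rule isometry_chart[OF c(1) d(1)])
  have cont: "continuous_map (top_of_set I) (mtop M) \<alpha>" using \<alpha> unfolding C2_curve_def by blast
  let ?x = "\<lambda>t. chart_map c (\<alpha> t)"
  have xs: "?x s \<in> chart_map c ` (chart_dom c \<inter> chart_dom d)" using c d by blast
  obtain w b where w: "\<And>s. s \<in> I \<Longrightarrow> \<alpha> s \<in> chart_dom d \<Longrightarrow> ((\<lambda>t. chart_map d (\<alpha> t)) has_vector_derivative w s) (at s within I)"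
    "\<And>s. s \<in> I \<Longrightarrow> \<alpha> s \<in> chart_dom d \<Longrightarrow> (w has_vector_derivative b s) (at s within I)"
    "continuous_on {s \<in> I. \<alpha> s \<in> chart_dom d} b"
    by (rule curve_derivatives[OF I \<alpha> d(1)]) (rule that)
  have wv: "w t = FD (transition c d) (?x t) (v t)" if t: "t \<in> I" "\<alpha> t \<in> chart_dom c" "\<alpha> t \<in> chart_dom d" for t
    using components_velocity(1)[OF I \<alpha> d(1) t(1,3) w(1)[OF t(1,3)]]
      components_chart[OF c(1) d(1) t(2,3), of "v t"] components_velocity(2)[OF I \<alpha> c(1) t(1,2) v[OF t(1,2)]] by simp
  have ev: "\<forall>\<^sub>F t in at s within I. FD (transition c d) (?x t) (v t) = w t"
    using curve_in_chart(1)[OF chart[OF c(1)] cont s c(2)] curve_in_chart(1)[OF chart[OF d(1)] cont s d(2)]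
    by eventually_elim (simp add: wv)
  have "(w has_vector_derivative FD (transition c d) (?x s) (a + Is.A.\<Gamma> (?x s) (v s) (v s))
       - Is.B.\<Gamma> (transition c d (?x s)) (FD (transition c d) (?x s) (v s)) (FD (transition c d) (?x s) (v s))) (at s within I)"
    using Is.second_derivative_transform[of ?x s, OF xs v[OF s c(2)] a] ev wv[OF s c(2) d(2)] s
    unfolding has_vector_derivative_def by (elim has_derivative_transform_eventually) auto
  from acceleration_chart_at(1)[OF I \<alpha> s d_def w(1) this] show ?thesis
    unfolding christoffel_chris transition_at[OF c] wv[OF s c(2) d(2)] d_def by simp
qed

lemma acceleration_zero_chart:
  assumes s: "s \<in> I" and c: "c \<in> atlas M" "\<alpha> s \<in> chart_dom c"
    and v: "\<And>t. t \<in> I \<Longrightarrow> \<alpha> t \<in> chart_dom c \<Longrightarrow> ((\<lambda>t. chart_map c (\<alpha> t)) has_vector_derivative v t) (at t within I)"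
    and a: "(v has_vector_derivative a) (at s within I)"
  shows "acceleration M I \<alpha> s = 0 \<longleftrightarrow> a = - chris (metric M c) (chart_map c (\<alpha> s)) (v s) (v s)"
proof -
  note p = curve_points[OF I \<alpha> s]
  note b = transition_bij[OF c(1) chart_at(1)[OF p] c(2) chart_at(2)[OF p]]
  have acc: "acceleration M I \<alpha> s = FD (transition c (chart_at M (\<alpha> s))) (chart_map c (\<alpha> s)) (a + christoffel M c (chart_map c (\<alpha> s)) (v s) (v s))"
    by (rule acceleration_chart[OF s c v a])
  show ?thesis
    unfolding acc christoffel_chris
    using linear_injective_0[OF b(2)] bij_is_inj[OF b(1)] linear_0[OF b(2)] by (auto simp: eq_neg_iff_add_eq_0)
qed

lemma curvature_chart:
  assumes s: "s \<in> I" and c: "c \<in> atlas M" "\<alpha> s \<in> chart_dom c"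
    and v: "\<And>t. t \<in> I \<Longrightarrow> \<alpha> t \<in> chart_dom c \<Longrightarrow> ((\<lambda>t. chart_map c (\<alpha> t)) has_vector_derivative v t) (at t within I)"
    and a: "(v has_vector_derivative a) (at s within I)"
    and A: "A = a + chris (metric M c) (chart_map c (\<alpha> s)) (v s) (v s)"
  shows "curvature M I \<alpha> s = sqrt (metric M c (chart_map c (\<alpha> s)) A A)"
    and "norm_at M (\<alpha> s) (velocity M I \<alpha> s) = sqrt (metric M c (chart_map c (\<alpha> s)) (v s) (v s))"
proof -
  have acc: "acceleration M I \<alpha> s = FD (transition c (chart_at M (\<alpha> s))) (chart_map c (\<alpha> s)) (a + christoffel M c (chart_map c (\<alpha> s)) (v s) (v s))"
    by (rule acceleration_chart[OF s c v a])
  show "curvature M I \<alpha> s = sqrt (metric M c (chart_map c (\<alpha> s)) A A)"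
    unfolding curvature_def norm_at_def acc inner_at_chart[OF c] A christoffel_chris ..
  show "norm_at M (\<alpha> s) (velocity M I \<alpha> s) = sqrt (metric M c (chart_map c (\<alpha> s)) (v s) (v s))"
    unfolding norm_at_def components_velocity(2)[OF I \<alpha> c(1) s c(2) v[OF s c(2)]] inner_at_chart[OF c] ..
qed

end

text \<open>In another chart the second derivative is expressed by the Christoffel symbols of both
  charts, from which its continuity is visible.\<close>

lemma C2_curve_chart:
  assumes c: "c \<in> atlas M" and x: "\<And>s. s \<in> I \<Longrightarrow> x s \<in> chart_range c"
    and v: "\<And>s. s \<in> I \<Longrightarrow> (x has_vector_derivative v s) (at s within I)"
    and a: "\<And>s. s \<in> I \<Longrightarrow> (v has_vector_derivative a s) (at s within I)" "continuous_on I a"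
  shows "C2_curve M I (\<lambda>s. chart_inv c (x s))"
  unfolding C2_curve_def
proof (intro conjI ballI)
  have cx: "continuous_on I x" and cv: "continuous_on I v"
    using v a(1) has_vector_derivative_continuous continuous_on_eq_continuous_within by blast+
  have "continuous_map (top_of_set I) (top_of_set (chart_range c)) x"
    using cx x by (simp add: continuous_map_in_subtopology image_subset_iff Pi_iff)
  from continuous_map_compose[OF this continuous_chart_inv[OF chart[OF c]]]
  show "continuous_map (top_of_set I) (mtop M) (\<lambda>s. chart_inv c (x s))" by (simp add: o_def)
  fix d assume d: "d \<in> atlas M"
  interpret Is: isometry "chart_range c" "chart_range d" "metric M c" "metric M d"
    "chart_map c ` (chart_dom c \<inter> chart_dom d)" "transition c d" by (rule isometry_chart[OF c d])
  let ?W = "chart_map c ` (chart_dom c \<inter> chart_dom d)"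
  let ?J = "{s \<in> I. chart_inv c (x s) \<in> chart_dom d}"
  have W: "x s \<in> ?W" if "s \<in> ?J" for s
    using that chart_inv_right[OF chart[OF c] x[of s]] by force
  let ?w = "\<lambda>s. FD (transition c d) (x s) (v s)"
  let ?b = "\<lambda>s. FD (transition c d) (x s) (a s + Is.A.\<Gamma> (x s) (v s) (v s)) - Is.B.\<Gamma> (transition c d (x s)) (?w s) (?w s)"
  have J: "continuous_on ?J x" "continuous_on ?J v" "continuous_on ?J a" "x ` ?J \<subseteq> ?W" "x ` ?J \<subseteq> chart_range c"
    using cx cv a(2) W x by (auto elim: continuous_on_subset)
  have ct: "continuous_on ?W (transition c d)" "continuous_on ?W (\<lambda>y. FD (transition c d) y u)" for u
    using Ck_on_mono[OF Is.C3, of 0] Ck_on_mono[OF Ck_on_FD[OF Is.C3], of 0 u] by simp_all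
  have cF: "continuous_on ?J (\<lambda>s. FD (transition c d) (x s) (u s))" if "continuous_on ?J u" for u
    by (rule continuous_linear_family[OF Is.lin ct(2) J(1,4) that])
  have c\<Gamma>: "continuous_on (chart_range c) (\<lambda>y. Is.A.\<Gamma> y u w)" "continuous_on (chart_range d) (\<lambda>y. Is.B.\<Gamma> y u w)" for u w
    using Ck_on_SucD[OF Is.A.C1_\<Gamma>] Ck_on_SucD[OF Is.B.C1_\<Gamma>] by simp_all
  have cb: "continuous_on ?J ?b"
  proof (rule continuous_on_diff)
    show "continuous_on ?J (\<lambda>s. FD (transition c d) (x s) (a s + Is.A.\<Gamma> (x s) (v s) (v s)))"
      by (intro cF continuous_on_add J continuous_bilinear_family[OF Is.A.\<Gamma>_bil c\<Gamma>(1)])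
    show "continuous_on ?J (\<lambda>s. Is.B.\<Gamma> (transition c d (x s)) (?w s) (?w s))"
      by (rule continuous_bilinear_family[OF Is.B.\<Gamma>_bil c\<Gamma>(2) continuous_on_compose2[OF ct(1) J(1,4)] _ cF[OF J(2)] cF[OF J(2)]])
        (use W Is.inU(2) in auto)
  qed
  show "\<exists>v a. (\<forall>s\<in>I. chart_inv c (x s) \<in> chart_dom d \<longrightarrow>
           ((chart_map d \<circ> (\<lambda>s. chart_inv c (x s))) has_vector_derivative v s) (at s within I) \<and>
           (v has_vector_derivative a s) (at s within I)) \<and>
        continuous_on ?J a"
  proof (rule exI[of _ ?w], rule exI[of _ ?b], intro conjI ballI impI cb)
    fix s assume s: "s \<in> I" "chart_inv c (x s) \<in> chart_dom d"
    then have sW: "x s \<in> ?W" using W by simp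
    show "((chart_map d \<circ> (\<lambda>s. chart_inv c (x s))) has_vector_derivative ?w s) (at s within I)"
      using Is.first_derivative_transform[of x s, OF sW v[OF s(1)]] by (simp add: o_def transition_def)
    show "(?w has_vector_derivative ?b s) (at s within I)"
      by (rule Is.second_derivative_transform[of x s, OF sW v[OF s(1)] a(1)[OF s(1)]])
  qed
qed

subsection \<open>The exponential map in a chart\<close>

text \<open>A competing geodesic of \<open>M\<close> is not confined to the chart, so uniqueness for
  the differential equation applies only while it stays there. A continuation argument extends the
  coincidence to the whole interval, which makes the description in \<open>exp_map\<close>
  proper.\<close>

lemma exp_graph_chart:
  assumes p: "p \<in> points M" and c: "c = chart_at M p"
    and flow: "geodesic_flow (chart_range c) (metric M c) (chart_map c p) \<delta> q v J K"
    and a: "a \<in> ball 0 \<delta>"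
  shows "exp_graph M p a y \<longleftrightarrow> y = chart_inv c (q a 1)"
proof -
  interpret F: geodesic_flow "chart_range c" "metric M c" "chart_map c p" \<delta> q v J K by (rule flow)
  have ca: "c \<in> atlas M" "p \<in> chart_dom c" using chart_at[OF p] c by auto
  note tc = chart[OF ca(1)]
  have nd: "nondegenerate_interval {0..1::real}"
    unfolding nondegenerate_interval_def by (intro conjI is_interval_cc bexI[of _ 0] bexI[of _ 1]) auto
  have cvq: "continuous_on {0..1} (q a)" "continuous_on {0..1} (v a)"
    using F.dq[OF a] F.dp[OF a] has_vector_derivative_continuous continuous_on_eq_continuous_within by blast+
  have qU: "q a ` {0..1} \<subseteq> chart_range c" using F.qU[OF a] by blast
  have c\<Gamma>: "continuous_on (chart_range c) (\<lambda>y. F.\<Gamma> y u w)" for u w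
    using Ck_on_SucD[OF F.C1_\<Gamma>] by simp
  have cacc: "continuous_on {0..1} (\<lambda>t. - F.\<Gamma> (q a t) (v a t) (v a t))"
    by (intro continuous_on_minus continuous_bilinear_family[OF F.\<Gamma>_bil c\<Gamma> cvq(1) qU cvq(2) cvq(2)])
  define \<gamma> where "\<gamma> t = chart_inv c (q a t)" for t
  have \<gamma>d: "\<gamma> t \<in> chart_dom c" "chart_map c (\<gamma> t) = q a t" if "t \<in> {0..1}" for t
    using chart_inv_right[OF tc F.qU[OF a that]] by (auto simp: \<gamma>_def)
  have C2: "C2_curve M {0..1} \<gamma>"
    unfolding \<gamma>_def by (rule C2_curve_chart[OF ca(1) F.qU[OF a] F.dq[OF a] F.dp[OF a] cacc])
  have d\<gamma>: "((\<lambda>t. chart_map c (\<gamma> t)) has_vector_derivative v a t) (at t within {0..1})" if "t \<in> {0..1}" for t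
    by (rule has_vector_derivative_transform[OF that _ F.dq[OF a that]]) (simp add: \<gamma>d)
  have \<gamma>0: "\<gamma> 0 = p" using F.init(1)[OF a] chart_inv_left[OF tc ca(2)] by (simp add: \<gamma>_def)
  have geo: "geodesic M {0..1} \<gamma>"
    unfolding geodesic_def
  proof (intro conjI ballI C2)
    fix s :: real assume s: "s \<in> {0..1}"
    show "acceleration M {0..1} \<gamma> s = 0"
      using acceleration_zero_chart[OF nd C2 s ca(1) \<gamma>d(1)[OF s] d\<gamma> F.dp[OF a s]] \<gamma>d(2)[OF s] by simp
  qed
  have vel: "velocity M {0..1} \<gamma> 0 = a"
    using acceleration_chart_at(2)[OF nd C2, of 0 c "v a"] d\<gamma> F.dp[OF a] F.init(2)[OF a] c \<gamma>0 by force
  have "exp_graph M p a (chart_inv c (q a 1))"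
    unfolding exp_graph_def using geo \<gamma>0 vel by (intro exI[of _ \<gamma>]) (simp add: \<gamma>_def)
  moreover have "y = chart_inv c (q a 1)" if y: "exp_graph M p a y"
  proof -
    obtain \<eta> where \<eta>: "geodesic M {0..1} \<eta>" "\<eta> 0 = p" "velocity M {0..1} \<eta> 0 = a" "\<eta> 1 = y"
      using y unfolding exp_graph_def by blast
    have C2': "C2_curve M {0..1} \<eta>" using \<eta>(1) unfolding geodesic_def by blast
    have cont: "continuous_map (top_of_set {0..1}) (mtop M) \<eta>" "continuous_map (top_of_set {0..1}) (mtop M) \<gamma>"
      using C2 C2' unfolding C2_curve_def by blast+
    obtain w b where w: "\<And>s. s \<in> {0..1} \<Longrightarrow> \<eta> s \<in> chart_dom c \<Longrightarrow> ((\<lambda>t. chart_map c (\<eta> t)) has_vector_derivative w s) (at s within {0..1})"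
      "\<And>s. s \<in> {0..1} \<Longrightarrow> \<eta> s \<in> chart_dom c \<Longrightarrow> (w has_vector_derivative b s) (at s within {0..1})"
      "continuous_on {s \<in> {0..1}. \<eta> s \<in> chart_dom c} b"
      by (rule curve_derivatives[OF nd C2' ca(1)]) (rule that)
    have b: "b s = - F.\<Gamma> (chart_map c (\<eta> s)) (w s) (w s)" if s: "s \<in> {0..1}" "\<eta> s \<in> chart_dom c" for s
      using acceleration_zero_chart[OF nd C2' s(1) ca(1) s(2) w(1) w(2)[OF s]] \<eta>(1) s(1) unfolding geodesic_def by blast
    have w0: "w 0 = a"
      using acceleration_chart_at(2)[OF nd C2', of 0 c w "b 0"] w \<eta>(2,3) c ca(2) by force
    have step: "\<eta> t = \<gamma> t" if "e \<le> 1" "t \<in> {0..e}" and dom: "\<And>s. s \<in> {0..e} \<Longrightarrow> \<eta> s \<in> chart_dom c" for e t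
    proof -
      have sub: "{0..e} \<subseteq> {0..1}" using that by auto
      have "chart_map c (\<eta> t) = q a t"
      proof (rule F.geodesic_unique(1)[where v=w and w="v a" and b=e])
        fix s assume s: "s \<in> {0..e}"
        then have s1: "s \<in> {0..1}" using sub by blast
        show "chart_map c (\<eta> s) \<in> chart_range c" using dom[OF s] by blast
        show "q a s \<in> chart_range c" by (rule F.qU[OF a s1])
        show "((\<lambda>t. chart_map c (\<eta> t)) has_vector_derivative w s) (at s within {0..e})"
          by (rule has_vector_derivative_within_subset[OF w(1)[OF s1 dom[OF s]] sub])
        show "(w has_vector_derivative - F.\<Gamma> (chart_map c (\<eta> s)) (w s) (w s)) (at s within {0..e})"
          using has_vector_derivative_within_subset[OF w(2)[OF s1 dom[OF s]] sub] b[OF s1 dom[OF s]] by simp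
        show "(q a has_vector_derivative v a s) (at s within {0..e})"
          by (rule has_vector_derivative_within_subset[OF F.dq[OF a s1] sub])
        show "(v a has_vector_derivative - F.\<Gamma> (q a s) (v a s) (v a s)) (at s within {0..e})"
          by (rule has_vector_derivative_within_subset[OF F.dp[OF a s1] sub])
      next
        show "chart_map c (\<eta> 0) = q a 0" "w 0 = v a 0" using \<eta>(2) w0 F.init[OF a] by auto
      qed fact
      then show ?thesis using chart_inv_left[OF tc dom[OF that(2)]] by (simp add: \<gamma>_def)
    qed
    \<comment> \<open>The times up to which the two curves agree throughout; its supremum
      \<open>m\<close> will leave no room before 1.\<close>
    define S where "S = {t \<in> {0..1}. \<forall>s\<in>{0..t}. \<eta> s = \<gamma> s}"
    have S0: "0 \<in> S" using \<gamma>0 \<eta>(2) by (auto simp: S_def)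
    have bdd: "bdd_above S" unfolding S_def by (rule bdd_aboveI[of _ 1]) auto
    define m where "m = Sup S"
    have ne: "S \<noteq> {}" using S0 by blast
    have m: "0 \<le> m" "m \<le> 1"
    proof -
      show "0 \<le> m" unfolding m_def by (rule cSup_upper[OF S0 bdd])
      show "m \<le> 1" unfolding m_def by (rule cSup_least[OF ne]) (auto simp: S_def)
    qed
    have lt: "\<eta> s = \<gamma> s" if s: "s \<in> {0..<m}" for s
    proof -
      obtain t where "t \<in> S" "s < t" using s less_cSup_iff[OF ne bdd, of s] unfolding m_def by auto
      then show ?thesis using s by (auto simp: S_def)
    qed
    \<comment> \<open>In a Hausdorff space the set of coincidence is closed, so the curves still
      agree at \<open>m\<close>.\<close>
    have "closedin (top_of_set {0..1}) {t \<in> topspace (top_of_set {0..1}). \<eta> t = \<gamma> t}"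
      by (rule closedin_continuous_maps_eq[OF hausdorff cont])
    then have cl: "closed {t \<in> {0..1}. \<eta> t = \<gamma> t}" using closedin_closed_trans by fastforce
    have m_eq: "\<eta> m = \<gamma> m"
    proof (cases "m = 0")
      case False
      then have "m \<in> closure {0..<m}" using m by simp
      moreover have "closure {0..<m} \<subseteq> {t \<in> {0..1}. \<eta> t = \<gamma> t}"
        by (rule closure_minimal[OF _ cl]) (use lt m in auto)
      ultimately show ?thesis by blast
    qed (use \<gamma>0 \<eta>(2) in simp)
    have mI: "m \<in> {0..1}" using m by simp
    have "\<forall>\<^sub>F t in at m within {0..1}. t \<in> {0..1} \<and> \<eta> t \<in> chart_dom c"
      by (rule curve_in_chart(1)[OF tc cont(1) mI]) (use m_eq \<gamma>d(1)[OF mI] in simp)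
    then obtain d where d: "d > 0" "\<And>t. t \<in> {0..1} \<Longrightarrow> t \<noteq> m \<Longrightarrow> dist t m < d \<Longrightarrow> \<eta> t \<in> chart_dom c"
      unfolding eventually_at by blast
    \<comment> \<open>The curve stays in the chart for a while after \<open>m\<close>, so the
      coincidence extends to \<open>e\<close>; this contradicts the choice of \<open>m\<close>
      unless \<open>e\<close> is 1.\<close>
    define e where "e = min 1 (m + d / 2)"
    have e: "e \<le> 1" "0 \<le> e" "e \<le> m + d / 2" using m d by (auto simp: e_def)
    have dom: "\<eta> s \<in> chart_dom c" if s: "s \<in> {0..e}" for s
    proof (cases "s < m")
      case True
      then show ?thesis using lt[of s] \<gamma>d(1)[of s] s e by auto
    next
      case False
      then have "s = m \<or> \<eta> s \<in> chart_dom c" using d(2)[of s] s e d(1) by (auto simp: dist_real_def)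
      then show ?thesis using m_eq \<gamma>d(1)[OF mI] by auto
    qed
    have "e \<in> S" using step[OF e(1) _ dom] e by (auto simp: S_def)
    then have "e \<le> m" unfolding m_def by (rule cSup_upper[OF _ bdd])
    then have "e = 1" using d(1) by (auto simp: e_def min_def split: if_splits)
    then have "\<eta> 1 = \<gamma> 1" using step[of 1 1] dom by simp
    then show ?thesis using \<eta>(4) by (simp add: \<gamma>_def)
  qed
  ultimately show ?thesis by blast
qed

end

section \<open>Inverse functions of class \<open>C\<^sup>2\<close>\<close>

text \<open>The vector inv (M y) v solves M y w \<bullet> M y z = v \<bullet> M y z, a linear
  equation for \<open>w\<close> whose left-hand side is a positive definite form.\<close>

lemma Ck_on_inv_linear:
  fixes M :: "'e::euclidean_space \<Rightarrow> 'a::euclidean_space \<Rightarrow> 'a"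
  assumes V: "open V" and lin: "\<And>y. y \<in> V \<Longrightarrow> linear (M y)" "\<And>y. y \<in> V \<Longrightarrow> bij (M y)"
    and C: "\<And>w. Ck_on (Suc 0) (\<lambda>y. M y w) V"
  shows "Ck_on (Suc 0) (\<lambda>y. inv (M y) v) V"
proof (rule Ck_on_linear_equation[OF V])
  let ?g = "\<lambda>y w z. M y w \<bullet> M y z"
  show "posdef (?g y)" if y: "y \<in> V" for y
    unfolding posdef_def bilinear_def
  proof (intro conjI allI impI)
    show "linear (?g y w)" "linear (\<lambda>w. ?g y w z)" for w z
      using linear_compose[OF lin(1)[OF y], of "\<lambda>u. M y w \<bullet> u"] linear_compose[OF lin(1)[OF y], of "\<lambda>u. u \<bullet> M y z"]
      by (simp_all add: o_def bounded_linear.linear[OF bounded_linear_inner_right] bounded_linear.linear[OF bounded_linear_inner_left])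
    show "?g y w z = ?g y z w" for w z by (rule inner_commute)
    show "?g y w w > 0" if "w \<noteq> 0" for w
      using that linear_injective_0[OF lin(1)[OF y]] bij_is_inj[OF lin(2)[OF y]] by (auto simp: inner_gt_zero_iff)
  qed
  show "Ck_on 1 (\<lambda>y. ?g y w z) V" "Ck_on (Suc 0) (\<lambda>y. ?g y w z) V" for w z
    using Ck_on_inner[OF V C C] by simp_all
  show "Ck_on (Suc 0) (\<lambda>y. v \<bullet> M y z) V" for z
    by (intro Ck_on_inner V C Ck_on_const)
  show "?g y (inv (M y) v) z = v \<bullet> M y z" if "y \<in> V" for y z
    using surj_f_inv_f[OF bij_is_surj[OF lin(2)[OF that]]] by simp
qed

text \<open>The derivative of \<open>h\<close> at \<open>y\<close> is the inverse of FD f (h y), a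
  bijection that depends on \<open>y\<close> in a C^1 way.\<close>

lemma C2_inverse_function:
  fixes f :: "'a::euclidean_space \<Rightarrow> 'a"
  assumes U: "open U" "Ck_on (Suc (Suc 0)) f U" "x0 \<in> U" and inj: "inj (FD f x0)"
  obtains U' V h where "open U'" "U' \<subseteq> U" "x0 \<in> U'" "open V" "f x0 \<in> V"
    "\<And>x. x \<in> U' \<Longrightarrow> f x \<in> V" "\<And>x. x \<in> U' \<Longrightarrow> h (f x) = x"
    "\<And>y. y \<in> V \<Longrightarrow> h y \<in> U'" "\<And>y. y \<in> V \<Longrightarrow> f (h y) = y" "Ck_on (Suc (Suc 0)) h V"
    "\<And>x. x \<in> U' \<Longrightarrow> bij (FD f x)"
proof -
  have U1: "Ck_on 1 f U" using Ck_on_SucD[OF U(2)] by simp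
  obtain U' V h where V: "open U'" "U' \<subseteq> U" "x0 \<in> U'" "open V" "f x0 \<in> V" "homeomorphism U' V f h"
    "\<And>y. y \<in> V \<Longrightarrow> (h has_derivative inv (FD f (h y))) (at y)" "\<And>y. y \<in> V \<Longrightarrow> bij (FD f (h y))" "Ck_on (Suc 0) h V"
    by (rule C1_inverse_function[OF U(1) U1 U(3) inj]) (rule that)
  have h: "h y \<in> U'" "f (h y) = y" if "y \<in> V" for y
    using V(6) that unfolding homeomorphism_def by blast+
  have f: "f x \<in> V" "h (f x) = x" if "x \<in> U'" for x
    using V(6) that unfolding homeomorphism_def by blast+
  have hU: "h ` V \<subseteq> U" using h(1) V(2) by blast
  have "Ck_on (Suc 0) (\<lambda>y. inv (FD f (h y)) v) V" for v
  proof (rule Ck_on_inv_linear[OF V(4)])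
    show "linear (FD f (h y))" if "y \<in> V" for y
      using has_derivative_linear[OF Ck_on_has_derivative[OF U(2,1)]] hU that by blast
    show "Ck_on (Suc 0) (\<lambda>y. FD f (h y) w) V" for w
      by (rule Ck_on_compose[OF V(4) U(1) Ck_on_FD[OF U(2)] V(9) hU])
  qed (rule V(8))
  from Ck_on_SucI[OF V(4) V(7) this] have C2: "Ck_on (Suc (Suc 0)) h V" by blast
  have bij: "bij (FD f x)" if "x \<in> U'" for x using V(8)[OF f(1)[OF that]] f(2)[OF that] by simp
  show thesis by (rule that[OF V(1-5) f h C2 bij])
qed

text \<open>A linear left inverse \<open>L\<close> of the derivative at \<open>y0\<close> makes L F
  a map between spaces of equal dimension with invertible derivative. The left inverse
  \<open>l\<close> lives on an open set of the ambient space, so it can be composed with curves and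
  charts there.\<close>

lemma local_left_inverse:
  fixes F :: "'f::euclidean_space \<Rightarrow> 'e::euclidean_space"
  assumes Y: "open Y" "Ck_on (Suc (Suc 0)) F Y" "y0 \<in> Y" and inj: "inj (FD F y0)"
  obtains Y' A l where "open Y'" "Y' \<subseteq> Y" "y0 \<in> Y'" "open A" "\<And>y. y \<in> Y' \<Longrightarrow> F y \<in> A"
    "Ck_on (Suc (Suc 0)) l A" "\<And>y. y \<in> Y' \<Longrightarrow> l (F y) = y"
proof -
  have dF: "(F has_derivative FD F y0) (at y0)" by (rule Ck_on_has_derivative[OF Y(2,1,3)])
  obtain L where L: "linear L" "L \<circ> FD F y0 = id"
    using linear_injective_left_inverse[OF has_derivative_linear[OF dF] inj] by blast
  have bL: "bounded_linear L" using L(1) linear_conv_bounded_linear by blast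
  have C: "Ck_on (Suc (Suc 0)) (\<lambda>y. L (F y)) Y" by (rule Ck_on_bounded_linear[OF bL Y(1,2)])
  have "FD (\<lambda>y. L (F y)) y0 = (\<lambda>v. L (FD F y0 v))"
    by (rule FD_eq[OF bounded_linear.has_derivative[OF bL dF]])
  also have "\<dots> = id" using L(2) by (simp add: o_def)
  finally have inj': "inj (FD (\<lambda>y. L (F y)) y0)" by simp
  obtain Y' V h where h: "open Y'" "Y' \<subseteq> Y" "y0 \<in> Y'" "open V" "L (F y0) \<in> V"
    "\<And>x. x \<in> Y' \<Longrightarrow> L (F x) \<in> V" "\<And>x. x \<in> Y' \<Longrightarrow> h (L (F x)) = x"
    "\<And>y. y \<in> V \<Longrightarrow> h y \<in> Y'" "\<And>y. y \<in> V \<Longrightarrow> L (F (h y)) = y" "Ck_on (Suc (Suc 0)) h V"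
    "\<And>x. x \<in> Y' \<Longrightarrow> bij (FD (\<lambda>y. L (F y)) x)"
    by (rule C2_inverse_function[OF Y(1) C Y(3) inj']) (rule that)
  have oA: "open (L -` V)" using continuous_open_vimage[OF h(4)] linear_continuous_at[OF bL] by blast
  show thesis
  proof (rule that[OF h(1-3) oA])
    show "Ck_on (Suc (Suc 0)) (\<lambda>x. h (L x)) (L -` V)"
      by (rule Ck_on_compose[OF oA h(4,10) Ck_on_bounded_linear[OF bL oA Ck_on_id[OF oA]]]) auto
  qed (use h in auto)
qed

text \<open>The kernel of \<open>l\<close> is a subspace, the model space of the hypersurface a
  type; \<open>j\<close> identifies them, and \<pi> is the projection along \<open>e\<close>
  followed by this identification.\<close>

lemma hyperplane_split:
  fixes l :: "'e::euclidean_space \<Rightarrow> real" and e :: 'e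
  assumes l: "linear l" and e: "l e \<noteq> 0" and dim: "DIM('e) = DIM('f::euclidean_space) + 1"
  obtains j :: "'f::euclidean_space \<Rightarrow> 'e" and \<pi> :: "'e \<Rightarrow> 'f" where "linear j" "linear \<pi>" "\<And>y. \<pi> (j y) = y" "\<pi> e = 0"
    "\<And>y. l (j y) = 0" "\<And>v. v = j (\<pi> v) + (l v / l e) *\<^sub>R e"
proof -
  define a where "a = (\<Sum>b\<in>Basis. l b *\<^sub>R b)"
  have la: "l v = a \<bullet> v" for v
    using linear_expand[OF l, of v] by (simp add: a_def inner_sum_right inner_commute[of _ v] mult.commute)
  then have "a \<noteq> 0" using e by auto
  define S where "S = {v. a \<bullet> v = 0}"
  have S: "subspace S" unfolding S_def by (rule subspace_hyperplane)
  have "dim S = DIM('f)" using dim_hyperplane[OF \<open>a \<noteq> 0\<close>] dim by (simp add: S_def)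
  then have "dim (UNIV :: 'f set) = dim S" by simp
  note dimS = this
  obtain j :: "'f \<Rightarrow> 'e" and i where j: "linear j" "linear i" "j ` UNIV = S" "i ` S = UNIV"
    "\<And>y. norm (j y) = norm y" "\<And>v. v \<in> S \<Longrightarrow> norm (i v) = norm v"
    "\<And>y. i (j y) = y" "\<And>v. v \<in> S \<Longrightarrow> j (i v) = v"
    by (rule isometries_subspaces[OF subspace_UNIV S dimS]) (rule that, simp_all)
  define \<pi> where "\<pi> v = i (v - (l v / l e) *\<^sub>R e)" for v
  have lj: "l (j y) = 0" for y using j(3) la by (auto simp: S_def)
  have inS: "v - (l v / l e) *\<^sub>R e \<in> S" for v
    using e by (simp add: S_def la[symmetric] linear_diff[OF l] linear_scale[OF l])
  show thesis
  proof (rule that[of j \<pi>])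
    show "linear \<pi>"
      unfolding \<pi>_def by (intro linearI) (simp_all add: linear_add[OF l] linear_scale[OF l] linear_add[OF j(2)] linear_diff[OF j(2)]
        linear_scale[OF j(2)] scaleR_add_left add_divide_distrib algebra_simps)
    show "\<pi> (j y) = y" for y using lj by (simp add: \<pi>_def j(7))
    show "\<pi> e = 0" using e by (simp add: \<pi>_def linear_0[OF j(2)])
    show "v = j (\<pi> v) + (l v / l e) *\<^sub>R e" for v using j(8)[OF inS] by (simp add: \<pi>_def)
  qed (use j lj in auto)
qed

section \<open>Level hypersurfaces\<close>

text \<open>Isolates what is used of geodesic spheres: a function \<open>rho\<close> with C^1
  gradient \<open>T\<close>, with |T|^2 = 2 rho and a symmetric Hessian that fixes \<open>T\<close>.
  The exponential map does not enter.\<close>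

locale level_hypersurface = riemannian M for M :: "('a, 'e::euclidean_space) riem" +
  fixes c :: "('a, 'e) chart" and V :: "'e set" and T :: "'e \<Rightarrow> 'e" and rho :: "'e \<Rightarrow> real" and R :: real
    and F_type :: "'f::euclidean_space itself"
  assumes dim: "DIM('e) = DIM('f) + 1"
    and c: "c \<in> atlas M" and V: "open V" "V \<subseteq> chart_range c" and R: "R > 0"
    and C1_T: "Ck_on (Suc 0) T V"
    and drho: "\<And>x. x \<in> V \<Longrightarrow> (rho has_derivative (\<lambda>v. metric M c x (T x) v)) (at x)"
    and g_T: "\<And>x. x \<in> V \<Longrightarrow> metric M c x (T x) (T x) = 2 * rho x"
    and hessian_sym: "\<And>x u v. x \<in> V \<Longrightarrow> metric M c x (FD T x u + chris (metric M c) x u (T x)) v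
      = metric M c x u (FD T x v + chris (metric M c) x v (T x))"
    and hessian_T: "\<And>x v. x \<in> V \<Longrightarrow> metric M c x (FD T x v + chris (metric M c) x v (T x)) (T x) = metric M c x (T x) v"
begin

sublocale A: local_metric "chart_range c" "metric M c"
  by (rule local_metric_chart[OF c])

abbreviation "g \<equiv> metric M c"

definition L :: "'e set" where "L = {x \<in> V. rho x = R\<^sup>2 / 2}"
definition G :: "'a set" where "G = chart_inv c ` L"

lemma LV: "x \<in> L \<Longrightarrow> x \<in> V" "x \<in> L \<Longrightarrow> x \<in> chart_range c" "x \<in> L \<Longrightarrow> rho x = R\<^sup>2 / 2"
  using V by (auto simp: L_def)

lemma T_L: "x \<in> L \<Longrightarrow> g x (T x) (T x) = R\<^sup>2"
  using g_T[OF LV(1)] LV(3) by simp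

lemma G_chart: "p \<in> G \<Longrightarrow> p \<in> chart_dom c" "p \<in> G \<Longrightarrow> chart_map c p \<in> L"
  using chart_inv_right[OF chart[OF c]] LV(2) by (auto simp: G_def)

lemma G_points: "G \<subseteq> points M"
  using G_chart(1) dom_subset[OF chart[OF c]] by blast

lemma C2_rho: "Ck_on (Suc (Suc 0)) rho V"
proof (rule Ck_on_SucI[OF V(1) drho])
  show "Ck_on (Suc 0) (\<lambda>x. g x (T x) v) V" for v
    by (rule Ck_on_bilinear_family[OF V(1) A.open_U A.g_bil Ck_on_SucD[OF A.g2] _ Ck_on_id[OF V(1)] C1_T Ck_on_const[OF V(1)]])
      (use V in auto)
qed

text \<open>Since the level set is transversal to e = T x0, the pair of \<pi> and \<open>rho\<close>
  is a coordinate system near \<open>x0\<close>, packed into one map \<Psi> by the splitting along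
  \<open>e\<close>. The level set is the slice where \<open>rho\<close> equals R^2/2.\<close>

lemma graph_parametrization:
  assumes x0: "x0 \<in> L"
  obtains U' Y and \<pi> :: "'e \<Rightarrow> 'f" and F :: "'f \<Rightarrow> 'e" where "open U'" "x0 \<in> U'" "U' \<subseteq> V" "open Y" "linear \<pi>"
    "\<And>x. x \<in> U' \<Longrightarrow> x \<in> L \<Longrightarrow> \<pi> x \<in> Y" "\<And>x. x \<in> U' \<Longrightarrow> x \<in> L \<Longrightarrow> F (\<pi> x) = x"
    "\<And>y. y \<in> Y \<Longrightarrow> F y \<in> U'" "\<And>y. y \<in> Y \<Longrightarrow> F y \<in> L" "\<And>y. y \<in> Y \<Longrightarrow> \<pi> (F y) = y"
    "Ck_on (Suc (Suc 0)) F Y"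
proof -
  define l where "l v = g x0 (T x0) v" for v
  define e where "e = T x0"
  have l: "linear l" unfolding l_def using A.g_bil[OF LV(2)[OF x0]] by (simp add: bilinear_def)
  have le: "l e \<noteq> 0" using T_L[OF x0] R by (simp add: l_def e_def)
  obtain j :: "'f \<Rightarrow> 'e" and \<pi> :: "'e \<Rightarrow> 'f" where j: "linear j" "linear \<pi>" "\<And>y. \<pi> (j y) = y" "\<pi> e = 0"
    "\<And>y. l (j y) = 0" "\<And>v. v = j (\<pi> v) + (l v / l e) *\<^sub>R e"
    by (rule hyperplane_split[OF l le dim]) (rule that)
  have bj: "bounded_linear j" and bp: "bounded_linear \<pi>" using j(1,2) linear_conv_bounded_linear by blast+
  define \<Psi> where "\<Psi> x = j (\<pi> x) + rho x *\<^sub>R e" for x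
  have C: "Ck_on (Suc (Suc 0)) \<Psi> V"
    unfolding \<Psi>_def
    by (intro Ck_on_add Ck_on_scaleR V(1) C2_rho Ck_on_const Ck_on_bounded_linear[OF bj] Ck_on_bounded_linear[OF bp] Ck_on_id)
  have xV: "x0 \<in> V" using LV(1)[OF x0] .
  have d\<Psi>: "FD \<Psi> x0 v = j (\<pi> v) + l v *\<^sub>R e" for v
  proof -
    have "(\<Psi> has_derivative (\<lambda>v. j (\<pi> v) + l v *\<^sub>R e)) (at x0)"
      unfolding \<Psi>_def[abs_def] l_def
      by (intro has_derivative_add bounded_linear.has_derivative[OF bj] bounded_linear.has_derivative[OF bp]
          has_derivative_ident bounded_linear.has_derivative[OF bounded_linear_scaleR_left] drho xV)
    then show ?thesis by (simp add: FD_eq)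
  qed
  have split: "a = b \<and> y = z" if "j y + a *\<^sub>R e = j z + b *\<^sub>R e" for y z a b
  proof -
    have "a * l e = b * l e"
      using arg_cong[OF that, of l] by (simp add: linear_add[OF l] linear_scale[OF l] j(5))
    moreover have "y = z"
      using arg_cong[OF that, of \<pi>] by (simp add: linear_add[OF j(2)] linear_scale[OF j(2)] j(3,4))
    ultimately show ?thesis using le by simp
  qed
  have inj: "inj (FD \<Psi> x0)"
  proof (rule injI)
    fix u v assume "FD \<Psi> x0 u = FD \<Psi> x0 v"
    then have "l u = l v \<and> \<pi> u = \<pi> v" unfolding d\<Psi> by (rule split)
    then show "u = v" using j(6)[of u] j(6)[of v] by simp
  qed
  obtain U' W h where h: "open U'" "U' \<subseteq> V" "x0 \<in> U'" "open W" "\<Psi> x0 \<in> W"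
    "\<And>x. x \<in> U' \<Longrightarrow> \<Psi> x \<in> W" "\<And>x. x \<in> U' \<Longrightarrow> h (\<Psi> x) = x"
    "\<And>y. y \<in> W \<Longrightarrow> h y \<in> U'" "\<And>y. y \<in> W \<Longrightarrow> \<Psi> (h y) = y" "Ck_on (Suc (Suc 0)) h W"
    "\<And>x. x \<in> U' \<Longrightarrow> bij (FD \<Psi> x)"
    by (rule C2_inverse_function[OF V(1) C xV inj]) (rule that)
  define k where "k y = j y + (R\<^sup>2 / 2) *\<^sub>R e" for y
  define Y where "Y = k -` W"
  have ck: "isCont k y" for y unfolding k_def by (intro continuous_intros linear_continuous_at bj)
  have oO: "open Y" unfolding Y_def using continuous_open_vimage[OF h(4)] ck by blast
  have Ck: "Ck_on (Suc (Suc 0)) k Y"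
    unfolding k_def by (intro Ck_on_add oO Ck_on_bounded_linear[OF bj oO] Ck_on_id Ck_on_const)
  have kL: "\<Psi> x = k (\<pi> x)" if "x \<in> L" for x using LV(3)[OF that] by (simp add: \<Psi>_def k_def)
  show thesis
  proof (rule that[of U' Y \<pi> "\<lambda>y. h (k y)"])
    fix x assume x: "x \<in> U'" "x \<in> L"
    show "\<pi> x \<in> Y" "h (k (\<pi> x)) = x" using h(6,7)[OF x(1)] kL[OF x(2)] by (auto simp: Y_def)
  next
    fix y assume y: "y \<in> Y"
    then have W: "k y \<in> W" by (simp add: Y_def)
    then show "h (k y) \<in> U'" by (rule h(8))
    have "j (\<pi> (h (k y))) + rho (h (k y)) *\<^sub>R e = j y + (R\<^sup>2 / 2) *\<^sub>R e"
      using h(9)[OF W] by (simp add: \<Psi>_def k_def)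
    from split[OF this] show "h (k y) \<in> L" "\<pi> (h (k y)) = y" using h(2) h(8)[OF W] by (auto simp: L_def)
  next
    show "Ck_on (Suc (Suc 0)) (\<lambda>y. h (k y)) Y"
      by (rule Ck_on_compose[OF oO h(4,10) Ck]) (auto simp: Y_def)
  qed (use h oO j in auto)
qed

text \<open>The chart is \<pi> in the coordinates of \<open>c\<close>, on the piece of
  \<open>G\<close> that the graph covers; its inverse is an immersion because \<pi> is a left
  inverse of it.\<close>

lemma is_submanifold_G: "is_submanifold M G TYPE('f)"
  unfolding is_submanifold_def
proof (intro conjI ballI G_points)
  fix q assume q: "q \<in> G"
  note tc = chart[OF c]
  define x0 where "x0 = chart_map c q"
  have x0: "x0 \<in> L" using G_chart(2)[OF q] by (simp add: x0_def)
  obtain U' Y and \<pi> :: "'e \<Rightarrow> 'f" and F :: "'f \<Rightarrow> 'e" where F: "open U'" "x0 \<in> U'" "U' \<subseteq> V" "open Y" "linear \<pi>"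
    "\<And>x. x \<in> U' \<Longrightarrow> x \<in> L \<Longrightarrow> \<pi> x \<in> Y" "\<And>x. x \<in> U' \<Longrightarrow> x \<in> L \<Longrightarrow> F (\<pi> x) = x"
    "\<And>y. y \<in> Y \<Longrightarrow> F y \<in> U'" "\<And>y. y \<in> Y \<Longrightarrow> F y \<in> L" "\<And>y. y \<in> Y \<Longrightarrow> \<pi> (F y) = y"
    "Ck_on (Suc (Suc 0)) F Y"
    by (rule graph_parametrization[OF x0]) (rule that)
  define D where "D = {p \<in> G. chart_map c p \<in> U'}"
  define k where "k = (D, \<lambda>p. \<pi> (chart_map c p))"
  have kd: "chart_dom k = D" "chart_map k = (\<lambda>p. \<pi> (chart_map c p))" by (auto simp: k_def)
  have DF: "chart_inv c (F y) \<in> D" "chart_map k (chart_inv c (F y)) = y" if y: "y \<in> Y" for y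
  proof -
    have "chart_map c (chart_inv c (F y)) = F y" using chart_inv_right(2)[OF tc LV(2)[OF F(9)[OF y]]] .
    then show "chart_inv c (F y) \<in> D" "chart_map k (chart_inv c (F y)) = y"
      using F(8-10)[OF y] by (auto simp: D_def G_def kd)
  qed
  have FD': "F (chart_map k p) = chart_map c p" "chart_map k p \<in> Y" "chart_inv c (F (chart_map k p)) = p" if p: "p \<in> D" for p
  proof -
    have p': "chart_map c p \<in> U'" "chart_map c p \<in> L" "p \<in> chart_dom c" using p G_chart by (auto simp: D_def)
    show "F (chart_map k p) = chart_map c p" "chart_map k p \<in> Y" using F(6,7)[OF p'(1,2)] by (auto simp: kd)
    then show "chart_inv c (F (chart_map k p)) = p" using chart_inv_left[OF tc p'(3)] by simp
  qed
  have range: "chart_range k = Y" using DF FD'(2) by (force simp: kd(1))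
  have Dc: "D \<subseteq> chart_dom c" using G_chart(1) by (auto simp: D_def)
  have Dp: "D \<subseteq> points M" using G_points by (auto simp: D_def)
  have inj: "inj_on (chart_map k) D" using FD'(3) by (metis inj_onI)
  have kinv: "chart_inv k y = chart_inv c (F y)" if "y \<in> Y" for y
    unfolding chart_inv_def[of k] kd(1) using inv_into_f_f[OF inj DF(1)[OF that]] DF(2)[OF that] by simp
  have cF: "continuous_on Y F" using Ck_on_mono[OF F(11), of 0] by simp
  have "homeomorphic_maps (subtopology (mtop M) D) (top_of_set Y) (chart_map k) (\<lambda>y. chart_inv c (F y))"
    unfolding homeomorphic_maps_def
  proof (intro conjI ballI)
    have 1: "continuous_map (subtopology (mtop M) D) euclidean (chart_map c)"
      using continuous_map_from_subtopology[OF continuous_chart_map[OF tc], of D] Dc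
      by (simp add: subtopology_subtopology inf.absorb2)
    have "continuous_map euclidean euclidean \<pi>"
      using linear_continuous_on[of \<pi> UNIV] F(5) linear_conv_bounded_linear by auto
    from continuous_map_compose[OF 1 this]
    show "continuous_map (subtopology (mtop M) D) (top_of_set Y) (chart_map k)"
      using FD'(2) Dp by (intro continuous_map_into_subtopology) (auto simp: kd(2) o_def)
    have "continuous_map (top_of_set Y) (top_of_set (chart_range c)) F"
      using cF LV(2)[OF F(9)] by (intro continuous_map_into_subtopology) auto
    from continuous_map_compose[OF this continuous_chart_inv[OF tc]]
    show "continuous_map (top_of_set Y) (subtopology (mtop M) D) (\<lambda>y. chart_inv c (F y))"
      using DF(1) by (intro continuous_map_into_subtopology) (auto simp: o_def)
  qed (use DF FD' Dp in auto)
  then have hom: "homeomorphic_map (subtopology (mtop M) (chart_dom k)) (top_of_set (chart_range k)) (chart_map k)"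
    unfolding range unfolding kd(1) by (rule homeomorphic_maps_imp_map)
  have "openin (subtopology (mtop M) (chart_dom c)) {p \<in> topspace (subtopology (mtop M) (chart_dom c)). chart_map c p \<in> U'}"
    by (rule openin_continuous_map_preimage[OF continuous_chart_map[OF tc]]) (use F(1) in simp)
  moreover have "openin (mtop M) (chart_dom c)" using tc unfolding top_chart_def by blast
  ultimately have "openin (mtop M) {p \<in> topspace (subtopology (mtop M) (chart_dom c)). chart_map c p \<in> U'}"
    by (rule openin_trans_full)
  then have "openin (subtopology (mtop M) G) (G \<inter> {p \<in> topspace (subtopology (mtop M) (chart_dom c)). chart_map c p \<in> U'})"
    by (rule openin_subtopology_Int2)
  moreover have "G \<inter> {p \<in> topspace (subtopology (mtop M) (chart_dom c)). chart_map c p \<in> U'} = D"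
    using G_chart(1) G_points by (auto simp: D_def)
  ultimately have op: "openin (subtopology (mtop M) G) (chart_dom k)" by (simp add: kd(1))
  have dF: "y \<in> Y \<Longrightarrow> (F has_derivative FD F y) (at y)" for y by (rule Ck_on_has_derivative[OF F(11,4)])
  have injF: "v = w" if y: "y \<in> Y" and "FD F y v = FD F y w" for y v w
  proof -
    have 1: "((\<lambda>y. \<pi> (F y)) has_derivative (\<lambda>v. \<pi> (FD F y v))) (at y)"
      using F(5) linear_conv_bounded_linear by (intro bounded_linear.has_derivative[OF _ dF[OF y]]) blast
    have 2: "((\<lambda>y. \<pi> (F y)) has_derivative (\<lambda>v. v)) (at y)"
      by (rule has_derivative_transform_within_open[OF has_derivative_ident F(4) y]) (simp add: F(10))
    show ?thesis using has_derivative_unique[OF 1 2] that(2) by metis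
  qed
  have "submanifold_chart M G k"
    unfolding submanifold_chart_def
  proof (intro conjI ballI op hom)
    show "open (chart_range k)" unfolding range by (rule F(4))
    fix d assume d: "d \<in> atlas M"
    define Q where "Q = chart_map k ` (chart_dom k \<inter> chart_dom d)"
    let ?W = "chart_map c ` (chart_dom c \<inter> chart_dom d)"
    have QO: "Q \<subseteq> Y" using FD'(2) by (auto simp: Q_def kd(1))
    have oW: "open ?W" by (rule open_overlap[OF c d])
    have Q: "Q = Y \<inter> F -` ?W"
    proof (intro equalityI subsetI)
      fix y assume "y \<in> Q"
      then obtain p where p: "p \<in> D" "p \<in> chart_dom d" "y = chart_map k p" by (auto simp: Q_def kd(1))
      then show "y \<in> Y \<inter> F -` ?W" using FD'(1,2)[OF p(1)] Dc by auto
    next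
      fix y assume y: "y \<in> Y \<inter> F -` ?W"
      then obtain p where p: "F y = chart_map c p" "p \<in> chart_dom c" "p \<in> chart_dom d" by auto
      then have "chart_inv c (F y) = p" using chart_inv_left[OF tc] by simp
      then have "p \<in> D" "y = chart_map k p" using DF[of y] y by auto
      then show "y \<in> Q" using p(3) by (auto simp: Q_def kd(1))
    qed
    have oQ: "open Q" unfolding Q by (rule continuous_open_preimage[OF cF F(4) oW])
    have tr: "transition k d y = transition c d (F y)" if "y \<in> Q" for y
      using kinv[of y] QO that by (auto simp: transition_def)
    have C2t: "Ck_on (Suc (Suc 0)) (transition c d) ?W" by (rule Ck_on_SucD[OF C3_transition[OF c d]])
    have CQ: "Ck_on (Suc (Suc 0)) (\<lambda>y. transition c d (F y)) Q"
      by (rule Ck_on_compose[OF oQ oW C2t Ck_on_subset[OF F(11) QO]]) (auto simp: Q)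
    then show "Ck_on 2 (transition k d) (chart_map k ` (chart_dom k \<inter> chart_dom d))"
      unfolding Q_def[symmetric] numeral_2_eq_2 using Ck_on_cong[where f = "transition k d", OF oQ tr] by blast
    fix y assume "y \<in> chart_map k ` (chart_dom k \<inter> chart_dom d)"
    then have y: "y \<in> Q" "y \<in> Y" "F y \<in> ?W" using QO Q by (auto simp: Q_def)
    have "FD (transition k d) y = FD (\<lambda>y. transition c d (F y)) y" by (rule FD_cong[OF oQ y(1) tr])
    also have "\<dots> = (\<lambda>v. FD (transition c d) (F y) (FD F y v))"
      by (rule FD_eq[OF has_derivative_compose[OF dF[OF y(2)] Ck_on_has_derivative[OF C2t oW y(3)]]])
    finally have e: "FD (transition k d) y = (\<lambda>v. FD (transition c d) (F y) (FD F y v))" .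
    show "inj (FD (transition k d) y)"
      unfolding e using injF[OF y(2)] isometry.inj[OF isometry_chart[OF c d] y(3)] by (auto intro!: injI dest: injD)
  qed
  moreover have "q \<in> chart_dom k" using q F(2) by (simp add: kd(1) D_def x0_def)
  ultimately show "\<exists>k :: ('a, 'f) chart. submanifold_chart M G k \<and> q \<in> chart_dom k" by blast
qed

end

lemma has_vector_derivative_FD:
  fixes f :: "'e::euclidean_space \<Rightarrow> 'c::euclidean_space"
  assumes "open W" "Ck_on (Suc k) f W" "X s \<in> W" "(X has_vector_derivative X') (at s within S)"
  shows "((\<lambda>s. f (X s)) has_vector_derivative FD f (X s) X') (at s within S)"
  using has_derivative_compose[OF assms(4)[unfolded has_vector_derivative_def] Ck_on_has_derivative[OF assms(2,1,3)]]
    linear_scale[OF has_derivative_linear[OF Ck_on_has_derivative[OF assms(2,1,3)]]]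
  by (simp add: has_vector_derivative_def)

lemma has_derivative_FD_apply:
  fixes f :: "'e::euclidean_space \<Rightarrow> 'c::euclidean_space"
  assumes W: "open W" "Ck_on (Suc (Suc k)) f W" and X: "X z \<in> W" "(X has_derivative X') (at z within S)"
    and V: "(V has_derivative V') (at z within S)"
  shows "((\<lambda>z. FD f (X z) (V z)) has_derivative (\<lambda>h. FD (\<lambda>y. FD f y (V z)) (X z) (X' h) + FD f (X z) (V' h))) (at z within S)"
proof -
  have lin: "linear (FD f x)" if "x \<in> W" for x
    by (rule has_derivative_linear[OF Ck_on_has_derivative[OF W(2,1) that]])
  have bil: "bilinear (\<lambda>v (r::real). r *\<^sub>R FD f x v)" if "x \<in> W" for x
    unfolding bilinear_def using lin[OF that]
    by (auto intro!: linearI simp: linear_add linear_scale scaleR_add_left scaleR_add_right)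
  have d: "((\<lambda>x. (r::real) *\<^sub>R FD f x v) has_derivative (\<lambda>h. r *\<^sub>R FD (\<lambda>y. FD f y v) (X z) h)) (at (X z))" for r v
    by (rule has_derivative_scaleR_right[OF Ck_on_has_derivative[OF Ck_on_FD[OF W(2)] W(1) X(1)]])
  have "((\<lambda>z. (1::real) *\<^sub>R FD f (X z) (V z)) has_derivative
     (\<lambda>h. (1::real) *\<^sub>R FD (\<lambda>y. FD f y (V z)) (X z) (X' h) + (1::real) *\<^sub>R FD f (X z) (V' h) + (0::real) *\<^sub>R FD f (X z) (V z))) (at z within S)"
    by (rule has_derivative_bilinear_family[OF W(1) bil d X V has_derivative_const])
  then show ?thesis by simp
qed

lemma has_vector_derivative_FD_apply:
  fixes f :: "'e::euclidean_space \<Rightarrow> 'c::euclidean_space"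
  assumes W: "open W" "Ck_on (Suc (Suc k)) f W" and X: "X s \<in> W" "(X has_vector_derivative X') (at s within S)"
    and V: "(V has_vector_derivative V') (at s within S)"
  shows "((\<lambda>s. FD f (X s) (V s)) has_vector_derivative FD (\<lambda>y. FD f y (V s)) (X s) X' + FD f (X s) V') (at s within S)"
  unfolding has_vector_derivative_def
  by (rule has_derivative_eq_rhs[OF has_derivative_FD_apply[OF W X[unfolded has_vector_derivative_def] V[unfolded has_vector_derivative_def]]])
    (simp add: fun_eq_iff scaleR_add_right linear_scale[OF has_derivative_linear[OF Ck_on_has_derivative[OF W(2,1) X(1)]]]
      linear_scale[OF has_derivative_linear[OF Ck_on_has_derivative[OF Ck_on_FD[OF W(2)] W(1) X(1)]]])

text \<open>Local first and second derivatives agree on overlaps because derivatives within a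
  nondegenerate interval are unique; choosing them by \<open>vector_derivative\<close> glues
  them.\<close>

lemma C2_local:
  fixes f :: "real \<Rightarrow> 'c::real_normed_vector"
  assumes I: "nondegenerate_interval I" "S \<subseteq> I"
    and loc: "\<And>s. s \<in> S \<Longrightarrow> \<exists>A v a. open A \<and> s \<in> A \<and> I \<inter> A \<subseteq> S \<and>
      (\<forall>t\<in>I \<inter> A. (f has_vector_derivative v t) (at t within I) \<and> (v has_vector_derivative a t) (at t within I)) \<and>
      continuous_on (I \<inter> A) a"
  shows "\<exists>v a. (\<forall>s\<in>S. (f has_vector_derivative v s) (at s within I) \<and> (v has_vector_derivative a s) (at s within I)) \<and>
    continuous_on S a"
proof -
  define v where "v s = vector_derivative f (at s within I)" for s
  define a where "a s = vector_derivative v (at s within I)" for s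
  have *: "(f has_vector_derivative v s) (at s within I) \<and> (v has_vector_derivative a s) (at s within I) \<and> continuous (at s within S) a"
    if s: "s \<in> S" for s
  proof -
    obtain A v0 a0 where A: "open A" "s \<in> A" "I \<inter> A \<subseteq> S"
      "\<And>t. t \<in> I \<inter> A \<Longrightarrow> (f has_vector_derivative v0 t) (at t within I)"
      "\<And>t. t \<in> I \<inter> A \<Longrightarrow> (v0 has_vector_derivative a0 t) (at t within I)" "continuous_on (I \<inter> A) a0"
      using loc[OF s] by blast
    note nb = nondegenerate_at_within[OF I(1)]
    have v: "v t = v0 t" if "t \<in> I \<inter> A" for t
      unfolding v_def using vector_derivative_within[OF nb A(4)[OF that]] that by blast
    have dv: "(v has_vector_derivative a0 t) (at t within I)" if t: "t \<in> I \<inter> A" for t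
    proof -
      have "\<forall>\<^sub>F x in at t within I. v0 x = v x"
        unfolding eventually_at_topological using A(1) t v by (intro exI[of _ A]) auto
      then show ?thesis
        using has_derivative_transform_eventually[OF A(5)[OF t, unfolded has_vector_derivative_def], of v] v[OF t] t
        by (simp add: has_vector_derivative_def)
    qed
    have a: "a t = a0 t" if "t \<in> I \<inter> A" for t
      unfolding a_def using vector_derivative_within[OF nb dv[OF that]] that by blast
    have sIA: "s \<in> I \<inter> A" using s A(2) I(2) by blast
    have "continuous_on (I \<inter> A) a" by (rule continuous_on_eq[OF A(6)]) (simp add: a)
    moreover have "at s within S = at s within (I \<inter> A)"
      by (rule at_within_nhd[OF A(2,1)]) (use A(3) I(2) in auto)
    ultimately have "continuous (at s within S) a" using sIA by (simp add: continuous_on_eq_continuous_within)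
    then show ?thesis using A(4)[OF sIA] dv[OF sIA] v[OF sIA] a[OF sIA] by simp
  qed
  then show ?thesis by (intro exI[of _ v] exI[of _ a]) (simp add: continuous_on_eq_continuous_within)
qed

section \<open>The induced structure of a level hypersurface\<close>

context level_hypersurface
begin

abbreviation N :: "('a, 'f) riem" where "N \<equiv> submanifold M G"
abbreviation F :: "('a, 'f) chart \<Rightarrow> 'f \<Rightarrow> 'e" where "F k \<equiv> transition k c"

lemma mtop_N: "mtop N = subtopology (mtop M) G"
  and atlas_N: "atlas N = {k. submanifold_chart M G k}"
  by (simp_all add: submanifold_def)

lemma points_N: "points N = G"
  using G_points by (auto simp: mtop_N)

lemma dom_N:
  assumes "k \<in> atlas N"
  shows "chart_dom k \<subseteq> G" "chart_dom k \<subseteq> chart_dom c"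
proof -
  have "openin (subtopology (mtop M) G) (chart_dom k)"
    using assms unfolding atlas_N submanifold_chart_def by blast
  then show "chart_dom k \<subseteq> G" using openin_subset by fastforce
  then show "chart_dom k \<subseteq> chart_dom c" using G_chart(1) by blast
qed

lemma chart_N:
  assumes k: "k \<in> atlas N"
  shows "top_chart (mtop N) k"
proof -
  have "subtopology (mtop N) (chart_dom k) = subtopology (mtop M) (chart_dom k)"
    using dom_N(1)[OF k] by (simp add: mtop_N subtopology_subtopology inf.absorb2)
  then show ?thesis using k unfolding top_chart_def mtop_N atlas_N submanifold_chart_def by simp
qed

lemma transition_map:
  "k \<in> atlas N \<Longrightarrow> p \<in> chart_dom k \<Longrightarrow> transition k d (chart_map k p) = chart_map d p"
  using chart_inv_left[OF chart_N] by (simp add: transition_def)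

lemma F_L: "k \<in> atlas N \<Longrightarrow> y \<in> chart_range k \<Longrightarrow> F k y \<in> L"
  using transition_map[where d = c] G_chart(2) dom_N(1) by fastforce

lemma open_range: "k \<in> atlas N \<Longrightarrow> open (chart_range k)"
  using chart_N unfolding top_chart_def by blast

lemma C2_F:
  assumes k: "k \<in> atlas N"
  shows "Ck_on (Suc (Suc 0)) (F k) (chart_range k)" "y \<in> chart_range k \<Longrightarrow> inj (FD (F k) y)"
proof -
  have e: "chart_map k ` (chart_dom k \<inter> chart_dom c) = chart_range k"
    using dom_N(2)[OF k] by (simp add: inf.absorb1)
  have "Ck_on 2 (F k) (chart_map k ` (chart_dom k \<inter> chart_dom c)) \<and>
    (\<forall>y \<in> chart_map k ` (chart_dom k \<inter> chart_dom c). inj (FD (F k) y))"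
    using k c unfolding atlas_N submanifold_chart_def by blast
  then show "Ck_on (Suc (Suc 0)) (F k) (chart_range k)" "y \<in> chart_range k \<Longrightarrow> inj (FD (F k) y)"
    unfolding e numeral_2_eq_2 by blast+
qed

lemma dF: "k \<in> atlas N \<Longrightarrow> y \<in> chart_range k \<Longrightarrow> (F k has_derivative FD (F k) y) (at y)"
  by (rule Ck_on_has_derivative[OF C2_F(1) open_range])

lemma lin_F: "k \<in> atlas N \<Longrightarrow> y \<in> chart_range k \<Longrightarrow> linear (FD (F k) y)"
  by (rule has_derivative_linear[OF dF])

lemma FD_transition:
  assumes k: "k \<in> atlas N" and d: "d \<in> atlas M" and p: "p \<in> chart_dom k" "p \<in> chart_dom d"
  shows "FD (transition k d) (chart_map k p) u = FD (transition c d) (chart_map c p) (FD (F k) (chart_map k p) u)"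
proof -
  let ?Q = "chart_map k ` (chart_dom k \<inter> chart_dom d)"
  let ?y = "chart_map k p"
  have "?Q = chart_map k ` (chart_dom k \<inter> (G \<inter> chart_dom d))" using dom_N(1)[OF k] by auto
  moreover have "openin (mtop N) (G \<inter> chart_dom d)"
    unfolding mtop_N using chart[OF d] openin_subtopology_Int2 unfolding top_chart_def by blast
  ultimately have oQ: "open ?Q" using open_chart_image[OF chart_N[OF k]] by simp
  have tr: "transition k d y = transition c d (F k y)" if "y \<in> ?Q" for y
    using that transition_map[OF k, where d = d] transition_map[OF k, where d = c] transition_at[OF c, where d = d] dom_N(2)[OF k] by auto
  have y: "?y \<in> ?Q" "?y \<in> chart_range k" using p by auto
  have Fy: "F k ?y = chart_map c p" by (rule transition_map[OF k p(1)])
  have "FD (transition k d) ?y = FD (\<lambda>y. transition c d (F k y)) ?y" by (rule FD_cong[OF oQ y(1) tr])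
  also have "\<dots> = (\<lambda>v. FD (transition c d) (F k ?y) (FD (F k) ?y v))"
    by (rule FD_eq[OF has_derivative_compose[OF dF[OF k y(2)]]]) (use dtrans[OF c d] p dom_N(2)[OF k] Fy in auto)
  finally show ?thesis by (simp add: Fy)
qed

text \<open>Intrinsic coordinates are locally C^2 functions of the ambient ones; this serves
  transitions between charts of the hypersurface as well as curves in it.\<close>

lemma inverse_of_F:
  assumes k: "k \<in> atlas N" and p: "p \<in> chart_dom k"
  obtains W A l where "openin (mtop N) W" "p \<in> W" "W \<subseteq> chart_dom k" "open A" "Ck_on (Suc (Suc 0)) l A"
    "\<And>q. q \<in> W \<Longrightarrow> chart_map c q \<in> A" "\<And>q. q \<in> W \<Longrightarrow> l (chart_map c q) = chart_map k q"
proof -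
  have y: "chart_map k p \<in> chart_range k" using p by blast
  obtain Y A l where Y: "open Y" "Y \<subseteq> chart_range k" "chart_map k p \<in> Y" "open A"
    "\<And>y. y \<in> Y \<Longrightarrow> F k y \<in> A" "Ck_on (Suc (Suc 0)) l A" "\<And>y. y \<in> Y \<Longrightarrow> l (F k y) = y"
    by (rule local_left_inverse[OF open_range[OF k] C2_F(1)[OF k] y C2_F(2)[OF k y]]) (rule that)
  define W where "W = {q \<in> topspace (subtopology (mtop N) (chart_dom k)). chart_map k q \<in> Y}"
  have Wk: "W \<subseteq> chart_dom k" by (auto simp: W_def)
  have "openin (subtopology (mtop N) (chart_dom k)) W"
    unfolding W_def by (rule openin_continuous_map_preimage[OF continuous_chart_map[OF chart_N[OF k]]]) (use Y(1) in simp)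
  moreover have "openin (mtop N) (chart_dom k)" using chart_N[OF k] unfolding top_chart_def by blast
  ultimately have oW: "openin (mtop N) W" by (rule openin_trans_full)
  have pW: "p \<in> W" using p Y(3) topspace_dom[OF chart_N[OF k]] by (simp add: W_def)
  have "F k (chart_map k q) \<in> A" "l (F k (chart_map k q)) = chart_map k q" if "q \<in> W" for q
    using that Y(5,7) by (auto simp: W_def)
  then have "chart_map c q \<in> A" "l (chart_map c q) = chart_map k q" if "q \<in> W" for q
    unfolding transition_map[OF k subsetD[OF Wk that], of c, symmetric] using that by auto
  then show thesis by (rule that[OF oW pW Wk Y(4,6)])
qed

sublocale N: diff_atlas N
proof
  fix p assume "p \<in> points N"
  then show "\<exists>k\<in>atlas N. p \<in> chart_dom k"
    using is_submanifold_G unfolding points_N is_submanifold_def atlas_N by blast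
next
  fix k k' :: "('a, 'f) chart" and p
  assume k: "k \<in> atlas N" "k' \<in> atlas N" and p: "p \<in> chart_dom k" "p \<in> chart_dom k'"
  obtain W A l where W: "openin (mtop N) W" "p \<in> W" "W \<subseteq> chart_dom k'" "open A" "Ck_on (Suc (Suc 0)) l A"
    "\<And>q. q \<in> W \<Longrightarrow> chart_map c q \<in> A" "\<And>q. q \<in> W \<Longrightarrow> l (chart_map c q) = chart_map k' q"
    by (rule inverse_of_F[OF k(2) p(2)]) (rule that)
  let ?y = "chart_map k p" and ?Q = "chart_map k ` (chart_dom k \<inter> W)"
  have y: "?y \<in> ?Q" "?y \<in> chart_range k" using p W(2) by auto
  have oQ: "open ?Q" by (rule open_chart_image[OF chart_N[OF k(1)] W(1)])
  have Fy: "F k ?y = chart_map c p" by (rule transition_map[OF k(1) p(1)])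
  have dl: "(l has_derivative FD l (F k ?y)) (at (F k ?y))"
    unfolding Fy by (rule Ck_on_has_derivative[OF W(5,4) W(6)[OF W(2)]])
  have eq: "l (F k y) = transition k k' y" if "y \<in> ?Q" for y
    using that transition_map[OF k(1), where d = c] transition_map[OF k(1), where d = k'] W(7) by auto
  have "(transition k k' has_derivative (\<lambda>v. FD l (F k ?y) (FD (F k) ?y v))) (at ?y)"
    by (rule has_derivative_transform_within_open[OF has_derivative_compose[OF dF[OF k(1) y(2)] dl] oQ y(1) eq])
  then show "transition k k' differentiable (at ?y)" by (rule differentiableI)
qed (rule chart_N)

text \<open>Ambient regularity passes to the hypersurface by composition with a local C^2 left
  inverse of the parametrisation; the local data are glued by \<open>C2_local\<close>.\<close>

lemma C2_curve_N:
  assumes I: "nondegenerate_interval I" and \<alpha>: "C2_curve M I \<alpha>" "\<alpha> ` I \<subseteq> G"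
  shows "C2_curve N I \<alpha>"
  unfolding C2_curve_def
proof (intro conjI ballI)
  have "continuous_map (top_of_set I) (mtop M) \<alpha>" using \<alpha>(1) unfolding C2_curve_def by blast
  then show c\<alpha>: "continuous_map (top_of_set I) (mtop N) \<alpha>"
    unfolding mtop_N using \<alpha>(2) by (intro continuous_map_into_subtopology) auto
  have \<alpha>c: "\<alpha> s \<in> chart_dom c" if "s \<in> I" for s using that \<alpha>(2) G_chart(1) by blast
  obtain v a where va: "\<And>s. s \<in> I \<Longrightarrow> \<alpha> s \<in> chart_dom c \<Longrightarrow> ((\<lambda>t. chart_map c (\<alpha> t)) has_vector_derivative v s) (at s within I)"
    "\<And>s. s \<in> I \<Longrightarrow> \<alpha> s \<in> chart_dom c \<Longrightarrow> (v has_vector_derivative a s) (at s within I)"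
    "continuous_on {s \<in> I. \<alpha> s \<in> chart_dom c} a"
    by (rule curve_derivatives[OF I \<alpha>(1) c]) (rule that)
  define x where "x t = chart_map c (\<alpha> t)" for t
  have x: "(x has_vector_derivative v s) (at s within I)" "(v has_vector_derivative a s) (at s within I)" if "s \<in> I" for s
    using va(1,2)[OF that \<alpha>c[OF that]] by (simp_all add: x_def[abs_def])
  have cont: "continuous_on I x" "continuous_on I v"
    using x has_vector_derivative_continuous continuous_on_eq_continuous_within by blast+
  have "{s \<in> I. \<alpha> s \<in> chart_dom c} = I" using \<alpha>c by blast
  then have ca: "continuous_on I a" using va(3) by simp
  fix k assume k: "k \<in> atlas N"
  have "\<exists>v a. (\<forall>s\<in>{s \<in> I. \<alpha> s \<in> chart_dom k}. ((chart_map k \<circ> \<alpha>) has_vector_derivative v s) (at s within I) \<and>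
           (v has_vector_derivative a s) (at s within I)) \<and>
        continuous_on {s \<in> I. \<alpha> s \<in> chart_dom k} a"
  proof (rule C2_local[OF I])
    fix s assume "s \<in> {s \<in> I. \<alpha> s \<in> chart_dom k}"
    then have s: "s \<in> I" "\<alpha> s \<in> chart_dom k" by auto
    obtain W A l where W: "openin (mtop N) W" "\<alpha> s \<in> W" "W \<subseteq> chart_dom k" "open A" "Ck_on (Suc (Suc 0)) l A"
      "\<And>q. q \<in> W \<Longrightarrow> chart_map c q \<in> A" "\<And>q. q \<in> W \<Longrightarrow> l (chart_map c q) = chart_map k q"
      by (rule inverse_of_F[OF k s(2)]) (rule that)
    have "openin (top_of_set I) {t \<in> topspace (top_of_set I). \<alpha> t \<in> W}"
      by (rule openin_continuous_map_preimage[OF c\<alpha> W(1)])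
    then obtain Z where Z: "open Z" "{t \<in> I. \<alpha> t \<in> W} = I \<inter> Z" unfolding openin_open by auto
    let ?w = "\<lambda>t. FD l (x t) (v t)"
    let ?b = "\<lambda>t. FD (\<lambda>y. FD l y (v t)) (x t) (v t) + FD l (x t) (a t)"
    have ZW: "\<alpha> t \<in> W" "x t \<in> A" "l (x t) = chart_map k (\<alpha> t)" if "t \<in> I \<inter> Z" for t
      using that Z(2) W(6,7) by (auto simp: x_def)
    have dl: "(l has_derivative FD l y) (at y)" "((\<lambda>y. FD l y u) has_derivative FD (\<lambda>y. FD l y u) y) (at y)" if "y \<in> A" for y u
      using Ck_on_has_derivative[OF W(5,4) that] Ck_on_has_derivative[OF Ck_on_FD[OF W(5)] W(4) that] .
    have dk: "((chart_map k \<circ> \<alpha>) has_vector_derivative ?w t) (at t within I)" if t: "t \<in> I \<inter> Z" for t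
    proof -
      have "\<forall>\<^sub>F t' in at t within I. l (x t') = (chart_map k \<circ> \<alpha>) t'"
        unfolding eventually_at_topological using Z(1) t ZW(3) by (intro exI[of _ Z]) auto
      moreover have "((\<lambda>t. l (x t)) has_vector_derivative ?w t) (at t within I)"
        by (rule has_vector_derivative_FD[where X = x, OF W(4,5) ZW(2)[OF t] x(1)]) (use t in simp)
      ultimately show ?thesis
        unfolding has_vector_derivative_def using t ZW(3)[OF t]
        by (intro has_derivative_transform_eventually[where f = "\<lambda>t. l (x t)" and g = "chart_map k \<circ> \<alpha>"]) auto
    qed
    have dw: "(?w has_vector_derivative ?b t) (at t within I)" if t: "t \<in> I \<inter> Z" for t
      by (rule has_vector_derivative_FD_apply[where X = x and V = v, OF W(4,5) ZW(2)[OF t]]) (use x[of t] t in simp_all)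
    have IZ: "continuous_on (I \<inter> Z) x" "continuous_on (I \<inter> Z) v" "continuous_on (I \<inter> Z) a" "x ` (I \<inter> Z) \<subseteq> A"
      using cont ca ZW(2) by (auto elim: continuous_on_subset)
    have "continuous_on A (\<lambda>y. FD l y u)" "continuous_on A (\<lambda>y. FD (\<lambda>y. FD l y u) y w)" for u w
      using Ck_on_mono[OF Ck_on_FD[OF W(5)], of 0 u] Ck_on_mono[OF Ck_on_FD[OF Ck_on_FD[OF W(5)]], of 0 u w] by simp_all
    note cl = this
    have bil: "bilinear (\<lambda>u w. FD (\<lambda>y. FD l y u) y w)" if y: "y \<in> A" for y
      unfolding bilinear_def
    proof (intro conjI allI)
      show "linear (\<lambda>w. FD (\<lambda>y. FD l y u) y w)" for u by (rule has_derivative_linear[OF dl(2)[OF y]])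
      show "linear (\<lambda>u. FD (\<lambda>y. FD l y u) y w)" for w
        unfolding Ck_on_symmetric[OF W(4,5) y, of _ w] by (rule has_derivative_linear[OF dl(2)[OF y]])
    qed
    have "continuous_on (I \<inter> Z) ?b"
    proof (rule continuous_on_add)
      show "continuous_on (I \<inter> Z) (\<lambda>t. FD (\<lambda>y. FD l y (v t)) (x t) (v t))"
        by (rule continuous_bilinear_family[OF bil cl(2) IZ(1,4,2,2)])
      show "continuous_on (I \<inter> Z) (\<lambda>t. FD l (x t) (a t))"
        by (rule continuous_linear_family[OF has_derivative_linear[OF dl(1)] cl(1) IZ(1,4,3)])
    qed
    moreover have "s \<in> Z" "I \<inter> Z \<subseteq> {s \<in> I. \<alpha> s \<in> chart_dom k}" using s W(2,3) Z(2) by auto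
    ultimately show "\<exists>A v a. open A \<and> s \<in> A \<and> I \<inter> A \<subseteq> {s \<in> I. \<alpha> s \<in> chart_dom k} \<and>
      (\<forall>t\<in>I \<inter> A. ((chart_map k \<circ> \<alpha>) has_vector_derivative v t) (at t within I) \<and> (v has_vector_derivative a t) (at t within I)) \<and>
      continuous_on (I \<inter> A) a"
      using Z(1) dk dw by (intro exI[of _ Z]) (rule exI[of _ ?w], rule exI[of _ ?b], simp)
  qed auto
  then show "\<exists>v a. (\<forall>s\<in>I. \<alpha> s \<in> chart_dom k \<longrightarrow> ((chart_map k \<circ> \<alpha>) has_vector_derivative v s) (at s within I) \<and>
           (v has_vector_derivative a s) (at s within I)) \<and>
        continuous_on {s \<in> I. \<alpha> s \<in> chart_dom k} a" by (simp only: mem_Collect_eq Ball_def imp_conjL)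
qed

subsection \<open>Tangent spaces and the induced connection\<close>

text \<open>At points of \<open>L\<close>, where the square length of \<open>T\<close> is R^2, this
  is the orthogonal projection along \<open>T\<close>.\<close>

definition tang :: "'e \<Rightarrow> 'e \<Rightarrow> 'e" where "tang x w = w - (g x w (T x) / R\<^sup>2) *\<^sub>R T x"

text \<open>\<open>inv\<close> is a genuine inverse here: the projected vector lies in the range of
  the injective differential.\<close>

definition proj :: "('a, 'f) chart \<Rightarrow> 'f \<Rightarrow> 'e \<Rightarrow> 'f" where
  "proj k y w = inv (FD (F k) y) (tang (F k y) w)"

lemma g_tang:
  assumes x: "x \<in> L"
  shows "g x (tang x w) (T x) = 0" "g x w (T x) = 0 \<Longrightarrow> tang x w = w" "linear (tang x)"
    "g x z (T x) = 0 \<Longrightarrow> g x (tang x w) z = g x w z"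
  using T_L[OF x] R A.g_sym[OF LV(2)[OF x], of z "T x"]
  by (auto intro!: linearI simp: tang_def A.g_lin[OF LV(2)[OF x]] add_divide_distrib scaleR_add_left algebra_simps)

context
  fixes k y
  assumes k: "k \<in> atlas N" and y: "y \<in> chart_range k"
begin

lemma tangent_F: "g (F k y) (FD (F k) y u) (T (F k y)) = 0"
proof -
  have "((\<lambda>y. rho (F k y)) has_derivative (\<lambda>v. g (F k y) (T (F k y)) (FD (F k) y v))) (at y)"
    by (rule has_derivative_compose[OF dF[OF k y] drho[OF LV(1)[OF F_L[OF k y]]]])
  moreover have "((\<lambda>y. rho (F k y)) has_derivative (\<lambda>v. 0)) (at y)"
    by (rule has_derivative_transform_within_open[OF has_derivative_const[of "R\<^sup>2 / 2"] open_range[OF k] y]) (simp add: LV(3)[OF F_L[OF k]])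
  ultimately have "(\<lambda>v. g (F k y) (T (F k y)) (FD (F k) y v)) = (\<lambda>v. 0)" by (rule has_derivative_unique)
  from fun_cong[OF this, of u] show ?thesis using A.g_sym[OF LV(2)[OF F_L[OF k y]]] by simp
qed

text \<open>The differential maps into the complement of \<open>T\<close>, whose dimension is that
  of the model space; followed by \<pi> it is an injective endomorphism, hence onto.\<close>

lemma tangent_range:
  assumes w: "g (F k y) w (T (F k y)) = 0"
  obtains u where "FD (F k) y u = w"
proof -
  let ?x = "F k y"
  have x: "?x \<in> L" by (rule F_L[OF k y])
  have l: "linear (\<lambda>w. g ?x w (T ?x))" using A.g_bil[OF LV(2)[OF x]] unfolding bilinear_def by blast
  have e: "g ?x (T ?x) (T ?x) \<noteq> 0" using T_L[OF x] R by simp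
  obtain j :: "'f \<Rightarrow> 'e" and \<pi> :: "'e \<Rightarrow> 'f" where j: "linear j" "linear \<pi>" "\<And>y. \<pi> (j y) = y" "\<pi> (T ?x) = 0"
    "\<And>y. g ?x (j y) (T ?x) = 0" "\<And>v. v = j (\<pi> v) + (g ?x v (T ?x) / g ?x (T ?x) (T ?x)) *\<^sub>R T ?x"
    by (rule hyperplane_split[OF l e dim]) (rule that)
  have jp: "v = j (\<pi> v)" if "g ?x v (T ?x) = 0" for v using j(6)[of v] that by simp
  have "inj (\<lambda>u. \<pi> (FD (F k) y u))"
  proof (rule injI)
    fix u v assume "\<pi> (FD (F k) y u) = \<pi> (FD (F k) y v)"
    then have "FD (F k) y u = FD (F k) y v" using jp[OF tangent_F[of u]] jp[OF tangent_F[of v]] by simp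
    then show "u = v" by (rule injD[OF C2_F(2)[OF k y]])
  qed
  moreover have "linear (\<lambda>u. \<pi> (FD (F k) y u))" using linear_compose[OF lin_F[OF k y] j(2)] by (simp add: o_def)
  ultimately have "surj (\<lambda>u. \<pi> (FD (F k) y u))" using linear_injective_imp_surjective by blast
  then obtain u where "\<pi> w = \<pi> (FD (F k) y u)" by (rule surjE)
  then have "FD (F k) y u = w" using jp[OF w] jp[OF tangent_F[of u]] by simp
  then show thesis by (rule that)
qed

lemma F_proj: "FD (F k) y (proj k y w) = tang (F k y) w"
proof -
  obtain u where "FD (F k) y u = tang (F k y) w" by (rule tangent_range[OF g_tang(1)[OF F_L[OF k y]]])
  then show ?thesis unfolding proj_def by (metis f_inv_into_f rangeI)
qed

lemma proj_unique: "FD (F k) y u = tang (F k y) w \<Longrightarrow> proj k y w = u"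
  using F_proj injD[OF C2_F(2)[OF k y]] by simp

lemma linear_proj: "linear (proj k y)"
  by (intro linearI proj_unique)
    (simp_all add: F_proj linear_add[OF lin_F[OF k y]] linear_scale[OF lin_F[OF k y]]
      linear_add[OF g_tang(3)[OF F_L[OF k y]]] linear_scale[OF g_tang(3)[OF F_L[OF k y]]])

lemma metric_N: "metric N k y u v = g (F k y) (FD (F k) y u) (FD (F k) y v)"
proof -
  define q where "q = chart_inv k y"
  have q: "q \<in> chart_dom k" "chart_map k q = y" using chart_inv_right[OF chart_N[OF k] y] by (auto simp: q_def)
  have qc: "q \<in> chart_dom c" "q \<in> points M" using q(1) dom_N[OF k] G_points by blast+
  have Fy: "F k y = chart_map c q" using transition_map[OF k q(1)] q(2) by simp
  have "FD (transition k (chart_at M q)) y w = FD (transition c (chart_at M q)) (chart_map c q) (FD (F k) y w)" for w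
    using FD_transition[OF k chart_at(1)[OF qc(2)] q(1) chart_at(2)[OF qc(2)]] q(2) by simp
  then show ?thesis
    using inner_at_chart[OF c qc(1)] by (simp add: submanifold_def Let_def q_def[symmetric] Fy)
qed

lemma posdef_metric_N: "posdef (metric N k y)"
proof -
  note x = LV(2)[OF F_L[OF k y]]
  have "FD (F k) y u \<noteq> 0" if "u \<noteq> 0" for u
    using that injD[OF C2_F(2)[OF k y], of u 0] linear_0[OF lin_F[OF k y]] by auto
  then show ?thesis
    unfolding posdef_def bilinear_def metric_N
    using A.g_pos[OF x] A.g_sym[OF x]
    by (auto intro!: linearI simp: A.g_lin[OF x] linear_add[OF lin_F[OF k y]] linear_scale[OF lin_F[OF k y]])
qed

end

text \<open>The tangential part of the ambient covariant derivative is symmetric and compatible with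
  the induced metric; uniqueness makes it the Levi-Civita connection of the hypersurface.\<close>

lemma christoffel_N:
  assumes k: "k \<in> atlas N" and y: "y \<in> chart_range k"
  shows "chris (metric N k) y = (\<lambda>u v. proj k y (FD (\<lambda>y. FD (F k) y v) y u + A.\<Gamma> (F k y) (FD (F k) y u) (FD (F k) y v)))"
proof (rule chris_eqI[where g = "metric N k", OF posdef_metric_N[OF k y]])
  let ?D = "\<lambda>u v. FD (\<lambda>y. FD (F k) y v) y u + A.\<Gamma> (F k y) (FD (F k) y u) (FD (F k) y v)"
  have x: "F k y \<in> L" "F k y \<in> chart_range c" using F_L[OF k y] LV(2) by blast+
  have dDF: "((\<lambda>y. FD (F k) y v) has_derivative FD (\<lambda>y. FD (F k) y v) y) (at y)" for v
    by (rule Ck_on_has_derivative[OF Ck_on_FD[OF C2_F(1)[OF k]] open_range[OF k] y])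
  have sym2: "FD (\<lambda>y. FD (F k) y v) y u = FD (\<lambda>y. FD (F k) y u) y v" for u v
    by (rule Ck_on_symmetric[OF open_range[OF k] C2_F(1)[OF k] y])
  have sym: "?D u v = ?D v u" for u v
    unfolding sym2[of v u] A.\<Gamma>_sym[OF x(2), of "FD (F k) y u"] ..
  have linD: "linear (\<lambda>u. ?D u v)" for v
    using has_derivative_linear[OF dDF[of v]] lin_F[OF k y]
    by (auto intro!: linearI simp: linear_add linear_scale A.\<Gamma>_lin[OF x(2)] algebra_simps)
  show "levi_civita (metric N k) y (\<lambda>u v. proj k y (?D u v))"
    unfolding levi_civita_def
  proof (intro conjI allI)
    have l1: "linear (\<lambda>u. proj k y (?D u v))" for v
      using linear_compose[OF linD linear_proj[OF k y]] by (simp add: o_def)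
    show "bilinear (\<lambda>u v. proj k y (?D u v))"
      unfolding bilinear_def using l1 sym by (metis (no_types, lifting) ext)
    show "proj k y (?D u v) = proj k y (?D v u)" for u v by (simp only: sym[of u v])
    fix u v w
    have "((\<lambda>y. g (F k y) (FD (F k) y u) (FD (F k) y v)) has_derivative
      (\<lambda>h. g (F k y) (?D h u) (FD (F k) y v) + g (F k y) (FD (F k) y u) (?D h v))) (at y)"
      by (rule A.has_derivative_g[OF x(2) dF[OF k y] dDF dDF])
    then have "((\<lambda>y. metric N k y u v) has_derivative
      (\<lambda>h. g (F k y) (?D h u) (FD (F k) y v) + g (F k y) (FD (F k) y u) (?D h v))) (at y)"
      by (rule has_derivative_transform_within_open[OF _ open_range[OF k] y]) (simp add: metric_N[OF k])
    from FD_eq[OF this] have 1: "FD (\<lambda>y. metric N k y u v) y w =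
      g (F k y) (?D w u) (FD (F k) y v) + g (F k y) (FD (F k) y u) (?D w v)" by simp
    have 2: "g (F k y) (tang (F k y) z) (FD (F k) y v) = g (F k y) z (FD (F k) y v)" for z v
      by (rule g_tang(4)[OF x(1) tangent_F[OF k y]])
    show "FD (\<lambda>y. metric N k y u v) y w = metric N k y (proj k y (?D w u)) v + metric N k y u (proj k y (?D w v))"
      unfolding 1 metric_N[OF k y] F_proj[OF k y]
      using 2 A.g_sym[OF x(2), of "FD (F k) y u"] by simp
  qed
qed

text \<open>By \<open>christoffel_N\<close> the differential of the inclusion maps the intrinsic
  acceleration to the tangential part of the ambient one, and it is injective.\<close>

lemma acceleration_N:
  assumes I: "nondegenerate_interval I" and \<alpha>: "C2_curve M I \<alpha>" "\<alpha> ` I \<subseteq> G" and s: "s \<in> I"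
    and v: "\<And>t. t \<in> I \<Longrightarrow> ((\<lambda>t. chart_map c (\<alpha> t)) has_vector_derivative v t) (at t within I)"
    and a: "(v has_vector_derivative a) (at s within I)"
  shows "acceleration N I \<alpha> s = 0 \<longleftrightarrow>
    tang (chart_map c (\<alpha> s)) (a + A.\<Gamma> (chart_map c (\<alpha> s)) (v s) (v s)) = 0"
proof -
  note \<alpha>N = C2_curve_N[OF I \<alpha>]
  define k where "k = chart_at N (\<alpha> s)"
  have q: "\<alpha> s \<in> points N" using s \<alpha>(2) by (auto simp: points_N)
  have k: "k \<in> atlas N" "\<alpha> s \<in> chart_dom k" using N.chart_at[OF q] by (auto simp: k_def)
  define y where "y t = chart_map k (\<alpha> t)" for t
  obtain w b where wb: "\<And>s. s \<in> I \<Longrightarrow> \<alpha> s \<in> chart_dom k \<Longrightarrow> ((\<lambda>t. chart_map k (\<alpha> t)) has_vector_derivative w s) (at s within I)"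
    "\<And>s. s \<in> I \<Longrightarrow> \<alpha> s \<in> chart_dom k \<Longrightarrow> (w has_vector_derivative b s) (at s within I)"
    by (rule N.curve_derivatives[OF I \<alpha>N k(1)]) (rule that)
  have acc: "acceleration N I \<alpha> s = b s + christoffel N k (y s) (w s) (w s)"
    unfolding y_def by (rule N.acceleration_chart_at(1)[OF I \<alpha>N s k_def wb(1) wb(2)[OF s k(2)]])
  have ev: "\<forall>\<^sub>F t in at s within I. t \<in> I \<and> \<alpha> t \<in> chart_dom k"
    by (rule curve_in_chart(1)[where \<alpha> = \<alpha>, OF chart_N[OF k(1)] _ s k(2)]) (use \<alpha>N in \<open>auto simp: C2_curve_def\<close>)
  have ys: "y s \<in> chart_range k" using k(2) by (simp add: y_def)
  have Fy: "F k (y t) = chart_map c (\<alpha> t)" if "\<alpha> t \<in> chart_dom k" for t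
    unfolding y_def by (rule transition_map[OF k(1) that])
  note nb = nondegenerate_at_within[OF I]
  have vt: "v t = FD (F k) (y t) (w t)" if t: "t \<in> I" "\<alpha> t \<in> chart_dom k" for t
  proof -
    have yt: "y t \<in> chart_range k" using t by (simp add: y_def)
    have e: "\<forall>\<^sub>F t' in at t within I. F k (y t') = chart_map c (\<alpha> t')"
      by (rule eventually_mono[OF curve_in_chart(1)[where \<alpha> = \<alpha>, OF chart_N[OF k(1)] _ t]]) (use \<alpha>N Fy in \<open>auto simp: C2_curve_def\<close>)
    have "(y has_vector_derivative w t) (at t within I)" using wb(1)[OF t] by (simp add: y_def[abs_def])
    from has_vector_derivative_FD[OF open_range[OF k(1)] C2_F(1)[OF k(1)] yt this]
    have "((\<lambda>t. chart_map c (\<alpha> t)) has_vector_derivative FD (F k) (y t) (w t)) (at t within I)"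
      unfolding has_vector_derivative_def
      by (rule has_derivative_transform_eventually[OF _ e Fy[OF t(2)] t(1)])
    then show ?thesis using v[OF t(1)] vector_derivative_unique_within[OF nb[OF t(1)]] by blast
  qed
  have "((\<lambda>t. FD (F k) (y t) (w t)) has_vector_derivative
      FD (\<lambda>z. FD (F k) z (w s)) (y s) (w s) + FD (F k) (y s) (b s)) (at s within I)"
    by (rule has_vector_derivative_FD_apply[where X = y and V = w, OF open_range[OF k(1)] C2_F(1)[OF k(1)] ys _ wb(2)[OF s k(2)]])
      (use wb(1)[OF s k(2)] in \<open>simp add: y_def[abs_def]\<close>)
  then have "(v has_vector_derivative FD (\<lambda>z. FD (F k) z (w s)) (y s) (w s) + FD (F k) (y s) (b s)) (at s within I)"
    unfolding has_vector_derivative_def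
    by (rule has_derivative_transform_eventually[where f = "\<lambda>t. FD (F k) (y t) (w t)" and g = v, OF _ _ vt[OF s k(2), symmetric] s]) (use vt ev in \<open>auto elim: eventually_mono\<close>)
  then have as: "a = FD (\<lambda>z. FD (F k) z (w s)) (y s) (w s) + FD (F k) (y s) (b s)"
    using a vector_derivative_unique_within[OF nb[OF s]] by blast
  note x = F_L[OF k(1) ys]
  have tan: "tang (F k (y s)) (FD (F k) (y s) u) = FD (F k) (y s) u" for u
    by (rule g_tang(2)[OF x tangent_F[OF k(1) ys]])
  have "FD (F k) (y s) (acceleration N I \<alpha> s) = FD (F k) (y s) (b s) +
    tang (F k (y s)) (FD (\<lambda>z. FD (F k) z (w s)) (y s) (w s) + A.\<Gamma> (F k (y s)) (v s) (v s))"
    unfolding acc christoffel_chris christoffel_N[OF k(1) ys]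
    by (simp add: linear_add[OF lin_F[OF k(1) ys]] F_proj[OF k(1) ys] vt[OF s k(2)])
  also have "\<dots> = tang (F k (y s)) (a + A.\<Gamma> (F k (y s)) (v s) (v s))"
    unfolding as using tan by (simp add: linear_add[OF g_tang(3)[OF x]])
  finally have "FD (F k) (y s) (acceleration N I \<alpha> s) = tang (chart_map c (\<alpha> s)) (a + A.\<Gamma> (chart_map c (\<alpha> s)) (v s) (v s))"
    by (simp add: Fy[OF k(2)])
  moreover have "FD (F k) (y s) (acceleration N I \<alpha> s) = 0 \<longleftrightarrow> acceleration N I \<alpha> s = 0"
    using injD[OF C2_F(2)[OF k(1) ys], of "acceleration N I \<alpha> s" 0] linear_0[OF lin_F[OF k(1) ys]] by auto
  ultimately show ?thesis by simp
qed

end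

lemma Ck_on_FD_apply:
  fixes f :: "'e::euclidean_space \<Rightarrow> 'c::euclidean_space" and X :: "'z::euclidean_space \<Rightarrow> 'e"
  assumes "open S" "open W" "Ck_on (Suc k) f W" "X ` S \<subseteq> W" "Ck_on k X S" "Ck_on k V S"
  shows "Ck_on k (\<lambda>z. FD f (X z) (V z)) S"
proof -
  have "Ck_on k (\<lambda>z. \<Sum>b\<in>Basis. (V z \<bullet> b) *\<^sub>R FD f (X z) b) S"
    by (intro Ck_on_sum Ck_on_scaleR Ck_on_inner Ck_on_const assms Ck_on_compose[OF assms(1,2) Ck_on_FD[OF assms(3)] assms(5,4)])
  moreover have "FD f (X z) (V z) = (\<Sum>b\<in>Basis. (V z \<bullet> b) *\<^sub>R FD f (X z) b)" if "z \<in> S" for z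
    by (rule linear_expand[OF has_derivative_linear[OF Ck_on_has_derivative[OF assms(3,2)]]]) (use that assms(4) in blast)
  ultimately show ?thesis using Ck_on_cong[OF assms(1)] by (metis (no_types, lifting))
qed

lemma C1_inverse_sqrt: "Ck_on (Suc 0) (\<lambda>r::real. inverse (sqrt r)) {0<..}"
proof (rule Ck_on_SucI)
  fix r :: real assume "r \<in> {0<..}"
  then show "((\<lambda>r. inverse (sqrt r)) has_derivative (\<lambda>h. - (inverse (sqrt r) ^ 3 / 2) * h)) (at r)"
    by (auto intro!: derivative_eq_intros simp: has_field_derivative_def[symmetric] field_simps power3_eq_cube)
next
  fix v :: real
  have "continuous_on {0<..} (\<lambda>r. - (inverse (sqrt r) ^ 3 / 2) * v)" by (intro continuous_intros) auto
  then show "Ck_on 0 (\<lambda>r. - (inverse (sqrt r) ^ 3 / 2) * v) {0<..}" by simp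
qed simp

context level_hypersurface
begin

definition B :: "'e \<Rightarrow> 'e \<Rightarrow> 'e" where "B x v = FD T x v + A.\<Gamma> x v (T x)"

lemma VU: "x \<in> V \<Longrightarrow> x \<in> chart_range c"
  using V by blast

lemma dT: "x \<in> V \<Longrightarrow> (T has_derivative FD T x) (at x)"
  by (rule Ck_on_has_derivative[OF C1_T V(1)])

lemma linear_B: "x \<in> V \<Longrightarrow> linear (B x)"
  using has_derivative_linear[OF dT, of x] A.\<Gamma>_lin[OF VU, of x]
  by (auto intro!: linearI simp: B_def linear_add linear_scale algebra_simps)

lemma g_B: "x \<in> V \<Longrightarrow> g x (B x u) v = g x u (B x v)" "x \<in> V \<Longrightarrow> g x (B x v) (T x) = g x (T x) v"
  using hessian_sym hessian_T by (simp_all add: B_def)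

subsection \<open>Unit normal fields and the shape operator\<close>

lemma component_at:
  assumes q: "q \<in> G"
  shows "FD (transition c (chart_at M q)) (chart_map c q) (components M c q v) = v"
    and "inner_at M q v w = g (chart_map c q) (components M c q v) (components M c q w)"
    and "components M c q (FD (transition c (chart_at M q)) (chart_map c q) z) = z"
proof -
  have p: "q \<in> points M" "q \<in> chart_dom c" using q G_points G_chart(1) by auto
  note d = chart_at[OF p(1)]
  show 1: "FD (transition c (chart_at M q)) (chart_map c q) (components M c q v) = v" for v
    unfolding components_def coords_def by (rule FD_trans_inverse[OF d(1) c d(2) p(2)])
  show "components M c q (FD (transition c (chart_at M q)) (chart_map c q) z) = z"
    unfolding components_chart[OF c c p(2) p(2)] by (rule FD_trans_self[OF c p(2)])
  show "inner_at M q v w = g (chart_map c q) (components M c q v) (components M c q w)"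
    using inner_at_chart[OF c p(2), of "components M c q v" "components M c q w"] by (simp add: 1)
qed

lemma d_incl_eq:
  assumes q: "q \<in> G"
  shows "d_incl M N q u = FD (transition c (chart_at M q)) (chart_map c q) (FD (F (chart_at N q)) (coords N q) u)"
proof -
  have p: "q \<in> points M" "q \<in> points N" using q G_points points_N by auto
  show ?thesis
    unfolding d_incl_def coords_def
    by (rule FD_transition[OF N.chart_at(1)[OF p(2)] chart_at(1)[OF p(1)] N.chart_at(2)[OF p(2)] chart_at(2)[OF p(1)]])
qed

lemma coords_N:
  assumes q: "q \<in> G"
  shows "chart_at N q \<in> atlas N" "coords N q \<in> chart_range (chart_at N q)" "F (chart_at N q) (coords N q) = chart_map c q"
  using N.chart_at[of q] q transition_map[of "chart_at N q" q c] by (auto simp: points_N coords_def)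

text \<open>A normal vector has no tangential part, so it is a multiple of \<open>T\<close>, which
  has length \<open>R\<close>.\<close>

lemma unit_normal_components:
  assumes \<xi>: "unit_normal_field M N \<xi>" and q: "q \<in> G"
  obtains s where "components M c q (\<xi> q) = s *\<^sub>R T (chart_map c q)" "s\<^sup>2 = 1 / R\<^sup>2"
proof -
  define x where "x = chart_map c q"
  define e where "e = components M c q (\<xi> q)"
  define k where "k = chart_at N q"
  define y where "y = coords N q"
  have k: "k \<in> atlas N" "y \<in> chart_range k" "F k y = x" using coords_N[OF q] by (simp_all add: k_def y_def x_def)
  have x: "x \<in> L" "x \<in> chart_range c" using G_chart(2)[OF q] LV(2) by (auto simp: x_def)
  have qN: "q \<in> points N" using q by (simp add: points_N)
  have n: "norm_at M q (\<xi> q) = 1" "inner_at M q (\<xi> q) (d_incl M N q u) = 0" for u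
    using \<xi> qN unfolding unit_normal_field_def by blast+
  have e1: "g x e e = 1" using n(1) unfolding norm_at_def component_at(2)[OF q] by (simp add: x_def e_def)
  have orth: "g x e (FD (F k) y u) = 0" for u
    using n(2)[of u] unfolding component_at(2)[OF q] d_incl_eq[OF q] component_at(3)[OF q] by (simp add: x_def e_def k_def y_def)
  obtain u where u: "FD (F k) y u = tang x e" using tangent_range[OF k(1,2), of "tang x e"] g_tang(1)[OF x(1)] k(3) by blast
  have "g x (tang x e) (tang x e) = g x e (tang x e)" by (rule g_tang(4)[OF x(1) g_tang(1)[OF x(1)]])
  then have "tang x e = 0" using orth[of u] u A.g_zero[OF x(2)] by simp
  then have s: "e = (g x e (T x) / R\<^sup>2) *\<^sub>R T x" by (simp add: tang_def)
  define s where "s = g x e (T x) / R\<^sup>2"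
  have es: "e = s *\<^sub>R T x" using s by (simp add: s_def)
  have "s * (s * R\<^sup>2) = 1" using e1 T_L[OF x(1)] unfolding es by (simp add: A.g_lin[OF x(2)])
  then have "s\<^sup>2 = 1 / R\<^sup>2" using R by (simp add: field_simps power2_eq_square)
  then show thesis using es by (intro that[of s]) (simp_all add: e_def x_def)
qed

text \<open>Near \<open>q\<close> the field is s T with a constant factor, so its covariant
  derivative is s B. On tangent vectors this is tangent by \<open>g_B\<close>, and the description
  that defines the shape operator has exactly one solution.\<close>

lemma shape_operator_eq:
  assumes \<xi>: "unit_normal_field M N \<xi>" and q: "q \<in> G"
  obtains s where "\<bar>s\<bar> = 1 / R"
    "\<And>u. FD (F (chart_at N q)) (coords N q) (shape_operator M N \<xi> q u)
      = - s *\<^sub>R B (chart_map c q) (FD (F (chart_at N q)) (coords N q) u)"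
proof -
  define x where "x = chart_map c q"
  define k where "k = chart_at N q"
  define y where "y = coords N q"
  define d where "d = chart_at M q"
  define \<tau> where "\<tau> = transition c d"
  have k: "k \<in> atlas N" "y \<in> chart_range k" "F k y = x" using coords_N[OF q] by (simp_all add: k_def y_def x_def)
  have x: "x \<in> L" "x \<in> chart_range c" "x \<in> V" using G_chart(2)[OF q] LV by (auto simp: x_def)
  have p: "q \<in> points M" "q \<in> chart_dom c" "q \<in> chart_dom k"
    using q G_points G_chart(1) N.chart_at(2)[of q] by (auto simp: points_N k_def)
  have d: "d \<in> atlas M" "q \<in> chart_dom d" using chart_at[OF p(1)] by (auto simp: d_def)
  have y: "y = chart_map k q" by (simp add: y_def k_def coords_def)
  have ky: "chart_inv k y = q" unfolding y by (rule chart_inv_left[OF chart_N[OF k(1)] p(3)])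
  define e where "e y = components M c (chart_inv k y) (\<xi> (chart_inv k y))" for y
  have C1e: "Ck_on 1 e (chart_range k)"
  proof -
    have "chart_map k ` (chart_dom k \<inter> chart_dom c) = chart_range k" using dom_N(2)[OF k(1)] by (simp add: inf.absorb1)
    moreover have "Ck_on 1 (\<lambda>y. components M c (chart_inv k y) (\<xi> (chart_inv k y))) (chart_map k ` (chart_dom k \<inter> chart_dom c))"
      using \<xi> k(1) c unfolding unit_normal_field_def by blast
    ultimately show ?thesis by (simp add: e_def[abs_def])
  qed
  have inv: "chart_inv k z \<in> G" "chart_map c (chart_inv k z) = F k z" if "z \<in> chart_range k" for z
    using chart_inv_right[OF chart_N[OF k(1)] that] dom_N(1)[OF k(1)] by (auto simp: transition_def)
  define \<sigma> where "\<sigma> z = g (F k z) (e z) (T (F k z)) / R\<^sup>2" for z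
  have e: "e z = \<sigma> z *\<^sub>R T (F k z)" "(\<sigma> z)\<^sup>2 = 1 / R\<^sup>2" if z: "z \<in> chart_range k" for z
  proof -
    obtain s where s: "e z = s *\<^sub>R T (F k z)" "s\<^sup>2 = 1 / R\<^sup>2"
      using unit_normal_components[OF \<xi> inv(1)[OF z]] unfolding inv(2)[OF z] e_def by blast
    then have "\<sigma> z = s" using R T_L[OF F_L[OF k(1) z]] by (simp add: \<sigma>_def A.g_lin[OF LV(2)[OF F_L[OF k(1) z]]])
    then show "e z = \<sigma> z *\<^sub>R T (F k z)" "(\<sigma> z)\<^sup>2 = 1 / R\<^sup>2" using s by simp_all
  qed
  have cF: "continuous_on (chart_range k) (F k)" using Ck_on_mono[OF C2_F(1)[OF k(1)], of 0] by simp
  have FV: "F k ` chart_range k \<subseteq> V" using LV(1) F_L[OF k(1)] by blast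
  have c\<sigma>: "continuous_on (chart_range k) \<sigma>"
    unfolding \<sigma>_def using R FV VU C1e Ck_on_mono[OF C1_T, of 0]
    by (intro continuous_intros A.continuous_g cF continuous_on_compose2[OF _ cF]) (auto simp: differentiable_imp_continuous_on)
  note op = open_range[OF k(1)]
  define s where "s = \<sigma> y"
  have s2: "s\<^sup>2 = (1 / R)\<^sup>2" using e(2)[OF k(2)] by (simp add: s_def power_divide)
  then have "\<bar>s\<bar> = \<bar>1 / R\<bar>" by (simp only: abs_eq_iff power2_eq_iff)
  then have s: "\<bar>s\<bar> = 1 / R" using R by simp
  \<comment> \<open>The factor is continuous with values 1/R and -1/R, so it is constant where it
    differs from \<open>s\<close> by less than 1/R.\<close>
  define Z where "Z = chart_range k \<inter> \<sigma> -` ball s (1 / R)"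
  have oZ: "open Z" unfolding Z_def by (rule continuous_open_preimage[OF c\<sigma> op]) simp
  have yZ: "y \<in> Z" using k(2) R by (simp add: Z_def s_def)
  have \<sigma>Z: "\<sigma> z = s" if "z \<in> Z" for z
  proof -
    have "(\<sigma> z)\<^sup>2 = s\<^sup>2" using e(2) that s2 by (simp add: Z_def power_divide)
    then have "\<sigma> z = s \<or> \<sigma> z = - s" by (simp add: power2_eq_iff)
    moreover have "\<bar>s - \<sigma> z\<bar> < 1 / R" using that by (simp add: Z_def dist_real_def)
    ultimately show ?thesis using s by auto
  qed
  have eZ: "components M c (chart_inv k z) (\<xi> (chart_inv k z)) = s *\<^sub>R T (F k z)" if "z \<in> Z" for z
    using e(1)[of z] \<sigma>Z[OF that] that by (simp add: Z_def e_def)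
  interpret Is: isometry "chart_range c" "chart_range d" g "metric M d" "chart_map c ` (chart_dom c \<inter> chart_dom d)" \<tau>
    unfolding \<tau>_def by (rule isometry_chart[OF c d(1)])
  have xW: "F k y \<in> chart_map c ` (chart_dom c \<inter> chart_dom d)" unfolding k(3) x_def using p(2) d(2) by blast
  define Z' where "Z' = Z \<inter> chart_map k ` (chart_dom k \<inter> (G \<inter> chart_dom d))"
  have "openin (mtop N) (G \<inter> chart_dom d)"
    unfolding mtop_N using chart[OF d(1)] openin_subtopology_Int2 unfolding top_chart_def by blast
  then have oZ': "open Z'" unfolding Z'_def using oZ open_chart_image[OF chart_N[OF k(1)]] by blast
  have yZ': "y \<in> Z'" unfolding Z'_def y using yZ[unfolded y] p(3) q d(2) by blast
  have comp: "components M d (chart_inv k z) (\<xi> (chart_inv k z)) = FD \<tau> (F k z) (s *\<^sub>R T (F k z))" if z: "z \<in> Z'" for z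
  proof -
    obtain q' where q': "q' \<in> chart_dom k" "q' \<in> G" "q' \<in> chart_dom d" "z = chart_map k q'"
      using z by (auto simp: Z'_def)
    have i: "chart_inv k z = q'" unfolding q'(4) by (rule chart_inv_left[OF chart_N[OF k(1)] q'(1)])
    have Fz: "F k z = chart_map c q'" unfolding q'(4) by (rule transition_map[OF k(1) q'(1)])
    have "components M d q' (\<xi> q') = FD \<tau> (chart_map c q') (components M c q' (\<xi> q'))"
      using components_chart[OF c d(1) G_chart(1)[OF q'(2)] q'(3), of "components M c q' (\<xi> q')"]
      unfolding component_at(1)[OF q'(2)] \<tau>_def .
    moreover have "z \<in> Z" using z by (simp add: Z'_def)
    ultimately show ?thesis using eZ[of z] by (simp add: i Fz)
  qed
  have dTF: "((\<lambda>z. s *\<^sub>R T (F k z)) has_derivative (\<lambda>h. s *\<^sub>R FD T x (FD (F k) y h))) (at y)"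
    by (rule has_derivative_scaleR_right[OF has_derivative_compose[OF dF[OF k(1,2)] dT[OF x(3), folded k(3)], unfolded k(3)]])
  have "((\<lambda>z. FD \<tau> (F k z) (s *\<^sub>R T (F k z))) has_derivative
    (\<lambda>h. FD \<tau> (F k y) (s *\<^sub>R FD T x (FD (F k) y h) + A.\<Gamma> (F k y) (FD (F k) y h) (s *\<^sub>R T (F k y)))
      - Is.B.\<Gamma> (\<tau> (F k y)) (FD \<tau> (F k y) (FD (F k) y h)) (FD \<tau> (F k y) (s *\<^sub>R T (F k y))))) (at y)"
    by (rule Is.covariant_derivative_transform[OF xW dF[OF k(1,2)] dTF])
  then have "((\<lambda>z. components M d (chart_inv k z) (\<xi> (chart_inv k z))) has_derivative
    (\<lambda>h. FD \<tau> (F k y) (s *\<^sub>R FD T x (FD (F k) y h) + A.\<Gamma> (F k y) (FD (F k) y h) (s *\<^sub>R T (F k y)))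
      - Is.B.\<Gamma> (\<tau> (F k y)) (FD \<tau> (F k y) (FD (F k) y h)) (FD \<tau> (F k y) (s *\<^sub>R T (F k y))))) (at y)"
    by (rule has_derivative_transform_within_open[OF _ oZ' yZ']) (simp only: comp)
  note fd = FD_eq[OF this]
  have \<xi>q: "\<xi> q = FD \<tau> x (s *\<^sub>R T x)"
    using component_at(1)[OF q, of "\<xi> q"] eZ[OF yZ] by (simp add: ky k(3) \<tau>_def x_def d_def)
  have cq: "coords M q = \<tau> x" unfolding \<tau>_def x_def coords_def d_def[symmetric] by (rule transition_at[OF c p(2), symmetric])
  have incl: "d_incl M N q u = FD \<tau> x (FD (F k) y u)" for u
    using d_incl_eq[OF q, of u] by (simp add: x_def k_def y_def \<tau>_def d_def)
  have nab: "nabla_along M N \<xi> q u = FD \<tau> x (s *\<^sub>R B x (FD (F k) y u))" for u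
    unfolding nabla_along_def Let_def d_def[symmetric] k_def[symmetric] y_def[symmetric] fd christoffel_chris cq incl \<xi>q k(3)
    by (simp add: B_def A.\<Gamma>_lin[OF x(2)] scaleR_add_right)
  have inj\<tau>: "inj (FD \<tau> x)" "linear (FD \<tau> x)" using Is.inj[OF xW] Is.lin[OF xW] by (simp_all add: k(3))
  have "FD (F k) y (shape_operator M N \<xi> q u) = - s *\<^sub>R B x (FD (F k) y u)" for u
  proof -
    have "g x (B x (FD (F k) y u)) (T x) = 0"
      using g_B(2)[OF x(3)] tangent_F[OF k(1,2), of u] A.g_sym[OF x(2)] by (simp add: k(3))
    then have "g x (- s *\<^sub>R B x (FD (F k) y u)) (T x) = 0" by (simp add: A.g_lin[OF x(2)])
    then obtain w where w: "FD (F k) y w = - s *\<^sub>R B x (FD (F k) y u)" using tangent_range[OF k(1,2)] k(3) by metis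
    have iff: "d_incl M N q w' = - nabla_along M N \<xi> q u \<longleftrightarrow> w' = w" for w'
    proof -
      have "- nabla_along M N \<xi> q u = FD \<tau> x (FD (F k) y w)"
        unfolding nab w using linear_neg[OF inj\<tau>(2), of "s *\<^sub>R B x (FD (F k) y u)"] by simp
      then show ?thesis unfolding incl using inj\<tau>(1) C2_F(2)[OF k(1,2)] by (simp add: inj_eq)
    qed
    have "shape_operator M N \<xi> q u = w" unfolding shape_operator_def iff by simp
    then show ?thesis using w by simp
  qed
  then show thesis by (intro that[OF s]) (simp add: k_def y_def x_def)
qed

text \<open>The field T/R, transported to the chart chosen at each point; in a fixed chart it is of
  class C^1 because \<open>T\<close> is.\<close>

lemma unit_normal_exists:
  "unit_normal_field M N (\<lambda>q. FD (transition c (chart_at M q)) (chart_map c q) ((1 / R) *\<^sub>R T (chart_map c q)))"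
  (is "unit_normal_field M N ?\<xi>")
  unfolding unit_normal_field_def points_N
proof (intro conjI ballI allI)
  fix q assume q: "q \<in> G"
  define x where "x = chart_map c q"
  have x: "x \<in> L" "x \<in> chart_range c" using G_chart(2)[OF q] LV(2) by (auto simp: x_def)
  show "norm_at M q (?\<xi> q) = 1"
    unfolding norm_at_def component_at(2)[OF q] component_at(3)[OF q] unfolding x_def[symmetric]
    using T_L[OF x(1)] R by (simp add: A.g_lin[OF x(2)] power2_eq_square)
  show "inner_at M q (?\<xi> q) (d_incl M N q u) = 0" for u
    using tangent_F[OF coords_N(1,2)[OF q], of u]
    unfolding component_at(2)[OF q] d_incl_eq[OF q] component_at(3)[OF q] coords_N(3)[OF q] unfolding x_def[symmetric]
    by (simp add: A.g_lin[OF x(2)] A.g_sym[OF x(2), of "T x"])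
next
  fix k :: "('a, 'f) chart" and d assume k: "k \<in> atlas N" and d: "d \<in> atlas M"
  let ?Q = "chart_map k ` (chart_dom k \<inter> chart_dom d)"
  have "?Q = chart_map k ` (chart_dom k \<inter> (G \<inter> chart_dom d))" using dom_N(1)[OF k] by auto
  moreover have "openin (mtop N) (G \<inter> chart_dom d)"
    unfolding mtop_N using chart[OF d] openin_subtopology_Int2 unfolding top_chart_def by blast
  ultimately have oQ: "open ?Q" using open_chart_image[OF chart_N[OF k]] by simp
  have eq: "FD (transition c d) (F k y) ((1 / R) *\<^sub>R T (F k y)) = components M d (chart_inv k y) (?\<xi> (chart_inv k y))"
    and FW: "F k y \<in> chart_map c ` (chart_dom c \<inter> chart_dom d)" "F k y \<in> V" if "y \<in> ?Q" for y
  proof -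
    obtain q where q: "y = chart_map k q" "q \<in> chart_dom k" "q \<in> chart_dom d" using \<open>y \<in> ?Q\<close> by blast
    have i: "chart_inv k y = q" unfolding q(1) by (rule chart_inv_left[OF chart_N[OF k] q(2)])
    have Fy: "F k y = chart_map c q" unfolding q(1) by (rule transition_map[OF k q(2)])
    have qc: "q \<in> chart_dom c" using q(2) dom_N(2)[OF k] by blast
    show "FD (transition c d) (F k y) ((1 / R) *\<^sub>R T (F k y)) = components M d (chart_inv k y) (?\<xi> (chart_inv k y))"
      unfolding i Fy using components_chart[OF c d qc q(3)] by simp
    show "F k y \<in> chart_map c ` (chart_dom c \<inter> chart_dom d)" unfolding Fy using qc q(3) by blast
    show "F k y \<in> V" using LV(1)[OF F_L[OF k]] q by blast
  qed
  have C2: "Ck_on (Suc 0) (F k) ?Q"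
    by (rule Ck_on_subset[OF Ck_on_SucD[OF C2_F(1)[OF k]]]) blast
  have "Ck_on (Suc 0) (\<lambda>y. FD (transition c d) (F k y) ((1 / R) *\<^sub>R T (F k y))) ?Q"
  proof (rule Ck_on_FD_apply[OF oQ open_overlap[OF c d] Ck_on_SucD[OF C3_transition[OF c d]] _ C2])
    show "F k ` ?Q \<subseteq> chart_map c ` (chart_dom c \<inter> chart_dom d)" using FW(1) by blast
    show "Ck_on (Suc 0) (\<lambda>y. (1 / R) *\<^sub>R T (F k y)) ?Q"
      by (intro Ck_on_scaleR Ck_on_const oQ Ck_on_compose[OF oQ V(1) C1_T C2]) (use FW(2) in blast)
  qed
  then show "Ck_on 1 (\<lambda>y. components M d (chart_inv k y) (?\<xi> (chart_inv k y))) ?Q"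
    unfolding One_nat_def by (rule iffD1[OF Ck_on_cong[OF oQ], rotated]) (rule eq)
qed

subsection \<open>Curves in the hypersurface\<close>

context
  fixes I \<alpha> s v a x A
  assumes I: "nondegenerate_interval I" and \<alpha>: "C2_curve M I \<alpha>" "\<alpha> ` I \<subseteq> G" and s: "s \<in> I"
    and v: "\<And>t. t \<in> I \<Longrightarrow> ((\<lambda>t. chart_map c (\<alpha> t)) has_vector_derivative v t) (at t within I)"
    and a: "(v has_vector_derivative a) (at s within I)"
    and xA: "x = chart_map c (\<alpha> s)" "A = a + A.\<Gamma> x (v s) (v s)"
begin

lemma curve_tangent:
  assumes t: "t \<in> I"
  shows "g (chart_map c (\<alpha> t)) (T (chart_map c (\<alpha> t))) (v t) = 0"
proof -
  let ?x = "\<lambda>t. chart_map c (\<alpha> t)"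
  have xL: "?x t \<in> L" if "t \<in> I" for t using G_chart(2) \<alpha>(2) that by blast
  have "((\<lambda>t. rho (?x t)) has_derivative (\<lambda>h. g (?x t) (T (?x t)) (h *\<^sub>R v t))) (at t within I)"
    by (rule has_derivative_compose[OF v[OF t, unfolded has_vector_derivative_def] drho[OF LV(1)[OF xL[OF t]]]])
  then have 1: "((\<lambda>t. rho (?x t)) has_vector_derivative g (?x t) (T (?x t)) (v t)) (at t within I)"
    by (simp add: has_vector_derivative_def A.g_lin[OF LV(2)[OF xL[OF t]]])
  have "((\<lambda>t. rho (?x t)) has_derivative (\<lambda>h. 0)) (at t within I)"
    by (rule has_derivative_transform[where f = "\<lambda>t. R\<^sup>2 / 2", OF t LV(3)[OF xL] has_derivative_const])
  then have "((\<lambda>t. rho (?x t)) has_vector_derivative 0) (at t within I)" by (simp add: has_vector_derivative_def)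
  from vector_derivative_unique_within[OF nondegenerate_at_within[OF I t] 1 this] show ?thesis .
qed

text \<open>Differentiate g(T,v) = 0 along the curve.\<close>

lemma curve_normal_curvature: "g x A (T x) = - g x (B x (v s)) (v s)"
proof -
  let ?x = "\<lambda>t. chart_map c (\<alpha> t)"
  have xL: "x \<in> L" using G_chart(2) \<alpha>(2) s xA(1) by blast
  have xV: "x \<in> V" "x \<in> chart_range c" using LV[OF xL] by auto
  have "((\<lambda>t. T (?x t)) has_vector_derivative FD T x (v s)) (at s within I)"
    using has_vector_derivative_FD[where X = ?x, OF V(1) C1_T _ v[OF s]] xV(1) by (simp add: xA(1))
  from A.has_vector_derivative_g[where q = ?x, OF _ v[OF s] this a]
  have 1: "((\<lambda>t. g (?x t) (T (?x t)) (v t)) has_vector_derivative g x (B x (v s)) (v s) + g x (T x) A) (at s within I)"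
    using xV(2) by (simp add: xA B_def has_real_derivative_iff_has_vector_derivative)
  have "((\<lambda>t. g (?x t) (T (?x t)) (v t)) has_derivative (\<lambda>h. 0)) (at s within I)"
    by (rule has_derivative_transform[where f = "\<lambda>t. 0", OF s curve_tangent has_derivative_const])
  then have "((\<lambda>t. g (?x t) (T (?x t)) (v t)) has_vector_derivative 0) (at s within I)" by (simp add: has_vector_derivative_def)
  from vector_derivative_unique_within[OF nondegenerate_at_within[OF I s] 1 this]
  show ?thesis using A.g_sym[OF xV(2), of "T x" A] by simp
qed

text \<open>Pythagoras for the tangential and the normal part of the acceleration, the latter being
  known from \<open>curve_normal_curvature\<close>.\<close>

lemma curve_curvature: "(curvature M I \<alpha> s)\<^sup>2 = g x (tang x A) (tang x A) + (g x (B x (v s)) (v s) / R)\<^sup>2"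
  and curve_curvature_nonneg: "curvature M I \<alpha> s \<ge> 0"
  and curve_speed: "norm_at M (\<alpha> s) (velocity M I \<alpha> s) = sqrt (g x (v s) (v s))"
proof -
  have xL: "x \<in> L" using G_chart(2) \<alpha>(2) s xA(1) by blast
  note x = LV(2)[OF xL]
  have sc: "\<alpha> s \<in> chart_dom c" using \<alpha>(2) s G_chart(1) by blast
  note cc = curvature_chart[where A = A, OF I \<alpha>(1) s c sc v a xA(2)[unfolded xA(1)]]
  show "norm_at M (\<alpha> s) (velocity M I \<alpha> s) = sqrt (g x (v s) (v s))" using cc(2) by (simp add: xA(1))
  have k: "curvature M I \<alpha> s = sqrt (g x A A)" using cc(1) by (simp add: xA(1))
  then show "curvature M I \<alpha> s \<ge> 0" using A.g_ge[OF x] by simp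
  have "A = tang x A + (g x A (T x) / R\<^sup>2) *\<^sub>R T x" by (simp add: tang_def)
  then have "g x A A = g x (tang x A + (g x A (T x) / R\<^sup>2) *\<^sub>R T x) (tang x A + (g x A (T x) / R\<^sup>2) *\<^sub>R T x)" by simp
  also have "\<dots> = g x (tang x A) (tang x A) + (g x A (T x) / R\<^sup>2)\<^sup>2 * R\<^sup>2"
    using g_tang(1)[OF xL, of A] A.g_sym[OF x, of "T x" "tang x A"] T_L[OF xL]
    by (simp add: A.g_lin[OF x] power2_eq_square)
  also have "(g x A (T x) / R\<^sup>2)\<^sup>2 * R\<^sup>2 = (g x (B x (v s)) (v s) / R)\<^sup>2"
    unfolding curve_normal_curvature using R by (simp add: field_simps power2_eq_square)
  finally show "(curvature M I \<alpha> s)\<^sup>2 = g x (tang x A) (tang x A) + (g x (B x (v s)) (v s) / R)\<^sup>2"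
    using k A.g_ge[OF x] by simp
qed

end

lemma arclength_curve:
  assumes I: "nondegenerate_interval I" and \<alpha>: "arclength_C2_curve M I \<alpha>" "\<alpha> ` I \<subseteq> G" and s: "s \<in> I"
    and x: "x = chart_map c (\<alpha> s)"
  obtains v A where "g x v v = 1" "g x (T x) v = 0"
    "(curvature M I \<alpha> s)\<^sup>2 = g x (tang x A) (tang x A) + (g x (B x v) v / R)\<^sup>2" "curvature M I \<alpha> s \<ge> 0"
    "acceleration N I \<alpha> s = 0 \<longleftrightarrow> tang x A = 0"
proof -
  have C2: "C2_curve M I \<alpha>" and speed: "norm_at M (\<alpha> s) (velocity M I \<alpha> s) = 1"
    using \<alpha>(1) s unfolding arclength_C2_curve_def by auto
  have \<alpha>c: "\<alpha> t \<in> chart_dom c" if "t \<in> I" for t using that \<alpha>(2) G_chart(1) by blast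
  obtain v a where va: "\<And>s. s \<in> I \<Longrightarrow> \<alpha> s \<in> chart_dom c \<Longrightarrow> ((\<lambda>t. chart_map c (\<alpha> t)) has_vector_derivative v s) (at s within I)"
    "\<And>s. s \<in> I \<Longrightarrow> \<alpha> s \<in> chart_dom c \<Longrightarrow> (v has_vector_derivative a s) (at s within I)"
    by (rule curve_derivatives[OF I C2 c]) (rule that)
  note v = va(1)[OF _ \<alpha>c] and a = va(2)[OF s \<alpha>c[OF s]]
  define A where "A = a s + A.\<Gamma> x (v s) (v s)"
  note cv = I C2 \<alpha>(2) s v a x A_def
  show thesis
  proof (rule that[of "v s" A])
    show "g x (v s) (v s) = 1" using curve_speed[OF cv] speed by simp
    show "g x (T x) (v s) = 0" using curve_tangent[OF cv s] by (simp add: x)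
    show "(curvature M I \<alpha> s)\<^sup>2 = g x (tang x A) (tang x A) + (g x (B x (v s)) (v s) / R)\<^sup>2"
      by (rule curve_curvature[OF cv])
    show "curvature M I \<alpha> s \<ge> 0" by (rule curve_curvature_nonneg[OF cv])
    show "acceleration N I \<alpha> s = 0 \<longleftrightarrow> tang x A = 0"
      using acceleration_N[OF I C2 \<alpha>(2) s v a] by (simp add: A_def x)
  qed
qed

section \<open>Umbilicity and curves of the hypersurface\<close>

lemma umbilic_mean_curvature:
  assumes \<xi>: "unit_normal_field M N \<xi>" and q: "q \<in> G"
    and umb: "\<And>v. g (chart_map c q) (T (chart_map c q)) v = 0 \<Longrightarrow> B (chart_map c q) v = \<mu> *\<^sub>R v"
  shows "\<bar>mean_curvature M N \<xi> q\<bar> = \<bar>\<mu>\<bar> / R"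
proof -
  define k where "k = chart_at N q"
  define y where "y = coords N q"
  have k: "k \<in> atlas N" "y \<in> chart_range k" "F k y = chart_map c q" using coords_N[OF q] by (simp_all add: k_def y_def)
  have x: "chart_map c q \<in> chart_range c" using G_chart(2)[OF q] LV(2) by blast
  obtain s where s: "\<bar>s\<bar> = 1 / R"
    "\<And>u. FD (F k) y (shape_operator M N \<xi> q u) = - s *\<^sub>R B (chart_map c q) (FD (F k) y u)"
    using shape_operator_eq[OF \<xi> q] unfolding k_def y_def by blast
  have "FD (F k) y (shape_operator M N \<xi> q u) = FD (F k) y ((- s * \<mu>) *\<^sub>R u)" for u
    using tangent_F[OF k(1,2), of u] umb[of "FD (F k) y u"] A.g_sym[OF x, of "T (chart_map c q)"]
    by (simp add: s(2) k(3) linear_neg[OF lin_F[OF k(1,2)]] linear_scale[OF lin_F[OF k(1,2)]])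
  then have "shape_operator M N \<xi> q u = (- s * \<mu>) *\<^sub>R u" for u
    using injD[OF C2_F(2)[OF k(1,2)]] by blast
  then have "mean_curvature M N \<xi> q = - s * \<mu>"
    by (simp add: mean_curvature_def endo_trace_def)
  then show ?thesis using s(1) by (simp add: abs_mult)
qed

text \<open>At each parameter \<kappa>^2 exceeds H^2 by the square length of the intrinsic
  acceleration, so the inequality and the case of equality are read off pointwise.\<close>

lemma umbilic_curves:
  assumes umb: "\<And>x. x \<in> L \<Longrightarrow> \<exists>\<mu>. \<forall>v. g x (T x) v = 0 \<longrightarrow> B x v = \<mu> *\<^sub>R v"
    and \<xi>: "unit_normal_field M N \<xi>"
    and I: "nondegenerate_interval I" and \<alpha>: "arclength_C2_curve M I \<alpha>" "\<alpha> ` I \<subseteq> G"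
  shows "(\<forall>s\<in>I. curvature M I \<alpha> s \<ge> \<bar>mean_curvature M N \<xi> (\<alpha> s)\<bar>) \<and>
    ((\<forall>s\<in>I. curvature M I \<alpha> s = \<bar>mean_curvature M N \<xi> (\<alpha> s)\<bar>) \<longleftrightarrow> geodesic N I \<alpha>)"
proof -
  have *: "curvature M I \<alpha> s \<ge> \<bar>mean_curvature M N \<xi> (\<alpha> s)\<bar> \<and>
    (curvature M I \<alpha> s = \<bar>mean_curvature M N \<xi> (\<alpha> s)\<bar> \<longleftrightarrow> acceleration N I \<alpha> s = 0)" if s: "s \<in> I" for s
  proof -
    define x where "x = chart_map c (\<alpha> s)"
    define H where "H = \<bar>mean_curvature M N \<xi> (\<alpha> s)\<bar>"
    have q: "\<alpha> s \<in> G" using \<alpha>(2) s by blast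
    have x: "x \<in> L" "x \<in> chart_range c" using G_chart(2)[OF q] LV(2) by (auto simp: x_def)
    obtain \<mu> where \<mu>: "\<And>v. g x (T x) v = 0 \<Longrightarrow> B x v = \<mu> *\<^sub>R v" using umb[OF x(1)] by blast
    have "H = \<bar>\<mu>\<bar> / R" unfolding H_def by (rule umbilic_mean_curvature[OF \<xi> q \<mu>[unfolded x_def]])
    then have H: "H\<^sup>2 = (\<mu> / R)\<^sup>2" "H \<ge> 0" using R by (simp_all add: power_divide)
    obtain v A where va: "g x v v = 1" "g x (T x) v = 0"
      "(curvature M I \<alpha> s)\<^sup>2 = g x (tang x A) (tang x A) + (g x (B x v) v / R)\<^sup>2" "curvature M I \<alpha> s \<ge> 0"
      "acceleration N I \<alpha> s = 0 \<longleftrightarrow> tang x A = 0"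
      by (rule arclength_curve[OF I \<alpha> s x_def]) (rule that)
    have \<kappa>: "(curvature M I \<alpha> s)\<^sup>2 = g x (tang x A) (tang x A) + H\<^sup>2"
      using va(1,3) \<mu>[OF va(2)] H(1) by (simp add: A.g_lin[OF x(2)])
    then have "H\<^sup>2 \<le> (curvature M I \<alpha> s)\<^sup>2" using A.g_ge[OF x(2)] by simp
    then have 1: "H \<le> curvature M I \<alpha> s" by (rule power2_le_imp_le[OF _ va(4)])
    have "curvature M I \<alpha> s = H \<longleftrightarrow> (curvature M I \<alpha> s)\<^sup>2 = H\<^sup>2" using va(4) H(2) by simp
    also have "\<dots> \<longleftrightarrow> tang x A = 0" unfolding \<kappa> using A.g_zero[OF x(2)] by simp
    finally show ?thesis using 1 va(5) by (simp add: H_def)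
  qed
  have "C2_curve M I \<alpha>" using \<alpha>(1) unfolding arclength_C2_curve_def by blast
  from C2_curve_N[OF I this \<alpha>(2)] show ?thesis unfolding geodesic_def using * by blast
qed

text \<open>The curve is an integral curve of the normalized tangential part of a field \<open>W\<close> that is parallel
  at \<open>x0\<close>.\<close>

lemma tangent_curve:
  assumes x0: "x0 \<in> L" and u: "g x0 u (T x0) = 0" "g x0 u u = 1"
  obtains b \<alpha> where "b > 0" "arclength_C2_curve M {0..b} \<alpha>" "\<alpha> ` {0..b} \<subseteq> G" "\<alpha> 0 = chart_inv c x0"
    "curvature M {0..b} \<alpha> 0 = \<bar>g x0 (B x0 u) u\<bar> / R"
proof -
  have x0V: "x0 \<in> V" "x0 \<in> chart_range c" using LV[OF x0] by auto
  have TT0: "g x0 (T x0) (T x0) \<noteq> 0" using T_L[OF x0] R by simp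
  have "linear (\<lambda>x. A.\<Gamma> x0 x u)" using A.\<Gamma>_bil[OF x0V(2)] unfolding bilinear_def by simp
  then have bl: "bounded_linear (\<lambda>x. A.\<Gamma> x0 x u)" by (simp add: linear_conv_bounded_linear)
  \<comment> \<open>Its covariant derivative at \<open>x0\<close> vanishes: the linear term cancels
    the Christoffel symbol there.\<close>
  define W where "W x = u - A.\<Gamma> x0 (x - x0) u" for x
  define V1 where "V1 = V \<inter> (\<lambda>x. g x (T x) (T x)) -` (- {0})"
  have CT: "Ck_on (Suc 0) (\<lambda>x. g x (T x) (T x)) V" and CWT: "Ck_on (Suc 0) (\<lambda>x. g x (W x) (T x)) V"
    and CW: "Ck_on (Suc 0) W V"
  proof -
    have "Ck_on (Suc 0) (\<lambda>x. A.\<Gamma> x0 (x - x0) u) V"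
      by (rule Ck_on_bounded_linear[OF bl V(1) Ck_on_diff[OF V(1) Ck_on_id[OF V(1)] Ck_on_const[OF V(1)]]])
    from Ck_on_diff[OF V(1) Ck_on_const[OF V(1)] this] show CW: "Ck_on (Suc 0) W V" unfolding W_def .
    have sub: "(\<lambda>x. x) ` V \<subseteq> chart_range c" using V(2) by simp
    note fam = Ck_on_bilinear_family[where f = "\<lambda>x. x", OF V(1) A.open_U A.g_bil Ck_on_SucD[OF A.g2] sub Ck_on_id[OF V(1)]]
    show "Ck_on (Suc 0) (\<lambda>x. g x (T x) (T x)) V" by (rule fam[OF _ C1_T C1_T])
    show "Ck_on (Suc 0) (\<lambda>x. g x (W x) (T x)) V" by (rule fam[OF _ CW C1_T])
  qed
  have oV1: "open V1" unfolding V1_def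
    by (rule continuous_open_preimage[OF _ V(1)]) (use Ck_on_mono[OF CT, of 0] in \<open>simp_all add: open_Compl\<close>)
  have V1: "V1 \<subseteq> V" "V1 \<subseteq> chart_range c" "x0 \<in> V1" "\<And>x. x \<in> V1 \<Longrightarrow> g x (T x) (T x) \<noteq> 0"
    using x0V TT0 V(2) by (auto simp: V1_def)
  \<comment> \<open>The coefficient of the component along \<open>T\<close>, removed also at points
    outside the level set, so that the flow of \<open>X\<close> preserves
    \<open>rho\<close>.\<close>
  define \<psi> where "\<psi> x = g x (W x) (T x) * inverse (g x (T x) (T x))" for x
  have C\<psi>: "Ck_on (Suc 0) \<psi> V1" unfolding \<psi>_def
    by (intro Ck_on_mult Ck_on_inverse oV1 V1(4) Ck_on_subset[OF CWT V1(1)] Ck_on_subset[OF CT V1(1)])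
  define Y where "Y x = W x - \<psi> x *\<^sub>R T x" for x
  have CY: "Ck_on (Suc 0) Y V1" unfolding Y_def
    by (intro Ck_on_diff Ck_on_scaleR oV1 C\<psi> Ck_on_subset[OF CW V1(1)] Ck_on_subset[OF C1_T V1(1)])
  have CYY: "Ck_on (Suc 0) (\<lambda>x. g x (Y x) (Y x)) V1"
    by (rule Ck_on_bilinear_family[where f = "\<lambda>x. x", OF oV1 A.open_U A.g_bil Ck_on_SucD[OF A.g2] _ Ck_on_id[OF oV1] CY CY])
      (use V1(2) in auto)
  define V2 where "V2 = V1 \<inter> (\<lambda>x. g x (Y x) (Y x)) -` {0<..}"
  have oV2: "open V2" unfolding V2_def
    by (rule continuous_open_preimage[OF _ oV1]) (use Ck_on_mono[OF CYY, of 0] in simp_all)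
  have W0: "W x0 = u" by (simp add: W_def A.\<Gamma>_lin[OF x0V(2)])
  have \<psi>0: "\<psi> x0 = 0" by (simp add: \<psi>_def W0 u(1))
  have Y0: "Y x0 = u" by (simp add: Y_def W0 \<psi>0)
  have V2: "V2 \<subseteq> V1" "x0 \<in> V2" "\<And>x. x \<in> V2 \<Longrightarrow> g x (Y x) (Y x) > 0" using V1(3) u(2) by (auto simp: V2_def Y0)
  define \<phi> where "\<phi> x = inverse (sqrt (g x (Y x) (Y x)))" for x
  have C\<phi>: "Ck_on (Suc 0) \<phi> V2" unfolding \<phi>_def
    by (rule Ck_on_compose[OF oV2 _ C1_inverse_sqrt Ck_on_subset[OF CYY V2(1)]]) (use V2(3) in auto)
  define X where "X x = \<phi> x *\<^sub>R Y x" for x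
  have CX: "Ck_on (Suc 0) X V2" unfolding X_def
    by (intro Ck_on_scaleR oV2 C\<phi> Ck_on_subset[OF CY V2(1)])
  have XT: "g x (T x) (X x) = 0" if "x \<in> V2" for x
  proof -
    have x: "x \<in> V1" "x \<in> chart_range c" using that V2(1) V1(2) by blast+
    have "g x (T x) (Y x) = 0"
      using V1(4)[OF x(1)] A.g_sym[OF x(2), of "T x" "W x"] by (simp add: Y_def \<psi>_def A.g_lin[OF x(2)])
    then show ?thesis by (simp add: X_def A.g_lin[OF x(2)])
  qed
  have XX: "g x (X x) (X x) = 1" if "x \<in> V2" for x
  proof -
    have x: "x \<in> chart_range c" using that V2(1) V1(2) by blast
    have "\<phi> x * (\<phi> x * g x (Y x) (Y x)) = 1"
      using V2(3)[OF that] by (simp add: \<phi>_def field_simps)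
    then show ?thesis by (simp add: X_def A.g_lin[OF x])
  qed
  have X0: "X x0 = u" by (simp add: X_def \<phi>_def Y0 u(2))
  have dX: "(X has_derivative FD X x) (at x)" if "x \<in> V2" for x by (rule Ck_on_has_derivative[OF CX oV2 that])
  \<comment> \<open>The covariant derivative of \<open>X\<close> in direction \<open>u\<close> has
    components along \<open>u\<close> and \<open>T\<close> only. The former vanishes because
    \<open>X\<close> has unit length, and \<open>tang\<close> removes the latter.\<close>
  have acc: "tang x0 (FD X x0 u + A.\<Gamma> x0 u u) = 0"
  proof -
    let ?A = "FD X x0 u + A.\<Gamma> x0 u u"
    have d\<phi>: "(\<phi> has_derivative FD \<phi> x0) (at x0)" by (rule Ck_on_has_derivative[OF C\<phi> oV2 V2(2)])
    have d\<psi>: "(\<psi> has_derivative FD \<psi> x0) (at x0)" by (rule Ck_on_has_derivative[OF C\<psi> oV1 V1(3)])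
    have dW: "(W has_derivative (\<lambda>h. 0 - A.\<Gamma> x0 (h - 0) u)) (at x0)" unfolding W_def
      by (intro has_derivative_diff has_derivative_const has_derivative_ident bounded_linear.has_derivative[OF bl])
    have "(X has_derivative (\<lambda>h. \<phi> x0 *\<^sub>R ((0 - A.\<Gamma> x0 (h - 0) u) - (\<psi> x0 *\<^sub>R FD T x0 h + FD \<psi> x0 h *\<^sub>R T x0))
      + FD \<phi> x0 h *\<^sub>R Y x0)) (at x0)"
      unfolding X_def Y_def by (intro has_derivative_scaleR has_derivative_diff d\<phi> d\<psi> dW dT x0V(1))
    from FD_eq[OF this] have A: "?A = FD \<phi> x0 u *\<^sub>R u - FD \<psi> x0 u *\<^sub>R T x0"
      by (simp add: \<psi>0 Y0 \<phi>_def u(2))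
    have "((\<lambda>x. g x (X x) (X x)) has_derivative (\<lambda>h. g x0 (FD X x0 h + A.\<Gamma> x0 h (X x0)) (X x0) + g x0 (X x0) (FD X x0 h + A.\<Gamma> x0 h (X x0)))) (at x0)"
      by (rule A.has_derivative_g[where q = "\<lambda>x. x", OF x0V(2) has_derivative_ident dX[OF V2(2)] dX[OF V2(2)]])
    moreover have "((\<lambda>x. g x (X x) (X x)) has_derivative (\<lambda>h. 0)) (at x0)"
      by (rule has_derivative_transform_within_open[OF has_derivative_const[of 1] oV2 V2(2)]) (simp add: XX)
    ultimately have "(\<lambda>h. g x0 (FD X x0 h + A.\<Gamma> x0 h (X x0)) (X x0) + g x0 (X x0) (FD X x0 h + A.\<Gamma> x0 h (X x0))) = (\<lambda>h. 0)"
      by (rule has_derivative_unique)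
    from fun_cong[OF this, of u] have "g x0 ?A u = 0" using A.g_sym[OF x0V(2), of u ?A] by (simp add: X0)
    then have "FD \<phi> x0 u = 0" unfolding A using u A.g_sym[OF x0V(2), of u "T x0"] by (simp add: A.g_lin[OF x0V(2)])
    then have "?A = (- FD \<psi> x0 u) *\<^sub>R T x0" using A by simp
    then show ?thesis using T_L[OF x0] R by (simp add: tang_def A.g_lin[OF x0V(2)])
  qed
  obtain b \<delta> \<Phi> where b: "b > 0" "\<delta> > 0"
    "\<And>z t. z \<in> ball x0 \<delta> \<Longrightarrow> t \<in> {0..1} \<Longrightarrow> \<Phi> z t \<in> V2" "\<And>z. z \<in> ball x0 \<delta> \<Longrightarrow> \<Phi> z 0 = z"
    "\<And>z t. z \<in> ball x0 \<delta> \<Longrightarrow> t \<in> {0..1} \<Longrightarrow> (\<Phi> z has_vector_derivative b *\<^sub>R X (\<Phi> z t)) (at t within {0..1})"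
    by (rule local_flow[OF oV2 CX[folded One_nat_def] V2(2)]) (rule that)
  have x0b: "x0 \<in> ball x0 \<delta>" using b(2) by simp
  \<comment> \<open>Back to the original time, so that the curve has unit speed.\<close>
  define x where "x t = \<Phi> x0 (t / b)" for t
  have tb: "t / b \<in> {0..1}" if "t \<in> {0..b}" for t using that b(1) by auto
  have xV2: "x t \<in> V2" if "t \<in> {0..b}" for t unfolding x_def by (rule b(3)[OF x0b tb[OF that]])
  have xx0: "x 0 = x0" by (simp add: x_def b(4)[OF x0b])
  have dx: "(x has_vector_derivative X (x t)) (at t within {0..b})" if t: "t \<in> {0..b}" for t
  proof -
    have "((\<lambda>t. t / b) has_vector_derivative 1 / b) (at t within {0..b})"
      using b(1) by (auto intro!: derivative_eq_intros simp: has_real_derivative_iff_has_vector_derivative[symmetric])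
    moreover have "(\<lambda>t. t / b) ` {0..b} \<subseteq> {0..1}" using tb by blast
    then have "(\<Phi> x0 has_vector_derivative b *\<^sub>R X (\<Phi> x0 (t / b))) (at (t / b) within (\<lambda>t. t / b) ` {0..b})"
      using has_vector_derivative_within_subset[OF b(5)[OF x0b tb[OF t]]] by blast
    ultimately have "(\<Phi> x0 \<circ> (\<lambda>t. t / b) has_vector_derivative (1 / b) *\<^sub>R (b *\<^sub>R X (\<Phi> x0 (t / b)))) (at t within {0..b})"
      by (rule vector_diff_chain_within)
    then show ?thesis using b(1) by (simp add: o_def x_def[abs_def])
  qed
  have xV: "x t \<in> V" "x t \<in> chart_range c" if "t \<in> {0..b}" for t using xV2[OF that] V2(1) V1(1,2) by blast+
  have rho: "rho (x t) = R\<^sup>2 / 2" if t: "t \<in> {0..b}" for t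
  proof -
    have "\<exists>k. \<forall>t\<in>{0..b}. rho (x t) = k"
    proof (rule has_derivative_zero_constant)
      fix t assume t: "t \<in> {0..b}"
      have "((\<lambda>t. rho (x t)) has_derivative (\<lambda>h. g (x t) (T (x t)) (h *\<^sub>R X (x t)))) (at t within {0..b})"
        by (rule has_derivative_compose[OF dx[OF t, unfolded has_vector_derivative_def] drho[OF xV(1)[OF t]]])
      then show "((\<lambda>t. rho (x t)) has_derivative (\<lambda>h. 0)) (at t within {0..b})"
        by (simp add: A.g_lin[OF xV(2)[OF t]] XT[OF xV2[OF t]])
    qed simp
    then have "rho (x t) = rho (x 0)" using t b(1) by force
    then show ?thesis using LV(3)[OF x0] by (simp add: xx0)
  qed
  have xL: "x t \<in> L" if "t \<in> {0..b}" for t using xV(1)[OF that] rho[OF that] by (simp add: L_def)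
  define \<alpha> where "\<alpha> t = chart_inv c (x t)" for t
  have \<alpha>x: "chart_map c (\<alpha> t) = x t" if "t \<in> {0..b}" for t
    unfolding \<alpha>_def by (rule chart_inv_right(2)[OF chart[OF c] xV(2)[OF that]])
  define a where "a t = FD X (x t) (X (x t))" for t
  have dv: "((\<lambda>t. X (x t)) has_vector_derivative a t) (at t within {0..b})" if t: "t \<in> {0..b}" for t
    unfolding a_def by (rule has_vector_derivative_FD[where X = x, OF oV2 CX xV2[OF t] dx[OF t]])
  have cx: "continuous_on {0..b} x"
    using dx has_vector_derivative_continuous continuous_on_eq_continuous_within by blast
  have ca: "continuous_on {0..b} a" unfolding a_def
  proof (rule continuous_linear_family[where f = x and T = V2 and \<beta> = "FD X"])
    show "linear (FD X z)" if "z \<in> V2" for z by (rule has_derivative_linear[OF dX[OF that]])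
    show "continuous_on V2 (\<lambda>z. FD X z w)" for w using Ck_on_FD[OF CX, of w] by simp
    show "continuous_on {0..b} (\<lambda>t. X (x t))"
      using dv has_vector_derivative_continuous continuous_on_eq_continuous_within by blast
  qed (use cx xV2 in auto)
  have I: "nondegenerate_interval {0..b}"
    unfolding nondegenerate_interval_def using b(1) by (intro conjI is_interval_cc bexI[of _ 0] bexI[of _ b]) auto
  have C2: "C2_curve M {0..b} \<alpha>" unfolding \<alpha>_def
    by (rule C2_curve_chart[where a = a, OF c xV(2) dx dv ca])
  have \<alpha>G: "\<alpha> ` {0..b} \<subseteq> G" using xL by (auto simp: \<alpha>_def G_def)
  have d\<alpha>: "((\<lambda>t. chart_map c (\<alpha> t)) has_vector_derivative X (x t)) (at t within {0..b})" if t: "t \<in> {0..b}" for t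
    using has_derivative_transform[OF t \<alpha>x dx[OF t, unfolded has_vector_derivative_def]] by (simp add: has_vector_derivative_def)
  have al: "arclength_C2_curve M {0..b} \<alpha>"
    unfolding arclength_C2_curve_def
  proof (intro conjI ballI C2)
    fix t assume t: "t \<in> {0..b}"
    show "norm_at M (\<alpha> t) (velocity M {0..b} \<alpha> t) = 1"
      using curve_speed[OF I C2 \<alpha>G t d\<alpha> dv[OF t] \<alpha>x[OF t, symmetric] refl] XX[OF xV2[OF t]] by simp
  qed
  have 0: "0 \<in> {0..b}" using b(1) by simp
  have \<kappa>: "(curvature M {0..b} \<alpha> 0)\<^sup>2 = (g x0 (B x0 u) u / R)\<^sup>2" "curvature M {0..b} \<alpha> 0 \<ge> 0"
    using curve_curvature[OF I C2 \<alpha>G 0 d\<alpha> dv[OF 0] \<alpha>x[OF 0, symmetric] refl] acc A.g_lin[OF x0V(2)]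
      curve_curvature_nonneg[OF I C2 \<alpha>G 0 d\<alpha> dv[OF 0] \<alpha>x[OF 0, symmetric] refl]
    by (simp_all add: xx0 X0 a_def)
  then have "curvature M {0..b} \<alpha> 0 = \<bar>g x0 (B x0 u) u / R\<bar>"
    by (metis abs_of_nonneg real_sqrt_abs)
  then show thesis using R by (intro that[OF b(1) al \<alpha>G]) (simp_all add: \<alpha>_def xx0)
qed

text \<open>The argument takes place in the model space of a chart, where \<open>B\<close> becomes
  the endomorphism \<beta>: the trace in the mean curvature is taken there, and \<beta> is
  self-adjoint for the induced metric.\<close>

lemma umbilic_of_curves:
  assumes \<xi>: "unit_normal_field M N \<xi>" and x: "x \<in> L"
    and curves: "\<And>I \<alpha> s. nondegenerate_interval I \<Longrightarrow> arclength_C2_curve M I \<alpha> \<Longrightarrow> \<alpha> ` I \<subseteq> G \<Longrightarrow> s \<in> I \<Longrightarrow>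
      curvature M I \<alpha> s \<ge> \<bar>mean_curvature M N \<xi> (\<alpha> s)\<bar>"
    and pos: "\<And>v. g x (B x v) v \<ge> 0"
  shows "\<exists>\<mu>. \<forall>v. g x (T x) v = 0 \<longrightarrow> B x v = \<mu> *\<^sub>R v"
proof -
  define q where "q = chart_inv c x"
  have xV: "x \<in> V" "x \<in> chart_range c" using LV[OF x] by auto
  have q: "q \<in> G" "chart_map c q = x" using x chart_inv_right(2)[OF chart[OF c] xV(2)] by (auto simp: q_def G_def)
  define k where "k = chart_at N q"
  define y where "y = coords N q"
  have k: "k \<in> atlas N" "y \<in> chart_range k" "F k y = x" using coords_N[OF q(1)] q(2) by (simp_all add: k_def y_def)
  let ?D = "FD (F k) y" and ?S = "shape_operator M N \<xi> q"
  define \<beta> where "\<beta> u = proj k y (B x (?D u))" for u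
  have tan: "g x (?D u) (T x) = 0" for u using tangent_F[OF k(1,2)] k(3) by simp
  have D\<beta>: "?D (\<beta> u) = B x (?D u)" for u
  proof -
    have "g x (B x (?D u)) (T x) = 0" using g_B(2)[OF xV(1)] tan A.g_sym[OF xV(2)] by simp
    then show ?thesis unfolding \<beta>_def F_proj[OF k(1,2)] k(3) by (rule g_tang(2)[OF x])
  qed
  have lin\<beta>: "linear \<beta>"
    using linear_compose[OF linear_compose[OF lin_F[OF k(1,2)] linear_B[OF xV(1)]] linear_proj[OF k(1,2)]]
    by (simp add: o_def \<beta>_def[abs_def])
  obtain s where s: "\<bar>s\<bar> = 1 / R" "\<And>u. ?D (?S u) = - s *\<^sub>R B x (?D u)"
    using shape_operator_eq[OF \<xi> q(1)] unfolding k_def y_def q(2) by blast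
  have "?S u = - s *\<^sub>R \<beta> u" for u
    by (rule injD[OF C2_F(2)[OF k(1,2)]]) (simp add: s(2) D\<beta> linear_neg[OF lin_F[OF k(1,2)]] linear_scale[OF lin_F[OF k(1,2)]])
  then have "endo_trace ?S = - s * endo_trace \<beta>" by (simp add: endo_trace_def sum_distrib_left sum_negf)
  then have H: "\<bar>mean_curvature M N \<xi> q\<bar> = \<bar>endo_trace \<beta> / DIM('f)\<bar> / R"
    using s(1) by (simp add: mean_curvature_def abs_mult)
  define m where "m = endo_trace \<beta> / DIM('f)"
  \<comment> \<open>After normalisation \<open>tangent_curve\<close> supplies a curve whose
    curvature at its starting point is |g(Bw,w)|/R; \<open>pos\<close> removes the absolute
    value.\<close>
  have ineq: "m * g x (?D u) (?D u) \<le> g x (B x (?D u)) (?D u)" for u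
  proof (cases "?D u = 0")
    case True
    then show ?thesis by (simp add: A.g_lin[OF xV(2)])
  next
    case False
    define n where "n = sqrt (g x (?D u) (?D u))"
    have n: "n > 0" "n * n = g x (?D u) (?D u)" using A.g_pos[OF xV(2) False] by (simp_all add: n_def)
    let ?w = "(1 / n) *\<^sub>R ?D u"
    have w: "g x ?w (T x) = 0" "g x ?w ?w = 1" using n tan by (simp_all add: A.g_lin[OF xV(2)] n(2)[symmetric])
    obtain b \<alpha> where b: "b > 0" "arclength_C2_curve M {0..b} \<alpha>" "\<alpha> ` {0..b} \<subseteq> G" "\<alpha> 0 = chart_inv c x"
      "curvature M {0..b} \<alpha> 0 = \<bar>g x (B x ?w) ?w\<bar> / R"
      by (rule tangent_curve[OF x w]) (rule that)
    have I: "nondegenerate_interval {0..b}"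
      unfolding nondegenerate_interval_def using b(1) by (intro conjI is_interval_cc bexI[of _ 0] bexI[of _ b]) auto
    have 0: "0 \<in> {0..b}" using b(1) by simp
    have "\<bar>m\<bar> / R \<le> \<bar>g x (B x ?w) ?w\<bar> / R"
      using curves[OF I b(2,3) 0] unfolding b(4,5) q_def[symmetric] H m_def .
    then have "\<bar>m\<bar> \<le> g x (B x ?w) ?w" using R pos[of ?w] by (simp add: divide_le_cancel)
    then have "m \<le> g x (B x ?w) ?w" by simp
    also have "g x (B x ?w) ?w = g x (B x (?D u)) (?D u) / (n * n)"
      by (simp add: A.g_lin[OF xV(2)] linear_scale[OF linear_B[OF xV(1)]])
    finally have "m * (n * n) \<le> g x (B x (?D u)) (?D u)" using mult_pos_pos[OF n(1) n(1)] by (simp only: pos_le_divide_eq)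
    then show ?thesis by (simp only: n(2))
  qed
  define S where "S u = \<beta> u - m *\<^sub>R u" for u
  have DS: "?D (S u) = B x (?D u) - m *\<^sub>R ?D u" for u
    by (simp add: S_def linear_diff[OF lin_F[OF k(1,2)]] linear_scale[OF lin_F[OF k(1,2)]] D\<beta>)
  have S0: "S u = 0" for u
  proof (rule trace_zero_psd[where g = "metric N k y" and S = S, OF posdef_metric_N[OF k(1,2)]])
    show "linear S" unfolding S_def using lin\<beta> by (auto intro!: linearI simp: linear_add linear_scale algebra_simps)
    show "metric N k y (S u) v = metric N k y u (S v)" for u v
      unfolding metric_N[OF k(1,2)] k(3) DS using g_B(1)[OF xV(1)] by (simp add: A.g_lin[OF xV(2)])
    show "metric N k y (S u) u \<ge> 0" for u
      unfolding metric_N[OF k(1,2)] k(3) DS using ineq[of u] by (simp add: A.g_lin[OF xV(2)])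
    show "endo_trace S = 0"
      by (simp add: endo_trace_def S_def inner_diff_left sum_subtractf m_def)
  qed
  have "B x v = m *\<^sub>R v" if "g x (T x) v = 0" for v
  proof -
    have "g (F k y) v (T (F k y)) = 0" using that A.g_sym[OF xV(2)] by (simp add: k(3))
    then obtain u where "?D u = v" by (rule tangent_range[OF k(1,2)])
    then show ?thesis using DS[of u] S0[of u] linear_0[OF lin_F[OF k(1,2)]] by simp
  qed
  then show ?thesis by blast
qed

end

section \<open>Geodesic spheres\<close>

text \<open>In terms of matrix entries: while their total deviation from those at \<open>z\<close>
  stays below the lower bound \<open>m\<close> of the form at \<open>z\<close>, no vector can make
  the form negative.\<close>

lemma posdef_nearby:
  fixes \<beta> :: "'z::topological_space \<Rightarrow> 'e::euclidean_space \<Rightarrow> 'e \<Rightarrow> real"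
  assumes V: "open V" "z \<in> V" and bil: "\<And>x. x \<in> V \<Longrightarrow> bilinear (\<beta> x)"
    and cont: "\<And>u v. continuous_on V (\<lambda>x. \<beta> x u v)" and pos: "posdef (\<beta> z)"
  obtains W where "open W" "z \<in> W" "W \<subseteq> V" "\<And>x v. x \<in> W \<Longrightarrow> \<beta> x v v \<ge> 0"
proof -
  obtain m where m: "m > 0" "\<And>v. m * (norm v)\<^sup>2 \<le> \<beta> z v v" by (rule posdef_lower_bound[OF pos]) (rule that)
  define f where "f x = (\<Sum>b\<in>Basis. \<Sum>c\<in>Basis. \<bar>\<beta> x b c - \<beta> z b c\<bar>)" for x
  have cf: "continuous_on V f" unfolding f_def by (intro continuous_intros cont)
  define W where "W = V \<inter> f -` {..<m}"
  have oW: "open W" unfolding W_def by (rule continuous_open_preimage[OF cf V(1)]) simp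
  have "z \<in> W" using V(2) m(1) by (simp add: W_def f_def)
  moreover have "\<beta> x v v \<ge> 0" if x: "x \<in> W" for x v
  proof -
    have xV: "x \<in> V" "f x < m" using x by (auto simp: W_def)
    have nb: "\<bar>v \<bullet> b\<bar> \<le> norm v" if "b \<in> Basis" for b using Basis_le_norm[OF that] .
    have "\<beta> z v v - \<beta> x v v = (\<Sum>b\<in>Basis. \<Sum>c\<in>Basis. ((v \<bullet> b) * (v \<bullet> c)) * (\<beta> z b c - \<beta> x b c))"
      unfolding bilinear_expand[OF bil[OF xV(1)], of v v] bilinear_expand[OF bil[OF V(2)], of v v]
      by (simp add: sum_subtractf[symmetric] algebra_simps)
    also have "\<dots> \<le> (\<Sum>b\<in>Basis. \<Sum>c\<in>Basis. (norm v * norm v) * \<bar>\<beta> x b c - \<beta> z b c\<bar>)"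
    proof (intro sum_mono)
      fix b c :: 'e assume "b \<in> Basis" "c \<in> Basis"
      then have "\<bar>(v \<bullet> b) * (v \<bullet> c)\<bar> \<le> norm v * norm v" unfolding abs_mult by (intro mult_mono nb) auto
      then have "\<bar>(v \<bullet> b) * (v \<bullet> c)\<bar> * \<bar>\<beta> z b c - \<beta> x b c\<bar> \<le> (norm v * norm v) * \<bar>\<beta> z b c - \<beta> x b c\<bar>"
        by (intro mult_right_mono) auto
      then show "((v \<bullet> b) * (v \<bullet> c)) * (\<beta> z b c - \<beta> x b c) \<le> (norm v * norm v) * \<bar>\<beta> x b c - \<beta> z b c\<bar>"
        unfolding abs_mult[symmetric] abs_minus_commute[of "\<beta> x b c"] by linarith
    qed
    also have "\<dots> = (norm v)\<^sup>2 * f x" by (simp add: f_def sum_distrib_left power2_eq_square)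
    also have "\<dots> \<le> (norm v)\<^sup>2 * m" using xV(2) by (intro mult_left_mono) auto
    finally show ?thesis using m(2)[of v] by (simp add: mult.commute)
  qed
  ultimately show thesis using oW by (intro that[of W]) (auto simp: W_def)
qed

context normal_nbhd
begin

text \<open>By the lower bound of the metric at \<open>x0\<close>, a small value of
  \<open>rho\<close> forces \<open>h x\<close> to be near 0, and the exponential map, which recovers
  \<open>x\<close> from it, is continuous.\<close>

lemma small_rho:
  assumes W: "open W" "x0 \<in> W"
  obtains e where "e > 0" "\<And>x. x \<in> V \<Longrightarrow> rho x < e \<Longrightarrow> x \<in> W"
proof -
  obtain m where m: "m > 0" "\<And>v. m * (norm v)\<^sup>2 \<le> g x0 v v"
    by (rule posdef_lower_bound[OF posdef_g[OF x0U]]) (rule that)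
  have "continuous_on (ball 0 \<delta>) (\<lambda>a. q a 1)"
    using has_derivative_continuous[OF Dq[OF _ one]] continuous_at_imp_continuous_on by blast
  then have "open (ball 0 \<delta> \<inter> (\<lambda>a. q a 1) -` W)" by (rule continuous_open_preimage[OF _ open_ball W(1)])
  moreover have "0 \<in> ball 0 \<delta> \<inter> (\<lambda>a. q a 1) -` W" using \<delta> W(2) at_zero(1)[OF one] by simp
  ultimately obtain d where d: "d > 0" "ball 0 d \<subseteq> ball 0 \<delta> \<inter> (\<lambda>a. q a 1) -` W"
    by (rule openE)
  show thesis
  proof (rule that[of "m * d\<^sup>2 / 2"])
    show "m * d\<^sup>2 / 2 > 0" using m(1) d(1) by simp
    fix x assume x: "x \<in> V" "rho x < m * d\<^sup>2 / 2"
    then have "m * (norm (h x))\<^sup>2 < m * d\<^sup>2" using m(2)[of "h x"] by (simp add: rho_def)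
    then have "(norm (h x))\<^sup>2 < d\<^sup>2" using m(1) by simp
    then have "norm (h x) < d" by (rule power2_less_imp_less) (use d(1) in simp)
    then have "h x \<in> (\<lambda>a. q a 1) -` W" using d(2) by auto
    then show "x \<in> W" using hV(2)[OF x(1)] by simp
  qed
qed

lemma B_nonneg:
  obtains e where "e > 0" "\<And>x v. x \<in> V \<Longrightarrow> rho x < e \<Longrightarrow> g x (B x v) v \<ge> 0"
proof -
  have bil: "bilinear (\<lambda>u v. g x (B x u) v)" if x: "x \<in> V" for x
    unfolding bilinear_def using lin_B[OF x]
    by (auto intro!: linearI simp: linear_add linear_scale g_lin[OF VU[OF x]])
  have cont: "continuous_on V (\<lambda>x. g x (B x u) v)" for u v
    by (rule continuous_g[OF continuous_on_id _ continuous_B continuous_on_const]) (use V_subset in auto)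
  have pos: "posdef (\<lambda>u v. g x0 (B x0 u) v)" unfolding B_center using posdef_g[OF x0U] .
  obtain W where W: "open W" "x0 \<in> W" "\<And>x v. x \<in> W \<Longrightarrow> g x (B x v) v \<ge> 0"
    by (rule posdef_nearby[where \<beta> = "\<lambda>x u v. g x (B x u) v", OF openV x0V(1) bil cont pos]) (assumption, rule that)
  obtain e where e: "e > 0" "\<And>x. x \<in> V \<Longrightarrow> rho x < e \<Longrightarrow> x \<in> W" by (rule small_rho[OF W(1,2)]) (rule that)
  show thesis by (rule that[OF e(1) W(3)[OF e(2)]])
qed

end

context riemannian
begin

lemma normal_chart_exists:
  assumes p: "p \<in> points M"
  obtains \<delta> q v J K r V h where
    "normal_nbhd (chart_range (chart_at M p)) (metric M (chart_at M p)) (chart_map (chart_at M p) p) \<delta> q v J K r V h"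
proof -
  let ?c = "chart_at M p"
  interpret A: local_metric "chart_range ?c" "metric M ?c" by (rule local_metric_chart[OF chart_at(1)[OF p]])
  have "chart_map ?c p \<in> chart_range ?c" using chart_at(2)[OF p] by blast
  then obtain \<delta> q v J K where "geodesic_flow (chart_range ?c) (metric M ?c) (chart_map ?c p) \<delta> q v J K"
    by (rule A.geodesic_flow_exists)
  then interpret F: geodesic_flow "chart_range ?c" "metric M ?c" "chart_map ?c p" \<delta> q v J K .
  show thesis by (rule F.normal_nbhd_exists) (rule that)
qed

context
  fixes p c \<delta> q v J K r V h
  assumes p: "p \<in> points M" and c: "c = chart_at M p"
    and nn: "normal_nbhd (chart_range c) (metric M c) (chart_map c p) \<delta> q v J K r V h"
begin

interpretation NN: normal_nbhd "chart_range c" "metric M c" "chart_map c p" \<delta> q v J K r V h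
  by (rule nn)

text \<open>Vectors of length R < r lie in the ball on which \<open>h\<close> inverts the
  exponential map, and there \<open>rho\<close> is half the squared length of the initial
  vector.\<close>

lemma geodesic_sphere_chart:
  assumes R: "0 < R" "R < r"
  shows "geodesic_sphere M p R = chart_inv c ` {x \<in> V. NN.rho x = R\<^sup>2 / 2}"
    and "norm_at M p u = 1 \<Longrightarrow> R *\<^sub>R u \<in> exp_domain M p"
proof -
  let ?g = "metric M c (chart_map c p)"
  have n: "norm_at M p u = 1 \<longleftrightarrow> ?g u u = 1" for u by (simp add: norm_at_def inner_at_def coords_def c)
  have gR: "?g (R *\<^sub>R u) (R *\<^sub>R u) = R\<^sup>2 * ?g u u" for u by (simp add: NN.g_lin[OF NN.x0U] power2_eq_square)
  have R2: "R\<^sup>2 < r\<^sup>2" using R by (simp add: power_strict_mono)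
  have eg: "exp_graph M p a y \<longleftrightarrow> y = chart_inv c (q a 1)" if "?g a a < r\<^sup>2" for a y
    by (rule exp_graph_chart[OF p c NN.geodesic_flow_axioms NN.rball[OF that]])
  have sm: "?g (R *\<^sub>R u) (R *\<^sub>R u) < r\<^sup>2" if "norm_at M p u = 1" for u using that R2 by (simp add: n gR)
  show "norm_at M p u = 1 \<Longrightarrow> R *\<^sub>R u \<in> exp_domain M p" unfolding exp_domain_def using eg[OF sm] by blast
  have em: "exp_map M p (R *\<^sub>R u) = chart_inv c (q (R *\<^sub>R u) 1)" if "norm_at M p u = 1" for u
    unfolding exp_map_def eg[OF sm[OF that]] by simp
  show "geodesic_sphere M p R = chart_inv c ` {x \<in> V. NN.rho x = R\<^sup>2 / 2}"
  proof (intro equalityI subsetI)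
    fix y assume "y \<in> geodesic_sphere M p R"
    then obtain u where u: "norm_at M p u = 1" "y = exp_map M p (R *\<^sub>R u)" unfolding geodesic_sphere_def by blast
    have "q (R *\<^sub>R u) 1 \<in> V" "NN.rho (q (R *\<^sub>R u) 1) = R\<^sup>2 / 2"
      using NN.qV[OF sm[OF u(1)]] u(1) by (simp_all add: NN.rho_def gR n)
    then show "y \<in> chart_inv c ` {x \<in> V. NN.rho x = R\<^sup>2 / 2}" unfolding u(2) em[OF u(1)] by blast
  next
    fix y assume "y \<in> chart_inv c ` {x \<in> V. NN.rho x = R\<^sup>2 / 2}"
    then obtain x where x: "x \<in> V" "NN.rho x = R\<^sup>2 / 2" "y = chart_inv c x" by blast
    let ?u = "(1 / R) *\<^sub>R h x"
    have Ru: "R *\<^sub>R ?u = h x" using R by simp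
    have "R\<^sup>2 * ?g ?u ?u = R\<^sup>2" using gR[of ?u] x(2) unfolding Ru by (simp add: NN.rho_def)
    then have u: "norm_at M p ?u = 1" using R by (simp add: n)
    have "exp_map M p (R *\<^sub>R ?u) = y" using em[OF u] unfolding Ru NN.hV(2)[OF x(1)] x(3) .
    then show "y \<in> geodesic_sphere M p R" unfolding geodesic_sphere_def using u by blast
  qed
qed

lemma level_hypersurface_sphere:
  assumes R: "0 < R" "R < r" and dim: "DIM('e) = DIM('f::euclidean_space) + 1"
  shows "level_hypersurface TYPE('f) M c V NN.T NN.rho R"
    and "geodesic_sphere M p R = level_hypersurface.G c V NN.rho R"
proof -
  show L: "level_hypersurface TYPE('f) M c V NN.T NN.rho R"
  proof unfold_locales
    show "c \<in> atlas M" using chart_at(1)[OF p] c by simp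
    show "metric M c x (FD NN.T x u + NN.\<Gamma> x u (NN.T x)) w = metric M c x u (FD NN.T x w + NN.\<Gamma> x w (NN.T x))"
      if "x \<in> V" for x u w using NN.B_sym[OF that] by (simp add: NN.B_def)
    show "metric M c x (FD NN.T x w + NN.\<Gamma> x w (NN.T x)) (NN.T x) = metric M c x (NN.T x) w" if "x \<in> V" for x w
      using NN.B_T[OF that] by (simp add: NN.B_def)
  qed (use dim R NN.openV NN.V_subset NN.C1_T NN.drho NN.g_T in auto)
  show "geodesic_sphere M p R = level_hypersurface.G c V NN.rho R"
    unfolding geodesic_sphere_chart(1)[OF R] level_hypersurface.G_def[OF L] level_hypersurface.L_def[OF L] ..
qed

end

end

text \<open>The condition that the theorem imposes on the sphere of centre \<open>p\<close> and
  radius \<open>R\<close>, named so that both implications can refer to it.\<close>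

definition sphere_condition :: "('a, 'e::euclidean_space) riem \<Rightarrow> 'f::euclidean_space itself \<Rightarrow> 'a \<Rightarrow> real \<Rightarrow> bool" where
  "sphere_condition M _ p R \<longleftrightarrow>
    (let G = geodesic_sphere M p R; N = (submanifold M G :: ('a, 'f) riem) in
      (\<forall>V. norm_at M p V = 1 \<longrightarrow> R *\<^sub>R V \<in> exp_domain M p) \<and>
      is_submanifold M G TYPE('f) \<and>
      (\<exists>\<xi>. unit_normal_field M N \<xi> \<and>
        (\<forall>I \<alpha>. nondegenerate_interval I \<and> arclength_C2_curve M I \<alpha> \<and> \<alpha> ` I \<subseteq> G \<longrightarrow>
          (\<forall>s\<in>I. curvature M I \<alpha> s \<ge> \<bar>mean_curvature M N \<xi> (\<alpha> s)\<bar>) \<and>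
          ((\<forall>s\<in>I. curvature M I \<alpha> s = \<bar>mean_curvature M N \<xi> (\<alpha> s)\<bar>) \<longleftrightarrow> geodesic N I \<alpha>))))"

section \<open>The two implications\<close>

context riemannian
begin

lemma sphere_condition_of_space_form:
  assumes "space_form M" and dim: "DIM('e) = DIM('f::euclidean_space) + 1" and p: "p \<in> points M"
  shows "\<exists>R0>0. \<forall>R. 0 < R \<and> R < R0 \<longrightarrow> sphere_condition M TYPE('f) p R"
proof -
  obtain K where K: "\<And>p u v. p \<in> points M \<Longrightarrow> u \<noteq> v \<and> independent {u, v} \<longrightarrow> sectional_curvature M p u v = K"
    using \<open>space_form M\<close> unfolding space_form_def by blast
  define c where "c = chart_at M p"
  have c: "c \<in> atlas M" "p \<in> chart_dom c" using chart_at[OF p] by (auto simp: c_def)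
  obtain \<delta> q v J K' r V h where nn: "normal_nbhd (chart_range c) (metric M c) (chart_map c p) \<delta> q v J K' r V h"
    by (rule normal_chart_exists[OF p, folded c_def]) (rule that)
  interpret NN: normal_nbhd "chart_range c" "metric M c" "chart_map c p" \<delta> q v J K' r V h by (rule nn)
  have cc: "NN.curv_const K x" if x: "x \<in> chart_range c" for x
  proof -
    note x' = chart_inv_right[OF chart[OF c(1)] x]
    have q: "chart_inv c x \<in> points M" using x'(1) dom_subset[OF chart[OF c(1)]] by blast
    show ?thesis using curvature_tensor_chart[OF q c(1) x'(1), of K] K[OF q] unfolding x'(2) by blast
  qed
  \<comment> \<open>R < 1/(\<bar>K\<bar> + 1) implies K R^2 \<le> 1, the smallness that keeps the
    scalar Jacobi solution from vanishing at time 1.\<close>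
  define R0 where "R0 = min r (1 / (\<bar>K\<bar> + 1))"
  have "R0 > 0" using NN.r by (simp add: R0_def)
  moreover have "sphere_condition M TYPE('f) p R" if R: "0 < R" "R < R0" for R
  proof -
    have Rr: "R < r" using R(2) by (simp add: R0_def)
    have "R < 1 / (\<bar>K\<bar> + 1)" using R(2) by (simp add: R0_def)
    then have "\<bar>K\<bar> * R + R < 1" by (simp add: pos_less_divide_eq algebra_simps)
    moreover have "0 \<le> \<bar>K\<bar> * R" using R(1) by simp
    ultimately have R1: "R < 1" "\<bar>K\<bar> * R < 1" using R(1) by linarith+
    have "K * R\<^sup>2 \<le> (\<bar>K\<bar> * R) * R" using R(1) by (simp add: power2_eq_square mult_right_mono)
    also have "\<dots> \<le> 1 * 1" using R1 R(1) by (intro mult_mono) auto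
    finally have KR: "K * R\<^sup>2 \<le> 1" by simp
    interpret S: level_hypersurface M c V NN.T NN.rho R "TYPE('f)"
      by (rule level_hypersurface_sphere(1)[OF p c_def nn R(1) Rr dim])
    have G: "geodesic_sphere M p R = S.G" by (rule level_hypersurface_sphere(2)[OF p c_def nn R(1) Rr dim])
    have umb: "\<exists>\<mu>. \<forall>v. metric M c x (NN.T x) v = 0 \<longrightarrow> S.B x v = \<mu> *\<^sub>R v" if x: "x \<in> S.L" for x
    proof -
      have small: "K * (2 * NN.rho x) \<le> 1" unfolding S.LV(3)[OF x] using KR by simp
      obtain \<mu> where "\<And>v. metric M c x (NN.T x) v = 0 \<Longrightarrow> NN.B x v = \<mu> *\<^sub>R v"
        by (rule NN.curv_const_umbilic[OF cc S.LV(1)[OF x] small]) (assumption, rule that)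
      then show ?thesis unfolding S.B_def NN.B_def by blast
    qed
    have "norm_at M p u = 1 \<longrightarrow> R *\<^sub>R u \<in> exp_domain M p" for u
      using geodesic_sphere_chart(2)[OF p c_def nn R(1) Rr] by blast
    then show ?thesis
      unfolding sphere_condition_def Let_def G
      using S.is_submanifold_G S.unit_normal_exists S.umbilic_curves[OF umb S.unit_normal_exists] by blast
  qed
  ultimately show ?thesis by blast
qed

lemma curv_const_of_sphere_condition:
  assumes dim: "DIM('e) = DIM('f::euclidean_space) + 1" "DIM('f) \<ge> 2" and p: "p \<in> points M"
    and R0: "R0 > 0" "\<And>R. 0 < R \<Longrightarrow> R < R0 \<Longrightarrow> sphere_condition M TYPE('f) p R"
  shows "\<exists>K. \<forall>u v. u \<noteq> v \<and> independent {u, v} \<longrightarrow> sectional_curvature M p u v = K"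
proof -
  define c where "c = chart_at M p"
  have c: "c \<in> atlas M" "p \<in> chart_dom c" using chart_at[OF p] by (auto simp: c_def)
  obtain \<delta> q v J K r V h where nn: "normal_nbhd (chart_range c) (metric M c) (chart_map c p) \<delta> q v J K r V h"
    by (rule normal_chart_exists[OF p, folded c_def]) (rule that)
  interpret NN: normal_nbhd "chart_range c" "metric M c" "chart_map c p" \<delta> q v J K r V h by (rule nn)
  obtain e where e: "e > 0" "\<And>x v. x \<in> V \<Longrightarrow> NN.rho x < e \<Longrightarrow> metric M c x (NN.B x v) v \<ge> 0"
    by (rule NN.B_nonneg) (rule that)
  \<comment> \<open>Below this level \<open>B\<close> is nonnegative and, as rho = R^2/2, the level
    sets are spheres of radius less than both \<open>r\<close> and \<open>R0\<close>.\<close>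
  define r1 where "r1 = min e ((min r R0)\<^sup>2 / 2)"
  have r1: "r1 > 0" using e(1) NN.r R0(1) by (simp add: r1_def)
  have umb: "\<exists>\<mu>. \<forall>v. metric M c x (NN.T x) v = 0 \<longrightarrow> NN.B x v = \<mu> *\<^sub>R v"
    if x: "x \<in> V" "NN.rho x > 0" "NN.rho x < r1" for x
  proof -
    define R where "R = sqrt (2 * NN.rho x)"
    have R2: "R\<^sup>2 = 2 * NN.rho x" "R > 0" using x(2) by (simp_all add: R_def)
    have "R\<^sup>2 < (min r R0)\<^sup>2" using x(3) unfolding R2(1) by (simp add: r1_def)
    then have "R < min r R0" by (rule power2_less_imp_less) (use NN.r R0(1) in simp)
    then have R: "R < r" "R < R0" by auto
    interpret S: level_hypersurface M c V NN.T NN.rho R "TYPE('f)"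
      by (rule level_hypersurface_sphere(1)[OF p c_def nn R2(2) R(1) dim(1)])
    have G: "geodesic_sphere M p R = S.G" by (rule level_hypersurface_sphere(2)[OF p c_def nn R2(2) R(1) dim(1)])
    have xL: "x \<in> S.L" using x(1) R2(1) by (simp add: S.L_def)
    obtain \<xi> where \<xi>: "unit_normal_field M S.N \<xi>"
      and curves: "\<forall>I \<alpha>. nondegenerate_interval I \<and> arclength_C2_curve M I \<alpha> \<and> \<alpha> ` I \<subseteq> S.G \<longrightarrow>
        (\<forall>s\<in>I. curvature M I \<alpha> s \<ge> \<bar>mean_curvature M S.N \<xi> (\<alpha> s)\<bar>) \<and>
        ((\<forall>s\<in>I. curvature M I \<alpha> s = \<bar>mean_curvature M S.N \<xi> (\<alpha> s)\<bar>) \<longleftrightarrow> geodesic S.N I \<alpha>)"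
      using R0(2)[OF R2(2) R(2)] unfolding sphere_condition_def Let_def G by (elim conjE exE) (rule that)
    have ineq: "curvature M I \<alpha> s \<ge> \<bar>mean_curvature M S.N \<xi> (\<alpha> s)\<bar>"
      if "nondegenerate_interval I" "arclength_C2_curve M I \<alpha>" "\<alpha> ` I \<subseteq> S.G" "s \<in> I" for I \<alpha> s
      using curves[rule_format, OF conjI[OF that(1) conjI[OF that(2,3)]]] that(4) by (elim conjE) (rule bspec)
    have pos: "metric M c x (S.B x v) v \<ge> 0" for v
      using e(2)[OF x(1), of v] x(3) unfolding S.B_def NN.B_def by (simp add: r1_def)
    show ?thesis using S.umbilic_of_curves[OF \<xi> xL ineq pos] unfolding S.B_def NN.B_def .
  qed
  have d3: "DIM('e) \<ge> 3" using dim by simp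
  obtain K where "NN.curv_const K (chart_map c p)"
    using NN.curv_const_of_triples[OF NN.x0U d3 NN.umbilic_orthogonal_triple[OF umb r1]] by blast
  then show ?thesis using curvature_tensor_chart[OF p c] by blast
qed

text \<open>In a chart the pointwise constant is a quotient of continuous functions, so Schur's
  lemma applies on balls; being locally constant, it is constant on a connected space.\<close>

lemma space_form_of_pointwise:
  assumes conn: "connected_space (mtop M)" and dim: "DIM('e) \<ge> 3"
    and pw: "\<And>p. p \<in> points M \<Longrightarrow> \<exists>K. \<forall>u v. u \<noteq> v \<and> independent {u, v} \<longrightarrow> sectional_curvature M p u v = K"
  shows "space_form M"
proof -
  obtain k where k: "\<And>p u v. p \<in> points M \<Longrightarrow> u \<noteq> v \<and> independent {u, v} \<longrightarrow> sectional_curvature M p u v = k p"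
    using pw by metis
  have loc: "\<exists>W. openin (mtop M) W \<and> p \<in> W \<and> (\<forall>q\<in>W. k q = k p)" if p: "p \<in> points M" for p
  proof -
    define c where "c = chart_at M p"
    have c: "c \<in> atlas M" "p \<in> chart_dom c" using chart_at[OF p] by (auto simp: c_def)
    note tc = chart[OF c(1)]
    interpret A: local_metric "chart_range c" "metric M c" by (rule local_metric_chart[OF c(1)])
    define l where "l x = k (chart_inv c x)" for x
    have cc: "A.curv_const (l x) x" if x: "x \<in> chart_range c" for x
    proof -
      note x' = chart_inv_right[OF tc x]
      have q: "chart_inv c x \<in> points M" using x'(1) dom_subset[OF tc] by blast
      show ?thesis using curvature_tensor_chart[OF q c(1) x'(1), of "l x"] k[OF q] unfolding x'(2) l_def by blast
    qed
    have "\<exists>u v :: 'e. u \<noteq> v \<and> independent {u, v}"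
    proof -
      obtain S :: "'e set" where S: "S \<subseteq> Basis" "card S = 2"
        using obtain_subset_with_card_n[of 2 "Basis :: 'e set"] dim by auto
      then obtain u v where "S = {u, v}" "u \<noteq> v" by (auto simp: card_2_iff)
      then show ?thesis using independent_mono[OF independent_Basis S(1)] by blast
    qed
    then obtain u v :: 'e where uv: "u \<noteq> v" "independent {u, v}" by blast
    let ?g = "metric M c"
    have "continuous_on (chart_range c) (\<lambda>x. ?g x (A.Rm x u v v) u / (?g x u u * ?g x v v - (?g x u v)\<^sup>2))"
    proof (rule continuous_on_divide)
      show "\<forall>x\<in>chart_range c. ?g x u u * ?g x v v - (?g x u v)\<^sup>2 \<noteq> 0" using A.gram_pos[OF _ uv] by force
    qed (intro continuous_intros A.continuous_g A.continuous_Rm_const; simp)+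
    moreover have "?g x (A.Rm x u v v) u / (?g x u u * ?g x v v - (?g x u v)\<^sup>2) = l x" if "x \<in> chart_range c" for x
      by (rule A.curv_const_sectional[OF that cc[OF that] uv])
    ultimately have cl: "continuous_on (chart_range c) l" by (simp cong: continuous_on_cong)
    have cp: "chart_map c p \<in> chart_range c" using c(2) by blast
    obtain d where d: "d > 0" "ball (chart_map c p) d \<subseteq> chart_range c" by (rule openE[OF A.open_U cp]) (rule that)
    have "openin (subtopology (mtop M) (chart_dom c)) {q \<in> topspace (subtopology (mtop M) (chart_dom c)). chart_map c q \<in> ball (chart_map c p) d}"
      by (rule openin_continuous_map_preimage[OF continuous_chart_map[OF tc]]) simp
    moreover have "openin (mtop M) (chart_dom c)" using tc unfolding top_chart_def by blast
    ultimately have "openin (mtop M) {q \<in> topspace (subtopology (mtop M) (chart_dom c)). chart_map c q \<in> ball (chart_map c p) d}"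
      by (rule openin_trans_full)
    moreover have "k q = k p" if "q \<in> chart_dom c" "chart_map c q \<in> ball (chart_map c p) d" for q
      using A.schur[where k = l, OF dim cc cl d(2) that(2)] unfolding l_def chart_inv_left[OF tc that(1)] chart_inv_left[OF tc c(2)] .
    moreover have "chart_map c p \<in> ball (chart_map c p) d" using d(1) by simp
    ultimately show ?thesis
      unfolding topspace_dom[OF tc] using c(2) by (intro exI[of _ "{q \<in> chart_dom c. chart_map c q \<in> ball (chart_map c p) d}"] conjI) blast+
  qed
  have "k q = k p" if p: "p \<in> points M" and q: "q \<in> points M" for p q
  proof (rule ccontr)
    assume n: "k q \<noteq> k p"
    let ?E = "{x \<in> points M. k x = k p}" and ?F = "{x \<in> points M. k x \<noteq> k p}"
    have sub: "\<exists>W. openin (mtop M) W \<and> x \<in> W \<and> W \<subseteq> {y \<in> points M. k y = k x}" if xM: "x \<in> points M" for x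
    proof -
      obtain W where W: "openin (mtop M) W" "x \<in> W" "\<forall>q\<in>W. k q = k x" using loc[OF xM] by blast
      moreover have "W \<subseteq> points M" by (rule openin_subset[OF W(1)])
      ultimately show ?thesis by blast
    qed
    have "openin (mtop M) ?E" unfolding openin_subopen[of _ ?E]
    proof
      fix x assume "x \<in> ?E"
      then show "\<exists>W. openin (mtop M) W \<and> x \<in> W \<and> W \<subseteq> ?E" using sub[of x] by auto
    qed
    moreover have "openin (mtop M) ?F" unfolding openin_subopen[of _ ?F]
    proof
      fix x assume x: "x \<in> ?F"
      then obtain W where W: "openin (mtop M) W" "x \<in> W" "W \<subseteq> {y \<in> points M. k y = k x}" using sub[of x] by auto
      have "W \<subseteq> ?F" using W(3) x by auto
      then show "\<exists>W. openin (mtop M) W \<and> x \<in> W \<and> W \<subseteq> ?F" using W(1,2) by blast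
    qed
    moreover have "points M \<subseteq> ?E \<union> ?F" "?E \<inter> ?F = {}" "?E \<noteq> {}" "?F \<noteq> {}" using p q n by auto
    ultimately show False using conn unfolding connected_space_def by blast
  qed
  then show ?thesis unfolding space_form_def using k by metis
qed

end

theorem theorem5:
  fixes M :: "('a, 'e::euclidean_space) riem"
  assumes "riemannian_manifold M" and "connected_space (mtop M)"
    and "DIM('e) = DIM('f::euclidean_space) + 1" and "DIM('f) \<ge> 2"
  shows "space_form M \<longleftrightarrow>
    (\<forall>p\<in>points M. \<exists>R0>0. \<forall>R. 0 < R \<and> R < R0 \<longrightarrow>
      (let G = geodesic_sphere M p R; N = (submanifold M G :: ('a, 'f) riem) in
        (\<forall>V. norm_at M p V = 1 \<longrightarrow> R *\<^sub>R V \<in> exp_domain M p) \<and>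
        is_submanifold M G TYPE('f) \<and>
        (\<exists>\<xi>. unit_normal_field M N \<xi> \<and>
          (\<forall>I \<alpha>. nondegenerate_interval I \<and> arclength_C2_curve M I \<alpha> \<and> \<alpha> ` I \<subseteq> G \<longrightarrow>
            (\<forall>s\<in>I. curvature M I \<alpha> s \<ge> \<bar>mean_curvature M N \<xi> (\<alpha> s)\<bar>) \<and>
            ((\<forall>s\<in>I. curvature M I \<alpha> s = \<bar>mean_curvature M N \<xi> (\<alpha> s)\<bar>) \<longleftrightarrow> geodesic N I \<alpha>)))))"
  unfolding sphere_condition_def[of M "TYPE('f)", symmetric]
proof -
  interpret riemannian M by unfold_locales (rule assms(1))
  have d3: "DIM('e) \<ge> 3" using assms(3,4) by simp
  show "space_form M \<longleftrightarrow> (\<forall>p\<in>points M. \<exists>R0>0. \<forall>R. 0 < R \<and> R < R0 \<longrightarrow> sphere_condition M TYPE('f) p R)"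
  proof
    assume "space_form M"
    then show "\<forall>p\<in>points M. \<exists>R0>0. \<forall>R. 0 < R \<and> R < R0 \<longrightarrow> sphere_condition M TYPE('f) p R"
      using sphere_condition_of_space_form[OF _ assms(3)] by blast
  next
    assume sc: "\<forall>p\<in>points M. \<exists>R0>0. \<forall>R. 0 < R \<and> R < R0 \<longrightarrow> sphere_condition M TYPE('f) p R"
    show "space_form M"
    proof (rule space_form_of_pointwise[OF assms(2) d3])
      fix p assume p: "p \<in> points M"
      then obtain R0 where "R0 > 0" "\<And>R. 0 < R \<Longrightarrow> R < R0 \<Longrightarrow> sphere_condition M TYPE('f) p R" using sc by blast
      then show "\<exists>K. \<forall>u v. u \<noteq> v \<and> independent {u, v} \<longrightarrow> sectional_curvature M p u v = K"
        by (rule curv_const_of_sphere_condition[OF assms(3,4) p])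
    qed
  qed
qed

end
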